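(* Let $n\geqslant1$ be an integer. (1) For every integer $r$ with $n\leqslant r\leqslant n+\lfloor n/3\rfloor$, there is an $n$-dimensional proper polyhedral cone with exactly $r$ extreme rays whose minimal operator system is $2$-subhomogeneous. When $r=n$, it is in fact $1$-subhomogeneous. (2) If $n=3$ and $r\geqslant5$, or if $n\geqslant4$ and $r\geqslant n+1$, then there is an $n$-dimensional proper polyhedral cone with exactly $r$ extreme rays whose minimal operator system is not subhomogeneous. Consequently, whenever $n\geqslant4$ and $n+1\leqslant r\leqslant n+\lfloor n/3\rfloor$, there exist $n$-dimensional proper polyhedral cones with exactly $r$ extreme rays whose minimal operator system is subhomogeneous, and also ones whose minimal operator system is not subhomogeneous.
   Context: A proper polyhedral cone $C\subseteq V$ in a finite-dimensional real vector space is a finitely generated convex cone that is pointed ($C\cap(-C)=\{0\}$) and has nonempty interior; its dimension is $\dim V$. Minimal operator system: an interior point $u$ of $C$ is (arbitrarily) fixed. With $\operatorname{Her}_s$ the complex Hermitian $s\times s$ matrices and $\operatorname{Her}_s(V)=\operatorname{Her}_s\otimes_{\mathbb R}V$, set $C_s^{\min}=\operatorname{cone}\{A\otimes c\mid A\in\operatorname{Her}_s,\ A\geqslant0,\ c\in C\}\subseteq\operatorname{Her}_s(V)$ and $C^{\min}=(V,(C_s^{\min})_{s\geqslant1},u)$, with matrix order unit $I_s\otimes u$ at level $s$. It is called $d$-subhomogeneous if it admits a unital complete order embedding into $\operatorname{Mat}_d(\mathcal A)$ for some commutative $C^*$-algebra $\mathcal A$, i.e. a real-linear map $\Phi$ from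 $V$ to the Hermitian elements of $\operatorname{Mat}_d(\mathcal A)$ with $\Phi(u)=1$ such that for all $s\geqslant1$ and $X\in\operatorname{Her}_s(V)$: $X\in C_s^{\min}$ if and only if $(\mathrm{id}\otimes\Phi)(X)\geqslant0$ in $\operatorname{Mat}_s(\operatorname{Mat}_d(\mathcal A))$. It is subhomogeneous if it is $d$-subhomogeneous for some $d\geqslant1$. *)

theory Defs
  imports
    "HOL-Analysis.Analysis"
    "HOL-Algebra.Module"
    "Jordan_Normal_Form.Schur_Decomposition"
begin

section \<open>Polyhedral cones\<close>

definition proper_polyhedral_cone :: "'v::euclidean_space set \<Rightarrow> bool" where
  "proper_polyhedral_cone C \<longleftrightarrow>
     (\<exists>S. finite S \<and> C = convex_cone hull S) \<and>
     C \<inter> uminus ` C = {0} \<and>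
     interior C \<noteq> {}"

definition extreme_rays :: "'v::euclidean_space set \<Rightarrow> 'v set set" where
  "extreme_rays C = {R. R face_of C \<and> aff_dim R = 1}"


section \<open>Hermitian matrices over a real vector space\<close>

definition psd_matrix :: "nat \<Rightarrow> complex mat \<Rightarrow> bool" where
  "psd_matrix s A \<longleftrightarrow>
     A \<in> carrier_mat s s \<and> mat_adjoint A = A \<and>
     (\<forall>v \<in> carrier_vec s. 0 \<le> (A *\<^sub>v v) \<bullet>c v)"

text \<open>The complexification of \<^typ>\<open>'v\<close> is realised as \<^typ>\<open>'v \<times> 'v\<close>, the pair \<open>(x, y)\<close> standing
  for \<open>x + \<i> y\<close>.  Then \<open>Her\<^sub>s \<otimes>\<^sub>\<real> V\<close> is the real vector space of those \<open>s \<times> s\<close> matrices over the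
  complexification that are fixed by the conjugate transpose, where \<open>A \<otimes> c\<close> has the entries
  \<open>A\<^sub>i\<^sub>j c = Re A\<^sub>i\<^sub>j c + \<i> Im A\<^sub>i\<^sub>j c\<close>.\<close>

definition Her :: "nat \<Rightarrow> ('v::real_vector \<times> 'v) mat set" where
  "Her s = {X \<in> carrier_mat s s.
     \<forall>i<s. \<forall>j<s. X $$ (j, i) = (fst (X $$ (i, j)), - snd (X $$ (i, j)))}"

definition tensor :: "complex mat \<Rightarrow> 'v::real_vector \<Rightarrow> ('v \<times> 'v) mat" where
  "tensor A c = map_mat (\<lambda>a. (Re a *\<^sub>R c, Im a *\<^sub>R c)) A"

definition Cmin :: "'v::real_vector set \<Rightarrow> nat \<Rightarrow> ('v \<times> 'v) mat set" where
  "Cmin C s =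
     {Matrix.mat s s (\<lambda>ij. \<Sum>k<m. t k *\<^sub>R (tensor (A k) (c k) $$ ij)) | (m::nat) t A c.
        \<forall>k<m. 0 \<le> t k \<and> psd_matrix s (A k) \<and> c k \<in> C}"


section \<open>Complex star-algebras and their matrix algebras\<close>

record 'a star_algebra = "(complex, 'a) module" +
  star :: "'a \<Rightarrow> 'a"

record 'a cstar_algebra = "'a star_algebra" +
  cnorm :: "'a \<Rightarrow> real"

text \<open>All algebras here have a unit: a matrix algebra \<open>Mat\<^sub>d(\<A>)\<close> with \<open>d \<ge> 1\<close> has a unit only if
  \<open>\<A>\<close> has one.  Commutativity is part of \<^locale>\<open>algebra\<close>.\<close>

locale commutative_cstar_algebra =
  algebra "class_ring :: complex ring" \<A> for \<A> :: "('a, 'm) cstar_algebra_scheme" (structure) +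
  assumes star_closed: "x \<in> carrier \<A> \<Longrightarrow> star \<A> x \<in> carrier \<A>"
    and star_star: "x \<in> carrier \<A> \<Longrightarrow> star \<A> (star \<A> x) = x"
    and star_add: "x \<in> carrier \<A> \<Longrightarrow> y \<in> carrier \<A> \<Longrightarrow> star \<A> (x \<oplus> y) = star \<A> x \<oplus> star \<A> y"
    and star_mult: "x \<in> carrier \<A> \<Longrightarrow> y \<in> carrier \<A> \<Longrightarrow> star \<A> (x \<otimes> y) = star \<A> y \<otimes> star \<A> x"
    and star_smult: "x \<in> carrier \<A> \<Longrightarrow> star \<A> (a \<odot> x) = cnj a \<odot> star \<A> x"
    and cnorm_nonneg: "x \<in> carrier \<A> \<Longrightarrow> 0 \<le> cnorm \<A> x"
    and cnorm_eq_0: "x \<in> carrier \<A> \<Longrightarrow> cnorm \<A> x = 0 \<longleftrightarrow> x = \<zero>"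
    and cnorm_smult: "x \<in> carrier \<A> \<Longrightarrow> cnorm \<A> (a \<odot> x) = cmod a * cnorm \<A> x"
    and cnorm_add: "x \<in> carrier \<A> \<Longrightarrow> y \<in> carrier \<A> \<Longrightarrow> cnorm \<A> (x \<oplus> y) \<le> cnorm \<A> x + cnorm \<A> y"
    and cnorm_mult: "x \<in> carrier \<A> \<Longrightarrow> y \<in> carrier \<A> \<Longrightarrow> cnorm \<A> (x \<otimes> y) \<le> cnorm \<A> x * cnorm \<A> y"
    and cstar_identity: "x \<in> carrier \<A> \<Longrightarrow> cnorm \<A> (star \<A> x \<otimes> x) = (cnorm \<A> x)\<^sup>2"
    and complete:
      "(\<forall>n. X n \<in> carrier \<A>) \<Longrightarrow>
       (\<forall>e>0. \<exists>N. \<forall>m\<ge>N. \<forall>n\<ge>N. cnorm \<A> (X m \<ominus> X n) < e) \<Longrightarrow>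
       \<exists>x \<in> carrier \<A>. (\<lambda>n. cnorm \<A> (X n \<ominus> x)) \<longlonglongrightarrow> 0"

definition Mat :: "nat \<Rightarrow> ('a, 'm) star_algebra_scheme \<Rightarrow> 'a mat star_algebra" where
  "Mat k A =
     \<lparr>carrier = {M \<in> carrier_mat k k. elements_mat M \<subseteq> carrier A},
      mult = (\<lambda>M N. Matrix.mat k k (\<lambda>(i, j).
                \<Oplus>\<^bsub>A\<^esub> l \<in> {0..<k}. M $$ (i, l) \<otimes>\<^bsub>A\<^esub> N $$ (l, j))),
      one = Matrix.mat k k (\<lambda>(i, j). if i = j then \<one>\<^bsub>A\<^esub> else \<zero>\<^bsub>A\<^esub>),
      zero = Matrix.mat k k (\<lambda>_. \<zero>\<^bsub>A\<^esub>),
      add = (\<lambda>M N. Matrix.mat k k (\<lambda>ij. M $$ ij \<oplus>\<^bsub>A\<^esub> N $$ ij)),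
      smult = (\<lambda>a M. Matrix.mat k k (\<lambda>ij. a \<odot>\<^bsub>A\<^esub> M $$ ij)),
      star = (\<lambda>M. Matrix.mat k k (\<lambda>(i, j). star A (M $$ (j, i))))\<rparr>"

text \<open>Used only for the C*-algebras \<open>Mat\<^sub>s(Mat\<^sub>d(\<A>))\<close>, whose positive elements are those of
  the form \<open>y\<^sup>* y\<close>; they are automatically self-adjoint.\<close>

definition positive_element :: "('a, 'm) star_algebra_scheme \<Rightarrow> 'a \<Rightarrow> bool" where
  "positive_element A x \<longleftrightarrow> (\<exists>y \<in> carrier A. x = star A y \<otimes>\<^bsub>A\<^esub> y)"


section \<open>Subhomogeneity\<close>

text \<open>On \<open>Her\<^sub>s \<otimes> V\<close> this is \<open>id \<otimes> \<Phi>\<close>: an entry \<open>x + \<i> y\<close> is sent to \<open>\<Phi> x + \<i> \<Phi> y\<close>, so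
  that \<open>A \<otimes> c\<close> is sent to the matrix with entries \<open>A\<^sub>i\<^sub>j \<Phi>(c)\<close>.\<close>

definition amplification ::
  "('a, 'm) star_algebra_scheme \<Rightarrow> ('v \<Rightarrow> 'a) \<Rightarrow> ('v \<times> 'v) mat \<Rightarrow> 'a mat" where
  "amplification D \<Phi> X = map_mat (\<lambda>(x, y). \<Phi> x \<oplus>\<^bsub>D\<^esub> (\<i> \<odot>\<^bsub>D\<^esub> \<Phi> y)) X"

definition unital_complete_order_embedding ::
  "(nat \<Rightarrow> ('v::euclidean_space \<times> 'v) mat set) \<Rightarrow> 'v \<Rightarrow> ('a, 'm) star_algebra_scheme \<Rightarrow>
     ('v \<Rightarrow> 'a) \<Rightarrow> bool" where
  "unital_complete_order_embedding K u D \<Phi> \<longleftrightarrow>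
     (\<forall>x. \<Phi> x \<in> carrier D \<and> star D (\<Phi> x) = \<Phi> x) \<and>
     (\<forall>x y. \<Phi> (x + y) = \<Phi> x \<oplus>\<^bsub>D\<^esub> \<Phi> y) \<and>
     (\<forall>r x. \<Phi> (r *\<^sub>R x) = complex_of_real r \<odot>\<^bsub>D\<^esub> \<Phi> x) \<and>
     \<Phi> u = \<one>\<^bsub>D\<^esub> \<and>
     (\<forall>s\<ge>1. \<forall>X \<in> Her s. X \<in> K s \<longleftrightarrow> positive_element (Mat s D) (amplification D \<Phi> X))"

text \<open>HOL cannot quantify existentially over types, so the carrier of the C*-algebra is taken inside
  one type having the cardinality of the continuum.  This is no restriction: lemma
  \<open>d_subhomogeneousI\<close> below shows that an embedding into \<open>Mat\<^sub>d(\<A>)\<close> for a commutative C*-algebra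
  \<open>\<A>\<close> over any type whatsoever yields one for an algebra over this type.\<close>

definition d_subhomogeneous ::
  "nat \<Rightarrow> (nat \<Rightarrow> ('v::euclidean_space \<times> 'v) mat set) \<Rightarrow> 'v \<Rightarrow> bool" where
  "d_subhomogeneous d K u \<longleftrightarrow>
     (\<exists>(\<A> :: (nat \<Rightarrow> complex) cstar_algebra) \<Phi>.
        commutative_cstar_algebra \<A> \<and> unital_complete_order_embedding K u (Mat d \<A>) \<Phi>)"

definition subhomogeneous :: "(nat \<Rightarrow> ('v::euclidean_space \<times> 'v) mat set) \<Rightarrow> 'v \<Rightarrow> bool" where
  "subhomogeneous K u \<longleftrightarrow> (\<exists>d\<ge>1. d_subhomogeneous d K u)"


section \<open>Independence of the type carrying the C*-algebra\<close>

subsection \<open>Matrix algebras and star-homomorphisms\<close>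

locale pre_star_algebra = abelian_monoid A for A :: "('a, 'm) star_algebra_scheme" (structure) +
  assumes mult_closed: "x \<in> carrier A \<Longrightarrow> y \<in> carrier A \<Longrightarrow> x \<otimes> y \<in> carrier A"
    and one_closed: "\<one> \<in> carrier A"
    and smult_closed: "x \<in> carrier A \<Longrightarrow> a \<odot> x \<in> carrier A"
    and star_closed: "x \<in> carrier A \<Longrightarrow> star A x \<in> carrier A"

lemma (in commutative_cstar_algebra) pre_star_algebra: "pre_star_algebra \<A>"
  by unfold_locales (auto intro: star_closed smult_closed)

lemma Mat_carrier_iff:
  "M \<in> carrier (Mat k A) \<longleftrightarrow> M \<in> carrier_mat k k \<and> (\<forall>i<k. \<forall>j<k. M $$ (i, j) \<in> carrier A)"
  unfolding Mat_def by (fastforce simp: elements_mat_def)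

lemma Mat_carrier_dim:
  "M \<in> carrier (Mat k A) \<Longrightarrow> dim_row M = k" "M \<in> carrier (Mat k A) \<Longrightarrow> dim_col M = k"
  by (auto simp: Mat_carrier_iff)

lemma pre_star_algebra_Mat:
  assumes "pre_star_algebra A"
  shows "pre_star_algebra (Mat k A)"
proof -
  interpret A: pre_star_algebra A by fact
  have "abelian_monoid (Mat k A)"
  proof (rule abelian_monoidI)
    show "\<zero>\<^bsub>Mat k A\<^esub> \<in> carrier (Mat k A)"
      unfolding Mat_carrier_iff by (simp add: Mat_def)
  next
    fix x y assume "x \<in> carrier (Mat k A)" "y \<in> carrier (Mat k A)"
    then show "x \<oplus>\<^bsub>Mat k A\<^esub> y \<in> carrier (Mat k A)"
      unfolding Mat_carrier_iff by (simp add: Mat_def)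
  next
    fix x y z assume "x \<in> carrier (Mat k A)" "y \<in> carrier (Mat k A)" "z \<in> carrier (Mat k A)"
    then show "x \<oplus>\<^bsub>Mat k A\<^esub> y \<oplus>\<^bsub>Mat k A\<^esub> z = x \<oplus>\<^bsub>Mat k A\<^esub> (y \<oplus>\<^bsub>Mat k A\<^esub> z)"
      unfolding Mat_carrier_iff by (auto simp: Mat_def intro!: eq_matI A.a_assoc)
  next
    fix x assume "x \<in> carrier (Mat k A)"
    then show "\<zero>\<^bsub>Mat k A\<^esub> \<oplus>\<^bsub>Mat k A\<^esub> x = x"
      unfolding Mat_carrier_iff by (auto simp: Mat_def intro!: eq_matI)
  next
    fix x y assume "x \<in> carrier (Mat k A)" "y \<in> carrier (Mat k A)"
    then show "x \<oplus>\<^bsub>Mat k A\<^esub> y = y \<oplus>\<^bsub>Mat k A\<^esub> x"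
      unfolding Mat_carrier_iff by (auto simp: Mat_def intro!: eq_matI A.a_comm)
  qed
  then interpret M: abelian_monoid "Mat k A" .
  show ?thesis
  proof unfold_locales
    fix x y assume "x \<in> carrier (Mat k A)" "y \<in> carrier (Mat k A)"
    then show "x \<otimes>\<^bsub>Mat k A\<^esub> y \<in> carrier (Mat k A)"
      unfolding Mat_carrier_iff by (auto simp: Mat_def intro!: A.finsum_closed A.mult_closed)
  next
    show "\<one>\<^bsub>Mat k A\<^esub> \<in> carrier (Mat k A)"
      unfolding Mat_carrier_iff by (simp add: Mat_def A.one_closed)
  next
    fix x a assume "x \<in> carrier (Mat k A)"
    then show "a \<odot>\<^bsub>Mat k A\<^esub> x \<in> carrier (Mat k A)" "star (Mat k A) x \<in> carrier (Mat k A)"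
      unfolding Mat_carrier_iff by (auto simp: Mat_def A.smult_closed A.star_closed)
  qed
qed

definition star_hom ::
  "('a, 'm) star_algebra_scheme \<Rightarrow> ('b, 'k) star_algebra_scheme \<Rightarrow> ('a \<Rightarrow> 'b) \<Rightarrow> bool" where
  "star_hom A B h \<longleftrightarrow>
     (\<forall>x \<in> carrier A. h x \<in> carrier B) \<and>
     (\<forall>x \<in> carrier A. \<forall>y \<in> carrier A. h (x \<oplus>\<^bsub>A\<^esub> y) = h x \<oplus>\<^bsub>B\<^esub> h y) \<and>
     (\<forall>x \<in> carrier A. \<forall>y \<in> carrier A. h (x \<otimes>\<^bsub>A\<^esub> y) = h x \<otimes>\<^bsub>B\<^esub> h y) \<and>
     h \<zero>\<^bsub>A\<^esub> = \<zero>\<^bsub>B\<^esub> \<and> h \<one>\<^bsub>A\<^esub> = \<one>\<^bsub>B\<^esub> \<and>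
     (\<forall>x \<in> carrier A. \<forall>a. h (a \<odot>\<^bsub>A\<^esub> x) = a \<odot>\<^bsub>B\<^esub> h x) \<and>
     (\<forall>x \<in> carrier A. h (star A x) = star B (h x))"

lemma star_homD:
  assumes "star_hom A B h"
  shows "x \<in> carrier A \<Longrightarrow> h x \<in> carrier B"
    and "x \<in> carrier A \<Longrightarrow> y \<in> carrier A \<Longrightarrow> h (x \<oplus>\<^bsub>A\<^esub> y) = h x \<oplus>\<^bsub>B\<^esub> h y"
    and "x \<in> carrier A \<Longrightarrow> y \<in> carrier A \<Longrightarrow> h (x \<otimes>\<^bsub>A\<^esub> y) = h x \<otimes>\<^bsub>B\<^esub> h y"
    and "h \<zero>\<^bsub>A\<^esub> = \<zero>\<^bsub>B\<^esub>" and "h \<one>\<^bsub>A\<^esub> = \<one>\<^bsub>B\<^esub>"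
    and "x \<in> carrier A \<Longrightarrow> h (a \<odot>\<^bsub>A\<^esub> x) = a \<odot>\<^bsub>B\<^esub> h x"
    and "x \<in> carrier A \<Longrightarrow> h (star A x) = star B (h x)"
  using assms by (auto simp: star_hom_def)

lemma star_hom_finsum:
  assumes "pre_star_algebra A" "pre_star_algebra B" "star_hom A B h" "finite I"
    and "\<And>i. i \<in> I \<Longrightarrow> f i \<in> carrier A"
  shows "h (\<Oplus>\<^bsub>A\<^esub> i \<in> I. f i) = (\<Oplus>\<^bsub>B\<^esub> i \<in> I. h (f i))"
proof -
  interpret A: pre_star_algebra A by fact
  interpret B: pre_star_algebra B by fact
  note h = star_homD[OF assms(3)]
  from assms(4,5) show ?thesis
  proof (induction I rule: finite_induct)
    case empty
    then show ?case by (simp add: h)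
  next
    case (insert i I)
    then show ?case
      by (simp add: A.finsum_insert B.finsum_insert h Pi_def A.finsum_closed)
  qed
qed

lemma star_hom_Mat:
  assumes A: "pre_star_algebra A" and B: "pre_star_algebra B" and h: "star_hom A B h"
  shows "star_hom (Mat k A) (Mat k B) (map_mat h)"
proof -
  interpret A: pre_star_algebra A by fact
  interpret B: pre_star_algebra B by fact
  note hD = star_homD[OF h]
  show ?thesis
    unfolding star_hom_def
  proof (intro conjI ballI allI)
    fix x y assume "x \<in> carrier (Mat k A)" "y \<in> carrier (Mat k A)"
    then have xy: "x \<in> carrier_mat k k" "y \<in> carrier_mat k k"
      "\<And>i j. i < k \<Longrightarrow> j < k \<Longrightarrow> x $$ (i, j) \<in> carrier A"
      "\<And>i j. i < k \<Longrightarrow> j < k \<Longrightarrow> y $$ (i, j) \<in> carrier A"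
      by (auto simp: Mat_carrier_iff)
    have "h (\<Oplus>\<^bsub>A\<^esub>l\<in>{0..<k}. x $$ (i, l) \<otimes>\<^bsub>A\<^esub> y $$ (l, j)) =
        (\<Oplus>\<^bsub>B\<^esub>l\<in>{0..<k}. map_mat h x $$ (i, l) \<otimes>\<^bsub>B\<^esub> map_mat h y $$ (l, j))"
      if "i < k" "j < k" for i j
    proof -
      have "h (\<Oplus>\<^bsub>A\<^esub>l\<in>{0..<k}. x $$ (i, l) \<otimes>\<^bsub>A\<^esub> y $$ (l, j)) =
          (\<Oplus>\<^bsub>B\<^esub>l\<in>{0..<k}. h (x $$ (i, l) \<otimes>\<^bsub>A\<^esub> y $$ (l, j)))"
        using that xy by (intro star_hom_finsum[OF A B h]) (auto simp: A.mult_closed)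
      also have "\<dots> = (\<Oplus>\<^bsub>B\<^esub>l\<in>{0..<k}. map_mat h x $$ (i, l) \<otimes>\<^bsub>B\<^esub> map_mat h y $$ (l, j))"
        using that xy by (intro B.finsum_cong') (auto simp: hD B.mult_closed)
      finally show ?thesis .
    qed
    then show "map_mat h (x \<otimes>\<^bsub>Mat k A\<^esub> y) = map_mat h x \<otimes>\<^bsub>Mat k B\<^esub> map_mat h y"
      by (intro eq_matI) (simp_all add: Mat_def)
  qed (unfold Mat_carrier_iff, auto simp: Mat_def hD intro!: eq_matI)
qed

lemma inj_on_map_mat_Mat:
  assumes "inj_on h (carrier A)"
  shows "inj_on (map_mat h) (carrier (Mat k A))"
proof (rule inj_onI)
  fix M N assume M: "M \<in> carrier (Mat k A)" and N: "N \<in> carrier (Mat k A)"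
    and eq: "map_mat h M = map_mat h N"
  have "M $$ (i, j) = N $$ (i, j)" if "i < k" "j < k" for i j
  proof -
    have "map_mat h M $$ (i, j) = map_mat h N $$ (i, j)" using eq by simp
    then have "h (M $$ (i, j)) = h (N $$ (i, j))"
      using that M N by (simp add: Mat_carrier_dim)
    then show ?thesis using that M N assms by (auto simp: Mat_carrier_iff inj_on_def)
  qed
  with M N show "M = N" by (auto simp: Mat_carrier_iff)
qed

subsection \<open>Transport of a closed star-subalgebra along an injection\<close>

locale closed_star_subalgebra = commutative_cstar_algebra \<A>
  for \<A> :: "('a, 'm) cstar_algebra_scheme" (structure) +
  fixes S :: "'a set" and g :: "'a \<Rightarrow> 'b"
  assumes sub: "S \<subseteq> carrier \<A>"
    and S_zero: "\<zero> \<in> S" and S_one: "\<one> \<in> S"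
    and S_add: "x \<in> S \<Longrightarrow> y \<in> S \<Longrightarrow> x \<oplus> y \<in> S"
    and S_mult: "x \<in> S \<Longrightarrow> y \<in> S \<Longrightarrow> x \<otimes> y \<in> S"
    and S_smult: "x \<in> S \<Longrightarrow> a \<odot> x \<in> S"
    and S_star: "x \<in> S \<Longrightarrow> star \<A> x \<in> S"
    and S_lim: "(\<And>n. X n \<in> S) \<Longrightarrow> x \<in> carrier \<A> \<Longrightarrow> (\<lambda>n. cnorm \<A> (X n \<ominus> x)) \<longlonglongrightarrow> 0 \<Longrightarrow> x \<in> S"
    and inj: "inj_on g S"
begin

definition h :: "'b \<Rightarrow> 'a" where "h = inv_into S g"

definition T :: "'b cstar_algebra" where
  "T = \<lparr>carrier = g ` S, mult = (\<lambda>x y. g (h x \<otimes> h y)), one = g \<one>, zero = g \<zero>,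
        add = (\<lambda>x y. g (h x \<oplus> h y)), smult = (\<lambda>a x. g (a \<odot> h x)), star = (\<lambda>x. g (star \<A> (h x))),
        cnorm = (\<lambda>x. cnorm \<A> (h x))\<rparr>"

lemma hg [simp]: "x \<in> S \<Longrightarrow> h (g x) = x"
  by (simp add: h_def inj)

lemma h_S: "x \<in> carrier T \<Longrightarrow> h x \<in> S"
  by (auto simp: T_def)

lemma gh: "x \<in> carrier T \<Longrightarrow> g (h x) = x"
  by (auto simp: T_def)

lemma inj_h: "inj_on h (carrier T)"
  by (metis gh inj_onI)

lemma T_simps:
  "carrier T = g ` S" "x \<otimes>\<^bsub>T\<^esub> y = g (h x \<otimes> h y)" "\<one>\<^bsub>T\<^esub> = g \<one>" "\<zero>\<^bsub>T\<^esub> = g \<zero>"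
  "x \<oplus>\<^bsub>T\<^esub> y = g (h x \<oplus> h y)" "a \<odot>\<^bsub>T\<^esub> x = g (a \<odot> h x)" "star T x = g (star \<A> (h x))"
  "cnorm T x = cnorm \<A> (h x)"
  by (simp_all add: T_def)

lemmas S_carrier [simp] = subsetD[OF sub]

lemma S_neg: assumes "x \<in> S" shows "\<ominus> x \<in> S" "\<ominus> x = (- 1) \<odot> x"
proof -
  have x: "x \<in> carrier \<A>" using assms by simp
  have "x \<oplus> (- 1) \<odot> x = (1 + - 1) \<odot> x"
    using smult_l_distr[of 1 "- 1" x] smult_one[of x] x by simp
  also have "\<dots> = \<zero>" using smult_l_null[of x] x by simp
  finally have "\<ominus> x = (- 1) \<odot> x"
    using x smult_closed[of "- 1" x] M.minus_equality[of "(- 1) \<odot> x" x] by (simp add: M.a_comm)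
  then show "\<ominus> x = (- 1) \<odot> x" "\<ominus> x \<in> S" using S_smult[OF assms] by simp_all
qed

lemma star_hom_h: "star_hom T \<A> h"
  by (auto simp: star_hom_def T_simps S_zero S_one S_add S_mult S_smult S_star)

lemma cring_T: "cring T"
proof (rule cringI)
  show "abelian_group T"
  proof (rule abelian_groupI)
    fix x assume "x \<in> carrier T"
    then obtain y where y: "y \<in> S" "x = g y" by (auto simp: T_simps)
    show "\<exists>y \<in> carrier T. y \<oplus>\<^bsub>T\<^esub> x = \<zero>\<^bsub>T\<^esub>"
      using y S_neg(1)[of y] by (intro bexI[of _ "g (\<ominus> y)"]) (auto simp: T_simps M.l_neg)
  qed (auto simp: T_simps S_zero S_add M.a_ac)
  show "Group.comm_monoid T"
    by (rule comm_monoidI) (auto simp: T_simps S_one S_mult m_assoc intro!: arg_cong[of _ _ g] m_comm)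
qed (auto simp: T_simps S_add S_mult l_distr)

lemma T_minus: assumes "x \<in> carrier T" "y \<in> carrier T" shows "h (x \<ominus>\<^bsub>T\<^esub> y) = h x \<ominus> h y"
proof -
  interpret TT: cring T by (rule cring_T)
  have y: "h y \<in> S" using assms h_S by simp
  have "g (\<ominus> h y) \<in> carrier T" using y S_neg(1)[OF y] by (auto simp: T_simps)
  moreover have "g (\<ominus> h y) \<oplus>\<^bsub>T\<^esub> y = \<zero>\<^bsub>T\<^esub>"
    using y S_neg(1)[OF y] by (auto simp: T_simps M.l_neg)
  ultimately have "\<ominus>\<^bsub>T\<^esub> y = g (\<ominus> h y)" using assms TT.minus_equality by blast
  then show ?thesis
    using y S_neg(1)[OF y] assms h_S by (simp add: a_minus_def T_simps S_add)
qed

lemma class_ring_cring: "cring (class_ring :: complex ring)"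
  using R.is_cring .

lemma commutative_cstar_algebra_T: "commutative_cstar_algebra T"
proof -
  interpret TT: cring T by (rule cring_T)
  have alg: "algebra (class_ring :: complex ring) T"
  proof (rule algebraI[OF class_ring_cring cring_T])
    fix a b :: complex and x assume "x \<in> carrier T"
    then have x: "x \<in> g ` S" "h x \<in> S" "g (h x) = x" by (auto simp: T_simps)
    show "(a \<oplus>\<^bsub>class_ring\<^esub> b) \<odot>\<^bsub>T\<^esub> x = a \<odot>\<^bsub>T\<^esub> x \<oplus>\<^bsub>T\<^esub> b \<odot>\<^bsub>T\<^esub> x"
      using smult_l_distr[of a b "h x"] x by (simp add: T_simps S_smult)
    show "(a \<otimes>\<^bsub>class_ring\<^esub> b) \<odot>\<^bsub>T\<^esub> x = a \<odot>\<^bsub>T\<^esub> (b \<odot>\<^bsub>T\<^esub> x)"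
      using smult_assoc1[of a b "h x"] x by (simp add: T_simps S_smult)
    show "\<one>\<^bsub>class_ring\<^esub> \<odot>\<^bsub>T\<^esub> x = x"
      using smult_one[of "h x"] x by (simp add: T_simps)
  qed (auto simp: T_simps S_add S_mult S_smult smult_r_distr smult_assoc2)
  show ?thesis
  proof (intro commutative_cstar_algebra.intro alg commutative_cstar_algebra_axioms.intro)
    fix X :: "nat \<Rightarrow> 'b" assume X: "\<forall>n. X n \<in> carrier T"
      and C: "\<forall>e>0. \<exists>N. \<forall>m\<ge>N. \<forall>n\<ge>N. cnorm T (X m \<ominus>\<^bsub>T\<^esub> X n) < e"
    have hX: "\<And>n. h (X n) \<in> S" using X h_S by simp
    then have "\<exists>x \<in> carrier \<A>. (\<lambda>n. cnorm \<A> (h (X n) \<ominus> x)) \<longlonglongrightarrow> 0"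
      using C X by (intro complete) (auto simp: T_simps(8) T_minus)
    then obtain x where x: "x \<in> carrier \<A>" "(\<lambda>n. cnorm \<A> (h (X n) \<ominus> x)) \<longlonglongrightarrow> 0" by blast
    then have "x \<in> S" using S_lim[of "\<lambda>n. h (X n)"] hX by blast
    then show "\<exists>x \<in> carrier T. (\<lambda>n. cnorm T (X n \<ominus>\<^bsub>T\<^esub> x)) \<longlonglongrightarrow> 0"
      using x X by (intro bexI[of _ "g x"]) (auto simp: T_simps T_minus[simplified T_simps])
  next
    fix x assume "x \<in> carrier T"
    then show "cnorm T x = 0 \<longleftrightarrow> x = \<zero>\<^bsub>T\<^esub>"
      using S_zero inj by (auto simp: T_simps cnorm_eq_0 inj_on_eq_iff)
  qed (auto simp: T_simps S_zero S_add S_mult S_smult S_star star_star star_add star_mult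
         star_smult cnorm_nonneg cnorm_smult cnorm_add cnorm_mult cstar_identity)
qed

lemma transport_embedding:
  assumes emb: "unital_complete_order_embedding K u (Mat d \<A>) \<Phi>"
    and entries: "\<And>x i j. i < d \<Longrightarrow> j < d \<Longrightarrow> \<Phi> x $$ (i, j) \<in> S"
    and witness: "\<And>s X. s \<ge> 1 \<Longrightarrow> X \<in> Her s \<Longrightarrow> X \<in> K s \<Longrightarrow>
      \<exists>y \<in> carrier (Mat s (Mat d \<A>)).
        amplification (Mat d \<A>) \<Phi> X = star (Mat s (Mat d \<A>)) y \<otimes>\<^bsub>Mat s (Mat d \<A>)\<^esub> y \<and>
        (\<forall>i<s. \<forall>j<s. \<forall>k<d. \<forall>l<d. y $$ (i, j) $$ (k, l) \<in> S)"
  shows "unital_complete_order_embedding K u (Mat d T) (\<lambda>x. map_mat g (\<Phi> x))"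
proof -
  let ?H = "map_mat h"
  define \<Psi> where "\<Psi> = (\<lambda>x. map_mat g (\<Phi> x))"
  interpret T: commutative_cstar_algebra T by (rule commutative_cstar_algebra_T)
  note pA = pre_star_algebra and pT = T.pre_star_algebra
  note pMA = pre_star_algebra_Mat[OF pA, of d] and pMT = pre_star_algebra_Mat[OF pT, of d]
  interpret MT: pre_star_algebra "Mat d T" by (rule pMT)
  interpret MA: pre_star_algebra "Mat d \<A>" by (rule pMA)
  have H: "star_hom (Mat d T) (Mat d \<A>) ?H" by (rule star_hom_Mat[OF pT pA star_hom_h])
  have iH: "inj_on ?H (carrier (Mat d T))" by (rule inj_on_map_mat_Mat[OF inj_h])
  note HD = star_homD[OF H]
  have E: "\<And>x. \<Phi> x \<in> carrier (Mat d \<A>)" "\<And>x. star (Mat d \<A>) (\<Phi> x) = \<Phi> x"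
    "\<And>x y. \<Phi> (x + y) = \<Phi> x \<oplus>\<^bsub>Mat d \<A>\<^esub> \<Phi> y"
    "\<And>r x. \<Phi> (r *\<^sub>R x) = complex_of_real r \<odot>\<^bsub>Mat d \<A>\<^esub> \<Phi> x"
    "\<Phi> u = \<one>\<^bsub>Mat d \<A>\<^esub>"
    "\<And>s X. s \<ge> 1 \<Longrightarrow> X \<in> Her s \<Longrightarrow>
       X \<in> K s \<longleftrightarrow> positive_element (Mat s (Mat d \<A>)) (amplification (Mat d \<A>) \<Phi> X)"
    using emb unfolding unital_complete_order_embedding_def by blast+
  have \<Psi>: "\<Psi> x \<in> carrier (Mat d T)" for x
    using E(1)[of x] entries[of _ _ x] by (auto simp: Mat_carrier_iff \<Psi>_def T_simps)
  have H\<Psi>: "?H (\<Psi> x) = \<Phi> x" for x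
    using E(1)[of x] entries[of _ _ x] by (auto simp: Mat_carrier_iff \<Psi>_def intro!: eq_matI)
  have eqI: "a = b" if "a \<in> carrier (Mat d T)" "b \<in> carrier (Mat d T)" "?H a = ?H b" for a b
    using iH that by (auto dest: inj_onD)
  have amp_closed: "amplification (Mat d T) \<Psi> X \<in> carrier (Mat s (Mat d T))" if "X \<in> Her s" for s X
  proof -
    have "X \<in> carrier_mat s s" using that by (simp add: Her_def)
    then show ?thesis unfolding Mat_carrier_iff[of _ s "Mat d T"]
    by (auto simp: amplification_def \<Psi> MT.smult_closed case_prod_unfold)
  qed
  have amp: "map_mat ?H (amplification (Mat d T) \<Psi> X) = amplification (Mat d \<A>) \<Phi> X" for X
    by (auto simp: amplification_def HD \<Psi> MT.smult_closed H\<Psi> case_prod_unfold intro!: eq_matI)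
  have pos: "positive_element (Mat s (Mat d T)) (amplification (Mat d T) \<Psi> X) \<longleftrightarrow> X \<in> K s"
    if s: "s \<ge> 1" and X: "X \<in> Her s" for s X
  proof -
    have HH: "star_hom (Mat s (Mat d T)) (Mat s (Mat d \<A>)) (map_mat ?H)"
      by (rule star_hom_Mat[OF pMT pMA H])
    have iHH: "inj_on (map_mat ?H) (carrier (Mat s (Mat d T)))"
      by (rule inj_on_map_mat_Mat[OF iH])
    note HHD = star_homD[OF HH]
    interpret MMT: pre_star_algebra "Mat s (Mat d T)" by (rule pre_star_algebra_Mat[OF pMT])
    show ?thesis
    proof
      assume "positive_element (Mat s (Mat d T)) (amplification (Mat d T) \<Psi> X)"
      then obtain y where y: "y \<in> carrier (Mat s (Mat d T))"
        "amplification (Mat d T) \<Psi> X = star (Mat s (Mat d T)) y \<otimes>\<^bsub>Mat s (Mat d T)\<^esub> y"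
        by (auto simp: positive_element_def)
      have "amplification (Mat d \<A>) \<Phi> X =
          star (Mat s (Mat d \<A>)) (map_mat ?H y) \<otimes>\<^bsub>Mat s (Mat d \<A>)\<^esub> map_mat ?H y"
        using y by (simp add: amp[symmetric] HHD MMT.star_closed)
      then show "X \<in> K s"
        using E(6)[OF s X] HHD(1)[OF y(1)] by (auto simp: positive_element_def)
    next
      assume "X \<in> K s"
      then obtain y where y: "y \<in> carrier (Mat s (Mat d \<A>))"
        "amplification (Mat d \<A>) \<Phi> X = star (Mat s (Mat d \<A>)) y \<otimes>\<^bsub>Mat s (Mat d \<A>)\<^esub> y"
        "\<forall>i<s. \<forall>j<s. \<forall>k<d. \<forall>l<d. y $$ (i, j) $$ (k, l) \<in> S"
        using witness[OF s X] by blast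
      have yd: "dim_row (y $$ (i, j)) = d" "dim_col (y $$ (i, j)) = d" if "i < s" "j < s" for i j
        using y(1) that by (auto simp: Mat_carrier_iff)
      define z where "z = map_mat (map_mat g) y"
      have z: "z \<in> carrier (Mat s (Mat d T))" and Hz: "map_mat ?H z = y"
        using y(1,3) yd by (auto simp: Mat_carrier_iff z_def T_simps intro!: eq_matI)
      have "amplification (Mat d T) \<Psi> X = star (Mat s (Mat d T)) z \<otimes>\<^bsub>Mat s (Mat d T)\<^esub> z"
        by (rule inj_onD[OF iHH])
          (simp_all add: amp y(2) HHD MMT.star_closed MMT.mult_closed z Hz amp_closed[OF X])
      then show "positive_element (Mat s (Mat d T)) (amplification (Mat d T) \<Psi> X)"
        using z by (auto simp: positive_element_def)
    qed
  qed
  have "unital_complete_order_embedding K u (Mat d T) \<Psi>"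
    unfolding unital_complete_order_embedding_def
  proof (intro conjI allI ballI impI)
    show "\<Psi> x \<in> carrier (Mat d T)" for x by (rule \<Psi>)
    show "star (Mat d T) (\<Psi> x) = \<Psi> x" for x
      by (rule eqI) (simp_all add: \<Psi> MT.star_closed HD H\<Psi> E)
    show "\<Psi> (x + y) = \<Psi> x \<oplus>\<^bsub>Mat d T\<^esub> \<Psi> y" for x y
      by (rule eqI) (simp_all add: \<Psi> HD H\<Psi> E)
    show "\<Psi> (r *\<^sub>R x) = complex_of_real r \<odot>\<^bsub>Mat d T\<^esub> \<Psi> x" for r x
      by (rule eqI) (simp_all add: \<Psi> MT.smult_closed HD H\<Psi> E)
    show "\<Psi> u = \<one>\<^bsub>Mat d T\<^esub>"
      by (rule eqI) (simp_all add: \<Psi> MT.one_closed HD H\<Psi> E)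
    show "X \<in> K s \<longleftrightarrow> positive_element (Mat s (Mat d T)) (amplification (Mat d T) \<Psi> X)"
      if "1 \<le> s" "X \<in> Her s" for s X using pos[OF that] by simp
  qed
  then show ?thesis by (simp add: \<Psi>_def)
qed

end

subsection \<open>Reduction to the type of complex sequences\<close>

text \<open>Terms for the elements generated by a family under the operations of a C*-algebra and
  under limits of sequences.\<close>

datatype cterm = cGen "nat \<Rightarrow> complex" | cZero | cOne | cAdd cterm cterm | cMult cterm cterm
  | cSmult complex cterm | cStar cterm | cLim "nat \<Rightarrow> cterm"

primrec cterm_code :: "cterm \<Rightarrow> nat list \<Rightarrow> nat \<times> complex \<times> (nat \<Rightarrow> complex)" where
  "cterm_code (cGen f) = (\<lambda>p. (0, 0, f))"
| "cterm_code cZero = (\<lambda>p. (1, 0, \<lambda>_. 0))"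
| "cterm_code cOne = (\<lambda>p. (2, 0, \<lambda>_. 0))"
| "cterm_code (cAdd a b) = (\<lambda>p. case p of [] \<Rightarrow> (3, 0, \<lambda>_. 0)
     | k # q \<Rightarrow> if k = 0 then cterm_code a q else cterm_code b q)"
| "cterm_code (cMult a b) = (\<lambda>p. case p of [] \<Rightarrow> (4, 0, \<lambda>_. 0)
     | k # q \<Rightarrow> if k = 0 then cterm_code a q else cterm_code b q)"
| "cterm_code (cSmult c a) = (\<lambda>p. case p of [] \<Rightarrow> (5, c, \<lambda>_. 0) | k # q \<Rightarrow> cterm_code a q)"
| "cterm_code (cStar a) = (\<lambda>p. case p of [] \<Rightarrow> (6, 0, \<lambda>_. 0) | k # q \<Rightarrow> cterm_code a q)"
| "cterm_code (cLim F) = (\<lambda>p. case p of [] \<Rightarrow> (7, 0, \<lambda>_. 0) | k # q \<Rightarrow> cterm_code (F k) q)"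

lemma cterm_code_inj: "cterm_code a = cterm_code b \<Longrightarrow> a = b"
proof (induction a arbitrary: b)
  case (cGen f)
  from fun_cong[OF cGen, of "[]"] show ?case by (cases b) auto
next
  case cZero
  from fun_cong[OF cZero, of "[]"] show ?case by (cases b) auto
next
  case cOne
  from fun_cong[OF cOne, of "[]"] show ?case by (cases b) auto
next
  case (cAdd a1 a2)
  from fun_cong[OF cAdd.prems, of "[]"] obtain b1 b2 where b: "b = cAdd b1 b2" by (cases b) auto
  have "cterm_code a1 q = cterm_code b1 q" for q using fun_cong[OF cAdd.prems, of "0 # q"] b by simp
  moreover have "cterm_code a2 q = cterm_code b2 q" for q
    using fun_cong[OF cAdd.prems, of "1 # q"] b by simp
  ultimately show ?case using cAdd.IH b by blast
next
  case (cMult a1 a2)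
  from fun_cong[OF cMult.prems, of "[]"] obtain b1 b2 where b: "b = cMult b1 b2" by (cases b) auto
  have "cterm_code a1 q = cterm_code b1 q" for q using fun_cong[OF cMult.prems, of "0 # q"] b by simp
  moreover have "cterm_code a2 q = cterm_code b2 q" for q
    using fun_cong[OF cMult.prems, of "1 # q"] b by simp
  ultimately show ?case using cMult.IH b by blast
next
  case (cSmult c a)
  from fun_cong[OF cSmult.prems, of "[]"] obtain b1 where b: "b = cSmult c b1" by (cases b) auto
  have "cterm_code a q = cterm_code b1 q" for q using fun_cong[OF cSmult.prems, of "0 # q"] b by simp
  then show ?case using cSmult.IH b by blast
next
  case (cStar a)
  from fun_cong[OF cStar.prems, of "[]"] obtain b1 where b: "b = cStar b1" by (cases b) auto
  have "cterm_code a q = cterm_code b1 q" for q using fun_cong[OF cStar.prems, of "0 # q"] b by simp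
  then show ?case using cStar.IH b by blast
next
  case (cLim F)
  from fun_cong[OF cLim.prems, of "[]"] obtain G where b: "b = cLim G" by (cases b) auto
  have "cterm_code (F k) q = cterm_code (G k) q" for k q
    using fun_cong[OF cLim.prems, of "k # q"] b by simp
  then have "F k = G k" for k using cLim.IH[of "F k"] by blast
  then show ?case using b by auto
qed

definition cterm_seq :: "cterm \<Rightarrow> nat \<Rightarrow> complex" where
  "cterm_seq a n = (case from_nat n :: nat list \<times> nat of (p, k) \<Rightarrow>
     (case cterm_code a p of (t, c, f) \<Rightarrow>
        if k = 0 then of_nat t else if k = 1 then c else f (k - 2)))"

lemma inj_cterm_seq: "inj cterm_seq"
proof (rule injI)
  fix a b assume eq: "cterm_seq a = cterm_seq b"
  have e: "(case cterm_code a p of (t, c, f) \<Rightarrow> if k = 0 then of_nat t else if k = 1 then c else f (k - 2)) =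
      (case cterm_code b p of (t, c, f) \<Rightarrow> if k = 0 then of_nat t else if k = 1 then c else f (k - 2))"
    for p k
    using fun_cong[OF eq, of "to_nat (p, k)"] by (simp add: cterm_seq_def)
  have "cterm_code a p = cterm_code b p" for p
  proof -
    obtain t c f t' c' f' where *: "cterm_code a p = (t, c, f)" "cterm_code b p = (t', c', f')"
      by (metis prod_cases3)
    have "f n = f' n" for n using e[of "n + 2" p] by (simp add: *)
    then show ?thesis using e[of 0 p] e[of 1 p] by (auto simp: *)
  qed
  then show "a = b" by (intro cterm_code_inj) auto
qed

text \<open>Types of cardinality at most the continuum.\<close>

definition small_type :: "'x itself \<Rightarrow> bool" where
  "small_type _ \<longleftrightarrow> (\<exists>e :: 'x \<Rightarrow> nat \<Rightarrow> complex. inj e)"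

lemma small_typeI: "inj (e :: 'x \<Rightarrow> nat \<Rightarrow> complex) \<Longrightarrow> small_type TYPE('x)"
  by (auto simp: small_type_def)

lemma small_type_inj:
  assumes "inj (f :: 'x \<Rightarrow> 'y)" "small_type TYPE('y)"
  shows "small_type TYPE('x)"
  using assms unfolding small_type_def by (metis inj_compose)

lemma small_type_fun:
  assumes "small_type TYPE('x)"
  shows "small_type TYPE(nat \<Rightarrow> 'x)"
proof -
  obtain e :: "'x \<Rightarrow> nat \<Rightarrow> complex" where e: "inj e" using assms by (auto simp: small_type_def)
  have "inj (\<lambda>(f :: nat \<Rightarrow> 'x) n. e (f (fst (prod_decode n))) (snd (prod_decode n)))"
  proof (rule injI)
    fix f f' :: "nat \<Rightarrow> 'x"
    assume eq: "(\<lambda>n. e (f (fst (prod_decode n))) (snd (prod_decode n))) =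
      (\<lambda>n. e (f' (fst (prod_decode n))) (snd (prod_decode n)))"
    have "e (f i) j = e (f' i) j" for i j using fun_cong[OF eq, of "prod_encode (i, j)"] by simp
    then have "e (f i) = e (f' i)" for i by blast
    then show "f = f'" using e by (auto dest: injD)
  qed
  then show ?thesis by (rule small_typeI)
qed

lemma small_type_prod:
  assumes "small_type TYPE('x)" "small_type TYPE('y)"
  shows "small_type TYPE('x \<times> 'y)"
proof -
  obtain e :: "'x \<Rightarrow> nat \<Rightarrow> complex" where e: "inj e" using assms(1) by (auto simp: small_type_def)
  obtain e' :: "'y \<Rightarrow> nat \<Rightarrow> complex" where e': "inj e'" using assms(2) by (auto simp: small_type_def)
  have "inj (\<lambda>(x, y) n. if n = (0::nat) then e x else e' y)"
  proof (rule injI)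
    fix p q assume "(case p of (x, y) \<Rightarrow> \<lambda>n. if n = (0::nat) then e x else e' y) =
      (case q of (x, y) \<Rightarrow> \<lambda>n. if n = (0::nat) then e x else e' y)"
    from fun_cong[OF this, of 0] fun_cong[OF this, of 1] show "p = q"
      using e e' by (auto dest: injD split: prod.splits)
  qed
  then show ?thesis by (rule small_type_inj) (intro small_type_fun small_typeI[of id] inj_on_id)
qed

lemma small_type_complex: "small_type TYPE(complex)"
  by (rule small_typeI[of "\<lambda>c _. c"]) (auto intro!: injI dest: fun_cong)

lemma small_type_countable: "small_type TYPE('x::countable)"
  by (rule small_type_inj[OF _ small_type_complex, of "\<lambda>x. of_nat (to_nat x)"]) (auto intro!: injI)

lemma small_type_euclidean: "small_type TYPE('v::euclidean_space)"
proof -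
  obtain b :: "nat \<Rightarrow> 'v" where b: "Basis = b ` {i. i < DIM('v)}"
    using finite_imp_nat_seg_image_inj_on[OF finite_Basis[where 'a = 'v]]
    by (metis card_Collect_less_nat card_image)
  have "inj (\<lambda>(x::'v) n. complex_of_real (x \<bullet> b n))"
  proof (rule injI)
    fix x y :: 'v assume eq: "(\<lambda>n. complex_of_real (x \<bullet> b n)) = (\<lambda>n. complex_of_real (y \<bullet> b n))"
    have "x \<bullet> b n = y \<bullet> b n" for n using fun_cong[OF eq, of n] by simp
    then show "x = y" using b by (metis euclidean_eqI imageE)
  qed
  then show ?thesis by (rule small_typeI)
qed

lemma small_type_mat:
  assumes "small_type TYPE('x)"
  shows "small_type TYPE('x mat)"
proof (rule small_type_inj)
  let ?f = "\<lambda>M :: 'x mat. ((dim_row M, dim_col M),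
    \<lambda>i j. if i < dim_row M \<and> j < dim_col M then M $$ (i, j) else undefined)"
  show "inj ?f"
  proof (rule injI)
    fix M N :: "'x mat" assume eq: "?f M = ?f N"
    have d: "dim_row M = dim_row N" "dim_col M = dim_col N" using arg_cong[OF eq, of fst] by simp_all
    have "M $$ (i, j) = N $$ (i, j)" if "i < dim_row N" "j < dim_col N" for i j
    proof -
      have "snd (?f M) i j = snd (?f N) i j" by (simp only: eq)
      then show ?thesis using that d by simp
    qed
    then show "M = N" using d by auto
  qed
  show "small_type TYPE((nat \<times> nat) \<times> (nat \<Rightarrow> nat \<Rightarrow> 'x))"
    by (intro small_type_prod small_type_fun small_type_countable assms)
qed

context commutative_cstar_algebra
begin

primrec ev :: "((nat \<Rightarrow> complex) \<Rightarrow> 'a) \<Rightarrow> cterm \<Rightarrow> 'a" where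
  "ev G (cGen f) = G f"
| "ev G cZero = \<zero>"
| "ev G cOne = \<one>"
| "ev G (cAdd a b) = ev G a \<oplus> ev G b"
| "ev G (cMult a b) = ev G a \<otimes> ev G b"
| "ev G (cSmult c a) = c \<odot> ev G a"
| "ev G (cStar a) = star \<A> (ev G a)"
| "ev G (cLim F) = (if \<exists>x \<in> carrier \<A>. (\<lambda>n. cnorm \<A> (ev G (F n) \<ominus> x)) \<longlonglongrightarrow> 0
     then SOME x. x \<in> carrier \<A> \<and> (\<lambda>n. cnorm \<A> (ev G (F n) \<ominus> x)) \<longlonglongrightarrow> 0 else \<zero>)"

lemma cnorm_minus_commute:
  assumes "x \<in> carrier \<A>" "y \<in> carrier \<A>"
  shows "cnorm \<A> (x \<ominus> y) = cnorm \<A> (y \<ominus> x)"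
proof -
  have neg: "\<ominus> z = (- 1) \<odot> z" if z: "z \<in> carrier \<A>" for z
  proof -
    have "z \<oplus> (- 1) \<odot> z = (1 + - 1) \<odot> z"
      using smult_l_distr[of 1 "- 1" z] smult_one[of z] z by simp
    also have "\<dots> = \<zero>" using smult_l_null[of z] z by simp
    finally show ?thesis
      using z smult_closed[of "- 1" z] M.minus_equality[of "(- 1) \<odot> z" z] by (simp add: M.a_comm)
  qed
  have "x \<ominus> y = \<ominus> (y \<ominus> x)"
    using assms by (simp add: a_minus_def M.minus_add M.a_comm)
  also have "\<dots> = (- 1) \<odot> (y \<ominus> x)" using assms by (intro neg) simp
  finally show ?thesis using assms cnorm_smult[of "y \<ominus> x" "- 1"] by simp
qed

lemma limit_unique:
  assumes X: "\<And>n. X n \<in> carrier \<A>" and x: "x \<in> carrier \<A>" and y: "y \<in> carrier \<A>"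
    and lx: "(\<lambda>n. cnorm \<A> (X n \<ominus> x)) \<longlonglongrightarrow> 0" and ly: "(\<lambda>n. cnorm \<A> (X n \<ominus> y)) \<longlonglongrightarrow> 0"
  shows "x = y"
proof -
  have le: "cnorm \<A> (x \<ominus> y) \<le> cnorm \<A> (X n \<ominus> x) + cnorm \<A> (X n \<ominus> y)" for n
  proof -
    have "x \<ominus> y = (x \<ominus> X n) \<oplus> (X n \<ominus> y)"
      using X[of n] x y by (simp add: a_minus_def M.a_assoc M.r_neg1)
    then have "cnorm \<A> (x \<ominus> y) \<le> cnorm \<A> (x \<ominus> X n) + cnorm \<A> (X n \<ominus> y)"
      using X x y by (simp add: cnorm_add)
    then show ?thesis using cnorm_minus_commute[OF x X[of n]] by simp
  qed
  have "(\<lambda>n. cnorm \<A> (X n \<ominus> x) + cnorm \<A> (X n \<ominus> y)) \<longlonglongrightarrow> 0 + 0"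
    by (intro tendsto_add lx ly)
  then have "cnorm \<A> (x \<ominus> y) \<le> 0 + 0" by (rule LIMSEQ_le_const) (use le in blast)
  then have "cnorm \<A> (x \<ominus> y) = 0" using cnorm_nonneg[of "x \<ominus> y"] x y by simp
  then have "x \<ominus> y = \<zero>" using cnorm_eq_0[of "x \<ominus> y"] x y by simp
  moreover have "x = (x \<ominus> y) \<oplus> y" using x y by (simp add: a_minus_def M.a_assoc M.l_neg)
  ultimately show ?thesis using y by simp
qed

lemma ev_closed:
  assumes "\<And>f. G f \<in> carrier \<A>"
  shows "ev G a \<in> carrier \<A>"
proof (induction a)
  case (cLim F)
  show ?case
  proof (cases "\<exists>x \<in> carrier \<A>. (\<lambda>n. cnorm \<A> (ev G (F n) \<ominus> x)) \<longlonglongrightarrow> 0")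
    case True
    then have "\<exists>x. x \<in> carrier \<A> \<and> (\<lambda>n. cnorm \<A> (ev G (F n) \<ominus> x)) \<longlonglongrightarrow> 0" by blast
    from someI_ex[OF this] True show ?thesis by simp
  qed auto
qed (auto simp: assms star_closed)

lemma closed_star_subalgebra_ev:
  assumes G: "\<And>f. G f \<in> carrier \<A>"
  shows "closed_star_subalgebra \<A> (range (ev G)) (\<lambda>x. cterm_seq (inv_into UNIV (ev G) x))"
proof unfold_locales
  note cl = ev_closed[OF G]
  show "range (ev G) \<subseteq> carrier \<A>" using cl by auto
  show "\<zero> \<in> range (ev G)" by (rule range_eqI[of _ _ cZero]) simp
  show "\<one> \<in> range (ev G)" by (rule range_eqI[of _ _ cOne]) simp
  show "x \<oplus> y \<in> range (ev G)" if "x \<in> range (ev G)" "y \<in> range (ev G)" for x y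
  proof -
    from that obtain a b where "x = ev G a" "y = ev G b" by auto
    then show ?thesis by (intro range_eqI[of _ _ "cAdd a b"]) simp
  qed
  show "x \<otimes> y \<in> range (ev G)" if "x \<in> range (ev G)" "y \<in> range (ev G)" for x y
  proof -
    from that obtain a b where "x = ev G a" "y = ev G b" by auto
    then show ?thesis by (intro range_eqI[of _ _ "cMult a b"]) simp
  qed
  show "a \<odot> x \<in> range (ev G)" if "x \<in> range (ev G)" for x a
  proof -
    from that obtain b where "x = ev G b" by auto
    then show ?thesis by (intro range_eqI[of _ _ "cSmult a b"]) simp
  qed
  show "star \<A> x \<in> range (ev G)" if "x \<in> range (ev G)" for x
  proof -
    from that obtain b where "x = ev G b" by auto
    then show ?thesis by (intro range_eqI[of _ _ "cStar b"]) simp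
  qed
  show "x \<in> range (ev G)" if X: "\<And>n. X n \<in> range (ev G)" and x: "x \<in> carrier \<A>"
    and l: "(\<lambda>n. cnorm \<A> (X n \<ominus> x)) \<longlonglongrightarrow> 0" for X x
  proof -
    have "\<forall>n. \<exists>t. X n = ev G t" using X by auto
    then obtain F where F: "\<And>n. X n = ev G (F n)" by metis
    have ex: "\<exists>x. x \<in> carrier \<A> \<and> (\<lambda>n. cnorm \<A> (ev G (F n) \<ominus> x)) \<longlonglongrightarrow> 0"
      using x l by (auto simp: F)
    then have "ev G (cLim F) = (SOME x. x \<in> carrier \<A> \<and> (\<lambda>n. cnorm \<A> (ev G (F n) \<ominus> x)) \<longlonglongrightarrow> 0)"
      by auto
    with someI_ex[OF ex] have *: "ev G (cLim F) \<in> carrier \<A>"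
      "(\<lambda>n. cnorm \<A> (ev G (F n) \<ominus> ev G (cLim F))) \<longlonglongrightarrow> 0" by simp_all
    have "x = ev G (cLim F)"
      by (rule limit_unique[of "\<lambda>n. ev G (F n)"]) (use * x l cl in \<open>auto simp: F\<close>)
    then show ?thesis by blast
  qed
  show "inj_on (\<lambda>x. cterm_seq (inv_into UNIV (ev G) x)) (range (ev G))"
  proof (rule inj_onI)
    fix x y assume xy: "x \<in> range (ev G)" "y \<in> range (ev G)"
      and "cterm_seq (inv_into UNIV (ev G) x) = cterm_seq (inv_into UNIV (ev G) y)"
    then have "inv_into UNIV (ev G) x = inv_into UNIV (ev G) y" using injD[OF inj_cterm_seq] by blast
    then show "x = y" using xy by (metis f_inv_into_f)
  qed
qed

end

theorem d_subhomogeneousI: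
  fixes \<A> :: "('a, 'm) cstar_algebra_scheme"
    and K :: "nat \<Rightarrow> ('v::euclidean_space \<times> 'v) mat set"
  assumes alg: "commutative_cstar_algebra \<A>"
    and emb: "unital_complete_order_embedding K u (Mat d \<A>) \<Phi>"
  shows "d_subhomogeneous d K u"
proof -
  interpret commutative_cstar_algebra \<A> by fact
  have \<Phi>: "\<And>x. \<Phi> x \<in> carrier (Mat d \<A>)"
    and pos: "\<And>s X. s \<ge> 1 \<Longrightarrow> X \<in> Her s \<Longrightarrow> X \<in> K s \<Longrightarrow>
       positive_element (Mat s (Mat d \<A>)) (amplification (Mat d \<A>) \<Phi> X)"
    using emb unfolding unital_complete_order_embedding_def by blast+
  let ?Q = "\<lambda>s X y. y \<in> carrier (Mat s (Mat d \<A>)) \<and>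
        amplification (Mat d \<A>) \<Phi> X = star (Mat s (Mat d \<A>)) y \<otimes>\<^bsub>Mat s (Mat d \<A>)\<^esub> y"
  have "\<forall>s X. \<exists>y. s \<ge> 1 \<and> X \<in> Her s \<and> X \<in> K s \<longrightarrow> ?Q s X y"
    using pos unfolding positive_element_def by blast
  then obtain W where W: "\<And>s X. s \<ge> 1 \<Longrightarrow> X \<in> Her s \<Longrightarrow> X \<in> K s \<Longrightarrow> ?Q s X (W s X)"
    by metis
  define \<iota> :: "bool \<times> 'v \<times> ('v \<times> 'v) mat \<times> nat \<times> nat \<times> nat \<times> nat \<times> nat \<Rightarrow> 'a" where
    "\<iota> = (\<lambda>(w, x, X, s, i, j, k, l). if w then W s X $$ (i, j) $$ (k, l) else \<Phi> x $$ (i, j))"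
  have "small_type TYPE(bool \<times> 'v \<times> ('v \<times> 'v) mat \<times> nat \<times> nat \<times> nat \<times> nat \<times> nat)"
    by (intro small_type_prod small_type_countable small_type_euclidean small_type_mat)
  then obtain e :: "bool \<times> 'v \<times> ('v \<times> 'v) mat \<times> nat \<times> nat \<times> nat \<times> nat \<times> nat \<Rightarrow> nat \<Rightarrow> complex"
    where e: "inj e" by (auto simp: small_type_def)
  define G where "G = (\<lambda>f. let a = \<iota> (inv_into UNIV e f) in if a \<in> carrier \<A> then a else \<zero>\<^bsub>\<A>\<^esub>)"
  have G: "G f \<in> carrier \<A>" for f by (simp add: G_def Let_def)
  have gen: "\<iota> q \<in> range (ev G)" if "\<iota> q \<in> carrier \<A>" for q
    using that e by (intro range_eqI[of _ _ "cGen (e q)"]) (simp add: G_def)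
  interpret S: closed_star_subalgebra \<A> "range (ev G)" "\<lambda>x. cterm_seq (inv_into UNIV (ev G) x)"
    by (rule closed_star_subalgebra_ev[OF G])
  have "unital_complete_order_embedding K u (Mat d S.T)
      (\<lambda>x. map_mat (\<lambda>x. cterm_seq (inv_into UNIV (ev G) x)) (\<Phi> x))"
  proof (rule S.transport_embedding[OF emb])
    fix x and i j :: nat assume "i < d" "j < d"
    then show "\<Phi> x $$ (i, j) \<in> range (ev G)"
      using gen[of "(False, x, undefined, 0, i, j, 0, 0)"] \<Phi>[of x]
      by (simp add: \<iota>_def Mat_carrier_iff)
  next
    fix s X assume s: "s \<ge> 1" "X \<in> Her s" "X \<in> K s"
    have "W s X $$ (i, j) $$ (k, l) \<in> range (ev G)" if "i < s" "j < s" "k < d" "l < d" for i j k l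
      using gen[of "(True, 0, X, s, i, j, k, l)"] W[OF s] that
      by (simp add: \<iota>_def Mat_carrier_iff)
    then show "\<exists>y \<in> carrier (Mat s (Mat d \<A>)).
        amplification (Mat d \<A>) \<Phi> X = star (Mat s (Mat d \<A>)) y \<otimes>\<^bsub>Mat s (Mat d \<A>)\<^esub> y \<and>
        (\<forall>i<s. \<forall>j<s. \<forall>k<d. \<forall>l<d. y $$ (i, j) $$ (k, l) \<in> range (ev G))"
      using W[OF s] by blast
  qed
  then show ?thesis
    unfolding d_subhomogeneous_def using S.commutative_cstar_algebra_T by blast
qed

end

theory Submission
  imports Defs
begin

text \<open>Subhomogeneous cones: for the cone over a square a matrix with entries in \<open>V\<close> is in the minimal cone as
  soon as it is positive under all two-dimensional representations; by duality this reduces to a trace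
  inequality for \<open>P\<^sub>1 + P\<^sub>2 = Q\<^sub>1 + Q\<^sub>2\<close>, which follows from diagonalising pairs of projections. The embedding is then
  evaluation at all unital positive maps into \<open>Mat\<^sub>2\<close>, a point of view that survives adding extreme rays as direct summands.

  Non-subhomogeneous cones: a unital positive map \<open>S\<close> of \<open>C\<close> into \<open>s \<times> s\<close> matrices is pure enough if every
  relation \<open>\<Sum>\<^sub>j S(w\<^sub>j) \<epsilon>\<^sub>j = 0\<close> is forced by null vectors of the \<open>S(c)\<close>, \<open>c \<in> C\<close>. A unital complete order
  embedding into \<open>Mat\<^sub>d(\<A>)\<close> then makes the algebra generated by \<open>S\<close> a subquotient of \<open>Mat\<^sub>d(\<A>)\<close>, which is
  impossible when it contains \<open>d + 1\<close> matrix units per row: over the commutative ring \<open>\<A>\<close> a homogeneous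
  linear system with more unknowns than equations has a nontrivial solution. Pure pencils of arbitrary size come
  from pairs of projections in general position.\<close>

section \<open>Hermitian forms over finite index sets\<close>

text \<open>An embedding may go into matrices over any commutative C*-algebra, and no Gelfand
  representation is used. The obstruction therefore works with ring identities, with square roots of
  \<open>1 - x\<close> for \<open>x\<close> of norm below 1, and with ideals that need not be
  maximal. Positivity is handled as domination by finite sums of rank-one terms: these add up
  freely, and a small multiple of the identity turns them back into a single Gram matrix, the form
  in which positive elements are defined.

  The order unit \<open>u\<close> is arbitrary. Both halves normalise their maps at a convenient
  vector \<open>e\<close> instead and use only that \<open>u - \<delta> e\<close> stays in the cone,
  which makes the image of \<open>u\<close> positive definite. The price is an inverse of
  \<open>S(u)\<close> in one half and a congruence in the other.

  Rigidity of a pencil means that \<open>x \<otimes> b\<^sub>l\<close> and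
  \<open>S(b\<^sub>l) x \<otimes> e\<close> agree modulo null tensors. With one additional ray this
  comes from two decompositions of \<open>e\<close> into orthogonal projections. On three
  coordinates there is no room for that; a null vector of \<open>P + Q - V - 1/2\<close> takes over,
  and its existence dictates the entries of \<open>v\<close>.\<close>

definition ip :: "'i set \<Rightarrow> ('i \<Rightarrow> complex) \<Rightarrow> ('i \<Rightarrow> complex) \<Rightarrow> complex" where
  "ip I x y = (\<Sum>i\<in>I. cnj (x i) * y i)"

definition mulv :: "'i set \<Rightarrow> ('i \<Rightarrow> 'i \<Rightarrow> complex) \<Rightarrow> ('i \<Rightarrow> complex) \<Rightarrow> 'i \<Rightarrow> complex" where
  "mulv I h x i = (\<Sum>j\<in>I. h i j * x j)"

definition form :: "'i set \<Rightarrow> ('i \<Rightarrow> 'i \<Rightarrow> complex) \<Rightarrow> ('i \<Rightarrow> complex) \<Rightarrow> complex" where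
  "form I h x = ip I x (mulv I h x)"

definition herm :: "'i set \<Rightarrow> ('i \<Rightarrow> 'i \<Rightarrow> complex) \<Rightarrow> bool" where
  "herm I h \<longleftrightarrow> (\<forall>i\<in>I. \<forall>j\<in>I. h j i = cnj (h i j))"

definition psd :: "'i set \<Rightarrow> ('i \<Rightarrow> 'i \<Rightarrow> complex) \<Rightarrow> bool" where
  "psd I h \<longleftrightarrow> herm I h \<and> (\<forall>x. 0 \<le> Re (form I h x))"

definition orthonormal :: "'i set \<Rightarrow> 'k set \<Rightarrow> ('k \<Rightarrow> 'i \<Rightarrow> complex) \<Rightarrow> bool" where
  "orthonormal I K v \<longleftrightarrow> (\<forall>k\<in>K. \<forall>l\<in>K. ip I (v k) (v l) = (if k = l then 1 else 0))"

lemma hermI: "(\<And>i j. i \<in> I \<Longrightarrow> j \<in> I \<Longrightarrow> cnj (h i j) = h j i) \<Longrightarrow> herm I h"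
  unfolding herm_def by metis

lemma hermD: "herm I h \<Longrightarrow> i \<in> I \<Longrightarrow> j \<in> I \<Longrightarrow> cnj (h i j) = h j i"
  unfolding herm_def by metis

lemma psdI: "herm I h \<Longrightarrow> (\<And>x. 0 \<le> Re (form I h x)) \<Longrightarrow> psd I h"
  and psdD: "psd I h \<Longrightarrow> herm I h" "psd I h \<Longrightarrow> 0 \<le> Re (form I h x)"
  by (simp_all add: psd_def)

lemma ip_add_right: "ip I x (\<lambda>i. y i + z i) = ip I x y + ip I x z"
  and ip_add_left: "ip I (\<lambda>i. y i + z i) x = ip I y x + ip I z x"
  and ip_diff_right: "ip I x (\<lambda>i. y i - z i) = ip I x y - ip I x z"
  and ip_diff_left: "ip I (\<lambda>i. y i - z i) x = ip I y x - ip I z x"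
  and ip_mult_right: "ip I x (\<lambda>i. c * y i) = c * ip I x y"
  and ip_mult_left: "ip I (\<lambda>i. c * y i) x = cnj c * ip I y x"
  and ip_cnj: "cnj (ip I x y) = ip I y x"
  by (simp_all add: ip_def algebra_simps sum.distrib sum_subtractf sum_distrib_left)

lemma ip_sum_right: "ip I x (\<lambda>i. \<Sum>k\<in>K. f k i) = (\<Sum>k\<in>K. ip I x (f k))"
  by (simp add: ip_def sum_distrib_left sum.swap[of _ K])

lemma ip_sum_left: "ip I (\<lambda>i. \<Sum>k\<in>K. f k i) x = (\<Sum>k\<in>K. ip I (f k) x)"
  by (simp add: ip_def sum_distrib_right sum.swap[of _ K])

lemma ip_self: "ip I x x = of_real (\<Sum>i\<in>I. (cmod (x i))\<^sup>2)"
  unfolding ip_def of_real_sum by (intro sum.cong refl) (metis complex_norm_square mult.commute)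

lemma ip_self_nonneg: "0 \<le> Re (ip I x x)"
  by (simp add: ip_self sum_nonneg)

lemma ip_self_Re: "of_real (Re (ip I x x)) = ip I x x"
  by (simp add: ip_self)

lemma ip_self_eq_0:
  assumes "finite I" "Re (ip I x x) = 0" "i \<in> I" shows "x i = 0"
  using assms by (simp add: ip_self sum_nonneg_eq_0_iff)

lemma ip_cong: "(\<And>i. i \<in> I \<Longrightarrow> x i = x' i) \<Longrightarrow> (\<And>i. i \<in> I \<Longrightarrow> y i = y' i) \<Longrightarrow> ip I x y = ip I x' y'"
  by (simp add: ip_def)

lemma mulv_cong: "(\<And>j. j \<in> I \<Longrightarrow> h i j = h' i j) \<Longrightarrow> (\<And>i. i \<in> I \<Longrightarrow> x i = x' i) \<Longrightarrow> mulv I h x i = mulv I h' x' i"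
  by (simp add: mulv_def)

lemma form_cong:
  "(\<And>i j. i \<in> I \<Longrightarrow> j \<in> I \<Longrightarrow> h i j = h' i j) \<Longrightarrow> (\<And>i. i \<in> I \<Longrightarrow> x i = x' i) \<Longrightarrow> form I h x = form I h' x'"
  unfolding form_def by (intro ip_cong mulv_cong) auto

lemma form_expand: "form I h x = (\<Sum>i\<in>I. \<Sum>j\<in>I. cnj (x i) * h i j * x j)"
  by (simp add: form_def ip_def mulv_def sum_distrib_left mult.assoc)

lemma mulv_add: "mulv I h (\<lambda>i. x i + y i) = (\<lambda>i. mulv I h x i + mulv I h y i)"
  and mulv_mult: "mulv I h (\<lambda>i. c * x i) = (\<lambda>i. c * mulv I h x i)"
  by (auto simp: mulv_def algebra_simps sum.distrib sum_distrib_left)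

lemma ip_mulv_herm:
  assumes "herm I h" shows "ip I (mulv I h x) y = ip I x (mulv I h y)"
proof -
  have "ip I (mulv I h x) y = (\<Sum>i\<in>I. \<Sum>j\<in>I. cnj (h i j) * cnj (x j) * y i)"
    by (simp add: ip_def mulv_def sum_distrib_right)
  also have "\<dots> = (\<Sum>j\<in>I. \<Sum>i\<in>I. cnj (h i j) * cnj (x j) * y i)" by (rule sum.swap)
  also have "\<dots> = (\<Sum>j\<in>I. \<Sum>i\<in>I. cnj (x j) * (h j i * y i))"
  proof (intro sum.cong refl)
    fix j i assume "j \<in> I" "i \<in> I"
    then have "h j i = cnj (h i j)" using assms unfolding herm_def by blast
    then show "cnj (h i j) * cnj (x j) * y i = cnj (x j) * (h j i * y i)" by simp
  qed
  finally show ?thesis by (simp add: ip_def mulv_def sum_distrib_left)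
qed

lemma form_real: "herm I h \<Longrightarrow> of_real (Re (form I h x)) = form I h x"
proof -
  assume "herm I h"
  then have "cnj (form I h x) = form I h x"
    using ip_mulv_herm[of I h x x] ip_cnj[of I x "mulv I h x"] by (simp add: form_def)
  then show ?thesis by (simp add: complex_eq_iff)
qed

text \<open>\<open>y\<close> is the residual of \<open>x\<close> after projection to the span of the
  \<open>v k\<close>; it is orthogonal to that span, and the first equation is Pythagoras. Bessel's
  inequality, completeness of bases and the existence of orthogonal unit vectors are read off from
  it.\<close>

lemma bessel_eq:
  fixes x :: "'i \<Rightarrow> complex" and I :: "'i set" and K :: "'k set" and v :: "'k \<Rightarrow> 'i \<Rightarrow> complex"
  defines "y \<equiv> \<lambda>i. x i - (\<Sum>k\<in>K. ip I (v k) x * v k i)"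
  assumes "finite K" "orthonormal I K v"
  shows "Re (ip I y y) = Re (ip I x x) - (\<Sum>k\<in>K. (cmod (ip I (v k) x))\<^sup>2)"
    and "\<And>k. k \<in> K \<Longrightarrow> ip I (v k) y = 0"
proof -
  show o: "ip I (v k) y = 0" if "k \<in> K" for k
  proof -
    have "ip I (v k) y = ip I (v k) x - (\<Sum>l\<in>K. ip I (v l) x * ip I (v k) (v l))"
      by (simp add: y_def ip_diff_right ip_sum_right ip_mult_right)
    also have "(\<Sum>l\<in>K. ip I (v l) x * ip I (v k) (v l)) = (\<Sum>l\<in>K. if l = k then ip I (v l) x else 0)"
      using assms(3) that by (intro sum.cong) (auto simp: orthonormal_def)
    finally show ?thesis using assms(2) that by simp
  qed
  have "ip I y y = ip I x y - (\<Sum>k\<in>K. cnj (ip I (v k) x) * ip I (v k) y)"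
    by (subst (1) y_def) (simp add: ip_diff_left ip_sum_left ip_mult_left)
  also have "\<dots> = ip I x y" by (simp add: o)
  also have "\<dots> = ip I x x - (\<Sum>k\<in>K. ip I (v k) x * cnj (ip I (v k) x))"
    by (simp add: y_def ip_diff_right ip_sum_right ip_mult_right ip_cnj)
  also have "\<dots> = ip I x x - of_real (\<Sum>k\<in>K. (cmod (ip I (v k) x))\<^sup>2)"
    by (simp only: complex_norm_square of_real_sum)
  finally show "Re (ip I y y) = Re (ip I x x) - (\<Sum>k\<in>K. (cmod (ip I (v k) x))\<^sup>2)" by simp
qed

lemma bessel:
  assumes "finite K" "orthonormal I K v"
  shows "(\<Sum>k\<in>K. (cmod (ip I (v k) x))\<^sup>2) \<le> Re (ip I x x)"
proof -
  have "0 \<le> Re (ip I x x) - (\<Sum>k\<in>K. (cmod (ip I (v k) x))\<^sup>2)"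
    unfolding bessel_eq(1)[OF assms, where x = x, symmetric] by (rule ip_self_nonneg)
  then show ?thesis by simp
qed

lemma ip_unit:
  assumes "finite I" "i \<in> I"
  shows "ip I x (\<lambda>j. if j = i then 1 else 0) = cnj (x i)"
    and "ip I (\<lambda>j. if j = i then 1 else 0) x = x i"
proof -
  have "ip I x (\<lambda>j. if j = i then 1 else 0) = (\<Sum>j\<in>I. if j = i then cnj (x j) else 0)"
    unfolding ip_def by (intro sum.cong) auto
  then show "ip I x (\<lambda>j. if j = i then 1 else 0) = cnj (x i)" using assms by simp
  have "ip I (\<lambda>j. if j = i then 1 else 0) x = (\<Sum>j\<in>I. if j = i then x j else 0)"
    unfolding ip_def by (intro sum.cong) auto
  then show "ip I (\<lambda>j. if j = i then 1 else 0) x = x i" using assms by simp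
qed

lemma orthonormal_sum_cmod:
  assumes "finite K" "orthonormal I K v"
  shows "(\<Sum>i\<in>I. \<Sum>k\<in>K. (cmod (v k i))\<^sup>2) = card K"
proof -
  have "(\<Sum>i\<in>I. (cmod (v k i))\<^sup>2) = 1" if "k \<in> K" for k
  proof -
    have "complex_of_real (\<Sum>i\<in>I. (cmod (v k i))\<^sup>2) = 1"
      using assms(2) that unfolding ip_self[symmetric] by (simp add: orthonormal_def)
    then show ?thesis by (metis of_real_eq_1_iff)
  qed
  then show ?thesis by (subst sum.swap) simp
qed

text \<open>The squared lengths of the projections of all standard unit vectors add up to
  \<open>card K\<close>. As this is less than \<open>card I\<close>, some unit vector is not fixed
  by the projection, and its normalised residual is the wanted vector.\<close>

lemma orthonormal_complement:
  assumes "finite I" "finite K" "card K < card I" "orthonormal I K v"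
  shows "\<exists>x. (\<forall>k\<in>K. ip I (v k) x = 0) \<and> ip I x x = 1 \<and> (\<forall>i. i \<notin> I \<longrightarrow> x i = 0)"
proof -
  have "\<exists>i\<in>I. (\<Sum>k\<in>K. (cmod (v k i))\<^sup>2) < 1"
  proof (rule ccontr)
    assume "\<not> ?thesis"
    then have "(\<Sum>i\<in>I. 1::real) \<le> (\<Sum>i\<in>I. \<Sum>k\<in>K. (cmod (v k i))\<^sup>2)" by (intro sum_mono) force
    then show False using orthonormal_sum_cmod[OF assms(2,4)] assms(3) by simp
  qed
  then obtain i where i: "i \<in> I" "(\<Sum>k\<in>K. (cmod (v k i))\<^sup>2) < 1" by blast
  define e where "e = (\<lambda>j. if j = i then 1 else (0::complex))"
  define y where "y = (\<lambda>j. e j - (\<Sum>k\<in>K. ip I (v k) e * v k j))"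
  note b = bessel_eq[OF assms(2,4), where x = e, folded y_def]
  have "Re (ip I e e) = 1" using ip_unit[OF assms(1) i(1)] by (simp add: e_def)
  then have pos: "Re (ip I y y) > 0" using b(1) i(2) ip_unit(1)[OF assms(1) i(1), folded e_def] by simp
  define c where "c = complex_of_real (1 / sqrt (Re (ip I y y)))"
  define x where "x = (\<lambda>j. if j \<in> I then c * y j else 0)"
  have x: "ip I z x = c * ip I z y" "ip I x z = cnj c * ip I y z" for z
    by (auto simp: x_def ip_def sum_distrib_left intro!: sum.cong)
  have "ip I x x = of_real ((1 / sqrt (Re (ip I y y)))\<^sup>2 * Re (ip I y y))"
    unfolding x of_real_mult ip_self_Re by (simp add: c_def power2_eq_square del: of_real_mult flip: of_real_mult)
  also have "(1 / sqrt (Re (ip I y y)))\<^sup>2 * Re (ip I y y) = 1" using pos by (simp add: power_divide)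
  finally have "ip I x x = 1" by simp
  moreover have "\<forall>k\<in>K. ip I (v k) x = 0" using b(2) by (simp add: x)
  moreover have "\<forall>i. i \<notin> I \<longrightarrow> x i = 0" by (simp add: x_def)
  ultimately show ?thesis by blast
qed

section \<open>Rayleigh quotients and the spectral theorem\<close>

lemma compact_box: "compact {x::'i \<Rightarrow> complex. (\<forall>i\<in>I. cmod (x i) \<le> r) \<and> (\<forall>i. i \<notin> I \<longrightarrow> x i = 0)}"
proof -
  let ?S = "\<lambda>i. if i \<in> I then cball (0::complex) r else {0}"
  \<comment> \<open>Compactness in the product topology: forcing the value 0 off \<open>I\<close>
    keeps every factor compact although the index type may be infinite.\<close>
  have "compactin (product_topology (\<lambda>_. euclidean) UNIV) (PiE UNIV ?S)"
    by (subst compactin_PiE) (auto simp: compactin_euclidean_iff)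
  moreover have "PiE UNIV ?S = {x. (\<forall>i\<in>I. cmod (x i) \<le> r) \<and> (\<forall>i. i \<notin> I \<longrightarrow> x i = 0)}"
    by (auto simp: PiE_def Pi_def split: if_splits)
  ultimately show ?thesis by (simp add: euclidean_product_topology compactin_euclidean_iff)
qed

lemma continuous_coord [continuous_intros]: "continuous_on S (\<lambda>x. x i)"
  by (rule continuous_on_product_then_coordinatewise[OF continuous_on_id])

lemma continuous_ip [continuous_intros]:
  assumes "\<And>i. continuous_on S (\<lambda>x. f x i)" "\<And>i. continuous_on S (\<lambda>x. g x i)"
  shows "continuous_on S (\<lambda>x. ip I (f x) (g x))"
  unfolding ip_def by (intro continuous_intros assms)

lemma continuous_mulv [continuous_intros]:
  assumes "\<And>i j. continuous_on S (\<lambda>x. h x i j)" "\<And>i. continuous_on S (\<lambda>x. g x i)"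
  shows "continuous_on S (\<lambda>x. mulv I (h x) (g x) i)"
  unfolding mulv_def by (intro continuous_intros assms)

text \<open>First-order optimality: after division by \<open>t\<close> the quadratic term disappears
  in the limit. It drives both extremal arguments, for the Rayleigh quotient and for the
  interpolation defect.\<close>

lemma linear_dominates_quadratic:
  fixes a b :: real
  assumes "\<And>t. 0 < t \<Longrightarrow> t < 1 \<Longrightarrow> t * a + t\<^sup>2 * b \<le> 0"
  shows "a \<le> 0"
proof -
  have "\<forall>\<^sub>F t in at_right 0. a + t * b \<le> 0"
    unfolding eventually_at_right_field
  proof (intro exI[of _ 1] conjI allI impI)
    fix t :: real assume "0 < t" "t < 1"
    then have "t * (a + t * b) \<le> 0" using assms[of t] by (simp add: power2_eq_square algebra_simps)
    then show "a + t * b \<le> 0" using \<open>0 < t\<close> by (simp add: mult_le_0_iff)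
  qed simp
  moreover have "((\<lambda>t. a + t * b) \<longlongrightarrow> a + 0 * b) (at_right 0)" by (intro tendsto_intros)
  ultimately show ?thesis using tendsto_upperbound[of "\<lambda>t. a + t * b" _ "at_right 0" 0] by simp
qed

text \<open>Take \<open>w\<close> maximising the form on the unit sphere orthogonal to the given
  eigenvectors. The residual \<open>y = h w - l w\<close> is orthogonal to \<open>w\<close> and to
  all \<open>v k\<close>, hence an admissible direction, along which the form grows at twice the
  squared norm of \<open>y\<close>; so \<open>y\<close> vanishes.\<close>

lemma exists_eigenvector:
  assumes I: "finite I" and h: "herm I h" and K: "finite K" "card K < card I" and v: "orthonormal I K v"
    and eig: "\<And>k i. k \<in> K \<Longrightarrow> i \<in> I \<Longrightarrow> mulv I h (v k) i = of_real (\<mu> k) * v k i"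
  shows "\<exists>w l. ip I w w = 1 \<and> (\<forall>k\<in>K. ip I (v k) w = 0) \<and> (\<forall>i\<in>I. mulv I h w i = of_real l * w i)"
proof -
  define S where "S = {x. (\<forall>i\<in>I. cmod (x i) \<le> 1) \<and> (\<forall>i. i \<notin> I \<longrightarrow> x i = 0)} \<inter>
    ({x. ip I x x = 1} \<inter> (\<Inter>k\<in>K. {x. ip I (v k) x = 0}))"
  have "closed ({x. ip I x x = 1} \<inter> (\<Inter>k\<in>K. {x. ip I (v k) x = 0}))"
    by (intro closed_Int closed_INT ballI closed_Collect_eq continuous_intros)
  then have "compact S" unfolding S_def by (intro compact_Int_closed compact_box)
  have S_iff: "x \<in> S \<longleftrightarrow> ip I x x = 1 \<and> (\<forall>k\<in>K. ip I (v k) x = 0) \<and> (\<forall>i. i \<notin> I \<longrightarrow> x i = 0)" for x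
  proof -
    have "cmod (x i) \<le> 1" if "ip I x x = 1" "i \<in> I" for i
    proof -
      have "(\<Sum>i\<in>I. (cmod (x i))\<^sup>2) = 1" using that(1) unfolding ip_self by (metis of_real_eq_1_iff)
      moreover have "(cmod (x i))\<^sup>2 \<le> (\<Sum>i\<in>I. (cmod (x i))\<^sup>2)"
        using I that(2) by (intro member_le_sum) auto
      ultimately show ?thesis by (simp add: power_le_one_iff)
    qed
    then show ?thesis by (auto simp: S_def)
  qed
  have "S \<noteq> {}" using orthonormal_complement[OF I K v] S_iff by blast
  moreover have "continuous_on S (\<lambda>x. Re (form I h x))"
    unfolding form_def by (intro continuous_intros)
  ultimately obtain w where w: "w \<in> S" "\<And>x. x \<in> S \<Longrightarrow> Re (form I h x) \<le> Re (form I h w)"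
    using continuous_attains_sup[OF \<open>compact S\<close>] by blast
  define l where "l = Re (form I h w)"
  define y where "y = (\<lambda>i. if i \<in> I then mulv I h w i - of_real l * w i else 0)"
  have ipy: "ip I z y = ip I z (mulv I h w) - of_real l * ip I z w" for z
    unfolding ip_diff_right[symmetric] ip_mult_right[symmetric] by (rule ip_cong) (auto simp: y_def)
  have w1: "ip I w w = 1" "\<And>k. k \<in> K \<Longrightarrow> ip I (v k) w = 0" using w S_iff by auto
  have wy: "ip I w y = 0" using w1 form_real[OF h, of w] by (simp add: ipy l_def form_def)
  then have yw: "ip I y w = 0" using ip_cnj[of I w y] by simp
  have vy: "ip I (v k) y = 0" if "k \<in> K" for k
  proof -
    have "ip I (v k) (mulv I h w) = ip I (mulv I h (v k)) w" by (simp add: ip_mulv_herm[OF h])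
    also have "\<dots> = ip I (\<lambda>i. of_real (\<mu> k) * v k i) w" by (rule ip_cong) (auto simp: eig that)
    finally show ?thesis using w1 that by (simp add: ipy ip_mult_left)
  qed
  define n where "n = Re (ip I y y)"
  have n0: "n \<ge> 0" by (simp add: n_def ip_self_nonneg)
  have nn: "ip I y y = of_real n" by (simp add: n_def ip_self_Re)
  have yhw: "ip I y (mulv I h w) = of_real n" using ipy[of y] yw by (simp add: nn)
  have whw: "ip I w (mulv I h y) = of_real n"
    using ip_mulv_herm[OF h, of w y] ip_cnj[of I y "mulv I h w"] yhw by simp
  \<comment> \<open>Maximality of \<open>w\<close> against the normalised vector
    \<open>w + t y\<close>, cleared of the denominator \<open>1 + t\<^sup>2 * n\<close>.\<close>
  have main: "t * (2 * n) + t\<^sup>2 * (Re (form I h y) - l * n) \<le> 0" if "t > 0" for t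
  proof -
    define x where "x = (\<lambda>i. w i + of_real t * y i)"
    have xx: "ip I x x = of_real (1 + t\<^sup>2 * n)"
      by (simp add: x_def ip_add_left ip_add_right ip_mult_left ip_mult_right w1 wy yw nn power2_eq_square)
    have fx: "Re (form I h x) = l + 2 * t * n + t\<^sup>2 * Re (form I h y)"
      by (simp add: x_def form_def mulv_add mulv_mult ip_add_left ip_add_right ip_mult_left ip_mult_right
          yhw whw l_def power2_eq_square algebra_simps)
    have N: "1 + t\<^sup>2 * n > 0" using n0 by (simp add: add_pos_nonneg)
    define c where "c = complex_of_real (1 / sqrt (1 + t\<^sup>2 * n))"
    have cc: "cnj c * c = of_real (1 / (1 + t\<^sup>2 * n))" using N by (simp add: c_def flip: of_real_mult)
    have "(\<lambda>i. c * x i) \<in> S"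
      unfolding S_iff
    proof (intro conjI allI ballI impI)
      have "ip I (\<lambda>i. c * x i) (\<lambda>i. c * x i) = cnj c * c * ip I x x" by (simp add: ip_mult_left ip_mult_right)
      then show "ip I (\<lambda>i. c * x i) (\<lambda>i. c * x i) = 1" unfolding cc xx of_real_mult[symmetric] using N by simp
      show "ip I (v k) (\<lambda>i. c * x i) = 0" if "k \<in> K" for k
        using that by (simp add: x_def ip_mult_right ip_add_right w1 vy)
      show "c * x i = 0" if "i \<notin> I" for i using that w(1) by (simp add: x_def y_def S_iff)
    qed
    from w(2)[OF this] have "Re (cnj c * c * form I h x) \<le> l"
      by (simp add: l_def form_def mulv_mult ip_mult_left ip_mult_right mult.assoc)
    then have "(1 / (1 + t\<^sup>2 * n)) * Re (form I h x) \<le> l" unfolding cc by simp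
    then have "Re (form I h x) \<le> l * (1 + t\<^sup>2 * n)" using N by (simp add: field_simps)
    then show ?thesis using fx by (simp add: algebra_simps)
  qed
  have "2 * n \<le> 0" by (rule linear_dominates_quadratic[OF main])
  then have "n = 0" using n0 by simp
  then have "\<forall>i\<in>I. mulv I h w i = of_real l * w i"
    using ip_self_eq_0[OF I, of y] by (fastforce simp: n_def y_def)
  then show ?thesis using w1 by blast
qed

theorem spectral:
  assumes I: "finite I" and h: "herm I h"
  obtains v \<mu> where "orthonormal I I v"
    "\<And>k i. k \<in> I \<Longrightarrow> i \<in> I \<Longrightarrow> mulv I h (v k) i = of_real (\<mu> k) * v k i"
proof -
  have "\<exists>v \<mu>. orthonormal I K v \<and> (\<forall>k\<in>K. \<forall>i\<in>I. mulv I h (v k) i = of_real (\<mu> k) * v k i)"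
    if "K \<subseteq> I" for K
  proof -
    have "finite K" using that I finite_subset by blast
    then show ?thesis using that
    proof (induction K rule: finite_induct)
      case empty
      show ?case by (simp add: orthonormal_def)
    next
      case (insert a K)
      then have "\<exists>v \<mu>. orthonormal I K v \<and> (\<forall>k\<in>K. \<forall>i\<in>I. mulv I h (v k) i = of_real (\<mu> k) * v k i)" by blast
      then obtain v \<mu> where v: "orthonormal I K v"
        and e: "\<And>k i. k \<in> K \<Longrightarrow> i \<in> I \<Longrightarrow> mulv I h (v k) i = of_real (\<mu> k) * v k i" by blast
      have "card K < card I" using insert I by (metis card_seteq insert_subset linorder_not_less)
      then obtain w l where w: "ip I w w = 1" "\<And>k. k \<in> K \<Longrightarrow> ip I (v k) w = 0"
        "\<And>i. i \<in> I \<Longrightarrow> mulv I h w i = of_real l * w i"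
        using exists_eigenvector[OF I h \<open>finite K\<close> _ v e] by blast
      have w': "ip I w (v k) = 0" if "k \<in> K" for k using w(2)[OF that] ip_cnj[of I "v k" w] by simp
      have "orthonormal I (insert a K) (v(a := w))"
        using v w w' insert(2) by (auto simp: orthonormal_def)
      moreover have "\<forall>k\<in>insert a K. \<forall>i\<in>I. mulv I h ((v(a := w)) k) i = of_real ((\<mu>(a := l)) k) * (v(a := w)) k i"
        using e w(3) insert(2) by auto
      ultimately show ?case by (intro exI[of _ "v(a := w)"] exI[of _ "\<mu>(a := l)"] conjI)
    qed
  qed
  from this[of I] show ?thesis using that by auto
qed

text \<open>Bessel's inequality bounds the squared length of each row by 1, and all rows together
  have squared length \<open>card I\<close>. So every row has length exactly 1, and each standard
  unit vector equals its own expansion.\<close>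

lemma orthonormal_complete:
  assumes I: "finite I" and v: "orthonormal I I v" and "i \<in> I" "j \<in> I"
  shows "(\<Sum>k\<in>I. v k i * cnj (v k j)) = (if i = j then 1 else 0)"
proof -
  have le: "(\<Sum>k\<in>I. (cmod (v k j))\<^sup>2) \<le> 1" if "j \<in> I" for j
    using bessel[OF I v, of "\<lambda>l. if l = j then 1 else 0"] ip_unit[OF I that] by simp
  have "(\<Sum>k\<in>I. (cmod (v k j))\<^sup>2) = 1" if j: "j \<in> I" for j
  proof (rule ccontr)
    assume "(\<Sum>k\<in>I. (cmod (v k j))\<^sup>2) \<noteq> 1"
    then have "(\<Sum>j\<in>I. \<Sum>k\<in>I. (cmod (v k j))\<^sup>2) < (\<Sum>j\<in>I. 1)"
      using le j I by (intro sum_strict_mono_ex1) (auto intro!: bexI[of _ j] simp: order_less_le)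
    then show False using orthonormal_sum_cmod[OF I v] by simp
  qed
  then have one: "(\<Sum>k\<in>I. (cmod (v k j))\<^sup>2) = 1" using assms by blast
  define e where "e = (\<lambda>l. if l = j then 1 else (0::complex))"
  have ev: "ip I (v k) e = cnj (v k j)" for k using ip_unit[OF I \<open>j \<in> I\<close>] by (simp add: e_def)
  have "Re (ip I (\<lambda>i. e i - (\<Sum>k\<in>I. ip I (v k) e * v k i)) (\<lambda>i. e i - (\<Sum>k\<in>I. ip I (v k) e * v k i))) = 0"
    unfolding bessel_eq(1)[OF I v] using one ip_unit(1)[OF I \<open>j \<in> I\<close>, of e, folded e_def]
    by (simp add: ev) (simp add: e_def)
  from ip_self_eq_0[OF I this \<open>i \<in> I\<close>] have "(\<Sum>k\<in>I. cnj (v k j) * v k i) = e i" by (simp add: ev)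
  then show ?thesis by (simp add: e_def mult.commute)
qed

lemma spectral_expand:
  assumes I: "finite I" and v: "orthonormal I I v"
    and e: "\<And>k i. k \<in> I \<Longrightarrow> i \<in> I \<Longrightarrow> mulv I h (v k) i = of_real (\<mu> k) * v k i"
    and ij: "i \<in> I" "j \<in> I"
  shows "h i j = (\<Sum>k\<in>I. of_real (\<mu> k) * v k i * cnj (v k j))"
proof -
  have "(\<Sum>k\<in>I. of_real (\<mu> k) * v k i * cnj (v k j)) = (\<Sum>k\<in>I. \<Sum>l\<in>I. h i l * v k l * cnj (v k j))"
    using ij by (intro sum.cong refl) (simp only: e[symmetric] mulv_def sum_distrib_right)
  also have "\<dots> = (\<Sum>l\<in>I. h i l * (\<Sum>k\<in>I. v k l * cnj (v k j)))"
    by (subst sum.swap) (simp add: sum_distrib_left mult.assoc)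
  also have "\<dots> = (\<Sum>l\<in>I. if l = j then h i l else 0)"
    using orthonormal_complete[OF I v] ij by (intro sum.cong) auto
  finally show ?thesis using I ij by simp
qed

lemma psd_gram:
  assumes I: "finite I" and h: "psd I h"
  obtains y where "\<And>i j. i \<in> I \<Longrightarrow> j \<in> I \<Longrightarrow> h i j = (\<Sum>l\<in>I. cnj (y l i) * y l j)"
proof -
  obtain v \<mu> where v: "orthonormal I I v"
    and e: "\<And>k i. k \<in> I \<Longrightarrow> i \<in> I \<Longrightarrow> mulv I h (v k) i = of_real (\<mu> k) * v k i"
    using spectral[OF I] h by (auto simp: psd_def)
  have mu: "\<mu> k \<ge> 0" if "k \<in> I" for k
  proof -
    have "form I h (v k) = ip I (v k) (\<lambda>i. of_real (\<mu> k) * v k i)"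
      unfolding form_def by (rule ip_cong) (auto simp: e that)
    then have "form I h (v k) = of_real (\<mu> k)" using v that by (simp add: ip_mult_right orthonormal_def)
    moreover have "0 \<le> Re (form I h (v k))" using h by (simp add: psd_def)
    ultimately show ?thesis by simp
  qed
  define y where "y = (\<lambda>l j. of_real (sqrt (\<mu> l)) * cnj (v l j))"
  show ?thesis
  proof
    fix i j assume "i \<in> I" "j \<in> I"
    have "cnj (y l i) * y l j = of_real (\<mu> l) * v l i * cnj (v l j)" if "l \<in> I" for l
    proof -
      have "complex_of_real (\<mu> l) = of_real (sqrt (\<mu> l)) * of_real (sqrt (\<mu> l))"
        using mu[OF that] by (simp flip: of_real_mult)
      then show ?thesis by (simp add: y_def)
    qed
    then show "h i j = (\<Sum>l\<in>I. cnj (y l i) * y l j)"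
      using spectral_expand[OF I v e \<open>i \<in> I\<close> \<open>j \<in> I\<close>] by simp
  qed
qed

lemma form_gram:
  assumes "\<And>i j. i \<in> I \<Longrightarrow> j \<in> I \<Longrightarrow> h i j = (\<Sum>l\<in>L. cnj (y l i) * y l j)"
  shows "form I h x = of_real (\<Sum>l\<in>L. (cmod (\<Sum>j\<in>I. y l j * x j))\<^sup>2)"
proof -
  have "form I h x = (\<Sum>i\<in>I. \<Sum>j\<in>I. \<Sum>l\<in>L. cnj (y l i * x i) * (y l j * x j))"
    unfolding form_expand by (intro sum.cong refl) (simp add: assms sum_distrib_left sum_distrib_right mult_ac)
  also have "\<dots> = (\<Sum>i\<in>I. \<Sum>l\<in>L. \<Sum>j\<in>I. cnj (y l i * x i) * (y l j * x j))"
    by (intro sum.cong refl) (rule sum.swap)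
  also have "\<dots> = (\<Sum>l\<in>L. \<Sum>i\<in>I. \<Sum>j\<in>I. cnj (y l i * x i) * (y l j * x j))"
    by (rule sum.swap)
  also have "\<dots> = (\<Sum>l\<in>L. (\<Sum>j\<in>I. y l j * x j) * cnj (\<Sum>j\<in>I. y l j * x j))"
    by (intro sum.cong refl) (subst mult.commute, simp only: cnj_sum sum_product)
  finally show ?thesis by (simp only: complex_norm_square of_real_sum)
qed

section \<open>Interpolation for the cone over a square\<close>

text \<open>The Hilbert-Schmidt inner product as a real number; on Hermitian matrices it is the
  trace of the product.\<close>

definition rip :: "'i set \<Rightarrow> ('i \<Rightarrow> 'i \<Rightarrow> complex) \<Rightarrow> ('i \<Rightarrow> 'i \<Rightarrow> complex) \<Rightarrow> real" where
  "rip I a b = (\<Sum>i\<in>I. \<Sum>j\<in>I. Re (cnj (a i j) * b i j))"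

lemma rip_add_left: "rip I (\<lambda>i j. a i j + b i j) c = rip I a c + rip I b c"
  and rip_add_right: "rip I c (\<lambda>i j. a i j + b i j) = rip I c a + rip I c b"
  and rip_diff_left: "rip I (\<lambda>i j. a i j - b i j) c = rip I a c - rip I b c"
  and rip_diff_right: "rip I c (\<lambda>i j. a i j - b i j) = rip I c a - rip I c b"
  and rip_minus_left: "rip I (\<lambda>i j. - a i j) c = - rip I a c"
  and rip_minus_right: "rip I c (\<lambda>i j. - a i j) = - rip I c a"
  and rip_mult_right: "rip I c (\<lambda>i j. of_real t * a i j) = t * rip I c a"
  and rip_commute: "rip I a b = rip I b a"
  by (simp_all add: rip_def algebra_simps sum.distrib sum_subtractf sum_negf sum_distrib_left)

lemma rip_cong:
  "(\<And>i j. i \<in> I \<Longrightarrow> j \<in> I \<Longrightarrow> a i j = a' i j) \<Longrightarrow> (\<And>i j. i \<in> I \<Longrightarrow> j \<in> I \<Longrightarrow> b i j = b' i j) \<Longrightarrow> rip I a b = rip I a' b'"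
  by (simp add: rip_def)

lemma rip_sum_left: "rip I (\<lambda>i j. \<Sum>k\<in>K. a k i j) b = (\<Sum>k\<in>K. rip I (a k) b)"
  unfolding rip_def
  by (simp add: sum_distrib_right sum_subtractf sum.distrib sum.swap[of _ K])

lemma rip_self: "rip I a a = (\<Sum>i\<in>I. \<Sum>j\<in>I. (cmod (a i j))\<^sup>2)"
  unfolding rip_def by (intro sum.cong refl) (simp add: cmod_power2, simp add: power2_eq_square)

lemma rip_self_nonneg: "0 \<le> rip I a a"
  by (simp add: rip_self sum_nonneg)

lemma cmod_le_rip:
  assumes "finite I" "i \<in> I" "j \<in> I"
  shows "(cmod (a i j))\<^sup>2 \<le> rip I a a"
proof -
  have "(cmod (a i j))\<^sup>2 \<le> (\<Sum>j\<in>I. (cmod (a i j))\<^sup>2)" using assms by (intro member_le_sum) auto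
  also have "\<dots> \<le> rip I a a"
    unfolding rip_self using assms
    by (intro member_le_sum[of i I "\<lambda>i. \<Sum>j\<in>I. (cmod (a i j))\<^sup>2"]) (auto intro: sum_nonneg)
  finally show ?thesis .
qed

lemma rip_outer:
  "rip I a (\<lambda>i j. x i * cnj (x j)) = Re (form I a x)"
  "rip I (\<lambda>i j. x i * cnj (x j)) a = Re (form I a x)"
  by (auto simp: rip_def form_expand algebra_simps intro!: sum.cong)

lemma form_outer: "form I (\<lambda>i j. x i * cnj (x j)) y = of_real ((cmod (ip I x y))\<^sup>2)"
proof -
  have "form I (\<lambda>i j. x i * cnj (x j)) y = (\<Sum>i\<in>I. cnj (y i) * x i) * (\<Sum>j\<in>I. cnj (x j) * y j)"
    unfolding form_expand sum_product by (intro sum.cong refl) simp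
  also have "\<dots> = ip I x y * cnj (ip I x y)" by (simp add: ip_def mult.commute)
  finally show ?thesis by (simp only: complex_norm_square)
qed

lemma psd_outer: "psd I (\<lambda>i j. x i * cnj (x j))"
  by (rule psdI) (auto simp: form_outer intro!: hermI)

lemma psdI_rip:
  assumes "herm I a" "\<And>s. psd I s \<Longrightarrow> 0 \<le> rip I a s"
  shows "psd I a"
  unfolding psd_def using assms(1) assms(2)[OF psd_outer] unfolding rip_outer by blast

lemma form_add: "form I (\<lambda>i j. a i j + b i j) x = form I a x + form I b x"
  and form_diff: "form I (\<lambda>i j. a i j - b i j) x = form I a x - form I b x"
  and form_mult: "form I (\<lambda>i j. c * a i j) x = c * form I a x"
  by (simp_all add: form_expand algebra_simps sum.distrib sum_subtractf sum_distrib_left)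

lemma psd_add: "psd I a \<Longrightarrow> psd I b \<Longrightarrow> psd I (\<lambda>i j. a i j + b i j)"
  by (rule psdI) (auto simp: form_add psdD hermD[OF psdD(1)] intro!: hermI)

lemma psd_scale: "psd I a \<Longrightarrow> 0 \<le> t \<Longrightarrow> psd I (\<lambda>i j. of_real t * a i j)"
  by (rule psdI) (auto simp: form_mult psdD hermD[OF psdD(1)] intro!: hermI)

lemma psd_cong: "(\<And>i j. i \<in> I \<Longrightarrow> j \<in> I \<Longrightarrow> a i j = b i j) \<Longrightarrow> psd I a \<Longrightarrow> psd I b"
  using form_cong[of I a b] by (intro psdI hermI) (metis hermD psdD(1), metis psdD(2))

lemma form_unit: "finite I \<Longrightarrow> form I (\<lambda>i j. if i = j then 1 else 0) x = ip I x x"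
  unfolding form_def
proof (rule ip_cong)
  fix i assume "finite I" "i \<in> I"
  moreover have "mulv I (\<lambda>i j. if i = j then 1 else 0) x i = (\<Sum>j\<in>I. if j = i then x j else 0)"
    unfolding mulv_def by (intro sum.cong) auto
  ultimately show "mulv I (\<lambda>i j. if i = j then 1 else 0) x i = x i" by simp
qed simp

lemma psd_unit: "finite I \<Longrightarrow> psd I (\<lambda>i j. if i = j then 1 else 0)"
  by (rule psdI) (auto simp: form_unit ip_self_nonneg intro!: hermI)

section \<open>Traces over orthonormal families\<close>

lemma sum_cmod_ip_subspace:
  assumes K: "finite K" "orthonormal I K e" and R: "finite R" "orthonormal I R u"
    and span: "\<And>r i. r \<in> R \<Longrightarrow> i \<in> I \<Longrightarrow> u r i = (\<Sum>k\<in>K. ip I (e k) (u r) * e k i)"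
  shows "(\<Sum>r\<in>R. (cmod (ip I a (u r)))\<^sup>2) \<le> (\<Sum>k\<in>K. (cmod (ip I a (e k)))\<^sup>2)"
proof -
  define p where "p = (\<lambda>i. \<Sum>k\<in>K. ip I (e k) a * e k i)"
  have pu: "ip I p x = (\<Sum>k\<in>K. ip I a (e k) * ip I (e k) x)" for x
    by (simp add: p_def ip_sum_left ip_mult_left ip_cnj)
  have "ip I p (u r) = ip I a (u r)" if "r \<in> R" for r
  proof -
    have "ip I a (u r) = ip I a (\<lambda>i. \<Sum>k\<in>K. ip I (e k) (u r) * e k i)"
      using span[OF that] by (intro ip_cong) auto
    then show ?thesis unfolding pu ip_sum_right ip_mult_right by (simp only: mult.commute)
  qed
  then have "(\<Sum>r\<in>R. (cmod (ip I a (u r)))\<^sup>2) = (\<Sum>r\<in>R. (cmod (ip I (u r) p))\<^sup>2)"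
    using ip_cnj[of I _ p] by (intro sum.cong) (auto, metis complex_mod_cnj)
  also have "\<dots> \<le> Re (ip I p p)" by (rule bessel[OF R])
  also have "ip I p p = (\<Sum>k\<in>K. ip I a (e k) * (\<Sum>l\<in>K. if l = k then ip I (e l) a else 0))"
    unfolding pu using K(2)
    by (intro sum.cong refl arg_cong2[of _ _ _ _ "(*)"])
      (auto simp: p_def ip_sum_right ip_mult_right orthonormal_def intro!: sum.cong)
  also have "\<dots> = of_real (\<Sum>k\<in>K. (cmod (ip I a (e k)))\<^sup>2)"
    using K(1) unfolding of_real_sum
    by (intro sum.cong refl) (simp only: sum.delta if_True complex_norm_square ip_cnj)
  finally show ?thesis by simp
qed

text \<open>A positive matrix has larger trace on a larger subspace. Gram factorisation reduces this
  to rank one, where it is Bessel's inequality for a projected vector.\<close>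

lemma sum_form_subspace:
  assumes "finite I" "psd I h" "finite K" "orthonormal I K e" "finite R" "orthonormal I R u"
    and "\<And>r i. r \<in> R \<Longrightarrow> i \<in> I \<Longrightarrow> u r i = (\<Sum>k\<in>K. ip I (e k) (u r) * e k i)"
  shows "(\<Sum>r\<in>R. Re (form I h (u r))) \<le> (\<Sum>k\<in>K. Re (form I h (e k)))"
proof -
  obtain y where y: "\<And>i j. i \<in> I \<Longrightarrow> j \<in> I \<Longrightarrow> h i j = (\<Sum>l\<in>I. cnj (y l i) * y l j)"
    using psd_gram[OF assms(1,2)] by metis
  have f: "Re (form I h x) = (\<Sum>l\<in>I. (cmod (ip I (\<lambda>j. cnj (y l j)) x))\<^sup>2)" for x
  proof -
    have "form I h x = of_real (\<Sum>l\<in>I. (cmod (\<Sum>j\<in>I. y l j * x j))\<^sup>2)"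
      by (rule form_gram) (rule y)
    then show ?thesis by (simp add: ip_def)
  qed
  have "(\<Sum>r\<in>R. Re (form I h (u r))) = (\<Sum>l\<in>I. \<Sum>r\<in>R. (cmod (ip I (\<lambda>j. cnj (y l j)) (u r)))\<^sup>2)"
    unfolding f by (rule sum.swap)
  also have "\<dots> \<le> (\<Sum>l\<in>I. \<Sum>k\<in>K. (cmod (ip I (\<lambda>j. cnj (y l j)) (e k)))\<^sup>2)"
    by (intro sum_mono sum_cmod_ip_subspace assms)
  also have "\<dots> = (\<Sum>k\<in>K. Re (form I h (e k)))" unfolding f by (rule sum.swap)
  finally show ?thesis .
qed

lemma sum_form_unitary:
  assumes "finite L" "orthonormal L L c"
  shows "(\<Sum>r\<in>L. form I h (\<lambda>i. \<Sum>j\<in>L. c r j * f j i)) = (\<Sum>j\<in>L. form I h (f j))"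
proof -
  have "form I h (\<lambda>i. \<Sum>j\<in>L. c r j * f j i) =
      (\<Sum>j\<in>L. \<Sum>l\<in>L. cnj (c r j) * c r l * ip I (f j) (mulv I h (f l)))" for r
  proof -
    have "mulv I h (\<lambda>i. \<Sum>j\<in>L. c r j * f j i) = (\<lambda>i. \<Sum>l\<in>L. c r l * mulv I h (f l) i)"
      by (auto simp: mulv_def sum_distrib_left sum.swap[of _ L] mult_ac)
    then show ?thesis
      by (simp add: form_def ip_sum_left ip_sum_right ip_mult_left ip_mult_right sum_distrib_left mult_ac)
  qed
  then have "(\<Sum>r\<in>L. form I h (\<lambda>i. \<Sum>j\<in>L. c r j * f j i)) =
      (\<Sum>r\<in>L. \<Sum>j\<in>L. \<Sum>l\<in>L. c r l * cnj (c r j) * ip I (f j) (mulv I h (f l)))"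
    by (simp add: mult.commute)
  also have "\<dots> = (\<Sum>j\<in>L. \<Sum>r\<in>L. \<Sum>l\<in>L. c r l * cnj (c r j) * ip I (f j) (mulv I h (f l)))"
    by (rule sum.swap)
  also have "\<dots> = (\<Sum>j\<in>L. \<Sum>l\<in>L. \<Sum>r\<in>L. c r l * cnj (c r j) * ip I (f j) (mulv I h (f l)))"
    by (rule sum.cong[OF refl]) (rule sum.swap)
  also have "\<dots> = (\<Sum>j\<in>L. \<Sum>l\<in>L. (\<Sum>r\<in>L. c r l * cnj (c r j)) * ip I (f j) (mulv I h (f l)))"
    by (simp add: sum_distrib_right)
  also have "\<dots> = (\<Sum>j\<in>L. \<Sum>l\<in>L. if l = j then ip I (f j) (mulv I h (f l)) else 0)"
    using orthonormal_complete[OF assms] by (intro sum.cong refl) auto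
  finally show ?thesis using assms(1) by (simp add: form_def)
qed

text \<open>The hypothesis on \<open>A\<close>, \<open>B\<close>, \<open>G\<close> says that \<open>A \<otimes> p\<^sub>1 + B \<otimes> p\<^sub>2 + G \<otimes> q\<^sub>1\<close> stays
  positive under all two-dimensional representations of a square cone, where \<open>p\<^sub>1, p\<^sub>2\<close> and
  \<open>q\<^sub>1, q\<^sub>2\<close> are sent to complementary pairs of rank-one projections.\<close>

definition square_positive where
  "square_positive I A B G \<longleftrightarrow>
     (\<forall>x y c s. c\<^sup>2 + s\<^sup>2 = 1 \<longrightarrow>
        0 \<le> Re (form I A x) + Re (form I B y) + Re (form I G (\<lambda>i. of_real c * x i + of_real s * y i)))"

lemma square_positive_psd:
  assumes "herm I A" "herm I B" "square_positive I A B G"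
  shows "psd I A" "psd I B"
proof -
  have z: "form I h (\<lambda>i. 0) = 0" for h by (simp add: form_expand)
  have "0 \<le> Re (form I A x)" for x
    using assms(3)[unfolded square_positive_def, rule_format, of 0 1 x "\<lambda>i. 0"] by (simp add: z)
  moreover have "0 \<le> Re (form I B x)" for x
    using assms(3)[unfolded square_positive_def, rule_format, of 1 0 "\<lambda>i. 0" x] by (simp add: z)
  ultimately show "psd I A" "psd I B" using assms by (auto intro: psdI)
qed

text \<open>Diagonalising the compression of one projection to the range of the other splits a pair of
  projections into blocks of size two.\<close>

lemma square_positive_projections:
  assumes I: "finite I" and AB: "psd I A" "psd I B" and sq: "square_positive I A B G"
    and e: "orthonormal I I e" and J: "J \<subseteq> I" and L: "finite L" "orthonormal I L f"
  shows "0 \<le> (\<Sum>k\<in>J. Re (form I A (e k))) + (\<Sum>k\<in>I - J. Re (form I B (e k))) + (\<Sum>l\<in>L. Re (form I G (f l)))"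
proof -
  define p where "p = (\<lambda>K x i. \<Sum>k\<in>K. ip I (e k) x * e k i)"
  have eo: "ip I (e k) (e l) = (if k = l then 1 else 0)" if "k \<in> I" "l \<in> I" for k l
    using e that by (simp add: orthonormal_def)
  have fin: "finite K" if "K \<subseteq> I" for K using I that finite_subset by blast
  have ep: "ip I (e k) (p K x) = (if k \<in> K then ip I (e k) x else 0)" if K: "K \<subseteq> I" and k: "k \<in> I" for K k x
  proof -
    have "ip I (e k) (p K x) = (\<Sum>l\<in>K. if l = k then ip I (e l) x else 0)"
      unfolding p_def ip_sum_right ip_mult_right using K k by (intro sum.cong refl) (auto simp: eo subset_iff)
    then show ?thesis using fin[OF K] by simp
  qed
  have pp: "ip I (p K x) (p K y) = (\<Sum>k\<in>K. ip I x (e k) * ip I (e k) y)" if K: "K \<subseteq> I" for K x y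
  proof -
    have "ip I (p K x) (p K y) = (\<Sum>k\<in>K. ip I x (e k) * ip I (e k) (p K y))"
      by (subst p_def) (simp add: ip_sum_left ip_mult_left ip_cnj)
    also have "\<dots> = (\<Sum>k\<in>K. ip I x (e k) * ip I (e k) y)"
      using K by (intro sum.cong refl) (auto simp: ep subset_iff)
    finally show ?thesis .
  qed
  have pI: "p I x i = x i" if "i \<in> I" for x i
  proof -
    have "p I x i = (\<Sum>k\<in>I. \<Sum>j\<in>I. x j * (e k i * cnj (e k j)))"
      unfolding p_def ip_def sum_distrib_right by (intro sum.cong refl) simp
    also have "\<dots> = (\<Sum>j\<in>I. x j * (\<Sum>k\<in>I. e k i * cnj (e k j)))"
      by (subst sum.swap) (simp add: sum_distrib_left)
    also have "\<dots> = (\<Sum>j\<in>I. if j = i then x j else 0)"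
      using orthonormal_complete[OF I e] that by (intro sum.cong) auto
    finally show ?thesis using I that by simp
  qed
  have psplit: "p J x i + p (I - J) x i = x i" if "i \<in> I" for x i
    using pI[OF that, of x] sum.subset_diff[OF J I, of "\<lambda>k. ip I (e k) x * e k i"] by (simp add: p_def add.commute)
  \<comment> \<open>Gram matrix of the projections of the \<open>f l\<close> to the span of the
    \<open>e k\<close> with \<open>k \<in> J\<close>. In its eigenbasis \<open>c\<close> the rotated
    vectors \<open>g r\<close> have orthogonal projections to this span and to its complement, of
    squared lengths \<open>\<gamma> r\<close> and \<open>1 - \<gamma> r\<close>.\<close>
  define \<Gamma> where "\<Gamma> = (\<lambda>j l. ip I (p J (f j)) (p J (f l)))"
  have "herm L \<Gamma>" by (rule hermI) (simp add: \<Gamma>_def ip_cnj)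
  then obtain c \<gamma> where c: "orthonormal L L c"
    and \<gamma>: "\<And>k i. k \<in> L \<Longrightarrow> i \<in> L \<Longrightarrow> mulv L \<Gamma> (c k) i = of_real (\<gamma> k) * c k i"
    using spectral[OF L(1)] by metis
  define g where "g = (\<lambda>r i. \<Sum>j\<in>L. c r j * f j i)"
  have co: "ip L (c r) (c t) = (if r = t then 1 else 0)" if "r \<in> L" "t \<in> L" for r t
    using c that by (simp add: orthonormal_def)
  have gg: "ip I (g r) (g t) = (if r = t then 1 else 0)" if "r \<in> L" "t \<in> L" for r t
  proof -
    have "ip I (g r) (g t) = (\<Sum>j\<in>L. cnj (c r j) * (\<Sum>l\<in>L. if l = j then c t l else 0))"
      unfolding g_def ip_sum_left ip_mult_left ip_sum_right ip_mult_right
      using L(2) by (intro sum.cong refl arg_cong2[of _ _ _ _ "(*)"]) (auto simp: orthonormal_def)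
    then show ?thesis using L(1) co[OF that] by (simp add: ip_def)
  qed
  have pg: "p J (g r) = (\<lambda>i. \<Sum>j\<in>L. c r j * p J (f j) i)" for r
    by (auto simp: p_def g_def ip_sum_right ip_mult_right sum_distrib_left sum_distrib_right sum.swap[of _ L] mult_ac)
  have pgg: "ip I (p J (g r)) (p J (g t)) = (if r = t then of_real (\<gamma> t) else 0)" if "r \<in> L" "t \<in> L" for r t
  proof -
    have "ip I (p J (g r)) (p J (g t)) = ip L (c r) (mulv L \<Gamma> (c t))"
      unfolding pg ip_sum_left ip_mult_left ip_sum_right ip_mult_right
      by (simp add: ip_def[of L] mulv_def \<Gamma>_def mult.commute)
    also have "\<dots> = ip L (c r) (\<lambda>i. of_real (\<gamma> t) * c t i)" using that by (intro ip_cong) (auto simp: \<gamma>)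
    finally show ?thesis using that co by (simp add: ip_mult_right)
  qed
  have qgg: "ip I (p (I - J) (g r)) (p (I - J) (g t)) = (if r = t then of_real (1 - \<gamma> t) else 0)"
    if "r \<in> L" "t \<in> L" for r t
  proof -
    have "ip I (p J (g r)) (p J (g t)) + ip I (p (I - J) (g r)) (p (I - J) (g t)) = ip I (p I (g r)) (p I (g t))"
      unfolding pp[OF J] pp[OF Diff_subset] pp[OF order_refl]
      using sum.subset_diff[OF J I, of "\<lambda>k. ip I (g r) (e k) * ip I (e k) (g t)"] by simp
    also have "\<dots> = ip I (g r) (g t)" by (rule ip_cong) (auto simp: pI)
    finally show ?thesis using that pgg gg by (auto simp: algebra_simps split: if_splits)
  qed
  have \<gamma>01: "0 \<le> \<gamma> r" "\<gamma> r \<le> 1" if "r \<in> L" for r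
    using pgg[OF that that] qgg[OF that that] ip_self_nonneg[of I "p J (g r)"] ip_self_nonneg[of I "p (I - J) (g r)"]
    by auto
  \<comment> \<open>The projected vectors are divided by their lengths \<open>sqrt (w r)\<close>.
    Those of length zero are replaced by the zero vector, which adds nothing to the trace and keeps
    the recovery equation valid; the others form an orthonormal family in the span of the
    \<open>e k\<close>, \<open>k \<in> K\<close>.\<close>
  have unit: "\<exists>u. (\<Sum>r\<in>L. Re (form I h (u r))) \<le> (\<Sum>k\<in>K. Re (form I h (e k))) \<and>
      (\<forall>r\<in>L. \<forall>i\<in>I. of_real (sqrt (w r)) * u r i = p K (g r) i)"
    if K: "K \<subseteq> I" and h: "psd I h" and w: "\<And>r. r \<in> L \<Longrightarrow> 0 \<le> w r"
      and o: "\<And>r t. r \<in> L \<Longrightarrow> t \<in> L \<Longrightarrow> ip I (p K (g r)) (p K (g t)) = (if r = t then of_real (w t) else 0)"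
    for K h and w :: "_ \<Rightarrow> real"
  proof -
    define R where "R = {r\<in>L. w r \<noteq> 0}"
    define \<rho> where "\<rho> = (\<lambda>r. complex_of_real (1 / sqrt (w r)))"
    have \<rho>: "cnj (\<rho> r) = \<rho> r" for r by (simp add: \<rho>_def)
    define u where "u = (\<lambda>r i. if r \<in> R then \<rho> r * p K (g r) i else 0)"
    have R: "finite R" "R \<subseteq> L" using L(1) by (auto simp: R_def)
    have u': "u r = (\<lambda>i. \<rho> r * p K (g r) i)" if "r \<in> R" for r
      using that by (simp add: u_def)
    have "orthonormal I R u"
      unfolding orthonormal_def
    proof (intro ballI)
      fix r t assume rt: "r \<in> R" "t \<in> R"
      then have "w t > 0" "r \<in> L" "t \<in> L" using w by (auto simp: R_def order_less_le)
      then have "\<rho> t * (\<rho> t * of_real (w t)) = 1"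
        unfolding \<rho>_def of_real_mult[symmetric] by (simp add: field_simps)
      then show "ip I (u r) (u t) = (if r = t then 1 else 0)"
        using rt \<open>r \<in> L\<close> \<open>t \<in> L\<close> by (auto simp: u' ip_mult_left ip_mult_right o \<rho>)
    qed
    moreover have "u r i = (\<Sum>k\<in>K. ip I (e k) (u r) * e k i)" if "r \<in> R" "i \<in> I" for r i
    proof -
      have "(\<Sum>k\<in>K. ip I (e k) (u r) * e k i) = (\<Sum>k\<in>K. \<rho> r * (ip I (e k) (g r) * e k i))"
        using K by (intro sum.cong refl) (auto simp: u'[OF that(1)] ip_mult_right ep subset_iff)
      then show ?thesis by (simp add: u'[OF that(1)] p_def sum_distrib_left)
    qed
    ultimately have "(\<Sum>r\<in>R. Re (form I h (u r))) \<le> (\<Sum>k\<in>K. Re (form I h (e k)))"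
      using I h fin[OF K] R eo[OF subsetD[OF K] subsetD[OF K]]
      by (intro sum_form_subspace) (auto simp: orthonormal_def[of I K])
    moreover have "(\<Sum>r\<in>L. Re (form I h (u r))) = (\<Sum>r\<in>R. Re (form I h (u r)))"
      using R L(1) by (intro sum.mono_neutral_right) (auto simp: u_def form_expand)
    moreover have "of_real (sqrt (w r)) * u r i = p K (g r) i" if "r \<in> L" "i \<in> I" for r i
    proof (cases "r \<in> R")
      case True
      then have "w r > 0" using w that by (auto simp: R_def order_less_le)
      then have "complex_of_real (sqrt (w r)) * \<rho> r = 1"
        unfolding \<rho>_def of_real_mult[symmetric] by simp
      then show ?thesis by (simp add: u'[OF True] mult.assoc[symmetric] del: of_real_mult)
    next
      case False
      then have "w r = 0" using that by (simp add: R_def)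
      then have "Re (ip I (p K (g r)) (p K (g r))) = 0" using o[of r r] that by simp
      then show ?thesis using ip_self_eq_0[OF I _ that(2)] \<open>w r = 0\<close> by simp
    qed
    ultimately show ?thesis by (intro exI[of _ u]) auto
  qed
  obtain x where x: "(\<Sum>r\<in>L. Re (form I A (x r))) \<le> (\<Sum>k\<in>J. Re (form I A (e k)))"
    "\<And>r i. r \<in> L \<Longrightarrow> i \<in> I \<Longrightarrow> of_real (sqrt (\<gamma> r)) * x r i = p J (g r) i"
    using unit[OF J AB(1), of \<gamma>] pgg \<gamma>01 by blast
  obtain y where y: "(\<Sum>r\<in>L. Re (form I B (y r))) \<le> (\<Sum>k\<in>I - J. Re (form I B (e k)))"
    "\<And>r i. r \<in> L \<Longrightarrow> i \<in> I \<Longrightarrow> of_real (sqrt (1 - \<gamma> r)) * y r i = p (I - J) (g r) i"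
    using unit[OF Diff_subset[of I J] AB(2), where w = "\<lambda>r. 1 - \<gamma> r"] qgg \<gamma>01 by auto
  \<comment> \<open>Each \<open>r\<close> is one two-dimensional block, with an angle of cosine
    \<open>sqrt (\<gamma> r)\<close>.\<close>
  have "0 \<le> (\<Sum>r\<in>L. Re (form I A (x r)) + Re (form I B (y r)) + Re (form I G (g r)))"
  proof (rule sum_nonneg)
    fix r assume r: "r \<in> L"
    have "form I G (g r) = form I G (\<lambda>i. of_real (sqrt (\<gamma> r)) * x r i + of_real (sqrt (1 - \<gamma> r)) * y r i)"
      using r by (intro form_cong) (auto simp: x y psplit)
    then show "0 \<le> Re (form I A (x r)) + Re (form I B (y r)) + Re (form I G (g r))"
      using sq[unfolded square_positive_def, rule_format, of "sqrt (\<gamma> r)" "sqrt (1 - \<gamma> r)" "x r" "y r"] \<gamma>01[OF r]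
      by simp
  qed
  also have "(\<Sum>r\<in>L. Re (form I G (g r))) = (\<Sum>l\<in>L. Re (form I G (f l)))"
    using sum_form_unitary[OF L(1) c, of I G f] unfolding g_def by (metis Re_sum)
  then have "(\<Sum>r\<in>L. Re (form I A (x r)) + Re (form I B (y r)) + Re (form I G (g r))) =
      (\<Sum>r\<in>L. Re (form I A (x r))) + (\<Sum>r\<in>L. Re (form I B (y r))) + (\<Sum>l\<in>L. Re (form I G (f l)))"
    by (simp add: sum.distrib)
  finally show ?thesis using x(1) y(1) by linarith
qed

lemma orthonormal_subset: "orthonormal I K v \<Longrightarrow> L \<subseteq> K \<Longrightarrow> orthonormal I L v"
  unfolding orthonormal_def by blast

lemma rip_spectral:
  assumes "finite I" "orthonormal I I e"
    and "\<And>k i. k \<in> I \<Longrightarrow> i \<in> I \<Longrightarrow> mulv I h (e k) i = of_real (a k) * e k i"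
  shows "rip I h b = (\<Sum>k\<in>I. a k * Re (form I b (e k)))"
proof -
  have "rip I h b = rip I (\<lambda>i j. \<Sum>k\<in>I. of_real (a k) * (e k i * cnj (e k j))) b"
    using spectral_expand[OF assms] by (intro rip_cong) (auto simp: mult.assoc)
  also have "\<dots> = (\<Sum>k\<in>I. rip I b (\<lambda>i j. of_real (a k) * (e k i * cnj (e k j))))"
    by (simp add: rip_sum_left rip_commute[of I _ b])
  finally show ?thesis by (simp only: rip_mult_right rip_outer)
qed

lemma form_eigenvector:
  assumes "\<And>i. i \<in> I \<Longrightarrow> mulv I h x i = of_real a * x i" "ip I x x = 1"
  shows "form I h x = of_real a"
proof -
  have "form I h x = ip I x (\<lambda>i. of_real a * x i)" unfolding form_def by (rule ip_cong) (auto simp: assms)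
  then show ?thesis using assms(2) by (simp add: ip_mult_right)
qed

text \<open>Over all effects \<open>0 \<le> P \<le> 1\<close> the trace against \<open>h\<close> is
  smallest at the spectral projection for the negative eigenvalues, collected in \<open>J\<close>.
  So it is enough to know an inequality for projections.\<close>

lemma effect_minimum:
  assumes I: "finite I" and h: "herm I h"
  shows "\<exists>e J. orthonormal I I e \<and> J \<subseteq> I \<and>
    (\<forall>P. psd I P \<longrightarrow> psd I (\<lambda>i j. (if i = j then 1 else 0) - P i j) \<longrightarrow> (\<Sum>k\<in>J. Re (form I h (e k))) \<le> rip I h P)"
proof -
  obtain e a where e: "orthonormal I I e"
    and a: "\<And>k i. k \<in> I \<Longrightarrow> i \<in> I \<Longrightarrow> mulv I h (e k) i = of_real (a k) * e k i"
    using spectral[OF I h] by metis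
  define J where "J = {k\<in>I. a k < 0}"
  have e1: "ip I (e k) (e k) = 1" if "k \<in> I" for k using e that by (simp add: orthonormal_def)
  show ?thesis
  proof (intro exI[of _ e] exI[of _ J] conjI allI impI e)
    show "J \<subseteq> I" by (auto simp: J_def)
    fix P assume P: "psd I P" "psd I (\<lambda>i j. (if i = j then 1 else 0) - P i j)"
    have "(\<Sum>k\<in>J. Re (form I h (e k))) = (\<Sum>k\<in>J. a k)"
      using form_eigenvector[OF a e1] by (intro sum.cong refl) (auto simp: J_def)
    also have "\<dots> = (\<Sum>k\<in>I. if a k < 0 then a k else 0)"
      using I by (simp add: J_def sum.If_cases Int_def)
    also have "\<dots> \<le> (\<Sum>k\<in>I. a k * Re (form I P (e k)))"
    proof (rule sum_mono)
      fix k assume k: "k \<in> I"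
      have "Re (form I P (e k)) \<ge> 0" using P(1) by (rule psdD)
      moreover have "Re (form I P (e k)) \<le> 1"
        using psdD(2)[OF P(2), of "e k"] e1[OF k] I by (simp add: form_diff form_unit)
      ultimately show "(if a k < 0 then a k else 0) \<le> a k * Re (form I P (e k))"
        using mult_left_mono_neg[of "Re (form I P (e k))" 1 "a k"] by simp
    qed
    also have "\<dots> = rip I h P" using rip_spectral[OF I e a] by simp
    finally show "(\<Sum>k\<in>J. Re (form I h (e k))) \<le> rip I h P" .
  qed
qed

lemma rip_unit_left:
  assumes I: "finite I" and e: "orthonormal I I e"
  shows "rip I b (\<lambda>i j. if i = j then 1 else 0) = (\<Sum>k\<in>I. Re (form I b (e k)))"
proof -
  have "rip I b (\<lambda>i j. if i = j then 1 else 0) = rip I (\<lambda>i j. \<Sum>k\<in>I. e k i * cnj (e k j)) b"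
    using orthonormal_complete[OF I e] by (subst rip_commute, intro rip_cong) auto
  then show ?thesis by (simp only: rip_sum_left rip_outer)
qed

text \<open>The expression is affine in \<open>P\<close>, with slope \<open>A - B\<close>, and in
  \<open>Q\<close>, with slope \<open>G\<close>. It can only decrease when both effects are replaced
  by their minimising spectral projections, where \<open>square_positive_projections\<close>
  applies.\<close>

lemma square_positive_effects:
  assumes I: "finite I" and h: "herm I A" "herm I B" "herm I G" and sq: "square_positive I A B G"
    and P: "psd I P" "psd I (\<lambda>i j. (if i = j then 1 else 0) - P i j)"
    and Q: "psd I Q" "psd I (\<lambda>i j. (if i = j then 1 else 0) - Q i j)"
  shows "0 \<le> rip I A P + rip I B (\<lambda>i j. (if i = j then 1 else 0) - P i j) + rip I G Q"
proof -
  have "herm I (\<lambda>i j. A i j - B i j)" using h by (intro hermI) (simp add: hermD[OF h(1)] hermD[OF h(2)])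
  then obtain e J where e: "orthonormal I I e" "J \<subseteq> I"
    and "\<And>P. psd I P \<Longrightarrow> psd I (\<lambda>i j. (if i = j then 1 else 0) - P i j) \<Longrightarrow>
      (\<Sum>k\<in>J. Re (form I (\<lambda>i j. A i j - B i j) (e k))) \<le> rip I (\<lambda>i j. A i j - B i j) P"
    using effect_minimum[OF I] by blast
  then have 1: "(\<Sum>k\<in>J. Re (form I (\<lambda>i j. A i j - B i j) (e k))) \<le> rip I (\<lambda>i j. A i j - B i j) P"
    using P by blast
  obtain f L where f: "orthonormal I I f" "L \<subseteq> I"
    and "\<And>P. psd I P \<Longrightarrow> psd I (\<lambda>i j. (if i = j then 1 else 0) - P i j) \<Longrightarrow>
      (\<Sum>k\<in>L. Re (form I G (f k))) \<le> rip I G P"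
    using effect_minimum[OF I h(3)] by blast
  then have 2: "(\<Sum>k\<in>L. Re (form I G (f k))) \<le> rip I G Q"
    using Q by blast
  have "0 \<le> (\<Sum>k\<in>J. Re (form I A (e k))) + (\<Sum>k\<in>I - J. Re (form I B (e k))) + (\<Sum>l\<in>L. Re (form I G (f l)))"
    using f finite_subset[OF f(2) I] orthonormal_subset[OF f]
    by (intro square_positive_projections[OF I square_positive_psd[OF h(1,2) sq] sq e])
  also have "\<dots> = (\<Sum>k\<in>J. Re (form I (\<lambda>i j. A i j - B i j) (e k))) + (\<Sum>k\<in>I. Re (form I B (e k)))
      + (\<Sum>l\<in>L. Re (form I G (f l)))"
    using sum.subset_diff[OF e(2) I, of "\<lambda>k. Re (form I B (e k))"] by (simp add: form_diff sum_subtractf)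
  also have "\<dots> \<le> rip I (\<lambda>i j. A i j - B i j) P + rip I B (\<lambda>i j. if i = j then 1 else 0) + rip I G Q"
    using 1 2 rip_unit_left[OF I e(1), of B] by simp
  finally show ?thesis by (simp add: rip_diff_left rip_diff_right)
qed

section \<open>Congruence to operators with sum one\<close>

definition cong_form :: "'i set \<Rightarrow> ('i \<Rightarrow> 'i \<Rightarrow> complex) \<Rightarrow> ('i \<Rightarrow> 'i \<Rightarrow> complex) \<Rightarrow> 'i \<Rightarrow> 'i \<Rightarrow> complex" where
  "cong_form I y h i j = ip I (y i) (mulv I h (y j))"

lemma form_cong_form: "form I (cong_form I y h) x = form I h (\<lambda>i. \<Sum>j\<in>I. x j * y j i)"
proof -
  have "mulv I h (\<lambda>i. \<Sum>j\<in>I. x j * y j i) = (\<lambda>i. \<Sum>j\<in>I. x j * mulv I h (y j) i)"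
    unfolding mulv_def sum_distrib_left by (rule ext, subst sum.swap) (simp add: mult_ac)
  then show ?thesis
    by (simp add: form_expand[of I "cong_form I y h"] cong_form_def form_def[of I h] ip_sum_left ip_sum_right
        ip_mult_left ip_mult_right sum_distrib_left mult_ac)
qed

lemma herm_cong_form: assumes "herm I h" shows "herm I (cong_form I y h)"
  by (rule hermI) (simp add: cong_form_def ip_cnj ip_mulv_herm[OF assms])

lemma psd_cong_form: "psd I h \<Longrightarrow> psd I (cong_form I y h)"
  by (rule psdI) (auto simp: form_cong_form psdD herm_cong_form)

text \<open>With the \<open>y j\<close> and \<open>z j\<close> as columns of matrices,
  \<open>dual\<close> says that the first times the adjoint of the second is the identity.
  Conjugating one argument of the trace by each of them therefore changes nothing, by
  cyclicity.\<close>

lemma rip_cong_form: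
  assumes I: "finite I"
    and dual: "\<And>b c. b \<in> I \<Longrightarrow> c \<in> I \<Longrightarrow> (\<Sum>j\<in>I. y j b * cnj (z j c)) = (if b = c then 1 else 0)"
    and h: "psd I p"
  shows "rip I (cong_form I y a) (cong_form I z p) = rip I a p"
proof -
  obtain x where x: "\<And>i j. i \<in> I \<Longrightarrow> j \<in> I \<Longrightarrow> p i j = (\<Sum>l\<in>I. cnj (x l i) * x l j)"
    using psd_gram[OF I h] by metis
  define w where "w = (\<lambda>l i. cnj (x l i))"
  have p: "p i j = (\<Sum>l\<in>I. w l i * cnj (w l j))" if "i \<in> I" "j \<in> I" for i j
    using x[OF that] by (simp add: w_def)
  have cz: "cong_form I z p i j = (\<Sum>l\<in>I. ip I (z i) (w l) * cnj (ip I (z j) (w l)))" for i j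
  proof -
    have "mulv I p (z j) i = (\<Sum>l\<in>I. w l i * ip I (w l) (z j))" if "i \<in> I" for i
      using that unfolding mulv_def ip_def sum_distrib_left
      by (subst sum.swap, intro sum.cong refl) (simp add: p sum_distrib_right mult.assoc)
    then have "cong_form I z p i j = ip I (z i) (\<lambda>i. \<Sum>l\<in>I. ip I (w l) (z j) * w l i)"
      unfolding cong_form_def by (intro ip_cong) (auto simp: mult.commute)
    then show ?thesis unfolding ip_sum_right ip_mult_right ip_cnj by (simp only: mult.commute)
  qed
  have wl: "(\<Sum>j\<in>I. ip I (z j) (w l) * y j b) = w l b" if b: "b \<in> I" for l b
  proof -
    have "(\<Sum>j\<in>I. ip I (z j) (w l) * y j b) = (\<Sum>c\<in>I. w l c * (\<Sum>j\<in>I. y j b * cnj (z j c)))"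
      unfolding ip_def sum_distrib_left sum_distrib_right by (subst sum.swap) (simp add: mult_ac)
    also have "\<dots> = (\<Sum>c\<in>I. if c = b then w l c else 0)"
      using b by (intro sum.cong refl) (auto simp: dual)
    finally show ?thesis using I b by simp
  qed
  have "rip I (cong_form I y a) (cong_form I z p) =
      rip I (\<lambda>i j. \<Sum>l\<in>I. ip I (z i) (w l) * cnj (ip I (z j) (w l))) (cong_form I y a)"
    by (subst rip_commute) (simp add: cz cong: rip_cong)
  also have "\<dots> = (\<Sum>l\<in>I. Re (form I (cong_form I y a) (\<lambda>i. ip I (z i) (w l))))"
    by (simp only: rip_sum_left rip_outer)
  also have "\<dots> = (\<Sum>l\<in>I. Re (form I a (w l)))"
    unfolding form_cong_form using wl by (intro sum.cong refl arg_cong[of _ _ Re] form_cong) auto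
  also have "\<dots> = rip I (\<lambda>i j. \<Sum>l\<in>I. w l i * cnj (w l j)) a" by (simp only: rip_sum_left rip_outer)
  also have "\<dots> = rip I a p" by (subst rip_commute, intro rip_cong) (auto simp: p)
  finally show ?thesis .
qed

lemma square_positive_cong_form:
  assumes "square_positive I A B G"
  shows "square_positive I (cong_form I y A) (cong_form I y B) (cong_form I y G)"
  unfolding square_positive_def
proof (intro allI impI)
  fix x x' :: "'a \<Rightarrow> complex" and c s :: real assume cs: "c\<^sup>2 + s\<^sup>2 = 1"
  have "(\<lambda>i. \<Sum>j\<in>I. (of_real c * x j + of_real s * x' j) * y j i) =
      (\<lambda>i. of_real c * (\<Sum>j\<in>I. x j * y j i) + of_real s * (\<Sum>j\<in>I. x' j * y j i))"
    by (simp add: algebra_simps sum.distrib sum_distrib_left)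
  then show "0 \<le> Re (form I (cong_form I y A) x) + Re (form I (cong_form I y B) x') +
      Re (form I (cong_form I y G) (\<lambda>i. of_real c * x i + of_real s * x' i))"
    using assms cs unfolding form_cong_form by (simp add: square_positive_def)
qed

text \<open>Both families are rescaled eigenvectors of \<open>h\<close>: \<open>z\<close> by the
  inverse square roots of the eigenvalues, \<open>y\<close> by the square roots.
  \<open>\<delta>\<close> bounds the eigenvalues away from zero.\<close>

lemma pos_def_orthonormalize:
  assumes I: "finite I" and h: "herm I h" and d: "\<delta> > 0" "\<And>x. \<delta> * Re (ip I x x) \<le> Re (form I h x)"
  obtains y z where "\<And>b c. b \<in> I \<Longrightarrow> c \<in> I \<Longrightarrow> (\<Sum>j\<in>I. y j b * cnj (z j c)) = (if b = c then 1 else 0)"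
    "\<And>i j. i \<in> I \<Longrightarrow> j \<in> I \<Longrightarrow> cong_form I z h i j = (if i = j then 1 else 0)"
proof -
  obtain k \<kappa> where k: "orthonormal I I k"
    and e: "\<And>l i. l \<in> I \<Longrightarrow> i \<in> I \<Longrightarrow> mulv I h (k l) i = of_real (\<kappa> l) * k l i"
    using spectral[OF I h] by metis
  have o: "ip I (k i) (k j) = (if i = j then 1 else 0)" if "i \<in> I" "j \<in> I" for i j
    using k that by (simp add: orthonormal_def)
  have pos: "\<kappa> l > 0" if "l \<in> I" for l
    using d(2)[of "k l"] d(1) form_eigenvector[of I h "k l" "\<kappa> l", OF e[OF that]] o[OF that that] by simp
  show ?thesis
  proof (rule that)
    fix b c assume bc: "b \<in> I" "c \<in> I"
    have "(\<Sum>j\<in>I. (of_real (sqrt (\<kappa> j)) * k j b) * cnj (of_real (1 / sqrt (\<kappa> j)) * k j c)) = (\<Sum>j\<in>I. k j b * cnj (k j c))"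
    proof (rule sum.cong[OF refl])
      fix j assume "j \<in> I"
      then have "complex_of_real (sqrt (\<kappa> j)) * of_real (1 / sqrt (\<kappa> j)) = 1"
        using pos unfolding of_real_mult[symmetric] by (simp add: less_imp_neq[THEN not_sym])
      then show "(of_real (sqrt (\<kappa> j)) * k j b) * cnj (of_real (1 / sqrt (\<kappa> j)) * k j c) = k j b * cnj (k j c)"
        unfolding complex_cnj_mult complex_cnj_complex_of_real by (metis (no_types, lifting) mult.assoc mult.commute mult_1)
    qed
    then show "(\<Sum>j\<in>I. (of_real (sqrt (\<kappa> j)) * k j b) * cnj (of_real (1 / sqrt (\<kappa> j)) * k j c)) = (if b = c then 1 else 0)"
      using orthonormal_complete[OF I k bc] by simp
  next
    fix i j assume ij: "i \<in> I" "j \<in> I"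
    define r where "r = (\<lambda>l. complex_of_real (1 / sqrt (\<kappa> l)))"
    have r: "cnj (r l) = r l" for l by (simp add: r_def)
    have "cong_form I (\<lambda>l b. r l * k l b) h i j = r i * (r j * ip I (k i) (mulv I h (k j)))"
      by (simp add: cong_form_def mulv_mult ip_mult_left ip_mult_right r)
    also have "ip I (k i) (mulv I h (k j)) = ip I (k i) (\<lambda>i. of_real (\<kappa> j) * k j i)"
      using ij by (intro ip_cong) (auto simp: e)
    also have "r i * (r j * \<dots>) = (if i = j then r j * (r j * of_real (\<kappa> j)) else 0)"
      using ij by (simp add: ip_mult_right o)
    also have "r j * (r j * of_real (\<kappa> j)) = 1"
      unfolding r_def of_real_mult[symmetric] using pos[OF ij(2)] by (simp add: field_simps)
    finally show "cong_form I (\<lambda>l b. complex_of_real (1 / sqrt (\<kappa> l)) * k l b) h i j = (if i = j then 1 else 0)"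
      by (simp add: r_def)
  qed
qed

lemma cong_form_diff: "cong_form I y (\<lambda>i j. a i j - b i j) = (\<lambda>i j. cong_form I y a i j - cong_form I y b i j)"
proof -
  have "mulv I (\<lambda>i j. a i j - b i j) x = (\<lambda>i. mulv I a x i - mulv I b x i)" for x
    by (rule ext) (simp add: mulv_def algebra_simps sum_subtractf)
  then show ?thesis by (intro ext) (simp add: cong_form_def ip_diff_right)
qed

text \<open>A congruence turns the common sum into the identity, so \<open>P1\<close> and
  \<open>Q1\<close> become effects. \<open>A\<close>, \<open>B\<close>, \<open>G\<close> are
  transformed dually, which preserves the pairings as well as
  \<open>square_positive\<close>.\<close>

lemma square_positive_pairing_pos_def:
  assumes I: "finite I" and h: "herm I A" "herm I B" "herm I G" and sq: "square_positive I A B G"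
    and P: "psd I P1" "psd I P2" "psd I Q1" "psd I Q2"
    and eq: "\<And>i j. i \<in> I \<Longrightarrow> j \<in> I \<Longrightarrow> P1 i j + P2 i j = Q1 i j + Q2 i j"
    and d: "\<delta> > 0" "\<And>x. \<delta> * Re (ip I x x) \<le> Re (form I P1 x) + Re (form I P2 x)"
  shows "0 \<le> rip I A P1 + rip I B P2 + rip I G Q1"
proof -
  define K where "K = (\<lambda>i j. P1 i j + P2 i j)"
  have "psd I K" unfolding K_def using P by (intro psd_add)
  then obtain y z where dual: "\<And>b c. b \<in> I \<Longrightarrow> c \<in> I \<Longrightarrow> (\<Sum>j\<in>I. y j b * cnj (z j c)) = (if b = c then 1 else 0)"
    and one: "\<And>i j. i \<in> I \<Longrightarrow> j \<in> I \<Longrightarrow> cong_form I z K i j = (if i = j then 1 else 0)"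
    using pos_def_orthonormalize[OF I psdD(1) d(1), of K] d(2) by (auto simp: K_def form_add)
  have cc: "cong_form I z b i j = (if i = j then 1 else 0) - cong_form I z a i j"
    if "i \<in> I" "j \<in> I" "\<And>i j. i \<in> I \<Longrightarrow> j \<in> I \<Longrightarrow> a i j + b i j = K i j" for a b i j
  proof -
    have "cong_form I z b i j = cong_form I z (\<lambda>i j. K i j - a i j) i j"
      unfolding cong_form_def using that(3) by (intro ip_cong mulv_cong) (auto simp: algebra_simps)
    then show ?thesis using one that by (simp add: cong_form_diff)
  qed
  note P2 = cc[of _ _ P1 P2, unfolded K_def, OF _ _ refl]
  have Q2: "cong_form I z Q2 i j = (if i = j then 1 else 0) - cong_form I z Q1 i j" if "i \<in> I" "j \<in> I" for i j
    using that eq by (intro cc) (auto simp: K_def)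
  have "0 \<le> rip I (cong_form I y A) (cong_form I z P1) +
      rip I (cong_form I y B) (\<lambda>i j. (if i = j then 1 else 0) - cong_form I z P1 i j) +
      rip I (cong_form I y G) (cong_form I z Q1)"
    using h P psd_cong[OF P2 psd_cong_form[OF P(2)]] psd_cong[OF Q2 psd_cong_form[OF P(4)]]
    by (intro square_positive_effects I herm_cong_form square_positive_cong_form sq psd_cong_form) auto
  also have "rip I (cong_form I y B) (\<lambda>i j. (if i = j then 1 else 0) - cong_form I z P1 i j) =
      rip I (cong_form I y B) (cong_form I z P2)" by (intro rip_cong) (auto simp: P2)
  finally show ?thesis by (simp add: rip_cong_form[OF I dual] P)
qed

text \<open>Adding \<open>t\<close> times the identity to all four operators keeps the two sums
  equal and makes them positive definite; then \<open>t\<close> tends to 0.\<close>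

lemma square_positive_pairing:
  assumes I: "finite I" and h: "herm I A" "herm I B" "herm I G" and sq: "square_positive I A B G"
    and P: "psd I P1" "psd I P2" "psd I Q1" "psd I Q2"
    and eq: "\<And>i j. i \<in> I \<Longrightarrow> j \<in> I \<Longrightarrow> P1 i j + P2 i j = Q1 i j + Q2 i j"
  shows "0 \<le> rip I A P1 + rip I B P2 + rip I G Q1"
proof -
  let ?u = "\<lambda>i j. if i = j then 1 else (0::complex)"
  define S where "S = rip I A ?u + rip I B ?u + rip I G ?u"
  have ge: "0 \<le> (rip I A P1 + rip I B P2 + rip I G Q1) + t * S" if t: "t > 0" for t
  proof -
    define e :: "('a \<Rightarrow> 'a \<Rightarrow> complex) \<Rightarrow> 'a \<Rightarrow> 'a \<Rightarrow> complex"
      where "e = (\<lambda>p i j. p i j + of_real t * ?u i j)"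
    have pe: "psd I (e p)" if "psd I p" for p
      unfolding e_def using that t I by (intro psd_add psd_scale psd_unit) auto
    have fe: "Re (form I (e p) x) = Re (form I p x) + t * Re (ip I x x)" for p x
      unfolding e_def form_add form_mult form_unit[OF I] by simp
    have "0 \<le> rip I A (e P1) + rip I B (e P2) + rip I G (e Q1)"
    proof (rule square_positive_pairing_pos_def[OF I h sq pe[OF P(1)] pe[OF P(2)] pe[OF P(3)] pe[OF P(4)] _ t])
      show "e P1 i j + e P2 i j = e Q1 i j + e Q2 i j" if "i \<in> I" "j \<in> I" for i j
        using eq[OF that] by (simp add: e_def algebra_simps)
      show "t * Re (ip I x x) \<le> Re (form I (e P1) x) + Re (form I (e P2) x)" for x
        unfolding fe using psdD(2)[OF P(1), of x] psdD(2)[OF P(2), of x] mult_nonneg_nonneg[OF less_imp_le[OF t] ip_self_nonneg[of I x]]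
        by linarith
    qed
    then show ?thesis by (simp only: e_def rip_add_right rip_mult_right S_def) (simp add: algebra_simps)
  qed
  show ?thesis
  proof (rule ccontr)
    assume neg: "\<not> ?thesis"
    define v where "v = rip I A P1 + rip I B P2 + rip I G Q1"
    have "v < 0" using neg by (simp add: v_def)
    \<comment> \<open>This value of \<open>t\<close> makes the perturbation at most half of
      \<open>- v\<close>.\<close>
    then have "0 \<le> v + (- v / (2 * (\<bar>S\<bar> + 1))) * S"
      unfolding v_def by (intro ge divide_pos_pos) auto
    moreover have "(- v / (2 * (\<bar>S\<bar> + 1))) * S \<le> - v / 2"
    proof -
      have "S / (\<bar>S\<bar> + 1) \<le> 1" by (simp add: field_simps)
      then have "(- v / 2) * (S / (\<bar>S\<bar> + 1)) \<le> (- v / 2) * 1" using \<open>v < 0\<close> by (intro mult_left_mono) auto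
      then show ?thesis by simp
    qed
    ultimately show False using \<open>v < 0\<close> by linarith
  qed
qed

section \<open>Minimising the interpolation defect\<close>

lemma psd_entry_bounds:
  assumes I: "finite I" and s: "psd I s" and ij: "i \<in> I" "j \<in> I"
  shows "0 \<le> Re (s i i)" "cmod (s i j) \<le> (Re (s i i) + Re (s j j)) / 2"
proof -
  obtain y where y: "\<And>i j. i \<in> I \<Longrightarrow> j \<in> I \<Longrightarrow> s i j = (\<Sum>l\<in>I. cnj (y l i) * y l j)"
    using psd_gram[OF I s] by metis
  have d: "s i i = of_real (\<Sum>l\<in>I. (cmod (y l i))\<^sup>2)" if "i \<in> I" for i
    unfolding y[OF that that] of_real_sum by (intro sum.cong refl) (metis complex_norm_square mult.commute)
  show "0 \<le> Re (s i i)" by (simp add: d[OF ij(1)] sum_nonneg)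
  have "cmod (s i j) \<le> (\<Sum>l\<in>I. cmod (y l i) * cmod (y l j))"
    unfolding y[OF ij] by (rule order_trans[OF norm_sum]) (simp add: norm_mult)
  also have "\<dots> \<le> (\<Sum>l\<in>I. ((cmod (y l i))\<^sup>2 + (cmod (y l j))\<^sup>2) / 2)"
  proof (rule sum_mono)
    fix l
    have "0 \<le> (cmod (y l i) - cmod (y l j))\<^sup>2" by simp
    then show "cmod (y l i) * cmod (y l j) \<le> ((cmod (y l i))\<^sup>2 + (cmod (y l j))\<^sup>2) / 2"
      by (simp add: power2_diff)
  qed
  also have "\<dots> = (Re (s i i) + Re (s j j)) / 2"
    by (simp add: d ij sum.distrib sum_divide_distrib[symmetric])
  finally show "cmod (s i j) \<le> (Re (s i i) + Re (s j j)) / 2" .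
qed

text \<open>The four slots stand for \<open>T\<close>, \<open>T + G\<close>, \<open>A - T\<close>
  and \<open>B - T\<close>; the defect measures by how much these relations fail. An interpolant is
  the same as a psd quadruple of defect 0.\<close>

definition square_defect where
  "square_defect I A B G X = rip I (\<lambda>i j. X 0 i j - X 1 i j + G i j) (\<lambda>i j. X 0 i j - X 1 i j + G i j)
    + rip I (\<lambda>i j. X 0 i j + X 2 i j - A i j) (\<lambda>i j. X 0 i j + X 2 i j - A i j)
    + rip I (\<lambda>i j. X 0 i j + X 3 i j - B i j) (\<lambda>i j. X 0 i j + X 3 i j - B i j)" for X :: "nat \<Rightarrow> _"

lemma closed_psd:
  assumes "\<And>i j. continuous_on UNIV (\<lambda>x. s x i j)"
  shows "closed {x. psd I (s x)}"
proof -
  have "{x. psd I (s x)} = (\<Inter>i\<in>I. \<Inter>j\<in>I. {x. cnj (s x i j) = s x j i}) \<inter> (\<Inter>y. {x. 0 \<le> Re (form I (s x) y)})"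
    by (auto intro!: psdI hermI simp: psdD dest: hermD[OF psdD(1)])
  then show ?thesis
    unfolding form_def
    by (auto intro!: closed_Int closed_INT closed_Collect_eq closed_Collect_le continuous_intros assms)
qed

text \<open>Diagonal entries are nonnegative, and \<open>X 0 + X 2\<close> and
  \<open>X 0 + X 3\<close> are close to \<open>A\<close> and \<open>B\<close>, so these slots cannot
  grow. \<open>X 1\<close> is close to \<open>X 0 + G\<close>, at the cost of a second
  \<open>sqrt M\<close>. Off-diagonal entries are controlled by the diagonal.\<close>

lemma square_defect_bounded:
  assumes I: "finite I" and X: "\<And>a. a < 4 \<Longrightarrow> psd I (X a)" and M: "square_defect I A B G X \<le> M"
    and ij: "i \<in> I" "j \<in> I" and a: "a < 4"
  shows "cmod (X a i j) \<le> 2 * (sqrt M + (\<Sum>i\<in>I. \<Sum>j\<in>I. cmod (A i j) + cmod (B i j) + cmod (G i j)))"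
proof -
  define c where "c = (\<Sum>i\<in>I. \<Sum>j\<in>I. cmod (A i j) + cmod (B i j) + cmod (G i j))"
  have c: "cmod (A i i) + cmod (B i i) + cmod (G i i) \<le> c" if "i \<in> I" for i
  proof -
    have "cmod (A i i) + cmod (B i i) + cmod (G i i) \<le> (\<Sum>j\<in>I. cmod (A i j) + cmod (B i j) + cmod (G i j))"
      using I that by (intro member_le_sum[of i I "\<lambda>j. cmod (A i j) + cmod (B i j) + cmod (G i j)"]) auto
    also have "\<dots> \<le> c"
      unfolding c_def using I that
      by (intro member_le_sum[of i I "\<lambda>i. \<Sum>j\<in>I. cmod (A i j) + cmod (B i j) + cmod (G i j)"] sum_nonneg) auto
    finally show ?thesis .
  qed
  have small: "\<bar>Re (n i i)\<bar> \<le> sqrt M" if "rip I n n \<le> M" "i \<in> I" for n i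
  proof -
    have "(cmod (n i i))\<^sup>2 \<le> M" using cmod_le_rip[OF I that(2,2), of n] that(1) by simp
    then have "cmod (n i i) \<le> sqrt M" by (rule real_le_rsqrt)
    then show ?thesis using abs_Re_le_cmod[of "n i i"] by simp
  qed
  have diag: "Re (X a i i) \<le> 2 * (sqrt M + c)" if i: "i \<in> I" for i
  proof -
    have n: "\<bar>Re (X 0 i i - X 1 i i + G i i)\<bar> \<le> sqrt M" "\<bar>Re (X 0 i i + X 2 i i - A i i)\<bar> \<le> sqrt M"
      "\<bar>Re (X 0 i i + X 3 i i - B i i)\<bar> \<le> sqrt M"
      using small[OF _ i, of "\<lambda>i j. X 0 i j - X 1 i j + G i j"] small[OF _ i, of "\<lambda>i j. X 0 i j + X 2 i j - A i j"]
        small[OF _ i, of "\<lambda>i j. X 0 i j + X 3 i j - B i j"] M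
        rip_self_nonneg[of I "\<lambda>i j. X 0 i j - X 1 i j + G i j"] rip_self_nonneg[of I "\<lambda>i j. X 0 i j + X 2 i j - A i j"]
        rip_self_nonneg[of I "\<lambda>i j. X 0 i j + X 3 i j - B i j"]
      unfolding square_defect_def by linarith+
    have p: "0 \<le> Re (X b i i)" if "b < 4" for b using psd_entry_bounds(1)[OF I X[OF that] i i] .
    have "\<bar>Re (A i i)\<bar> + \<bar>Re (B i i)\<bar> + \<bar>Re (G i i)\<bar> \<le> c"
      using c[OF i] abs_Re_le_cmod[of "A i i"] abs_Re_le_cmod[of "B i i"] abs_Re_le_cmod[of "G i i"] by linarith
    moreover have "a = 0 \<or> a = 1 \<or> a = 2 \<or> a = 3" using a by auto
    ultimately show ?thesis using n p[of 0] p[of 1] p[of 2] p[of 3] by (elim disjE) auto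
  qed
  show ?thesis
    using psd_entry_bounds(2)[OF I X[OF a] ij] diag[OF ij(1)] diag[OF ij(2)] by (simp add: c_def)
qed

lemma square_defect_minimizer:
  fixes I :: "'i set"
  assumes I: "finite I"
  obtains X where "\<And>a. a < 4 \<Longrightarrow> psd I (X a)"
    "\<And>Y. (\<And>a. a < 4 \<Longrightarrow> psd I (Y a)) \<Longrightarrow> square_defect I A B G X \<le> square_defect I A B G Y"
proof -
  let ?f = "square_defect I A B G"
  define D where "D = {..<4::nat} \<times> I \<times> I"
  define r where "r = 2 * (sqrt (?f (\<lambda>a i j. 0)) + (\<Sum>i\<in>I. \<Sum>j\<in>I. cmod (A i j) + cmod (B i j) + cmod (G i j)))"
  define cu :: "(nat \<times> 'i \<times> 'i \<Rightarrow> complex) \<Rightarrow> nat \<Rightarrow> 'i \<Rightarrow> 'i \<Rightarrow> complex" where "cu = (\<lambda>x a i j. x (a, i, j))"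
  define F where "F = {x. (\<forall>i\<in>D. cmod (x i) \<le> r) \<and> (\<forall>i. i \<notin> D \<longrightarrow> x i = 0)} \<inter> (\<Inter>a\<in>{..<4}. {x. psd I (cu x a)})"
  have "closed (\<Inter>a\<in>{..<4::nat}. {x. psd I (cu x a)})"
    unfolding cu_def by (intro closed_INT ballI closed_psd continuous_intros)
  then have "compact F" unfolding F_def by (intro compact_Int_closed compact_box)
  have z: "psd I (\<lambda>i j. 0)" by (rule psdI) (auto simp: form_expand intro: hermI)
  have rf: "0 \<le> ?f X" for X unfolding square_defect_def by (intro add_nonneg_nonneg rip_self_nonneg)
  have "0 \<le> r" unfolding r_def by (intro mult_nonneg_nonneg add_nonneg_nonneg sum_nonneg real_sqrt_ge_zero rf) auto
  then have "(\<lambda>_. 0) \<in> F" using z by (auto simp: F_def cu_def)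
  moreover have "continuous_on F (\<lambda>x. ?f (cu x))"
    unfolding square_defect_def rip_def cu_def by (intro continuous_intros)
  ultimately obtain x where x: "x \<in> F" "\<And>y. y \<in> F \<Longrightarrow> ?f (cu x) \<le> ?f (cu y)"
    using continuous_attains_inf[OF \<open>compact F\<close>] by blast
  show ?thesis
  proof (rule that)
    show "psd I (cu x a)" if "a < 4" for a using x(1) that by (auto simp: F_def)
    fix Y :: "nat \<Rightarrow> 'i \<Rightarrow> 'i \<Rightarrow> complex" assume Y: "\<And>a. a < 4 \<Longrightarrow> psd I (Y a)"
    show "?f (cu x) \<le> ?f Y"
    \<comment> \<open>The zero quadruple is admissible, so only quadruples at most as bad as it
      matter, and these lie in the compact box.\<close>
    proof (cases "?f Y \<le> ?f (\<lambda>a i j. 0)")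
      case True
      define y where "y = (\<lambda>(a, i, j). if (a, i, j) \<in> D then Y a i j else 0)"
      have cy: "cu y a i j = Y a i j" if "a < 4" "i \<in> I" "j \<in> I" for a i j
        using that by (simp add: cu_def y_def D_def)
      have "psd I (cu y a)" if "a < 4" for a using psd_cong[OF _ Y[OF that]] cy[OF that] by metis
      moreover have "cmod (y d) \<le> r" if "d \<in> D" for d
        using square_defect_bounded[OF I Y True] that by (auto simp: D_def y_def r_def)
      ultimately have "y \<in> F" by (auto simp: F_def y_def)
      moreover have "?f (cu y) = ?f Y"
        unfolding square_defect_def by (intro arg_cong2[where f = "(+) :: real \<Rightarrow> _"] rip_cong) (simp_all add: cy)
      ultimately show ?thesis using x(2) by metis
    next
      case False
      then show ?thesis using x(2)[OF \<open>(\<lambda>_. 0) \<in> F\<close>] by (simp add: cu_def)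
    qed
  qed
qed

lemma rip_perturb:
  "rip I (\<lambda>i j. n i j + of_real t * d i j) (\<lambda>i j. n i j + of_real t * d i j) = rip I n n + 2 * t * rip I n d + t\<^sup>2 * rip I d d"
  by (simp add: rip_add_left rip_add_right rip_mult_right rip_commute[of I "\<lambda>i j. of_real t * d i j"] power2_eq_square
      rip_commute[of I d n] algebra_simps)

text \<open>Duality by least squares. At a minimiser, variation in psd directions shows that
  \<open>- N2\<close>, \<open>N3\<close>, \<open>N4\<close> and \<open>N2 + N3 + N4\<close> are psd,
  and variation along the minimiser itself gives complementary slackness. For these four operators
  the pairing inequality then bounds the sum of the squared residuals by 0. Attainment of the
  minimum replaces a closedness argument for the cone of solvable data.\<close>

theorem square_interpolation:
  assumes I: "finite I" and h: "herm I A" "herm I B" "herm I G" and sq: "square_positive I A B G"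
  shows "\<exists>T. psd I T \<and> psd I (\<lambda>i j. T i j + G i j) \<and> psd I (\<lambda>i j. A i j - T i j) \<and> psd I (\<lambda>i j. B i j - T i j)"
proof -
  obtain X where X: "\<And>a. a < 4 \<Longrightarrow> psd I (X a)"
    and min: "\<And>Y. (\<And>a. a < 4 \<Longrightarrow> psd I (Y a)) \<Longrightarrow> square_defect I A B G X \<le> square_defect I A B G Y"
    using square_defect_minimizer[OF I] by blast
  define N2 where "N2 = (\<lambda>i j. X 0 i j - X 1 i j + G i j)"
  define N3 where "N3 = (\<lambda>i j. X 0 i j + X 2 i j - A i j)"
  define N4 where "N4 = (\<lambda>i j. X 0 i j + X 3 i j - B i j)"
  have var: "0 \<le> rip I N2 (\<lambda>i j. d 0 i j - d 1 i j) + rip I N3 (\<lambda>i j. d 0 i j + d 2 i j) + rip I N4 (\<lambda>i j. d 0 i j + d 3 i j)"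
    (is "0 \<le> ?L") if d: "\<And>t a. 0 < t \<Longrightarrow> t < 1 \<Longrightarrow> a < 4 \<Longrightarrow> psd I (\<lambda>i j. X a i j + of_real t * d a i j)" for d :: "nat \<Rightarrow> _"
  proof -
    let ?q = "rip I (\<lambda>i j. d 0 i j - d 1 i j) (\<lambda>i j. d 0 i j - d 1 i j) + rip I (\<lambda>i j. d 0 i j + d 2 i j) (\<lambda>i j. d 0 i j + d 2 i j)
      + rip I (\<lambda>i j. d 0 i j + d 3 i j) (\<lambda>i j. d 0 i j + d 3 i j)"
    have "t * (- 2 * ?L) + t\<^sup>2 * (- ?q) \<le> 0" if t: "0 < t" "t < 1" for t
    proof -
      have "square_defect I A B G X \<le> square_defect I A B G (\<lambda>a i j. X a i j + of_real t * d a i j)"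
        by (rule min) (rule d[OF t])
      also have "\<dots> = rip I (\<lambda>i j. N2 i j + of_real t * (d 0 i j - d 1 i j)) (\<lambda>i j. N2 i j + of_real t * (d 0 i j - d 1 i j))
          + rip I (\<lambda>i j. N3 i j + of_real t * (d 0 i j + d 2 i j)) (\<lambda>i j. N3 i j + of_real t * (d 0 i j + d 2 i j))
          + rip I (\<lambda>i j. N4 i j + of_real t * (d 0 i j + d 3 i j)) (\<lambda>i j. N4 i j + of_real t * (d 0 i j + d 3 i j))"
        unfolding square_defect_def N2_def N3_def N4_def
        by (intro arg_cong2[where f = "(+) :: real \<Rightarrow> _"] rip_cong) (simp_all add: algebra_simps)
      also have "\<dots> = square_defect I A B G X + 2 * t * ?L + t\<^sup>2 * ?q"
        unfolding rip_perturb by (simp add: square_defect_def N2_def N3_def N4_def algebra_simps)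
      finally show ?thesis by (simp add: algebra_simps)
    qed
    from linear_dominates_quadratic[OF this] show ?thesis by simp
  qed
  have var1: "0 \<le> (if a = 0 then rip I N2 s + rip I N3 s + rip I N4 s else if a = 1 then - rip I N2 s
      else if a = 2 then rip I N3 s else rip I N4 s)"
    if a: "a < 4" and s: "\<And>t. 0 < t \<Longrightarrow> t < 1 \<Longrightarrow> psd I (\<lambda>i j. X a i j + of_real t * s i j)" for a :: nat and s
  proof -
    have "psd I (\<lambda>i j. X b i j + of_real t * (if b = a then s i j else 0))" if "0 < t" "t < 1" "b < 4" for t b
      using s[OF that(1,2)] X[OF that(3)] by (cases "b = a") simp_all
    note v = var[of "\<lambda>b i j. if b = a then s i j else 0", OF this]
    have z: "rip I n (\<lambda>i j. 0) = 0" for n by (simp add: rip_def)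
    have "a = 0 \<or> a = 1 \<or> a = 2 \<or> a = 3" using a by auto
    then show ?thesis using v by (elim disjE) (simp_all add: z rip_minus_right)
  qed
  \<comment> \<open>Shrinking a slot keeps it psd, so the direction \<open>- X a\<close> is
    admissible too; it yields the reverse inequalities in \<open>le0\<close>.\<close>
  have scale: "psd I (\<lambda>i j. X a i j + of_real t * - X a i j)" if "a < 4" "0 < t" "t < 1" for a t
    using psd_scale[OF X[OF that(1)], of "1 - t"] that by (simp add: algebra_simps)
  have pos: "psd I s \<Longrightarrow> 0 \<le> rip I N2 s + rip I N3 s + rip I N4 s" "psd I s \<Longrightarrow> 0 \<le> - rip I N2 s"
    "psd I s \<Longrightarrow> 0 \<le> rip I N3 s" "psd I s \<Longrightarrow> 0 \<le> rip I N4 s" for s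
    using var1[of 0 s] var1[of 1 s] var1[of 2 s] var1[of 3 s] psd_add[OF X psd_scale[of I s]] by auto
  have le0: "rip I N2 (X 0) + rip I N3 (X 0) + rip I N4 (X 0) \<le> 0" "- rip I N2 (X 1) \<le> 0"
    "rip I N3 (X 2) \<le> 0" "rip I N4 (X 3) \<le> 0"
    using var1[of 0, OF _ scale[of 0]] var1[of 1, OF _ scale[of 1]] var1[of 2, OF _ scale[of 2]] var1[of 3, OF _ scale[of 3]]
    by (auto simp: rip_minus_right)
  have hX: "cnj (X a i j) = X a j i" if "a < 4" "i \<in> I" "j \<in> I" for a i j
    using hermD[OF psdD(1)[OF X]] that by blast
  have hN: "herm I N2" "herm I N3" "herm I N4"
    by (rule hermI, simp add: N2_def N3_def N4_def hX hermD[OF h(1)] hermD[OF h(2)] hermD[OF h(3)])+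
  have hm: "herm I (\<lambda>i j. - N2 i j)" "herm I (\<lambda>i j. N2 i j + N3 i j + N4 i j)"
    by (rule hermI, simp add: hermD[OF hN(1)] hermD[OF hN(2)] hermD[OF hN(3)])+
  \<comment> \<open>The balance of sums required by the pairing lemma is
    \<open>N3 + N4 = - N2 + (N2 + N3 + N4)\<close>.\<close>
  have "0 \<le> rip I A N3 + rip I B N4 + rip I G (\<lambda>i j. - N2 i j)"
  proof (rule square_positive_pairing[OF I h sq])
    show "psd I N3" "psd I N4" "psd I (\<lambda>i j. - N2 i j)" "psd I (\<lambda>i j. N2 i j + N3 i j + N4 i j)"
      using pos hN hm by (auto intro!: psdI_rip simp: rip_minus_left rip_add_left)
  qed simp
  also have "rip I A N3 = rip I (\<lambda>i j. X 0 i j + X 2 i j - N3 i j) N3" by (simp add: N3_def)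
  also have "rip I B N4 = rip I (\<lambda>i j. X 0 i j + X 3 i j - N4 i j) N4" by (simp add: N4_def)
  also have "rip I G (\<lambda>i j. - N2 i j) = rip I (\<lambda>i j. N2 i j - X 0 i j + X 1 i j) (\<lambda>i j. - N2 i j)" by (simp add: N2_def)
  finally have "rip I N2 N2 + rip I N3 N3 + rip I N4 N4 \<le> 0"
    using le0 by (simp add: rip_add_left rip_diff_left rip_minus_right rip_commute[of I "X _"])
  then have z: "rip I N2 N2 = 0" "rip I N3 N3 = 0" "rip I N4 N4 = 0"
    using rip_self_nonneg[of I N2] rip_self_nonneg[of I N3] rip_self_nonneg[of I N4] by linarith+
  have zero: "n i j = 0" if "rip I n n = 0" "i \<in> I" "j \<in> I" for n i j
    using cmod_le_rip[OF I that(2,3), of n] that(1) by simp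
  have "psd I (\<lambda>i j. X 0 i j + G i j)"
    using zero[OF z(1)] by (intro psd_cong[OF _ X[of 1]]) (auto simp: N2_def algebra_simps)
  moreover have "psd I (\<lambda>i j. A i j - X 0 i j)"
    using zero[OF z(2)] by (intro psd_cong[OF _ X[of 2]]) (auto simp: N3_def algebra_simps)
  moreover have "psd I (\<lambda>i j. B i j - X 0 i j)"
    using zero[OF z(3)] by (intro psd_cong[OF _ X[of 3]]) (auto simp: N4_def algebra_simps)
  ultimately show ?thesis using X[of 0] by (intro exI[of _ "X 0"]) auto
qed

section \<open>Square roots in commutative C*-algebras\<close>

context commutative_cstar_algebra
begin

lemma sm_closed [simp, intro]: "x \<in> carrier \<A> \<Longrightarrow> a \<odot> x \<in> carrier \<A>"
  by (rule smult_closed) simp_all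

lemma sm_add_left: "x \<in> carrier \<A> \<Longrightarrow> (a + b) \<odot> x = a \<odot> x \<oplus> b \<odot> x"
  and sm_add_right: "x \<in> carrier \<A> \<Longrightarrow> y \<in> carrier \<A> \<Longrightarrow> a \<odot> (x \<oplus> y) = a \<odot> x \<oplus> a \<odot> y"
  and sm_assoc [simp]: "x \<in> carrier \<A> \<Longrightarrow> a \<odot> (b \<odot> x) = (a * b) \<odot> x"
  and sm_mult_left [simp]: "x \<in> carrier \<A> \<Longrightarrow> y \<in> carrier \<A> \<Longrightarrow> (a \<odot> x) \<otimes> y = a \<odot> (x \<otimes> y)"
  and sm_one [simp]: "x \<in> carrier \<A> \<Longrightarrow> 1 \<odot> x = x"
  and sm_zero [simp]: "x \<in> carrier \<A> \<Longrightarrow> 0 \<odot> x = \<zero>"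
  and sm_of_zero [simp]: "a \<odot> \<zero> = \<zero>"
  using smult_l_distr[of a b x] smult_r_distr[of a x y] smult_assoc1[of a b x] smult_assoc2[of a x y] smult_one[of x]
    smult_l_null[of x] smult_r_null[of a]
  by (simp_all del: smult_one smult_l_null smult_r_null)

lemma sm_mult_right [simp]: "x \<in> carrier \<A> \<Longrightarrow> y \<in> carrier \<A> \<Longrightarrow> x \<otimes> (a \<odot> y) = a \<odot> (x \<otimes> y)"
  using sm_mult_left[of y x a] by (simp add: m_comm)

lemma neg_sm: "x \<in> carrier \<A> \<Longrightarrow> \<ominus> x = (- 1) \<odot> x"
proof -
  assume x: "x \<in> carrier \<A>"
  have "x \<oplus> (- 1) \<odot> x = (1 + - 1) \<odot> x" using x by (simp only: sm_add_left sm_one)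
  then have "x \<oplus> (- 1) \<odot> x = \<zero>" using x by simp
  then show ?thesis using x sm_closed[of x "- 1"] M.minus_equality[of "(- 1) \<odot> x" x] by (simp add: M.a_comm)
qed

lemma minus_sm: "x \<in> carrier \<A> \<Longrightarrow> y \<in> carrier \<A> \<Longrightarrow> x \<ominus> y = x \<oplus> (- 1) \<odot> y"
  by (simp add: a_minus_def neg_sm)

text \<open>Sums of scaled monomials are brought to the form \<open>a\<^sub>1 \<odot> x\<^sub>1 \<oplus> (a\<^sub>2 \<odot> x\<^sub>2 \<oplus> \<dots>)\<close>.\<close>

lemmas sm_expand = minus_sm l_distr r_distr sm_add_right m_ac M.a_ac

lemma sm_collect:
  "x \<in> carrier \<A> \<Longrightarrow> a \<odot> x \<oplus> b \<odot> x = (a + b) \<odot> x"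
  "x \<in> carrier \<A> \<Longrightarrow> y \<in> carrier \<A> \<Longrightarrow> a \<odot> x \<oplus> (b \<odot> x \<oplus> y) = (a + b) \<odot> x \<oplus> y"
  "x \<in> carrier \<A> \<Longrightarrow> x \<oplus> b \<odot> x = (1 + b) \<odot> x"
  "x \<in> carrier \<A> \<Longrightarrow> y \<in> carrier \<A> \<Longrightarrow> x \<oplus> (b \<odot> x \<oplus> y) = (1 + b) \<odot> x \<oplus> y"
  "x \<in> carrier \<A> \<Longrightarrow> a \<odot> x \<oplus> x = (a + 1) \<odot> x"
  "x \<in> carrier \<A> \<Longrightarrow> y \<in> carrier \<A> \<Longrightarrow> a \<odot> x \<oplus> (x \<oplus> y) = (a + 1) \<odot> x \<oplus> y"
  "x \<in> carrier \<A> \<Longrightarrow> x \<oplus> x = 2 \<odot> x"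
  "x \<in> carrier \<A> \<Longrightarrow> y \<in> carrier \<A> \<Longrightarrow> x \<oplus> (x \<oplus> y) = 2 \<odot> x \<oplus> y"
  using sm_add_left[of x a b] sm_add_left[of x 1 b] sm_add_left[of x a 1] sm_add_left[of x 1 1]
  by (simp_all flip: M.a_assoc)

lemma sm_cancel:
  "x \<in> carrier \<A> \<Longrightarrow> y \<in> carrier \<A> \<Longrightarrow> x \<oplus> (y \<oplus> (- 1) \<odot> x) = y"
  "x \<in> carrier \<A> \<Longrightarrow> y \<in> carrier \<A> \<Longrightarrow> z \<in> carrier \<A> \<Longrightarrow> x \<oplus> (y \<oplus> ((- 1) \<odot> x \<oplus> z)) = y \<oplus> z"
  using M.a_lcomm[of x y "(- 1) \<odot> x"] M.a_lcomm[of x y "(- 1) \<odot> x \<oplus> z"] by (simp_all add: sm_collect)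

lemma cnorm_star: assumes x: "x \<in> carrier \<A>" shows "cnorm \<A> (star \<A> x) = cnorm \<A> x"
proof -
  have le: "cnorm \<A> y \<le> cnorm \<A> (star \<A> y)" if y: "y \<in> carrier \<A>" for y
  proof (cases "cnorm \<A> y = 0")
    case True
    then show ?thesis using cnorm_nonneg[of "star \<A> y"] y by (simp add: star_closed)
  next
    case False
    then have "cnorm \<A> y > 0" using cnorm_nonneg[OF y] by simp
    moreover have "cnorm \<A> y * cnorm \<A> y \<le> cnorm \<A> (star \<A> y) * cnorm \<A> y"
      using cnorm_mult[of "star \<A> y" y] cstar_identity[OF y] y by (simp add: star_closed power2_eq_square)
    ultimately show ?thesis by simp
  qed
  show ?thesis using le[OF x] le[of "star \<A> x"] x by (simp add: star_closed star_star)
qed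

lemma cnorm_zero [simp]: "cnorm \<A> \<zero> = 0"
  using cnorm_eq_0[of \<zero>] by simp

lemma star_one [simp]: "star \<A> \<one> = \<one>"
  using star_mult[of "star \<A> \<one>" \<one>] by (simp add: star_star star_closed)

lemma star_zero [simp]: "star \<A> \<zero> = \<zero>"
  using star_smult[of \<zero> 0] by (simp add: star_closed)

lemma cnorm_one_le: "cnorm \<A> \<one> \<le> 1"
proof -
  have "cnorm \<A> \<one> = (cnorm \<A> \<one>)\<^sup>2" using cstar_identity[of \<one>] by simp
  then have "cnorm \<A> \<one> = 0 \<or> cnorm \<A> \<one> = 1" by (simp add: power2_eq_square)
  then show ?thesis by auto
qed

lemma minus_zero_iff: "x \<in> carrier \<A> \<Longrightarrow> y \<in> carrier \<A> \<Longrightarrow> x \<ominus> y = \<zero> \<longleftrightarrow> x = y"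
  by (metis M.minus_equality M.minus_minus M.r_neg M.a_inv_closed a_minus_def)

lemma cnorm_triangle:
  assumes "x \<in> carrier \<A>" "y \<in> carrier \<A>" "z \<in> carrier \<A>"
  shows "cnorm \<A> (x \<ominus> z) \<le> cnorm \<A> (x \<ominus> y) + cnorm \<A> (y \<ominus> z)"
proof -
  have "x \<ominus> z = (x \<ominus> y) \<oplus> (y \<ominus> z)"
    using assms by (simp add: a_minus_def M.a_assoc M.r_neg1 M.l_neg M.r_neg2)
  then show ?thesis using assms by (simp add: cnorm_add)
qed

lemma contraction_fixpoint:
  assumes S: "S \<subseteq> carrier \<A>" "S \<noteq> {}" and f: "\<And>x. x \<in> S \<Longrightarrow> f x \<in> S" and k: "k < 1"
    and lip: "\<And>x y. x \<in> S \<Longrightarrow> y \<in> S \<Longrightarrow> cnorm \<A> (f x \<ominus> f y) \<le> k * cnorm \<A> (x \<ominus> y)"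
    and closed: "\<And>X x. (\<And>n. X n \<in> S) \<Longrightarrow> x \<in> carrier \<A> \<Longrightarrow> (\<lambda>n. cnorm \<A> (X n \<ominus> x)) \<longlonglongrightarrow> 0 \<Longrightarrow> x \<in> S"
  obtains x where "x \<in> S" "f x = x"
proof -
  \<comment> \<open>\<open>Metric_space\<close> asks for nonnegativity and symmetry at all
    arguments, also outside \<open>S\<close>; hence the default 0.\<close>
  define d where "d = (\<lambda>x y. if x \<in> S \<and> y \<in> S then cnorm \<A> (x \<ominus> y) else 0)"
  have SA: "x \<in> carrier \<A>" if "x \<in> S" for x using S that by auto
  interpret S: Metric_space S d
  proof
    fix x y z
    show "0 \<le> d x y" by (auto simp: d_def SA intro: cnorm_nonneg)
    show "d x y = d y x" by (auto simp: d_def SA intro: cnorm_minus_commute)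
    assume xyz: "x \<in> S" "y \<in> S"
    then show "d x y = 0 \<longleftrightarrow> x = y" by (simp add: d_def cnorm_eq_0 minus_zero_iff SA)
    assume "z \<in> S"
    then show "d x z \<le> d x y + d y z" using xyz by (simp add: d_def cnorm_triangle SA)
  qed
  have "S.mcomplete"
    unfolding S.mcomplete_def
  proof (intro allI impI)
    fix X assume X: "S.MCauchy X"
    then have XS: "\<And>n. X n \<in> S" and C: "\<And>e. e > 0 \<Longrightarrow> \<exists>N. \<forall>m n. N \<le> m \<longrightarrow> N \<le> n \<longrightarrow> d (X m) (X n) < e"
      unfolding S.MCauchy_def by blast+
    have "\<exists>x \<in> carrier \<A>. (\<lambda>n. cnorm \<A> (X n \<ominus> x)) \<longlonglongrightarrow> 0"
      using C XS SA by (intro complete) (auto simp: d_def)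
    then obtain x where x: "x \<in> carrier \<A>" "(\<lambda>n. cnorm \<A> (X n \<ominus> x)) \<longlonglongrightarrow> 0" by blast
    then have xS: "x \<in> S" using closed XS by blast
    have "\<exists>N. \<forall>n\<ge>N. X n \<in> S \<and> d (X n) x < e" if "e > 0" for e
      using LIMSEQ_D[OF x(2) that] XS xS by (auto simp: d_def cnorm_nonneg SA)
    then have "limitin S.mtopology X x sequentially"
      unfolding S.limit_metric_sequentially using xS by blast
    then show "\<exists>x. limitin S.mtopology X x sequentially" ..
  qed
  moreover have "d (f x) (f y) \<le> k * d x y" if "x \<in> S" "y \<in> S" for x y
    using that lip f by (simp add: d_def)
  ultimately show ?thesis
    using S.Banach_fixedpoint_thm[of f k] S(2) f k that by (metis Pi_I)
qed

lemma star_minus: "x \<in> carrier \<A> \<Longrightarrow> y \<in> carrier \<A> \<Longrightarrow> star \<A> (x \<ominus> y) = star \<A> x \<ominus> star \<A> y"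
  by (simp add: minus_sm star_add star_smult star_closed)

lemma cnorm_limit_le:
  assumes "\<And>n. X n \<in> carrier \<A>" "x \<in> carrier \<A>" "(\<lambda>n. cnorm \<A> (X n \<ominus> x)) \<longlonglongrightarrow> 0"
    and "\<And>n. cnorm \<A> (X n) \<le> r"
  shows "cnorm \<A> x \<le> r"
proof -
  have "cnorm \<A> x \<le> r + cnorm \<A> (X n \<ominus> x)" for n
  proof -
    have "x = X n \<oplus> (x \<ominus> X n)" using assms by (simp add: a_minus_def M.a_lcomm M.r_neg)
    then have "cnorm \<A> x \<le> cnorm \<A> (X n) + cnorm \<A> (x \<ominus> X n)"
      using assms cnorm_add[of "X n" "x \<ominus> X n"] by simp
    then show ?thesis using assms(4)[of n] cnorm_minus_commute[OF assms(2) assms(1)[of n]] by linarith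
  qed
  moreover have "(\<lambda>n. r + cnorm \<A> (X n \<ominus> x)) \<longlonglongrightarrow> r + 0" by (intro tendsto_intros assms)
  ultimately show ?thesis using LIMSEQ_le_const[of "\<lambda>n. r + cnorm \<A> (X n \<ominus> x)" "r + 0" "cnorm \<A> x"] by auto
qed

lemma selfadjoint_limit:
  assumes X: "\<And>n. X n \<in> carrier \<A>" and x: "x \<in> carrier \<A>" "(\<lambda>n. cnorm \<A> (X n \<ominus> x)) \<longlonglongrightarrow> 0"
    and sa: "\<And>n. star \<A> (X n) = X n"
  shows "star \<A> x = x"
proof -
  have "cnorm \<A> (X n \<ominus> star \<A> x) = cnorm \<A> (X n \<ominus> x)" for n
  proof -
    have "star \<A> (X n \<ominus> x) = X n \<ominus> star \<A> x" by (simp only: star_minus[OF X x(1)] sa)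
    then show ?thesis using cnorm_star[OF M.minus_closed[OF X x(1)], of n] by simp
  qed
  then have "(\<lambda>n. cnorm \<A> (X n \<ominus> star \<A> x)) \<longlonglongrightarrow> 0" using x(2) by simp
  from limit_unique[OF X star_closed[OF x(1)] x(1) this x(2)] show ?thesis .
qed

text \<open>A fixed point of \<open>w \<mapsto> (x + w\<^sup>2) / 2\<close> satisfies
  \<open>(1 - w)\<^sup>2 = 1 - x\<close>. On the selfadjoint ball whose radius is the norm of
  \<open>x\<close> this map is a contraction, because \<open>w\<^sup>2 - v\<^sup>2\<close> factors
  in a commutative algebra.\<close>

lemma sqrt_one_minus:
  assumes x: "x \<in> carrier \<A>" "star \<A> x = x" and n: "cnorm \<A> x < 1"
  obtains z where "z \<in> carrier \<A>" "star \<A> z = z" "z \<otimes> z = \<one> \<ominus> x"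
proof -
  define \<rho> where "\<rho> = cnorm \<A> x"
  have \<rho>: "0 \<le> \<rho>" "\<rho> < 1" using n x by (auto simp: \<rho>_def cnorm_nonneg)
  define S where "S = {w \<in> carrier \<A>. star \<A> w = w \<and> cnorm \<A> w \<le> \<rho>}"
  define f where "f = (\<lambda>w. (1/2) \<odot> (x \<oplus> w \<otimes> w))"
  obtain w where w: "w \<in> S" "f w = w"
  proof (rule contraction_fixpoint[of S f \<rho>])
    show "S \<subseteq> carrier \<A>" by (auto simp: S_def)
    show "S \<noteq> {}" using \<rho> by (auto simp: S_def intro!: exI[of _ \<zero>])
    show "\<rho> < 1" by fact
    show "f w \<in> S" if "w \<in> S" for w
    proof -
      have w: "w \<in> carrier \<A>" "star \<A> w = w" "cnorm \<A> w \<le> \<rho>" using that by (auto simp: S_def)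
      have "cnorm \<A> (w \<otimes> w) \<le> \<rho> * \<rho>"
        using cnorm_mult[of w w] w mult_mono[OF w(3,3)] \<rho> cnorm_nonneg[of w] by simp
      also have "\<dots> \<le> \<rho>" using \<rho> by (simp add: mult_left_le)
      finally have "cnorm \<A> (x \<oplus> w \<otimes> w) \<le> \<rho> + \<rho>"
        using cnorm_add[of x "w \<otimes> w"] x w by (simp add: \<rho>_def)
      then show ?thesis
        using x w by (simp add: S_def f_def cnorm_smult star_smult star_add star_mult norm_divide)
    qed
    show "cnorm \<A> (f w \<ominus> f v) \<le> \<rho> * cnorm \<A> (w \<ominus> v)" if "w \<in> S" "v \<in> S" for w v
    proof -
      have wv: "w \<in> carrier \<A>" "v \<in> carrier \<A>" "cnorm \<A> w \<le> \<rho>" "cnorm \<A> v \<le> \<rho>" using that by (auto simp: S_def)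
      have "f w \<ominus> f v = (1/2) \<odot> ((w \<oplus> v) \<otimes> (w \<ominus> v))"
        using wv x by (simp add: f_def sm_expand sm_collect sm_cancel)
      then have "cnorm \<A> (f w \<ominus> f v) = cnorm \<A> ((w \<oplus> v) \<otimes> (w \<ominus> v)) / 2"
        using wv by (simp add: cnorm_smult norm_divide)
      also have "\<dots> \<le> (cnorm \<A> (w \<oplus> v) * cnorm \<A> (w \<ominus> v)) / 2" using wv by (simp add: cnorm_mult)
      also have "\<dots> \<le> ((\<rho> + \<rho>) * cnorm \<A> (w \<ominus> v)) / 2"
        using wv cnorm_add[of w v] by (intro divide_right_mono mult_right_mono cnorm_nonneg) auto
      finally show ?thesis by simp
    qed
    show "x \<in> S" if "\<And>n. X n \<in> S" "x \<in> carrier \<A>" "(\<lambda>n. cnorm \<A> (X n \<ominus> x)) \<longlonglongrightarrow> 0" for X x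
      using cnorm_limit_le[of X x \<rho>] selfadjoint_limit[of X x] that by (auto simp: S_def)
  qed
  have wA: "w \<in> carrier \<A>" "star \<A> w = w" using w by (auto simp: S_def)
  have "2 \<odot> w = x \<oplus> w \<otimes> w"
  proof -
    have "2 \<odot> w = 2 \<odot> f w" by (simp add: w)
    then show ?thesis using x wA by (simp add: f_def)
  qed
  then have "2 \<odot> w \<ominus> x = (x \<oplus> w \<otimes> w) \<ominus> x" by simp
  then have "w \<otimes> w = 2 \<odot> w \<ominus> x"
    using x wA by (simp add: minus_sm M.a_assoc sm_cancel)
  then have "(\<one> \<ominus> w) \<otimes> (\<one> \<ominus> w) = \<one> \<ominus> x"
    using x wA by (simp add: sm_expand sm_collect sm_cancel)
  then show ?thesis using that[of "\<one> \<ominus> w"] wA by (simp add: star_minus)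
qed

lemma inverse_one_minus:
  assumes x: "x \<in> carrier \<A>" and n: "cnorm \<A> x < 1"
  obtains z where "z \<in> carrier \<A>" "(\<one> \<ominus> x) \<otimes> z = \<one>"
proof -
  obtain z where z: "z \<in> carrier \<A>" "\<one> \<oplus> x \<otimes> z = z"
  proof (rule contraction_fixpoint[of "carrier \<A>" "\<lambda>z. \<one> \<oplus> x \<otimes> z" "cnorm \<A> x"])
    fix w v assume wv: "w \<in> carrier \<A>" "v \<in> carrier \<A>"
    have "(\<one> \<oplus> x \<otimes> w) \<ominus> (\<one> \<oplus> x \<otimes> v) = x \<otimes> (w \<ominus> v)"
      using wv x by (simp add: sm_expand sm_collect sm_cancel)
    then show "cnorm \<A> ((\<one> \<oplus> x \<otimes> w) \<ominus> (\<one> \<oplus> x \<otimes> v)) \<le> cnorm \<A> x * cnorm \<A> (w \<ominus> v)"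
      using cnorm_mult[of x "w \<ominus> v"] wv x by simp
  qed (use x n in auto)
  have "(\<one> \<ominus> x) \<otimes> z = z \<oplus> (- 1) \<odot> (x \<otimes> z)" using x z by (simp add: sm_expand)
  also have "\<dots> = \<one> \<oplus> (x \<otimes> z \<oplus> (- 1) \<odot> (x \<otimes> z))" using x z(1) arg_cong[OF z(2), of "\<lambda>y. y \<oplus> (- 1) \<odot> (x \<otimes> z)"] by (simp add: M.a_assoc)
  also have "\<dots> = \<one>" using x z by (simp add: sm_collect)
  finally show ?thesis using that z by blast
qed

text \<open>Positivity expressed by the norm, without a spectrum. In this form the triangle
  inequality shows at once that positive elements add.\<close>

definition pos :: "'a \<Rightarrow> bool" where
  "pos h \<longleftrightarrow> h \<in> carrier \<A> \<and> star \<A> h = h \<and> (\<exists>l\<ge>0. cnorm \<A> (complex_of_real l \<odot> \<one> \<ominus> h) \<le> l)"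

lemma pos_zero: "pos \<zero>"
  unfolding pos_def by (intro conjI exI[of _ 0]) (auto simp: minus_sm)

lemma pos_add:
  assumes "pos h" "pos k" shows "pos (h \<oplus> k)"
proof -
  obtain l m where hk: "h \<in> carrier \<A>" "star \<A> h = h" "k \<in> carrier \<A>" "star \<A> k = k"
    and lm: "l \<ge> 0" "m \<ge> 0" "cnorm \<A> (complex_of_real l \<odot> \<one> \<ominus> h) \<le> l" "cnorm \<A> (complex_of_real m \<odot> \<one> \<ominus> k) \<le> m"
    using assms by (auto simp: pos_def)
  have "complex_of_real (l + m) \<odot> \<one> \<ominus> (h \<oplus> k) = (complex_of_real l \<odot> \<one> \<ominus> h) \<oplus> (complex_of_real m \<odot> \<one> \<ominus> k)"
    using hk by (simp add: sm_expand sm_add_left)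
  then have "cnorm \<A> (complex_of_real (l + m) \<odot> \<one> \<ominus> (h \<oplus> k)) \<le> l + m"
    using cnorm_add[of "complex_of_real l \<odot> \<one> \<ominus> h" "complex_of_real m \<odot> \<one> \<ominus> k"] hk lm by simp
  then show ?thesis using hk lm unfolding pos_def
    by (intro conjI exI[of _ "l + m"]) (auto simp: star_add)
qed

text \<open>\<open>l\<close> exceeds the norm of \<open>star a a\<close>, so
  \<open>1 - star a a / l\<close> has a square root. That the complement of \<open>star a a\<close>
  in \<open>l\<close> is itself a square later absorbs multiplication by \<open>a\<close> into
  domination by \<open>l\<close>.\<close>

lemma star_mult_self_bound:
  assumes a: "a \<in> carrier \<A>"
  obtains l w where "l > 0" "w \<in> carrier \<A>" "star \<A> w = w" "complex_of_real l \<odot> \<one> = star \<A> a \<otimes> a \<oplus> w \<otimes> w"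
proof -
  define l where "l = (cnorm \<A> a)\<^sup>2 + 1"
  have l: "l > 0" unfolding l_def by (simp add: add_nonneg_pos)
  define x where "x = complex_of_real (1 / l) \<odot> (star \<A> a \<otimes> a)"
  have s: "star \<A> a \<in> carrier \<A>" using a by (simp add: star_closed)
  have x: "x \<in> carrier \<A>" "star \<A> x = x"
    using a s by (simp_all add: x_def star_smult star_mult star_star)
  have "cnorm \<A> x = (cnorm \<A> a)\<^sup>2 / l"
    using a s l by (simp add: x_def cnorm_smult cstar_identity norm_divide)
  also have "\<dots> < 1" using l by (simp add: l_def)
  finally have "cnorm \<A> x < 1" .
  then obtain z where z: "z \<in> carrier \<A>" "star \<A> z = z" "z \<otimes> z = \<one> \<ominus> x"
    using sqrt_one_minus[OF x] by blast
  have sq: "complex_of_real (sqrt l) * complex_of_real (sqrt l) = complex_of_real l"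
    using l by (simp flip: of_real_mult)
  have l1: "complex_of_real l * complex_of_real (1 / l) = 1" using l by (simp flip: of_real_mult)
  have "(complex_of_real (sqrt l) \<odot> z) \<otimes> (complex_of_real (sqrt l) \<odot> z) = complex_of_real l \<odot> (z \<otimes> z)"
    using z(1) sq by simp
  also have "\<dots> = complex_of_real l \<odot> \<one> \<oplus> (- 1) \<odot> (star \<A> a \<otimes> a)"
    using x a s l1 unfolding z(3) by (simp add: minus_sm sm_add_right) (simp add: x_def)
  finally have "star \<A> a \<otimes> a \<oplus> (complex_of_real (sqrt l) \<odot> z) \<otimes> (complex_of_real (sqrt l) \<odot> z) = complex_of_real l \<odot> \<one>"
    using a s by (simp add: M.a_ac sm_collect sm_cancel)
  then show ?thesis using that[of l "complex_of_real (sqrt l) \<odot> z"] l z by (simp add: star_smult)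
qed

text \<open>With \<open>x\<^sup>2 + z\<^sup>2 = l\<close>, the element \<open>z + i x\<close> is a multiple of a unitary, which bounds \<open>z\<close>.\<close>

lemma pos_square:
  assumes x: "x \<in> carrier \<A>" "star \<A> x = x" shows "pos (x \<otimes> x)"
proof -
  obtain l z where l: "l > 0" and z: "z \<in> carrier \<A>" "star \<A> z = z" and lz: "complex_of_real l \<odot> \<one> = x \<otimes> x \<oplus> z \<otimes> z"
    using star_mult_self_bound[OF x(1)] x(2) by metis
  define U where "U = z \<oplus> \<i> \<odot> x"
  have sU: "star \<A> U = z \<oplus> (- \<i>) \<odot> x" and U: "U \<in> carrier \<A>"
    using x z by (simp_all add: U_def star_add star_smult)
  have "star \<A> U \<otimes> U = complex_of_real l \<odot> \<one>"
    unfolding lz sU using x z by (simp add: U_def sm_expand sm_collect sm_cancel)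
  then have "(cnorm \<A> U)\<^sup>2 = l * cnorm \<A> \<one>"
    using cstar_identity[OF U] l by (simp add: cnorm_smult)
  also have "\<dots> \<le> l * 1" using l cnorm_one_le by (intro mult_left_mono) auto
  finally have "cnorm \<A> U \<le> sqrt l" by (intro real_le_rsqrt) simp
  have "2 \<odot> z = U \<oplus> star \<A> U" unfolding sU using x z by (simp add: U_def sm_expand sm_collect sm_cancel)
  then have "2 * cnorm \<A> z \<le> cnorm \<A> U + cnorm \<A> (star \<A> U)"
    using cnorm_add[of U "star \<A> U"] U z cnorm_smult[of z 2] by (simp add: star_closed)
  then have "cnorm \<A> z \<le> sqrt l" using \<open>cnorm \<A> U \<le> sqrt l\<close> cnorm_star[OF U] by simp
  then have "(cnorm \<A> z)\<^sup>2 \<le> (sqrt l)\<^sup>2" using cnorm_nonneg[OF z(1)] by (intro power_mono)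
  then have "cnorm \<A> (z \<otimes> z) \<le> l" using cstar_identity[OF z(1)] z l by simp
  moreover have "complex_of_real l \<odot> \<one> \<ominus> x \<otimes> x = z \<otimes> z"
    unfolding lz using x z by (simp add: sm_expand sm_collect sm_cancel)
  ultimately show ?thesis
    unfolding pos_def using x l by (intro conjI exI[of _ l]) (auto simp: star_mult)
qed

text \<open>By commutativity the product is \<open>x\<^sup>2 + y\<^sup>2\<close>, with
  \<open>x\<close> the real part of \<open>a\<close> and \<open>y\<close> its imaginary part up to
  sign.\<close>

lemma pos_star_mult_self:
  assumes a: "a \<in> carrier \<A>" shows "pos (star \<A> a \<otimes> a)"
proof -
  define s where "s = star \<A> a"
  have s: "s \<in> carrier \<A>" "star \<A> s = a" "star \<A> a = s" using a by (simp_all add: s_def star_closed star_star)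
  define x where "x = (1/2) \<odot> (a \<oplus> s)"
  define y where "y = (\<i>/2) \<odot> (a \<oplus> (- 1) \<odot> s)"
  have xy: "x \<in> carrier \<A>" "star \<A> x = x" "y \<in> carrier \<A>" "star \<A> y = y"
    using a s by (simp_all add: x_def y_def star_smult star_add M.a_comm sm_add_right)
  have "star \<A> a \<otimes> a = x \<otimes> x \<oplus> y \<otimes> y"
    unfolding x_def y_def using a s by (simp add: sm_expand sm_collect sm_cancel)
  then show ?thesis using pos_add pos_square xy by simp
qed

text \<open>\<open>\<epsilon> + h\<close> is \<open>L (1 - x)\<close> with
  \<open>L = l + \<epsilon>\<close> and \<open>x\<close> of norm at most \<open>l / L\<close>,
  strictly below 1. So a square root exists, and it is invertible because \<open>1 - x\<close>
  is.\<close>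

lemma pos_sqrt:
  assumes h: "pos h" and e: "\<epsilon> > 0"
  obtains w g where "w \<in> carrier \<A>" "star \<A> w = w" "w \<otimes> w = complex_of_real \<epsilon> \<odot> \<one> \<oplus> h"
    "g \<in> carrier \<A>" "star \<A> g = g" "w \<otimes> g = \<one>"
proof -
  obtain l where hA: "h \<in> carrier \<A>" "star \<A> h = h" and l: "l \<ge> 0" "cnorm \<A> (complex_of_real l \<odot> \<one> \<ominus> h) \<le> l"
    using h by (auto simp: pos_def)
  define L where "L = l + \<epsilon>"
  have L: "L > 0" "l < L" using l e by (auto simp: L_def)
  define x where "x = complex_of_real (1 / L) \<odot> (complex_of_real l \<odot> \<one> \<ominus> h)"
  have x: "x \<in> carrier \<A>" "star \<A> x = x"
    using hA by (simp_all add: x_def star_smult star_minus)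
  have "cnorm \<A> x \<le> l / L"
    using l L hA by (simp add: x_def cnorm_smult norm_divide divide_right_mono)
  also have "\<dots> < 1" using L by simp
  finally have n: "cnorm \<A> x < 1" .
  obtain z where z: "z \<in> carrier \<A>" "star \<A> z = z" "z \<otimes> z = \<one> \<ominus> x" using sqrt_one_minus[OF x n] .
  obtain v where v: "v \<in> carrier \<A>" "(\<one> \<ominus> x) \<otimes> v = \<one>" using inverse_one_minus[OF x(1) n] .
  define w where "w = complex_of_real (sqrt L) \<odot> z"
  define g where "g = complex_of_real (1 / sqrt L) \<odot> (z \<otimes> v)"
  have sq: "complex_of_real (sqrt L) * complex_of_real (sqrt L) = complex_of_real L"
    "complex_of_real (sqrt L) * complex_of_real (1 / sqrt L) = 1"
    "complex_of_real L * complex_of_real (1 / L) = 1"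
    using L by (simp_all flip: of_real_mult)
  have w: "w \<in> carrier \<A>" "star \<A> w = w" using z by (simp_all add: w_def star_smult)
  have "w \<otimes> w = complex_of_real L \<odot> (\<one> \<ominus> x)" using z sq by (simp add: w_def flip: z(3))
  also have "\<dots> = complex_of_real L \<odot> \<one> \<oplus> (- 1) \<odot> (complex_of_real l \<odot> \<one> \<oplus> (- 1) \<odot> h)"
  proof -
    have "complex_of_real L \<odot> x = complex_of_real l \<odot> \<one> \<oplus> (- 1) \<odot> h"
      using hA sq(3) unfolding x_def by (simp add: sm_assoc[symmetric] minus_sm del: sm_assoc of_real_divide) (simp add: mult.assoc[symmetric] del: of_real_divide)
    moreover have "complex_of_real L \<odot> (\<one> \<ominus> x) = complex_of_real L \<odot> \<one> \<oplus> (- 1) \<odot> (complex_of_real L \<odot> x)"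
      using x by (simp add: minus_sm sm_add_right)
    ultimately show ?thesis by simp
  qed
  also have "\<dots> = complex_of_real \<epsilon> \<odot> \<one> \<oplus> h"
    using hA by (simp add: sm_expand sm_collect L_def)
  finally have ww: "w \<otimes> w = complex_of_real \<epsilon> \<odot> \<one> \<oplus> h" .
  have g: "g \<in> carrier \<A>" using z v by (simp add: g_def)
  have "w \<otimes> g = (complex_of_real (sqrt L) * complex_of_real (1 / sqrt L)) \<odot> (z \<otimes> (z \<otimes> v))"
    using z(1) v(1) by (simp add: w_def g_def mult.commute del: of_real_divide)
  also have "\<dots> = z \<otimes> z \<otimes> v" unfolding sq using z(1) v(1) by (simp add: m_assoc)
  also have "\<dots> = \<one>" using v by (simp only: z(3))
  finally have wg: "w \<otimes> g = \<one>" .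
  have "star \<A> g = star \<A> g \<otimes> (w \<otimes> g)" using g wg by (simp add: star_closed)
  also have "\<dots> = star \<A> (w \<otimes> g) \<otimes> g" using g w by (simp add: star_mult star_closed m_assoc)
  also have "\<dots> = g" using g wg by simp
  finally show ?thesis using that[OF w ww g _ wg] by simp
qed

end

section \<open>Linear systems and sums of squares over a commutative C*-algebra\<close>

context cring
begin

text \<open>Ideals; closure under negatives comes from multiplication by
  \<open>\<ominus> \<one>\<close>.\<close>

definition absorbing :: "'a set \<Rightarrow> bool" where
  "absorbing J \<longleftrightarrow> J \<subseteq> carrier R \<and> \<zero> \<in> J \<and> (\<forall>x\<in>J. \<forall>y\<in>J. x \<oplus> y \<in> J) \<and> (\<forall>a\<in>carrier R. \<forall>x\<in>J. a \<otimes> x \<in> J)"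

lemma absorbingD:
  assumes "absorbing J"
  shows "x \<in> J \<Longrightarrow> x \<in> carrier R" "\<zero> \<in> J" "x \<in> J \<Longrightarrow> y \<in> J \<Longrightarrow> x \<oplus> y \<in> J"
    "a \<in> carrier R \<Longrightarrow> x \<in> J \<Longrightarrow> a \<otimes> x \<in> J"
  using assms unfolding absorbing_def by blast+

lemma absorbing_finsum:
  assumes J: "absorbing J" and "finite K" "\<And>k. k \<in> K \<Longrightarrow> f k \<in> J"
  shows "(\<Oplus>k\<in>K. f k) \<in> J"
  using assms(2,3)
proof (induction K rule: finite_induct)
  case (insert k K)
  have "(\<Oplus>k\<in>insert k K. f k) = f k \<oplus> (\<Oplus>k\<in>K. f k)"
    using insert absorbingD(1)[OF J] by (intro finsum_insert) auto
  then show ?case using insert absorbingD(3)[OF J] by simp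
qed (simp add: absorbingD[OF J])

lemma absorbing_colon:
  assumes J: "absorbing J" and m: "m \<in> carrier R" shows "absorbing {a \<in> carrier R. m \<otimes> a \<in> J}"
  unfolding absorbing_def using m absorbingD[OF J] by (auto simp: r_distr m_lcomm)

lemma absorbing_saturation:
  assumes J: "absorbing J" and p: "p \<in> carrier R"
  shows "absorbing {a \<in> carrier R. \<exists>n::nat. p [^] n \<otimes> a \<in> J}"
  unfolding absorbing_def
proof (intro conjI ballI)
  show "\<zero> \<in> {a \<in> carrier R. \<exists>n::nat. p [^] n \<otimes> a \<in> J}" using p absorbingD(2)[OF J] by simp
next
  fix x y assume "x \<in> {a \<in> carrier R. \<exists>n::nat. p [^] n \<otimes> a \<in> J}" "y \<in> {a \<in> carrier R. \<exists>n::nat. p [^] n \<otimes> a \<in> J}"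
  then obtain m n :: nat where *: "x \<in> carrier R" "y \<in> carrier R" "p [^] m \<otimes> x \<in> J" "p [^] n \<otimes> y \<in> J" by auto
  have "p [^] (m + n) \<otimes> (x \<oplus> y) = p [^] n \<otimes> (p [^] m \<otimes> x) \<oplus> p [^] m \<otimes> (p [^] n \<otimes> y)"
    using * p by (simp add: r_distr nat_pow_mult[symmetric] m_ac)
  also have "\<dots> \<in> J"
    using absorbingD(3)[OF J absorbingD(4)[OF J _ *(3)] absorbingD(4)[OF J _ *(4)], of "p [^] n" "p [^] m"] p by simp
  finally show "x \<oplus> y \<in> {a \<in> carrier R. \<exists>n::nat. p [^] n \<otimes> a \<in> J}" using * by auto
next
  fix a x assume a: "a \<in> carrier R" and "x \<in> {a \<in> carrier R. \<exists>n::nat. p [^] n \<otimes> a \<in> J}"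
  then obtain n :: nat where x: "x \<in> carrier R" "p [^] n \<otimes> x \<in> J" by auto
  have "p [^] n \<otimes> (a \<otimes> x) = a \<otimes> (p [^] n \<otimes> x)" using a x p by (simp add: m_lcomm)
  then show "a \<otimes> x \<in> {a \<in> carrier R. \<exists>n::nat. p [^] n \<otimes> a \<in> J}"
    using a x absorbingD(4)[OF J a x(2)] by (auto intro!: exI[of _ n])
qed auto

lemma absorbing_pow_mono:
  assumes J: "absorbing J" and p: "p \<in> carrier R" "x \<in> carrier R" "p [^] m \<otimes> x \<in> J" and le: "m \<le> (n::nat)"
  shows "p [^] n \<otimes> x \<in> J"
proof -
  have "p [^] n \<otimes> x = p [^] (n - m) \<otimes> (p [^] m \<otimes> x)"
    using p le by (simp add: m_assoc[symmetric] nat_pow_mult)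
  then show ?thesis using absorbingD(4)[OF J _ p(3)] p by simp
qed

text \<open>For each \<open>k\<close> in turn, \<open>m\<close> is multiplied by the last power of
  \<open>p k\<close> that keeps it outside \<open>J\<close>. The next power lands in
  \<open>J\<close>, and the relations achieved earlier survive multiplication.\<close>

lemma nilpotent_family_annihilator:
  assumes J: "absorbing J" "\<one> \<notin> J" and "finite K"
    and p: "\<And>k. k \<in> K \<Longrightarrow> p k \<in> carrier R" and nil: "\<And>k. k \<in> K \<Longrightarrow> \<exists>n::nat. p k [^] n \<in> J"
  shows "\<exists>m \<in> carrier R. m \<notin> J \<and> (\<forall>k\<in>K. m \<otimes> p k \<in> J)"
  using assms(3) p nil
proof (induction K rule: finite_induct)
  case empty
  then show ?case using J by (intro bexI[of _ \<one>]) auto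
next
  case (insert k K)
  then obtain m where m: "m \<in> carrier R" "m \<notin> J" "\<And>k. k \<in> K \<Longrightarrow> m \<otimes> p k \<in> J" by auto
  obtain n0 :: nat where "p k [^] n0 \<in> J" using insert.prems(2)[of k] by auto
  then have "m \<otimes> p k [^] n0 \<in> J" using absorbingD(4)[OF J(1) m(1)] by simp
  then have ex: "\<exists>n::nat. m \<otimes> p k [^] n \<in> J" ..
  define n where "n = (LEAST n::nat. m \<otimes> p k [^] n \<in> J)"
  have n: "m \<otimes> p k [^] n \<in> J" unfolding n_def using LeastI_ex[OF ex] .
  have "n \<noteq> 0" using n m by (intro notI) simp
  then obtain n' where n': "n = Suc n'" using not0_implies_Suc by blast
  have "m \<otimes> p k [^] n' \<notin> J" using not_less_Least[of n' "\<lambda>n. m \<otimes> p k [^] n \<in> J"] n' by (simp add: n_def)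
  moreover have "m \<otimes> p k [^] n' \<otimes> p k \<in> J" using n m insert by (simp add: n' m_assoc)
  moreover have "m \<otimes> p k [^] n' \<otimes> p l \<in> J" if "l \<in> K" for l
  proof -
    have "m \<otimes> p k [^] n' \<otimes> p l = p k [^] n' \<otimes> (m \<otimes> p l)" using m insert that by (simp add: m_ac)
    then show ?thesis using absorbingD(4)[OF J(1) _ m(3)[OF that]] insert by simp
  qed
  ultimately show ?case using m insert by (intro bexI[of _ "m \<otimes> p k [^] n'"]) auto
qed

text \<open>A homogeneous linear system with more unknowns than equations has a solution that is
  nontrivial modulo any given proper ideal.\<close>

lemma underdetermined_system:
  assumes "finite C" "absorbing J" "\<one> \<notin> J" "finite K" "card C < card K"
    and "\<And>k c. k \<in> K \<Longrightarrow> c \<in> C \<Longrightarrow> z k c \<in> carrier R"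
  shows "\<exists>a. (\<forall>k\<in>K. a k \<in> carrier R) \<and> (\<exists>k\<in>K. a k \<notin> J) \<and> (\<forall>c\<in>C. (\<Oplus>k\<in>K. a k \<otimes> z k c) \<in> J)"
  using assms
proof (induction C arbitrary: J K z rule: finite_induct)
  case empty
  then have "K \<noteq> {}" by auto
  then show ?case using empty by (intro exI[of _ "\<lambda>_. \<one>"]) auto
next
  case (insert c C)
  note J = insert.prems(1,2) and K = insert.prems(3,4)
  have z: "\<And>k d. k \<in> K \<Longrightarrow> d \<in> insert c C \<Longrightarrow> z k d \<in> carrier R" using insert.prems(5) .
  show ?case
  \<comment> \<open>A pivot that is not nilpotent modulo \<open>J\<close> can be inverted after
    passing to the saturation of \<open>J\<close>, and Gaussian elimination applies. If the whole
    column is nilpotent, some \<open>m\<close> outside \<open>J\<close> kills it, and the colon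
    ideal takes the place of \<open>J\<close>.\<close>
  proof (cases "\<exists>i\<in>K. \<forall>n::nat. z i c [^] n \<notin> J")
    case True
    then obtain i where i: "i \<in> K" "\<And>n::nat. z i c [^] n \<notin> J" by blast
    define p where "p = z i c"
    have p: "p \<in> carrier R" using z i by (simp add: p_def)
    define J' where "J' = {a \<in> carrier R. \<exists>n::nat. p [^] n \<otimes> a \<in> J}"
    have "absorbing J'" unfolding J'_def by (rule absorbing_saturation[OF J(1) p])
    moreover have "\<one> \<notin> J'" using i p by (auto simp: J'_def p_def)
    moreover have "finite (K - {i})" "card C < card (K - {i})" using K insert(1,2) i by auto
    ultimately have "\<exists>a. (\<forall>k\<in>K - {i}. a k \<in> carrier R) \<and> (\<exists>k\<in>K - {i}. a k \<notin> J') \<and>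
        (\<forall>d\<in>C. (\<Oplus>k\<in>K - {i}. a k \<otimes> (p \<otimes> z k d \<oplus> (\<ominus> z k c) \<otimes> z i d)) \<in> J')"
      using z i p by (intro insert.IH) auto
    then obtain a where a: "\<And>k. k \<in> K - {i} \<Longrightarrow> a k \<in> carrier R"
      and nz: "\<exists>k\<in>K - {i}. a k \<notin> J'"
      and sm: "\<And>d. d \<in> C \<Longrightarrow> (\<Oplus>k\<in>K - {i}. a k \<otimes> (p \<otimes> z k d \<oplus> (\<ominus> z k c) \<otimes> z i d)) \<in> J'"
      by blast
    define s where "s = (\<lambda>d. \<Oplus>k\<in>K - {i}. a k \<otimes> (p \<otimes> z k d \<oplus> (\<ominus> z k c) \<otimes> z i d))"
    \<comment> \<open>One exponent for all equations leads back from the saturation to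
      \<open>J\<close>.\<close>
    have "\<exists>n::nat. \<forall>d\<in>C. p [^] n \<otimes> s d \<in> J"
    proof -
      have "\<forall>d\<in>C. \<exists>n::nat. p [^] n \<otimes> s d \<in> J" using sm by (auto simp: J'_def s_def)
      then obtain n :: "_ \<Rightarrow> nat" where n: "\<And>d. d \<in> C \<Longrightarrow> p [^] n d \<otimes> s d \<in> J" by metis
      have "n d \<le> sum n C" if "d \<in> C" for d using insert(1) that by (simp add: member_le_sum)
      then show ?thesis using absorbing_pow_mono[OF J(1) p _ n] sm by (auto simp: s_def J'_def intro!: exI[of _ "sum n C"])
    qed
    then obtain n :: nat where n: "\<And>d. d \<in> C \<Longrightarrow> p [^] n \<otimes> s d \<in> J" by blast
    define S where "S = (\<Oplus>k\<in>K - {i}. a k \<otimes> \<ominus> z k c)"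
    have S: "S \<in> carrier R" unfolding S_def using a z by (intro finsum_closed) auto
    \<comment> \<open>The unknown \<open>i\<close> is chosen such that equation \<open>c\<close>
      holds exactly; the other unknowns get a factor \<open>p\<close> in place of a division by the
      pivot.\<close>
    define b where "b = (\<lambda>k. if k = i then p [^] n \<otimes> S else p [^] n \<otimes> (a k \<otimes> p))"
    have b: "b k \<in> carrier R" if "k \<in> K" for k using that S a p by (auto simp: b_def)
    have sb: "(\<Oplus>k\<in>K. b k \<otimes> z k d) = p [^] n \<otimes> s d" if d: "d \<in> insert c C" for d
    proof -
      have "(\<Oplus>k\<in>K. b k \<otimes> z k d) = (\<Oplus>k\<in>insert i (K - {i}). b k \<otimes> z k d)" using i by (simp add: insert_absorb)
      also have "\<dots> = b i \<otimes> z i d \<oplus> (\<Oplus>k\<in>K - {i}. b k \<otimes> z k d)"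
        using K b z d i by (intro finsum_insert) auto
      also have "(\<Oplus>k\<in>K - {i}. b k \<otimes> z k d) = (\<Oplus>k\<in>K - {i}. p [^] n \<otimes> (a k \<otimes> (p \<otimes> z k d)))"
        using a z d p by (intro finsum_cong') (auto simp: b_def m_assoc)
      also have "\<dots> = p [^] n \<otimes> (\<Oplus>k\<in>K - {i}. a k \<otimes> (p \<otimes> z k d))"
        using a z d p K by (intro finsum_rdistr[symmetric]) auto
      also have "b i \<otimes> z i d = p [^] n \<otimes> (\<Oplus>k\<in>K - {i}. (a k \<otimes> \<ominus> z k c) \<otimes> z i d)"
        using a z d p K i S by (simp add: b_def m_assoc, subst S_def, subst finsum_ldistr) (auto simp: m_assoc)
      also have "\<dots> \<oplus> p [^] n \<otimes> (\<Oplus>k\<in>K - {i}. a k \<otimes> (p \<otimes> z k d)) =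
          p [^] n \<otimes> ((\<Oplus>k\<in>K - {i}. (a k \<otimes> \<ominus> z k c) \<otimes> z i d) \<oplus> (\<Oplus>k\<in>K - {i}. a k \<otimes> (p \<otimes> z k d)))"
        using a z d p i by (intro r_distr[symmetric] finsum_closed) auto
      also have "(\<Oplus>k\<in>K - {i}. (a k \<otimes> \<ominus> z k c) \<otimes> z i d) \<oplus> (\<Oplus>k\<in>K - {i}. a k \<otimes> (p \<otimes> z k d)) =
          (\<Oplus>k\<in>K - {i}. (a k \<otimes> \<ominus> z k c) \<otimes> z i d \<oplus> a k \<otimes> (p \<otimes> z k d))"
        using a z d p i by (intro finsum_addf[symmetric]) auto
      also have "\<dots> = s d"
        unfolding s_def using a z d p i
        by (intro finsum_cong') (auto simp: r_distr m_assoc a_comm)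
      finally show ?thesis .
    qed
    have "s c = (\<Oplus>k\<in>K - {i}. \<zero>)"
      unfolding s_def using a z p i
    proof (intro finsum_cong')
      fix k assume k: "k \<in> K - {i}"
      then have "z k c \<in> carrier R" using z by auto
      then have "p \<otimes> z k c \<oplus> (\<ominus> z k c) \<otimes> z i c = \<zero>"
        using p by (simp add: p_def[symmetric] l_minus m_comm[of "z k c" p] r_neg)
      then show "a k \<otimes> (p \<otimes> z k c \<oplus> \<ominus> z k c \<otimes> z i c) = \<zero>" using a[OF k] by simp
    qed auto
    then have "s c = \<zero>" by simp
    then have "(\<Oplus>k\<in>K. b k \<otimes> z k d) \<in> J" if "d \<in> insert c C" for d
      using that sb n absorbingD(2)[OF J(1)] p by auto
    moreover have "\<exists>k\<in>K. b k \<notin> J"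
    proof -
      from nz obtain k where k: "k \<in> K - {i}" "a k \<notin> J'" by blast
      have "b k = p [^] Suc n \<otimes> a k" using k a[OF k(1)] p by (simp add: b_def m_ac)
      then have "b k \<notin> J" using k a[OF k(1)] unfolding J'_def by (metis (mono_tags, lifting) mem_Collect_eq)
      then show ?thesis using k by blast
    qed
    ultimately show ?thesis using b by blast
  next
    case False
    then obtain m where m: "m \<in> carrier R" "m \<notin> J" "\<And>k. k \<in> K \<Longrightarrow> m \<otimes> z k c \<in> J"
      using nilpotent_family_annihilator[OF J K(1), of "\<lambda>k. z k c"] z by auto
    define J' where "J' = {a \<in> carrier R. m \<otimes> a \<in> J}"
    have "absorbing J'" unfolding J'_def by (rule absorbing_colon[OF J(1) m(1)])
    moreover have "\<one> \<notin> J'" using m by (simp add: J'_def)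
    moreover have "card C < card K" using K insert(1,2) by simp
    ultimately have "\<exists>a. (\<forall>k\<in>K. a k \<in> carrier R) \<and> (\<exists>k\<in>K. a k \<notin> J') \<and> (\<forall>d\<in>C. (\<Oplus>k\<in>K. a k \<otimes> z k d) \<in> J')"
      using z K by (intro insert.IH) auto
    then obtain a where a: "\<And>k. k \<in> K \<Longrightarrow> a k \<in> carrier R" and nz: "\<exists>k\<in>K. a k \<notin> J'"
      and sm: "\<And>d. d \<in> C \<Longrightarrow> (\<Oplus>k\<in>K. a k \<otimes> z k d) \<in> J'"
      by blast
    have eq: "(\<Oplus>k\<in>K. (m \<otimes> a k) \<otimes> z k d) = m \<otimes> (\<Oplus>k\<in>K. a k \<otimes> z k d)" if "d \<in> insert c C" for d
    proof -
      have "(\<Oplus>k\<in>K. (m \<otimes> a k) \<otimes> z k d) = (\<Oplus>k\<in>K. m \<otimes> (a k \<otimes> z k d))"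
        using a z m that by (intro finsum_cong') (auto simp: m_assoc)
      then show ?thesis using a z m that K by (simp add: finsum_rdistr Pi_def)
    qed
    have "(\<Oplus>k\<in>K. (m \<otimes> a k) \<otimes> z k d) \<in> J" if "d \<in> insert c C" for d
    proof (cases "d = c")
      case True
      have "(m \<otimes> a k) \<otimes> z k c \<in> J" if "k \<in> K" for k
      proof -
        have "(m \<otimes> a k) \<otimes> z k c = a k \<otimes> (m \<otimes> z k c)" using a z m that by (simp add: m_ac)
        then show ?thesis using absorbingD(4)[OF J(1) a[OF that] m(3)[OF that]] by simp
      qed
      then show ?thesis unfolding True by (intro absorbing_finsum J K)
    next
      case False
      then show ?thesis using eq[OF that] sm[of d] that by (simp add: J'_def)
    qed
    then show ?thesis using a m nz by (intro exI[of _ "\<lambda>k. m \<otimes> a k"]) (auto simp: J'_def)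
  qed
qed

end

section \<open>Gram factorisation of sums of squares\<close>

context commutative_cstar_algebra
begin

text \<open>The number of rows is not bounded, so sums stay in this class without any square root.
  Keeping the rows in a list supports induction row by row.\<close>

definition sos :: "'i set \<Rightarrow> ('i \<Rightarrow> 'i \<Rightarrow> 'a) \<Rightarrow> bool" where
  "sos I h \<longleftrightarrow> (\<exists>rs. (\<forall>r\<in>set rs. \<forall>i\<in>I. r i \<in> carrier \<A>) \<and>
     (\<forall>i\<in>I. \<forall>j\<in>I. h i j = foldr (\<lambda>r s. star \<A> (r i) \<otimes> r j \<oplus> s) rs \<zero>))"

lemma foldr_rows_closed:
  "(\<And>r. r \<in> set rs \<Longrightarrow> r i \<in> carrier \<A> \<and> r j \<in> carrier \<A>) \<Longrightarrow>
    foldr (\<lambda>r s. star \<A> (r i) \<otimes> r j \<oplus> s) rs \<zero> \<in> carrier \<A>"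
  by (induction rs) (auto simp: star_closed)

lemma sos_closed: "sos I h \<Longrightarrow> i \<in> I \<Longrightarrow> j \<in> I \<Longrightarrow> h i j \<in> carrier \<A>"
proof -
  assume "sos I h" and ij: "i \<in> I" "j \<in> I"
  then obtain rs where rs: "\<forall>r\<in>set rs. \<forall>i\<in>I. r i \<in> carrier \<A>"
    "h i j = foldr (\<lambda>r s. star \<A> (r i) \<otimes> r j \<oplus> s) rs \<zero>"
    unfolding sos_def by blast
  from rs(1) ij show ?thesis unfolding rs(2) by (intro foldr_rows_closed) blast
qed

lemma sos_zero: "(\<And>i j. i \<in> I \<Longrightarrow> j \<in> I \<Longrightarrow> h i j = \<zero>) \<Longrightarrow> sos I h"
  unfolding sos_def by (intro exI[of _ "[]"]) auto

lemma sos_row: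
  assumes "sos I h" "\<And>i. i \<in> I \<Longrightarrow> r i \<in> carrier \<A>"
    "\<And>i j. i \<in> I \<Longrightarrow> j \<in> I \<Longrightarrow> k i j = star \<A> (r i) \<otimes> r j \<oplus> h i j"
  shows "sos I k"
proof -
  obtain rs where "\<forall>r\<in>set rs. \<forall>i\<in>I. r i \<in> carrier \<A>"
    "\<forall>i\<in>I. \<forall>j\<in>I. h i j = foldr (\<lambda>r s. star \<A> (r i) \<otimes> r j \<oplus> s) rs \<zero>"
    using assms(1) unfolding sos_def by blast
  then show ?thesis unfolding sos_def using assms(2,3) by (intro exI[of _ "r # rs"]) auto
qed

lemma sos_induct [consumes 1, case_names zero row]:
  assumes "sos I h"
    and zero: "\<And>h. (\<And>i j. i \<in> I \<Longrightarrow> j \<in> I \<Longrightarrow> h i j = \<zero>) \<Longrightarrow> P h"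
    and row: "\<And>h r k. sos I h \<Longrightarrow> P h \<Longrightarrow> (\<And>i. i \<in> I \<Longrightarrow> r i \<in> carrier \<A>) \<Longrightarrow>
      (\<And>i j. i \<in> I \<Longrightarrow> j \<in> I \<Longrightarrow> k i j = star \<A> (r i) \<otimes> r j \<oplus> h i j) \<Longrightarrow> P k"
  shows "P h"
proof -
  obtain rs where "\<forall>r\<in>set rs. \<forall>i\<in>I. r i \<in> carrier \<A>"
    "\<forall>i\<in>I. \<forall>j\<in>I. h i j = foldr (\<lambda>r s. star \<A> (r i) \<otimes> r j \<oplus> s) rs \<zero>"
    using assms(1) unfolding sos_def by blast
  then show ?thesis
  proof (induction rs arbitrary: h)
    case Nil
    then show ?case by (intro zero) simp
  next
    case (Cons r rs)
    let ?g = "\<lambda>i j. foldr (\<lambda>r s. star \<A> (r i) \<otimes> r j \<oplus> s) rs \<zero>"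
    have "P ?g" using Cons.prems(1) by (intro Cons.IH) simp_all
    moreover have "sos I ?g" unfolding sos_def using Cons.prems(1) by (intro exI[of _ rs]) simp
    ultimately show ?case using Cons.prems by (intro row[of ?g r h]) simp_all
  qed
qed

lemma sos_cong: "sos I h \<Longrightarrow> (\<And>i j. i \<in> I \<Longrightarrow> j \<in> I \<Longrightarrow> h i j = k i j) \<Longrightarrow> sos I k"
  unfolding sos_def by simp

lemma sos_add: "sos I h \<Longrightarrow> sos I k \<Longrightarrow> sos I (\<lambda>i j. h i j \<oplus> k i j)"
proof (induction rule: sos_induct)
  case (zero h)
  from zero(2) show ?case by (rule sos_cong) (auto simp: zero(1) sos_closed[OF zero(2)])
next
  case (row h r g)
  have sh: "sos I h" and sk: "sos I k" by fact+
  have r: "\<And>i. i \<in> I \<Longrightarrow> r i \<in> carrier \<A>"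
    and g: "\<And>i j. i \<in> I \<Longrightarrow> j \<in> I \<Longrightarrow> g i j = star \<A> (r i) \<otimes> r j \<oplus> h i j" by fact+
  have "sos I (\<lambda>i j. h i j \<oplus> k i j)" using sk by fact
  then show ?case
  proof (rule sos_row[where r = r])
    fix i j assume ij: "i \<in> I" "j \<in> I"
    have c: "star \<A> (r i) \<otimes> r j \<in> carrier \<A>" using r ij by (simp add: star_closed)
    show "g i j \<oplus> k i j = star \<A> (r i) \<otimes> r j \<oplus> (h i j \<oplus> k i j)"
      unfolding g[OF ij] by (rule M.a_assoc[OF c sos_closed[OF sh ij] sos_closed[OF sk ij]])
  qed (rule r)
qed

text \<open>When \<open>a'\<close> is the adjoint of \<open>a\<close>, this says that the rotation
  with rows \<open>(y, a')\<close> and \<open>(- a, y)\<close> preserves sums of squares up to the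
  factor \<open>y\<^sup>2 + a' a\<close>. The mixed terms \<open>B\<close> and \<open>C\<close>
  cancel.\<close>

lemma givens_identity:
  assumes A: "y \<in> carrier \<A>" "a \<in> carrier \<A>" "a' \<in> carrier \<A>" "p \<in> carrier \<A>" "q \<in> carrier \<A>"
    "r \<in> carrier \<A>" "s \<in> carrier \<A>"
  shows "(y \<otimes> p \<oplus> a \<otimes> r) \<otimes> (y \<otimes> q \<oplus> a' \<otimes> s) \<oplus> (y \<otimes> r \<oplus> (- 1) \<odot> (a' \<otimes> p)) \<otimes> (y \<otimes> s \<oplus> (- 1) \<odot> (a \<otimes> q)) =
    (y \<otimes> y \<oplus> a' \<otimes> a) \<otimes> (p \<otimes> q \<oplus> r \<otimes> s)"
proof -
  define B where "B = y \<otimes> p \<otimes> (a' \<otimes> s)"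
  define C where "C = a \<otimes> r \<otimes> (y \<otimes> q)"
  have BC: "B \<in> carrier \<A>" "C \<in> carrier \<A>" using A by (simp_all add: B_def C_def)
  have cancel: "(u \<oplus> b) \<oplus> (v \<oplus> (- 1) \<odot> b) = u \<oplus> v" if "u \<in> carrier \<A>" "v \<in> carrier \<A>" "b \<in> carrier \<A>" for u v b
  proof -
    have "(u \<oplus> b) \<oplus> (v \<oplus> (- 1) \<odot> b) = (u \<oplus> v) \<oplus> (b \<oplus> (- 1) \<odot> b)" using that by (simp add: M.a_ac)
    then show ?thesis using that by (simp add: sm_collect)
  qed
  have "(y \<otimes> p \<oplus> a \<otimes> r) \<otimes> (y \<otimes> q \<oplus> a' \<otimes> s) = ((y \<otimes> p \<otimes> (y \<otimes> q) \<oplus> a \<otimes> r \<otimes> (a' \<otimes> s)) \<oplus> B) \<oplus> C"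
    using A by (simp add: B_def C_def l_distr r_distr M.a_ac)
  moreover have "(y \<otimes> r \<oplus> (- 1) \<odot> (a' \<otimes> p)) \<otimes> (y \<otimes> s \<oplus> (- 1) \<odot> (a \<otimes> q)) =
      ((y \<otimes> r \<otimes> (y \<otimes> s) \<oplus> a' \<otimes> p \<otimes> (a \<otimes> q)) \<oplus> (- 1) \<odot> B) \<oplus> (- 1) \<odot> C"
    using A by (simp add: B_def C_def l_distr r_distr M.a_ac m_ac)
  moreover have "(y \<otimes> y \<oplus> a' \<otimes> a) \<otimes> (p \<otimes> q \<oplus> r \<otimes> s) =
      (y \<otimes> p \<otimes> (y \<otimes> q) \<oplus> a \<otimes> r \<otimes> (a' \<otimes> s)) \<oplus> (y \<otimes> r \<otimes> (y \<otimes> s) \<oplus> a' \<otimes> p \<otimes> (a \<otimes> q))"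
    using A by (simp add: l_distr r_distr M.a_ac m_ac)
  ultimately show ?thesis using A BC by (simp add: cancel)
qed

text \<open>A sequence of Givens rotations absorbs one more row into a triangular factor.\<close>

primrec triangular_factor :: "real \<Rightarrow> 'i set \<Rightarrow> 'i list \<Rightarrow> ('i \<Rightarrow> 'i \<Rightarrow> 'a) \<Rightarrow> bool" where
  "triangular_factor \<epsilon> I [] Y \<longleftrightarrow> True"
| "triangular_factor \<epsilon> I (l # ls) Y \<longleftrightarrow> (\<forall>i\<in>I. Y l i \<in> carrier \<A>) \<and> star \<A> (Y l l) = Y l l \<and>
     (\<exists>h. pos h \<and> Y l l \<otimes> Y l l = complex_of_real \<epsilon> \<odot> \<one> \<oplus> h) \<and> (\<forall>i\<in>I - set (l # ls). Y l i = \<zero>) \<and>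
     triangular_factor \<epsilon> I ls Y"

lemma triangular_factor_closed:
  "triangular_factor \<epsilon> I ls Y \<Longrightarrow> l \<in> set ls \<Longrightarrow> i \<in> I \<Longrightarrow> Y l i \<in> carrier \<A>"
  by (induction ls) auto

lemma triangular_factor_cong:
  "(\<And>l. l \<in> set ls \<Longrightarrow> Y l = Y' l) \<Longrightarrow> triangular_factor \<epsilon> I ls Y \<longleftrightarrow> triangular_factor \<epsilon> I ls Y'"
  by (induction ls) auto

text \<open>Rotating the pivot row against \<open>r\<close> clears the entry \<open>r l\<close>, and
  the new pivot is a square root of \<open>y\<^sup>2 + star a a\<close>. Since every squared pivot
  has the form \<open>\<epsilon> + h\<close> with \<open>h\<close> positive, this root exists and is
  invertible. The remainder \<open>r'\<close> goes on to the next pivot.\<close>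

lemma givens_update:
  assumes I: "finite I" and e: "\<epsilon> > 0" and "distinct ls" "set ls \<subseteq> I" "triangular_factor \<epsilon> I ls Y"
    and "\<And>i. i \<in> I \<Longrightarrow> r i \<in> carrier \<A>" "\<And>i. i \<in> I - set ls \<Longrightarrow> r i = \<zero>"
  shows "\<exists>Y'. triangular_factor \<epsilon> I ls Y' \<and> (\<forall>i\<in>I. \<forall>j\<in>I. (\<Oplus>l\<in>set ls. star \<A> (Y' l i) \<otimes> Y' l j) =
    (\<Oplus>l\<in>set ls. star \<A> (Y l i) \<otimes> Y l j) \<oplus> star \<A> (r i) \<otimes> r j)"
  using assms(3-)
proof (induction ls arbitrary: Y r)
  case Nil
  then show ?case by (intro exI[of _ Y]) auto
next
  case (Cons l ls)
  have r: "r i \<in> carrier \<A>" if "i \<in> I" for i using Cons.prems(4)[OF that] .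
  have l: "l \<in> I" "l \<notin> set ls" "set ls \<subseteq> I" using Cons.prems by auto
  note T = Cons.prems(3)[unfolded triangular_factor.simps]
  have Yl: "Y l i \<in> carrier \<A>" if "i \<in> I" for i using T that by blast
  define y where "y = Y l l"
  define a where "a = r l"
  obtain h where h: "pos h" "y \<otimes> y = complex_of_real \<epsilon> \<odot> \<one> \<oplus> h" and y: "star \<A> y = y" "y \<in> carrier \<A>"
    using T l by (auto simp: y_def)
  have a: "a \<in> carrier \<A>" "star \<A> a \<in> carrier \<A>" using r l by (auto simp: a_def star_closed)
  have h': "pos (h \<oplus> star \<A> a \<otimes> a)" by (intro pos_add h pos_star_mult_self a)
  have hA: "h \<in> carrier \<A>" using h by (simp add: pos_def)
  obtain w g where w: "w \<in> carrier \<A>" "star \<A> w = w" "w \<otimes> w = complex_of_real \<epsilon> \<odot> \<one> \<oplus> (h \<oplus> star \<A> a \<otimes> a)"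
    and g: "g \<in> carrier \<A>" "star \<A> g = g" "w \<otimes> g = \<one>"
    using pos_sqrt[OF h' e] by metis
  have ww: "w \<otimes> w = y \<otimes> y \<oplus> star \<A> a \<otimes> a" using w h hA a by (simp add: M.a_assoc)
  have ggww: "g \<otimes> g \<otimes> (w \<otimes> w \<otimes> x) = x" if "x \<in> carrier \<A>" for x
  proof -
    have "g \<otimes> g \<otimes> (w \<otimes> w \<otimes> x) = (w \<otimes> g) \<otimes> ((w \<otimes> g) \<otimes> x)" using g(1) w(1) that by (simp add: m_ac)
    then show ?thesis using g that by simp
  qed
  define u where "u = (\<lambda>i. g \<otimes> (y \<otimes> Y l i \<oplus> star \<A> a \<otimes> r i))"
  define r' where "r' = (\<lambda>i. g \<otimes> (y \<otimes> r i \<oplus> (- 1) \<odot> (a \<otimes> Y l i)))"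
  have cl: "u i \<in> carrier \<A>" "r' i \<in> carrier \<A>" if "i \<in> I" for i
    using that g y a r Yl by (simp_all add: u_def r'_def)
  have two: "star \<A> (u i) \<otimes> u j \<oplus> star \<A> (r' i) \<otimes> r' j = star \<A> (Y l i) \<otimes> Y l j \<oplus> star \<A> (r i) \<otimes> r j"
    if "i \<in> I" "j \<in> I" for i j
  proof -
    note c = that[THEN r] that[THEN Yl] that[THEN r, THEN star_closed] that[THEN Yl, THEN star_closed]
    have "star \<A> (u i) \<otimes> u j \<oplus> star \<A> (r' i) \<otimes> r' j =
      g \<otimes> g \<otimes> ((y \<otimes> star \<A> (Y l i) \<oplus> a \<otimes> star \<A> (r i)) \<otimes> (y \<otimes> Y l j \<oplus> star \<A> a \<otimes> r j) \<oplus>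
        (y \<otimes> star \<A> (r i) \<oplus> (- 1) \<odot> (star \<A> a \<otimes> star \<A> (Y l i))) \<otimes> (y \<otimes> r j \<oplus> (- 1) \<odot> (a \<otimes> Y l j)))"
    proof -
      have su: "star \<A> (u i) = g \<otimes> (y \<otimes> star \<A> (Y l i) \<oplus> a \<otimes> star \<A> (r i))"
        unfolding u_def using c g(1,2) y a by (simp add: star_mult star_add star_star m_comm)
      have sr: "star \<A> (r' i) = g \<otimes> (y \<otimes> star \<A> (r i) \<oplus> (- 1) \<odot> (star \<A> a \<otimes> star \<A> (Y l i)))"
        unfolding r'_def using c g(1,2) y a by (simp add: star_mult star_add star_smult star_star m_comm)
      have gg: "(g \<otimes> v) \<otimes> (g \<otimes> v') \<oplus> (g \<otimes> t) \<otimes> (g \<otimes> t') = g \<otimes> g \<otimes> (v \<otimes> v' \<oplus> t \<otimes> t')"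
        if "v \<in> carrier \<A>" "v' \<in> carrier \<A>" "t \<in> carrier \<A>" "t' \<in> carrier \<A>" for v v' t t'
        using g(1) that by (simp add: r_distr m_ac)
      show ?thesis unfolding su sr unfolding u_def r'_def using c y a by (intro gg) auto
    qed
    also have "\<dots> = g \<otimes> g \<otimes> (w \<otimes> w \<otimes> (star \<A> (Y l i) \<otimes> Y l j \<oplus> star \<A> (r i) \<otimes> r j))"
      unfolding ww using c y a by (subst givens_identity) auto
    also have "\<dots> = star \<A> (Y l i) \<otimes> Y l j \<oplus> star \<A> (r i) \<otimes> r j" using c by (intro ggww) auto
    finally show ?thesis .
  qed
  have "r' i = \<zero>" if i: "i \<in> I - set ls" for i
  proof (cases "i = l")
    case True
    then show ?thesis using y a g by (simp add: r'_def y_def[symmetric] a_def[symmetric] m_comm sm_collect)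
  next
    case False
    then have "r i = \<zero>" "Y l i = \<zero>" using i Cons.prems(5)[of i] T by auto
    then show ?thesis using y a g by (simp add: r'_def)
  qed
  then obtain Y' where Y': "triangular_factor \<epsilon> I ls Y'"
    "\<And>i j. i \<in> I \<Longrightarrow> j \<in> I \<Longrightarrow> (\<Oplus>l\<in>set ls. star \<A> (Y' l i) \<otimes> Y' l j) =
      (\<Oplus>l\<in>set ls. star \<A> (Y l i) \<otimes> Y l j) \<oplus> star \<A> (r' i) \<otimes> r' j"
    using Cons.IH[of Y r'] Cons.prems T cl(2) by auto
  define Z where "Z = (\<lambda>k. if k = l then u else Y' k)"
  have "triangular_factor \<epsilon> I ls Z"
  proof -
    have eq: "Y' k = Z k" if "k \<in> set ls" for k using l that by (auto simp: Z_def)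
    show ?thesis using Y'(1) triangular_factor_cong[of ls Y' Z, OF eq] by blast
  qed
  moreover have "u l = w"
  proof -
    have "u l = g \<otimes> (w \<otimes> w)" by (simp add: u_def ww y_def a_def)
    also have "\<dots> = (w \<otimes> g) \<otimes> w" using g(1) w(1) by (simp add: m_ac)
    finally show ?thesis using g w by simp
  qed
  moreover have "u i = \<zero>" if "i \<in> I - set (l # ls)" for i
    using that Cons.prems(5)[of i] T y a g by (auto simp: u_def)
  ultimately have "triangular_factor \<epsilon> I (l # ls) Z"
    unfolding triangular_factor.simps using cl w h' by (auto simp: Z_def)
  moreover have "(\<Oplus>k\<in>set (l # ls). star \<A> (Z k i) \<otimes> Z k j) =
      (\<Oplus>k\<in>set (l # ls). star \<A> (Y k i) \<otimes> Y k j) \<oplus> star \<A> (r i) \<otimes> r j" if ij: "i \<in> I" "j \<in> I" for i j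
  proof -
    have "triangular_factor \<epsilon> I ls Y" using T by blast
    note YA = triangular_factor_closed[OF this] and Y'A = triangular_factor_closed[OF Y'(1)]
    define s where "s = (\<Oplus>k\<in>set ls. star \<A> (Y k i) \<otimes> Y k j)"
    have s: "s \<in> carrier \<A>" unfolding s_def using YA ij by (intro M.finsum_closed) (auto simp: star_closed)
    have "(\<Oplus>k\<in>set (l # ls). star \<A> (Z k i) \<otimes> Z k j) =
        star \<A> (Z l i) \<otimes> Z l j \<oplus> (\<Oplus>k\<in>set ls. star \<A> (Z k i) \<otimes> Z k j)"
      using l cl ij Y'A by (simp, intro M.finsum_insert) (auto simp: Z_def star_closed)
    also have "(\<Oplus>k\<in>set ls. star \<A> (Z k i) \<otimes> Z k j) = (\<Oplus>k\<in>set ls. star \<A> (Y' k i) \<otimes> Y' k j)"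
      using l Y'A ij by (intro M.finsum_cong') (auto simp: Z_def star_closed)
    also have "star \<A> (Z l i) \<otimes> Z l j \<oplus> \<dots> = s \<oplus> (star \<A> (u i) \<otimes> u j \<oplus> star \<A> (r' i) \<otimes> r' j)"
      using Y'(2)[OF ij] s cl ij by (simp add: Z_def s_def[symmetric] star_closed M.a_ac)
    also have "\<dots> = (star \<A> (Y l i) \<otimes> Y l j \<oplus> s) \<oplus> star \<A> (r i) \<otimes> r j"
      unfolding two[OF ij] using s ij r Yl by (simp add: star_closed M.a_ac)
    also have "star \<A> (Y l i) \<otimes> Y l j \<oplus> s = (\<Oplus>k\<in>set (l # ls). star \<A> (Y k i) \<otimes> Y k j)"
      unfolding s_def using l Yl ij YA by (simp, intro M.finsum_insert[symmetric]) (auto simp: star_closed)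
    finally show ?thesis .
  qed
  ultimately show ?case by blast
qed

text \<open>Starting from \<open>sqrt \<epsilon>\<close> times the identity, the rows of the sum are
  absorbed one at a time. The factor stays square, as a positive element of a matrix algebra
  requires.\<close>

theorem sos_plus_epsilon_gram:
  fixes I :: "'i set"
  assumes I: "finite I" and e: "\<epsilon> > 0" and h: "sos I h"
  shows "\<exists>Y. (\<forall>l\<in>I. \<forall>i\<in>I. Y l i \<in> carrier \<A>) \<and>
    (\<forall>i\<in>I. \<forall>j\<in>I. (\<Oplus>l\<in>I. star \<A> (Y l i) \<otimes> Y l j) = h i j \<oplus> (if i = j then complex_of_real \<epsilon> \<odot> \<one> else \<zero>))"
proof -
  obtain ls where ls: "set ls = I" "distinct ls" using finite_distinct_list[OF I] by blast
  have "\<exists>Y. triangular_factor \<epsilon> I ls Y \<and>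
    (\<forall>i\<in>I. \<forall>j\<in>I. (\<Oplus>l\<in>I. star \<A> (Y l i) \<otimes> Y l j) = h i j \<oplus> (if i = j then complex_of_real \<epsilon> \<odot> \<one> else \<zero>))"
    using h
  proof (induction rule: sos_induct)
    case (zero h)
    define Y :: "'i \<Rightarrow> 'i \<Rightarrow> 'a" where "Y = (\<lambda>l i. if i = l then complex_of_real (sqrt \<epsilon>) \<odot> \<one> else \<zero>)"
    have sq: "complex_of_real (sqrt \<epsilon>) * complex_of_real (sqrt \<epsilon>) = complex_of_real \<epsilon>"
      using e by (simp flip: of_real_mult)
    have "triangular_factor \<epsilon> I ls' Y" for ls'
      by (induction ls') (auto simp: Y_def star_smult sq pos_zero intro!: exI[of _ \<zero>])
    moreover have "(\<Oplus>l\<in>I. star \<A> (Y l i) \<otimes> Y l j) = h i j \<oplus> (if i = j then complex_of_real \<epsilon> \<odot> \<one> else \<zero>)"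
      if ij: "i \<in> I" "j \<in> I" for i j
    proof -
      have "(\<Oplus>l\<in>I. star \<A> (Y l i) \<otimes> Y l j) = (\<Oplus>l\<in>I. if i = l then (if i = j then complex_of_real \<epsilon> \<odot> \<one> else \<zero>) else \<zero>)"
        by (intro M.finsum_cong') (auto simp: Y_def star_smult sq)
      also have "\<dots> = (if i = j then complex_of_real \<epsilon> \<odot> \<one> else \<zero>)"
        using I ij by (intro M.finsum_singleton) auto
      finally show ?thesis using zero[OF ij] by simp
    qed
    ultimately show ?case by blast
  next
    case (row h r k)
    have sh: "sos I h" by fact
    have r: "\<And>i. i \<in> I \<Longrightarrow> r i \<in> carrier \<A>"
      and k: "\<And>i j. i \<in> I \<Longrightarrow> j \<in> I \<Longrightarrow> k i j = star \<A> (r i) \<otimes> r j \<oplus> h i j" by fact+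
    from row.IH obtain Y where Y: "triangular_factor \<epsilon> I ls Y"
      "\<And>i j. i \<in> I \<Longrightarrow> j \<in> I \<Longrightarrow> (\<Oplus>l\<in>I. star \<A> (Y l i) \<otimes> Y l j) = h i j \<oplus> (if i = j then complex_of_real \<epsilon> \<odot> \<one> else \<zero>)"
      by blast
    obtain Y' where Y': "triangular_factor \<epsilon> I ls Y'"
      "\<And>i j. i \<in> I \<Longrightarrow> j \<in> I \<Longrightarrow> (\<Oplus>l\<in>I. star \<A> (Y' l i) \<otimes> Y' l j) =
        (\<Oplus>l\<in>I. star \<A> (Y l i) \<otimes> Y l j) \<oplus> star \<A> (r i) \<otimes> r j"
      using givens_update[OF I e ls(2) _ Y(1), of r] r ls(1) by auto
    have "(\<Oplus>l\<in>I. star \<A> (Y' l i) \<otimes> Y' l j) = k i j \<oplus> (if i = j then complex_of_real \<epsilon> \<odot> \<one> else \<zero>)"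
      if ij: "i \<in> I" "j \<in> I" for i j
    proof -
      have c: "h i j \<in> carrier \<A>" "star \<A> (r i) \<in> carrier \<A>" "r j \<in> carrier \<A>"
        using r ij sos_closed[OF sh ij] star_closed by blast+
      show ?thesis unfolding Y'(2)[OF ij] Y(2)[OF ij] k[OF ij] using c by (simp add: M.a_ac)
    qed
    then show ?case using Y' by blast
  qed
  then obtain Y where Y: "triangular_factor \<epsilon> I ls Y"
    "\<forall>i\<in>I. \<forall>j\<in>I. (\<Oplus>l\<in>I. star \<A> (Y l i) \<otimes> Y l j) = h i j \<oplus> (if i = j then complex_of_real \<epsilon> \<odot> \<one> else \<zero>)"
    by blast
  then show ?thesis using triangular_factor_closed[OF Y(1)] ls(1) by (intro exI[of _ Y]) simp
qed

end

section \<open>Minimal operator systems\<close>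

lemma psd_matrix_iff:
  "psd_matrix s A \<longleftrightarrow> A \<in> carrier_mat s s \<and> psd {0..<s} (\<lambda>i j. A $$ (i, j))"
proof (cases "A \<in> carrier_mat s s")
  case True
  have adj: "mat_adjoint A = A \<longleftrightarrow> herm {0..<s} (\<lambda>i j. A $$ (i, j))"
  proof -
    have d: "dim_row (mat_adjoint A) = s" "dim_col (mat_adjoint A) = s"
      using True by (auto simp: mat_adjoint_def mat_of_rows_def)
    have e: "mat_adjoint A $$ (i, j) = cnj (A $$ (j, i))" if "i < s" "j < s" for i j
      using True that by (simp add: mat_adjoint_def mat_of_rows_def cols_def conjugate_complex_def)
    show ?thesis
    proof
      assume a: "mat_adjoint A = A"
      show "herm {0..<s} (\<lambda>i j. A $$ (i, j))"
      proof (rule hermI)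
        fix i j assume "i \<in> {0..<s}" "j \<in> {0..<s}"
        then show "cnj (A $$ (i, j)) = A $$ (j, i)" using e[of j i, unfolded a] by simp
      qed
    next
      assume h: "herm {0..<s} (\<lambda>i j. A $$ (i, j))"
      have "mat_adjoint A $$ (i, j) = A $$ (i, j)" if "i < s" "j < s" for i j
        unfolding e[OF that] using hermD[OF h, of j i] that by simp
      then show "mat_adjoint A = A" using True d by (intro eq_matI) auto
    qed
  qed
  have f: "(A *\<^sub>v v) \<bullet>c v = form {0..<s} (\<lambda>i j. A $$ (i, j)) (vec_index v)" if "v \<in> carrier_vec s" for v
    using True that unfolding form_expand scalar_prod_def
    by (auto simp: scalar_prod_def sum_distrib_left sum_distrib_right mult_ac conjugate_complex_def intro!: sum.cong)
  have "(\<forall>v \<in> carrier_vec s. 0 \<le> (A *\<^sub>v v) \<bullet>c v) \<longleftrightarrow> (\<forall>x. 0 \<le> Re (form {0..<s} (\<lambda>i j. A $$ (i, j)) x))"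
    if h: "herm {0..<s} (\<lambda>i j. A $$ (i, j))"
  proof
    assume *: "\<forall>v \<in> carrier_vec s. 0 \<le> (A *\<^sub>v v) \<bullet>c v"
    show "\<forall>x. 0 \<le> Re (form {0..<s} (\<lambda>i j. A $$ (i, j)) x)"
    proof
      fix x
      have "form {0..<s} (\<lambda>i j. A $$ (i, j)) x = form {0..<s} (\<lambda>i j. A $$ (i, j)) (vec_index (Matrix.vec s x))"
        by (rule form_cong) auto
      moreover have "0 \<le> form {0..<s} (\<lambda>i j. A $$ (i, j)) (vec_index (Matrix.vec s x))"
        using * f[of "Matrix.vec s x"] by (metis vec_carrier)
      ultimately show "0 \<le> Re (form {0..<s} (\<lambda>i j. A $$ (i, j)) x)" by (simp add: less_eq_complex_def)
    qed
  next
    assume *: "\<forall>x. 0 \<le> Re (form {0..<s} (\<lambda>i j. A $$ (i, j)) x)"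
    show "\<forall>v \<in> carrier_vec s. 0 \<le> (A *\<^sub>v v) \<bullet>c v"
    proof
      fix v :: "complex Matrix.vec" assume v: "v \<in> carrier_vec s"
      have "of_real (Re (form {0..<s} (\<lambda>i j. A $$ (i, j)) (vec_index v))) = (A *\<^sub>v v) \<bullet>c v"
        unfolding f[OF v] by (rule form_real[OF h])
      moreover have "0 \<le> complex_of_real (Re (form {0..<s} (\<lambda>i j. A $$ (i, j)) (vec_index v)))"
        using * by (simp add: less_eq_complex_def)
      ultimately show "0 \<le> (A *\<^sub>v v) \<bullet>c v" by metis
    qed
  qed
  then show ?thesis unfolding psd_matrix_def psd_def using True adj by blast
qed (simp add: psd_matrix_def)

lemma rip_psd_nonneg:
  assumes I: "finite I" and "psd I a" "psd I b" shows "0 \<le> rip I a b"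
proof -
  obtain y where y: "\<And>i j. i \<in> I \<Longrightarrow> j \<in> I \<Longrightarrow> b i j = (\<Sum>l\<in>I. cnj (y l i) * y l j)"
    using psd_gram[OF I assms(3)] by metis
  have "rip I a b = rip I (\<lambda>i j. \<Sum>l\<in>I. cnj (y l i) * cnj (cnj (y l j))) a"
    by (subst rip_commute, intro rip_cong) (simp_all add: y)
  also have "\<dots> = (\<Sum>l\<in>I. Re (form I a (\<lambda>i. cnj (y l i))))"
    by (simp only: rip_sum_left rip_outer)
  finally show ?thesis using psdD(2)[OF assms(2)] by (simp add: sum_nonneg)
qed

lemma psd_of_real:
  fixes S :: "'i \<Rightarrow> 'i \<Rightarrow> real"
  assumes sym: "\<And>i j. i \<in> I \<Longrightarrow> j \<in> I \<Longrightarrow> S i j = S j i"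
    and pos: "\<And>x. 0 \<le> (\<Sum>i\<in>I. \<Sum>j\<in>I. x i * S i j * x j)"
  shows "psd I (\<lambda>i j. complex_of_real (S i j))"
proof (rule psdI)
  show "herm I (\<lambda>i j. complex_of_real (S i j))" by (rule hermI) (auto simp: sym)
  fix x
  have "Re (form I (\<lambda>i j. complex_of_real (S i j)) x) =
      (\<Sum>i\<in>I. \<Sum>j\<in>I. Re (x i) * S i j * Re (x j)) + (\<Sum>i\<in>I. \<Sum>j\<in>I. Im (x i) * S i j * Im (x j))"
    unfolding form_expand sum.distrib[symmetric] Re_sum by (intro sum.cong refl) (simp add: algebra_simps)
  then show "0 \<le> Re (form I (\<lambda>i j. complex_of_real (S i j)) x)"
    using pos[of "\<lambda>i. Re (x i)"] pos[of "\<lambda>i. Im (x i)"] by linarith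
qed

lemma CminI:
  fixes m :: nat
  assumes "X = Matrix.mat s s (\<lambda>ij. \<Sum>k<m. t k *\<^sub>R (tensor (A k) (c k) $$ ij))"
    and "\<And>k. k < m \<Longrightarrow> 0 \<le> t k \<and> psd_matrix s (A k) \<and> c k \<in> C"
  shows "X \<in> Cmin C s"
  unfolding Cmin_def using assms by (intro CollectI exI[of _ m] exI[of _ t] exI[of _ A] exI[of _ c] conjI allI impI) auto

lemma CminE:
  assumes "X \<in> Cmin C s"
  obtains m :: nat and t A c where "X = Matrix.mat s s (\<lambda>ij. \<Sum>k<m. t k *\<^sub>R (tensor (A k) (c k) $$ ij))"
    and "\<And>k. k < m \<Longrightarrow> 0 \<le> t k \<and> psd_matrix s (A k) \<and> c k \<in> C"
proof -
  obtain m :: nat and t A c where X: "X = Matrix.mat s s (\<lambda>ij. \<Sum>k<m. t k *\<^sub>R (tensor (A k) (c k) $$ ij))"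
    and k: "\<forall>k<m. 0 \<le> t k \<and> psd_matrix s (A k) \<and> c k \<in> C"
    using assms unfolding Cmin_def by (elim CollectE exE conjE)
  show ?thesis by (rule that[OF X]) (use k in blast)
qed

lemma CminI_tensor:
  assumes "psd_matrix s A" "c \<in> C" shows "tensor A c \<in> Cmin C s"
proof -
  have "A \<in> carrier_mat s s" using assms(1) by (simp add: psd_matrix_def)
  then show ?thesis
    using assms by (intro CminI[where m = 1 and t = "\<lambda>_. 1" and A = "\<lambda>_. A" and c = "\<lambda>_. c"])
      (auto simp: tensor_def)
qed

lemma sum_lessThan_add: "(\<Sum>k<m + n. f k) = (\<Sum>k<m. f k) + (\<Sum>k<n. f (m + k :: nat) :: 'b :: comm_monoid_add)"
  by (induction n) (simp_all add: add.assoc)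

lemma Cmin_add:
  assumes "X \<in> Cmin C s" "Y \<in> Cmin C s" shows "Matrix.mat s s (\<lambda>ij. X $$ ij + Y $$ ij) \<in> Cmin C s"
proof -
  obtain m :: nat and t A c where X: "X = Matrix.mat s s (\<lambda>ij. \<Sum>k<m. t k *\<^sub>R (tensor (A k) (c k) $$ ij))"
    and k: "\<And>k. k < m \<Longrightarrow> 0 \<le> t k \<and> psd_matrix s (A k) \<and> c k \<in> C"
    by (rule CminE[OF assms(1)]) blast
  obtain m' :: nat and t' A' c' where Y: "Y = Matrix.mat s s (\<lambda>ij. \<Sum>k<m'. t' k *\<^sub>R (tensor (A' k) (c' k) $$ ij))"
    and k': "\<And>k. k < m' \<Longrightarrow> 0 \<le> t' k \<and> psd_matrix s (A' k) \<and> c' k \<in> C"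
    by (rule CminE[OF assms(2)]) blast
  define T where "T = (\<lambda>k. if k < m then t k else t' (k - m))"
  define B where "B = (\<lambda>k. if k < m then A k else A' (k - m))"
  define e where "e = (\<lambda>k. if k < m then c k else c' (k - m))"
  have "Matrix.mat s s (\<lambda>ij. X $$ ij + Y $$ ij) = Matrix.mat s s (\<lambda>ij. \<Sum>k<m + m'. T k *\<^sub>R (tensor (B k) (e k) $$ ij))"
    unfolding sum_lessThan_add by (rule eq_matI) (auto simp: X Y T_def B_def e_def)
  moreover have "0 \<le> T j \<and> psd_matrix s (B j) \<and> e j \<in> C" if "j < m + m'" for j
    using k[of j] k'[of "j - m"] that by (auto simp: T_def B_def e_def)
  ultimately show ?thesis by (rule CminI)
qed

lemma Cmin_scale:
  assumes "X \<in> Cmin C s" "0 \<le> r" shows "Matrix.mat s s (\<lambda>ij. r *\<^sub>R X $$ ij) \<in> Cmin C s"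
proof -
  obtain m :: nat and t A c where X: "X = Matrix.mat s s (\<lambda>ij. \<Sum>k<m. t k *\<^sub>R (tensor (A k) (c k) $$ ij))"
    and k: "\<And>k. k < m \<Longrightarrow> 0 \<le> t k \<and> psd_matrix s (A k) \<and> c k \<in> C"
    by (rule CminE[OF assms(1)]) blast
  have "Matrix.mat s s (\<lambda>ij. r *\<^sub>R X $$ ij) = Matrix.mat s s (\<lambda>ij. \<Sum>k<m. (r * t k) *\<^sub>R (tensor (A k) (c k) $$ ij))"
    by (rule eq_matI) (auto simp: X scaleR_sum_right)
  moreover have "0 \<le> r * t j \<and> psd_matrix s (A j) \<and> c j \<in> C" if "j < m" for j using k[OF that] assms(2) by simp
  ultimately show ?thesis by (rule CminI)
qed

lemma Cmin_zero: "Matrix.mat s s (\<lambda>_. 0) \<in> Cmin C s"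
  by (rule CminI[where m = 0]) simp_all

lemma Cmin_induct [consumes 1, case_names zero add]:
  assumes "X \<in> Cmin C s" and zero: "P (Matrix.mat s s (\<lambda>_. 0))"
    and add: "\<And>Y t A c. P Y \<Longrightarrow> Y \<in> carrier_mat s s \<Longrightarrow> 0 \<le> t \<Longrightarrow> psd_matrix s A \<Longrightarrow> c \<in> C \<Longrightarrow>
      P (Matrix.mat s s (\<lambda>ij. Y $$ ij + t *\<^sub>R (tensor A c $$ ij)))"
  shows "P X"
proof -
  obtain m :: nat and t A c where X: "X = Matrix.mat s s (\<lambda>ij. \<Sum>k<m. t k *\<^sub>R (tensor (A k) (c k) $$ ij))"
    and k: "\<And>k. k < m \<Longrightarrow> 0 \<le> t k \<and> psd_matrix s (A k) \<and> c k \<in> C"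
    by (rule CminE[OF assms(1)]) blast
  have "P (Matrix.mat s s (\<lambda>ij. \<Sum>k<n. t k *\<^sub>R (tensor (A k) (c k) $$ ij)))" if "n \<le> m" for n
    using that
  proof (induction n)
    case 0
    then show ?case using zero by simp
  next
    case (Suc n)
    let ?Y = "Matrix.mat s s (\<lambda>ij. \<Sum>k<n. t k *\<^sub>R (tensor (A k) (c k) $$ ij))"
    have "P (Matrix.mat s s (\<lambda>ij. ?Y $$ ij + t n *\<^sub>R (tensor (A n) (c n) $$ ij)))"
      using Suc.IH Suc.prems k[of n] by (intro add) simp_all
    moreover have "Matrix.mat s s (\<lambda>ij. ?Y $$ ij + t n *\<^sub>R (tensor (A n) (c n) $$ ij)) =
        Matrix.mat s s (\<lambda>ij. \<Sum>k<Suc n. t k *\<^sub>R (tensor (A k) (c k) $$ ij))"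
      by (rule eq_matI) auto
    ultimately show ?case by simp
  qed
  then show ?thesis unfolding X by blast
qed

lemma tensor_index:
  "A \<in> carrier_mat s s \<Longrightarrow> i < s \<Longrightarrow> j < s \<Longrightarrow> tensor A c $$ (i, j) = (Re (A $$ (i, j)) *\<^sub>R c, Im (A $$ (i, j)) *\<^sub>R c)"
  by (simp add: tensor_def)

lemma psd_matrix_herm:
  assumes "psd_matrix s A" "i < s" "j < s" shows "A $$ (j, i) = cnj (A $$ (i, j))"
proof -
  have "psd {0..<s} (\<lambda>i j. A $$ (i, j))" using assms(1) by (simp add: psd_matrix_iff)
  from hermD[OF psdD(1)[OF this], of i j] assms(2,3) show ?thesis by simp
qed

lemma Cmin_Her: "X \<in> Cmin C s \<Longrightarrow> X \<in> Her s"
proof (induction rule: Cmin_induct)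
  case zero
  show ?case by (simp add: Her_def zero_prod_def)
next
  case (add Y t A c)
  have A: "A \<in> carrier_mat s s" using add(4) by (simp add: psd_matrix_def)
  show ?case
    unfolding Her_def
  proof (intro CollectI conjI allI impI)
    fix i j assume ij: "i < s" "j < s"
    have "Y $$ (j, i) = (fst (Y $$ (i, j)), - snd (Y $$ (i, j)))" using add(1) ij unfolding Her_def by blast
    then show "Matrix.mat s s (\<lambda>ij. Y $$ ij + t *\<^sub>R tensor A c $$ ij) $$ (j, i) =
      (fst (Matrix.mat s s (\<lambda>ij. Y $$ ij + t *\<^sub>R tensor A c $$ ij) $$ (i, j)),
       - snd (Matrix.mat s s (\<lambda>ij. Y $$ ij + t *\<^sub>R tensor A c $$ ij) $$ (i, j)))"
      using ij psd_matrix_herm[OF add(4) ij] by (simp add: tensor_index[OF A] prod_eq_iff)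
  qed simp
qed

section \<open>Positivity in iterated matrix algebras by entries\<close>

lemma (in abelian_monoid) finsum_product:
  assumes "finite A" "finite B" "\<And>a b. a \<in> A \<Longrightarrow> b \<in> B \<Longrightarrow> f a b \<in> carrier G"
  shows "(\<Oplus>a\<in>A. \<Oplus>b\<in>B. f a b) = (\<Oplus>ab\<in>A \<times> B. f (fst ab) (snd ab))"
  using assms(1,3)
proof (induction A rule: finite_induct)
  case (insert a A)
  have "(\<Oplus>ab\<in>insert a A \<times> B. f (fst ab) (snd ab)) = (\<Oplus>ab\<in>(Pair a ` B) \<union> A \<times> B. f (fst ab) (snd ab))"
    by (rule arg_cong[where f = "finsum G _"]) auto
  also have "\<dots> = (\<Oplus>ab\<in>Pair a ` B. f (fst ab) (snd ab)) \<oplus> (\<Oplus>ab\<in>A \<times> B. f (fst ab) (snd ab))"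
    using insert assms(2) by (intro finsum_Un_disjoint) auto
  also have "(\<Oplus>ab\<in>Pair a ` B. f (fst ab) (snd ab)) = (\<Oplus>b\<in>B. f a b)"
    using insert by (subst finsum_reindex) (auto simp: inj_on_def)
  also have "(\<Oplus>ab\<in>A \<times> B. f (fst ab) (snd ab)) = (\<Oplus>a\<in>A. \<Oplus>b\<in>B. f a b)" using insert by simp
  also have "(\<Oplus>b\<in>B. f a b) \<oplus> (\<Oplus>a\<in>A. \<Oplus>b\<in>B. f a b) = (\<Oplus>a\<in>insert a A. \<Oplus>b\<in>B. f a b)"
    using insert by (intro finsum_insert[symmetric] Pi_I finsum_closed) auto
  finally show ?case ..
qed simp

lemma Mat_finsum_index:
  assumes A: "pre_star_algebra A" and "finite L" "\<And>l. l \<in> L \<Longrightarrow> M l \<in> carrier (Mat d A)" and pq: "p < d" "q < d"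
  shows "(\<Oplus>\<^bsub>Mat d A\<^esub>l\<in>L. M l) $$ (p, q) = (\<Oplus>\<^bsub>A\<^esub>l\<in>L. M l $$ (p, q))"
  using assms(2,3)
proof (induction L rule: finite_induct)
  interpret A: pre_star_algebra A by fact
  interpret B: pre_star_algebra "Mat d A" by (rule pre_star_algebra_Mat[OF A])
  case empty
  show ?case using pq by (simp add: A.finsum_empty B.finsum_empty) (simp add: Mat_def)
next
  interpret A: pre_star_algebra A by fact
  interpret B: pre_star_algebra "Mat d A" by (rule pre_star_algebra_Mat[OF A])
  case (insert l L)
  have "(\<Oplus>\<^bsub>Mat d A\<^esub>l\<in>insert l L. M l) = M l \<oplus>\<^bsub>Mat d A\<^esub> (\<Oplus>\<^bsub>Mat d A\<^esub>l\<in>L. M l)"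
    using insert by (intro B.finsum_insert) auto
  moreover have "(\<Oplus>\<^bsub>A\<^esub>l\<in>insert l L. M l $$ (p, q)) = M l $$ (p, q) \<oplus>\<^bsub>A\<^esub> (\<Oplus>\<^bsub>A\<^esub>l\<in>L. M l $$ (p, q))"
    using insert pq by (intro A.finsum_insert) (auto simp: Mat_carrier_iff)
  moreover have "(\<Oplus>\<^bsub>Mat d A\<^esub>l\<in>L. M l) $$ (p, q) = (\<Oplus>\<^bsub>A\<^esub>l\<in>L. M l $$ (p, q))"
    using insert by auto
  ultimately show ?case using pq by (simp add: Mat_def)
qed

context commutative_cstar_algebra
begin

lemma star_mult_Mat_Mat_index:
  assumes y: "y \<in> carrier (Mat s (Mat d \<A>))" and "i < s" "j < s" "p < d" "q < d"
  shows "(star (Mat s (Mat d \<A>)) y \<otimes>\<^bsub>Mat s (Mat d \<A>)\<^esub> y) $$ (i, j) $$ (p, q) =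
    (\<Oplus>l\<in>{0..<s} \<times> {0..<d}. star \<A> (y $$ (fst l, i) $$ (snd l, p)) \<otimes> y $$ (fst l, j) $$ (snd l, q))"
proof -
  interpret B: pre_star_algebra "Mat d \<A>" by (rule pre_star_algebra_Mat[OF pre_star_algebra])
  have yB: "y $$ (l, i) \<in> carrier (Mat d \<A>)" if "l < s" "i < s" for l i
    using y that by (simp add: Mat_carrier_iff)
  then have yA: "y $$ (l, i) $$ (k, p) \<in> carrier \<A>" if "l < s" "i < s" "k < d" "p < d" for l i k p
    using that by (simp add: Mat_carrier_iff)
  have "(star (Mat s (Mat d \<A>)) y \<otimes>\<^bsub>Mat s (Mat d \<A>)\<^esub> y) $$ (i, j) =
      (\<Oplus>\<^bsub>Mat d \<A>\<^esub>l\<in>{0..<s}. star (Mat d \<A>) (y $$ (l, i)) \<otimes>\<^bsub>Mat d \<A>\<^esub> y $$ (l, j))"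
    using assms unfolding Mat_def[of s] by (auto intro!: B.finsum_cong' B.mult_closed B.star_closed yB)
  also have "\<dots> $$ (p, q) = (\<Oplus>l\<in>{0..<s}. (star (Mat d \<A>) (y $$ (l, i)) \<otimes>\<^bsub>Mat d \<A>\<^esub> y $$ (l, j)) $$ (p, q))"
    using assms yB by (intro Mat_finsum_index pre_star_algebra B.mult_closed B.star_closed) auto
  also have "\<dots> = (\<Oplus>l\<in>{0..<s}. \<Oplus>k\<in>{0..<d}. star \<A> (y $$ (l, i) $$ (k, p)) \<otimes> y $$ (l, j) $$ (k, q))"
  proof (intro M.finsum_cong' refl Pi_I M.finsum_closed)
    fix l assume l: "l \<in> {0..<s}"
    show "(star (Mat d \<A>) (y $$ (l, i)) \<otimes>\<^bsub>Mat d \<A>\<^esub> y $$ (l, j)) $$ (p, q) =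
        (\<Oplus>k\<in>{0..<d}. star \<A> (y $$ (l, i) $$ (k, p)) \<otimes> y $$ (l, j) $$ (k, q))"
      using assms l yA by (auto simp: Mat_def star_closed intro!: M.finsum_cong')
  qed (use yA assms in \<open>auto simp: star_closed\<close>)
  also have "\<dots> = (\<Oplus>l\<in>{0..<s} \<times> {0..<d}. star \<A> (y $$ (fst l, i) $$ (snd l, p)) \<otimes> y $$ (fst l, j) $$ (snd l, q))"
    using yA assms by (intro M.finsum_product) (auto simp: star_closed)
  finally show ?thesis .
qed

text \<open>Matrices over matrices are flattened to the index set of pairs, to which the results on
  Gram factors apply.\<close>

lemma positive_element_Mat_iff:
  assumes X: "X \<in> carrier (Mat s (Mat d \<A>))"
  shows "positive_element (Mat s (Mat d \<A>)) X \<longleftrightarrow>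
    (\<exists>Y. (\<forall>l\<in>{0..<s} \<times> {0..<d}. \<forall>i\<in>{0..<s} \<times> {0..<d}. Y l i \<in> carrier \<A>) \<and>
      (\<forall>i<s. \<forall>j<s. \<forall>p<d. \<forall>q<d. X $$ (i, j) $$ (p, q) =
        (\<Oplus>l\<in>{0..<s} \<times> {0..<d}. star \<A> (Y l (i, p)) \<otimes> Y l (j, q))))"
    (is "_ \<longleftrightarrow> (\<exists>Y. ?P Y)")
proof
  assume "positive_element (Mat s (Mat d \<A>)) X"
  then obtain y where y: "y \<in> carrier (Mat s (Mat d \<A>))" "X = star (Mat s (Mat d \<A>)) y \<otimes>\<^bsub>Mat s (Mat d \<A>)\<^esub> y"
    by (auto simp: positive_element_def)
  have "?P (\<lambda>l i. y $$ (fst l, fst i) $$ (snd l, snd i))"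
    using y(1) star_mult_Mat_Mat_index[OF y(1)] by (auto simp: Mat_carrier_iff y(2))
  then show "\<exists>Y. ?P Y" by (rule exI[of _ "\<lambda>l i. y $$ (fst l, fst i) $$ (snd l, snd i)"])
next
  assume "\<exists>Y. ?P Y"
  then obtain Y where Y: "?P Y" by blast
  interpret B: pre_star_algebra "Mat d \<A>" by (rule pre_star_algebra_Mat[OF pre_star_algebra])
  interpret BB: pre_star_algebra "Mat s (Mat d \<A>)" by (rule pre_star_algebra_Mat[OF B.pre_star_algebra_axioms])
  define y where "y = Matrix.mat s s (\<lambda>(l, i). Matrix.mat d d (\<lambda>(k, p). Y (l, k) (i, p)))"
  have y: "y \<in> carrier (Mat s (Mat d \<A>))"
    using Y by (auto simp: y_def Mat_carrier_iff)
  have cl: "star (Mat s (Mat d \<A>)) y \<otimes>\<^bsub>Mat s (Mat d \<A>)\<^esub> y \<in> carrier (Mat s (Mat d \<A>))"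
    using y by (intro BB.mult_closed BB.star_closed)
  have "X $$ (i, j) $$ (p, q) = (star (Mat s (Mat d \<A>)) y \<otimes>\<^bsub>Mat s (Mat d \<A>)\<^esub> y) $$ (i, j) $$ (p, q)"
    if "i < s" "j < s" "p < d" "q < d" for i j p q
  proof -
    have "X $$ (i, j) $$ (p, q) = (\<Oplus>l\<in>{0..<s} \<times> {0..<d}. star \<A> (Y l (i, p)) \<otimes> Y l (j, q))"
      using Y that by blast
    also have "\<dots> = (\<Oplus>l\<in>{0..<s} \<times> {0..<d}. star \<A> (y $$ (fst l, i) $$ (snd l, p)) \<otimes> y $$ (fst l, j) $$ (snd l, q))"
      using that Y by (intro M.finsum_cong') (auto simp: y_def star_closed)
    finally show ?thesis using star_mult_Mat_Mat_index[OF y that] by simp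
  qed
  note e = this
  have "X $$ (i, j) = (star (Mat s (Mat d \<A>)) y \<otimes>\<^bsub>Mat s (Mat d \<A>)\<^esub> y) $$ (i, j)" if ij: "i < s" "j < s" for i j
  proof -
    have "X $$ (i, j) \<in> carrier (Mat d \<A>)"
      "(star (Mat s (Mat d \<A>)) y \<otimes>\<^bsub>Mat s (Mat d \<A>)\<^esub> y) $$ (i, j) \<in> carrier (Mat d \<A>)"
      using X cl ij unfolding Mat_carrier_iff[of _ s] by blast+
    from this[THEN Mat_carrier_dim(1)] this[THEN Mat_carrier_dim(2)] e[OF ij] show ?thesis by (intro eq_matI) simp_all
  qed
  then have "X = star (Mat s (Mat d \<A>)) y \<otimes>\<^bsub>Mat s (Mat d \<A>)\<^esub> y"
    using X[THEN Mat_carrier_dim(1)] X[THEN Mat_carrier_dim(2)] cl[THEN Mat_carrier_dim(1)] cl[THEN Mat_carrier_dim(2)]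
    by (intro eq_matI) simp_all
  then show "positive_element (Mat s (Mat d \<A>)) X" using y unfolding positive_element_def by blast
qed

end

section \<open>An obstruction to embeddings\<close>

context commutative_cstar_algebra
begin

lemma sos_scale: "sos I h \<Longrightarrow> 0 \<le> t \<Longrightarrow> sos I (\<lambda>i j. complex_of_real t \<odot> h i j)"
proof (induction rule: sos_induct)
  case (zero h)
  then show ?case by (intro sos_zero) simp
next
  case (row h r k)
  have r: "\<And>i. i \<in> I \<Longrightarrow> r i \<in> carrier \<A>"
    and k: "\<And>i j. i \<in> I \<Longrightarrow> j \<in> I \<Longrightarrow> k i j = star \<A> (r i) \<otimes> r j \<oplus> h i j"
    and h: "sos I h" and t: "0 \<le> t" by fact+
  have IH: "sos I (\<lambda>i j. complex_of_real t \<odot> h i j)" using row.IH t by blast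
  have tt: "complex_of_real (sqrt t) * complex_of_real (sqrt t) = complex_of_real t"
    unfolding of_real_mult[symmetric] using t by simp
  show ?case
  proof (rule sos_row[OF IH, where r = "\<lambda>i. complex_of_real (sqrt t) \<odot> r i"])
    fix i j assume ij: "i \<in> I" "j \<in> I"
    show "complex_of_real t \<odot> k i j =
      star \<A> (complex_of_real (sqrt t) \<odot> r i) \<otimes> (complex_of_real (sqrt t) \<odot> r j) \<oplus> complex_of_real t \<odot> h i j"
      unfolding k[OF ij] using ij r h sos_closed[OF h ij]
      by (simp add: star_smult star_closed sm_add_right tt)
  qed (simp add: r)
qed

lemma sos_finsum:
  assumes "finite L" "\<And>l i. l \<in> L \<Longrightarrow> i \<in> I \<Longrightarrow> Y l i \<in> carrier \<A>"
  shows "sos I (\<lambda>i j. \<Oplus>l\<in>L. star \<A> (Y l i) \<otimes> Y l j)"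
  using assms
proof (induction L rule: finite_induct)
  case empty
  show ?case by (rule sos_zero) simp
next
  case (insert l L)
  have IH: "sos I (\<lambda>i j. \<Oplus>l\<in>L. star \<A> (Y l i) \<otimes> Y l j)" using insert by blast
  show ?case
    by (rule sos_row[OF IH, where r = "Y l"]) (use insert in \<open>auto simp: star_closed intro!: M.finsum_insert\<close>)
qed

text \<open>The parallelogram law, arranged such that the right side shows the row
  \<open>a + a'\<close> plus a remainder; this is why null rows add.\<close>

lemma parallelogram:
  assumes "a \<in> carrier \<A>" "b \<in> carrier \<A>" "a' \<in> carrier \<A>" "b' \<in> carrier \<A>" "g \<in> carrier \<A>" "g' \<in> carrier \<A>"
  shows "2 \<odot> (a \<otimes> b \<oplus> g \<oplus> (a' \<otimes> b' \<oplus> g')) =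
    (a \<oplus> a') \<otimes> (b \<oplus> b') \<oplus> ((a \<ominus> a') \<otimes> (b \<ominus> b') \<oplus> 2 \<odot> (g \<oplus> g'))"
proof -
  let ?P = "a \<otimes> b \<oplus> a' \<otimes> b'" and ?Q = "a \<otimes> b' \<oplus> a' \<otimes> b"
  have "(a \<oplus> a') \<otimes> (b \<oplus> b') = ?Q \<oplus> ?P" "(a \<ominus> a') \<otimes> (b \<ominus> b') = ?P \<oplus> (- 1) \<odot> ?Q"
    using assms by (simp_all add: sm_expand)
  moreover have "Q \<oplus> P \<oplus> (P \<oplus> (- 1) \<odot> Q \<oplus> G) = 2 \<odot> P \<oplus> G"
    if "P \<in> carrier \<A>" "Q \<in> carrier \<A>" "G \<in> carrier \<A>" for P Q G
  proof -
    have "Q \<oplus> P \<oplus> (P \<oplus> (- 1) \<odot> Q \<oplus> G) = Q \<oplus> ((P \<oplus> P \<oplus> G) \<oplus> (- 1) \<odot> Q)"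
      using that by (simp add: M.a_ac)
    also have "\<dots> = 2 \<odot> P \<oplus> G"
      using that by (subst sm_cancel) (simp_all add: sm_collect)
    finally show ?thesis .
  qed
  moreover have "2 \<odot> (a \<otimes> b \<oplus> g \<oplus> (a' \<otimes> b' \<oplus> g')) = 2 \<odot> ?P \<oplus> 2 \<odot> (g \<oplus> g')"
    using assms by (simp add: sm_add_right M.a_ac)
  ultimately show ?thesis using assms by simp
qed

end

text \<open>An embedding into \<open>Mat\<^sub>d(\<A>)\<close> together with a pencil \<open>S\<close> of size \<open>s > d\<close> that is positive on \<open>C\<close>.
  The kernel of \<open>w \<mapsto> \<Sum>\<^sub>j S(w\<^sub>j) \<epsilon>\<^sub>j\<close> on \<open>V\<^sup>s\<close> is spanned by the elements \<open>m \<otimes> c\<close> with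
  \<open>c \<in> C\<close> and \<open>S(c) m = 0\<close>.\<close>

locale embedded_pencil = commutative_cstar_algebra \<A>
  for \<A> :: "('a, 'm) cstar_algebra_scheme" (structure) +
  fixes C :: "'v::euclidean_space set" and u e :: 'v and d s :: nat and \<Phi> :: "'v \<Rightarrow> 'a mat"
    and S :: "'v \<Rightarrow> nat \<Rightarrow> nat \<Rightarrow> real" and \<delta> :: real
  assumes embedding: "unital_complete_order_embedding (Cmin C) u (Mat d \<A>) \<Phi>"
    and d: "1 \<le> d" "d < s"
    and S_add: "S (v + v') i j = S v i j + S v' i j" and S_scale: "S (r *\<^sub>R v) i j = r * S v i j"
    and S_sym: "S v i j = S v j i"
    and S_nonneg: "c \<in> C \<Longrightarrow> 0 \<le> (\<Sum>i\<in>{0..<s}. \<Sum>j\<in>{0..<s}. y i * S c i j * y j)"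
    and S_e: "i < s \<Longrightarrow> j < s \<Longrightarrow> S e i j = (if i = j then 1 else 0)"
    and S_u: "\<delta> * (\<Sum>i\<in>{0..<s}. (y i)\<^sup>2) \<le> (\<Sum>i\<in>{0..<s}. \<Sum>j\<in>{0..<s}. y i * S u i j * y j)"
    and \<delta>: "0 < \<delta>"
    and kernel: "(\<And>w w'. Z w \<Longrightarrow> Z w' \<Longrightarrow> Z (\<lambda>j. w j + w' j)) \<Longrightarrow> (\<And>r w. Z w \<Longrightarrow> Z (\<lambda>j. r *\<^sub>R w j)) \<Longrightarrow>
      (\<And>w w'. (\<And>j. j < s \<Longrightarrow> w j = w' j) \<Longrightarrow> Z w \<Longrightarrow> Z w') \<Longrightarrow>
      (\<And>m c. c \<in> C \<Longrightarrow> (\<And>i. i < s \<Longrightarrow> (\<Sum>j\<in>{0..<s}. S c i j * m j) = 0) \<Longrightarrow> Z (\<lambda>j. m j *\<^sub>R c)) \<Longrightarrow>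
      (\<And>i. i < s \<Longrightarrow> (\<Sum>j\<in>{0..<s}. S (w j) i j) = 0) \<Longrightarrow> Z w"
    and generation: "(\<And>v. G (\<lambda>i j. complex_of_real (S v i j))) \<Longrightarrow>
      (\<And>M N. G M \<Longrightarrow> G N \<Longrightarrow> G (\<lambda>i j. M i j + N i j)) \<Longrightarrow> (\<And>z M. G M \<Longrightarrow> G (\<lambda>i j. z * M i j)) \<Longrightarrow>
      (\<And>M N. G M \<Longrightarrow> G N \<Longrightarrow> G (\<lambda>i j. \<Sum>k\<in>{0..<s}. M i k * N k j)) \<Longrightarrow>
      (\<And>M N. (\<And>i j. i < s \<Longrightarrow> j < s \<Longrightarrow> M i j = N i j) \<Longrightarrow> G M \<Longrightarrow> G N) \<Longrightarrow>
      a \<le> d \<Longrightarrow> b \<le> d \<Longrightarrow> G (\<lambda>i j. if i = a \<and> j = b then 1 else 0)"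
begin

abbreviation "D \<equiv> {0..<s} \<times> {0..<d}"

definition x :: "'v \<Rightarrow> nat \<Rightarrow> nat \<Rightarrow> 'a" where "x v p q = \<Phi> v $$ (p, q)"

definition cx :: "'v \<times> 'v \<Rightarrow> nat \<Rightarrow> nat \<Rightarrow> 'a" where "cx z p q = x (fst z) p q \<oplus> \<i> \<odot> x (snd z) p q"

definition image_entry :: "('v \<times> 'v) mat \<Rightarrow> nat \<times> nat \<Rightarrow> nat \<times> nat \<Rightarrow> 'a" where
  "image_entry X a b = cx (X $$ (fst a, fst b)) (snd a) (snd b)"

text \<open>The functional on \<open>Her s\<close> given by the pencil. Only real parts occur: the
  imaginary parts of a Hermitian matrix are antisymmetric and would cancel against the symmetric
  \<open>S\<close>.\<close>

definition pairing :: "('v \<times> 'v) mat \<Rightarrow> real" where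
  "pairing X = (\<Sum>i\<in>{0..<s}. \<Sum>j\<in>{0..<s}. S (fst (X $$ (i, j))) i j)"

lemma pre_Mat: "pre_star_algebra (Mat d \<A>)"
  by (rule pre_star_algebra_Mat[OF pre_star_algebra])

lemma x_closed [simp]: "p < d \<Longrightarrow> q < d \<Longrightarrow> x v p q \<in> carrier \<A>"
  using embedding unfolding unital_complete_order_embedding_def x_def by (auto simp: Mat_carrier_iff)

lemma x_add: "p < d \<Longrightarrow> q < d \<Longrightarrow> x (v + w) p q = x v p q \<oplus> x w p q"
  using embedding unfolding unital_complete_order_embedding_def x_def by (auto simp: Mat_def)

lemma x_scale: "p < d \<Longrightarrow> q < d \<Longrightarrow> x (r *\<^sub>R v) p q = complex_of_real r \<odot> x v p q"
  using embedding unfolding unital_complete_order_embedding_def x_def by (auto simp: Mat_def)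

lemma x_zero: "p < d \<Longrightarrow> q < d \<Longrightarrow> x 0 p q = \<zero>"
  using x_scale[of p q 0 0] by simp

lemma x_u: "p < d \<Longrightarrow> q < d \<Longrightarrow> x u p q = (if p = q then \<one> else \<zero>)"
  using embedding unfolding unital_complete_order_embedding_def x_def by (auto simp: Mat_def)

lemma cx_closed [simp]: "p < d \<Longrightarrow> q < d \<Longrightarrow> cx z p q \<in> carrier \<A>"
  by (simp add: cx_def)

lemma cx_add: "p < d \<Longrightarrow> q < d \<Longrightarrow> cx (z + z') p q = cx z p q \<oplus> cx z' p q"
  by (simp add: cx_def x_add sm_add_right M.a_ac)

lemma cx_scale: "p < d \<Longrightarrow> q < d \<Longrightarrow> cx (r *\<^sub>R z) p q = complex_of_real r \<odot> cx z p q"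
  by (simp add: cx_def x_scale sm_add_right mult.commute)

lemma cx_complex: "p < d \<Longrightarrow> q < d \<Longrightarrow> cx (Re z *\<^sub>R v, Im z *\<^sub>R v) p q = z \<odot> x v p q"
  by (simp add: cx_def x_scale sm_add_left[symmetric] complex_eq[symmetric])

lemma cx_zero: "p < d \<Longrightarrow> q < d \<Longrightarrow> cx 0 p q = \<zero>"
  by (simp add: cx_def x_zero)

lemma image_entry_add:
  "a \<in> D \<Longrightarrow> b \<in> D \<Longrightarrow> image_entry (Matrix.mat s s (\<lambda>ij. X $$ ij + Y $$ ij)) a b = image_entry X a b \<oplus> image_entry Y a b"
  by (auto simp: image_entry_def cx_add)

lemma image_entry_scale:
  "a \<in> D \<Longrightarrow> b \<in> D \<Longrightarrow> image_entry (Matrix.mat s s (\<lambda>ij. r *\<^sub>R X $$ ij)) a b = complex_of_real r \<odot> image_entry X a b"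
  by (auto simp: image_entry_def cx_scale)

lemma image_entry_tensor:
  assumes "A \<in> carrier_mat s s" "a \<in> D" "b \<in> D"
  shows "image_entry (tensor A c) a b = A $$ (fst a, fst b) \<odot> x c (snd a) (snd b)"
  using assms by (auto simp: image_entry_def tensor_index[OF assms(1)] cx_complex)

lemma amplification_index:
  assumes "X \<in> carrier_mat k k" "i < k" "j < k" "p < d" "q < d"
  shows "amplification (Mat d \<A>) \<Phi> X $$ (i, j) $$ (p, q) = cx (X $$ (i, j)) p q"
  using assms by (auto simp: amplification_def cx_def x_def Mat_def split: prod.splits)

lemma amplification_closed:
  assumes "X \<in> carrier_mat k k" shows "amplification (Mat d \<A>) \<Phi> X \<in> carrier (Mat k (Mat d \<A>))"
proof -
  interpret B: pre_star_algebra "Mat d \<A>" by (rule pre_Mat)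
  have "\<Phi> v \<in> carrier (Mat d \<A>)" for v
    using embedding unfolding unital_complete_order_embedding_def by blast
  then show ?thesis using assms
    by (auto simp: Mat_carrier_iff[of _ k] amplification_def split: prod.splits intro!: B.smult_closed)
qed

lemma Cmin_iff:
  assumes "1 \<le> k" "X \<in> Her k"
  shows "X \<in> Cmin C k \<longleftrightarrow>
    (\<exists>Y. (\<forall>l\<in>{0..<k} \<times> {0..<d}. \<forall>i\<in>{0..<k} \<times> {0..<d}. Y l i \<in> carrier \<A>) \<and>
      (\<forall>i<k. \<forall>j<k. \<forall>p<d. \<forall>q<d. cx (X $$ (i, j)) p q =
        (\<Oplus>l\<in>{0..<k} \<times> {0..<d}. star \<A> (Y l (i, p)) \<otimes> Y l (j, q))))"
proof -
  have X: "X \<in> carrier_mat k k" using assms(2) by (simp add: Her_def)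
  have "X \<in> Cmin C k \<longleftrightarrow> positive_element (Mat k (Mat d \<A>)) (amplification (Mat d \<A>) \<Phi> X)"
    using embedding assms unfolding unital_complete_order_embedding_def by blast
  then show ?thesis unfolding positive_element_Mat_iff[OF amplification_closed[OF X]]
    by (simp add: amplification_index[OF X] cong: conj_cong)
qed

lemma pairing_add: "pairing (Matrix.mat s s (\<lambda>ij. X $$ ij + Y $$ ij)) = pairing X + pairing Y"
  unfolding pairing_def by (simp add: S_add sum.distrib)

lemma pairing_scale: "pairing (Matrix.mat s s (\<lambda>ij. r *\<^sub>R X $$ ij)) = r * pairing X"
  unfolding pairing_def by (simp add: S_scale sum_distrib_left)

lemma pairing_zero: "pairing (Matrix.mat s s (\<lambda>_. 0)) = 0"
  using pairing_scale[of 0 "Matrix.mat s s (\<lambda>_. 0)"] by simp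

lemma pairing_tensor:
  assumes "A \<in> carrier_mat s s"
  shows "pairing (tensor A c) = (\<Sum>i\<in>{0..<s}. \<Sum>j\<in>{0..<s}. Re (A $$ (i, j)) * S c i j)"
  unfolding pairing_def by (simp add: tensor_index[OF assms] S_scale)

lemma pairing_nonneg: "X \<in> Cmin C s \<Longrightarrow> 0 \<le> pairing X"
proof (induction rule: Cmin_induct)
  case zero
  then show ?case by (simp add: pairing_zero)
next
  case (add Y t A c)
  have A: "A \<in> carrier_mat s s" "psd {0..<s} (\<lambda>i j. A $$ (i, j))" and c: "c \<in> C" and t: "0 \<le> t" and Y: "0 \<le> pairing Y"
    using add by (simp_all add: psd_matrix_iff)
  have "psd {0..<s} (\<lambda>i j. complex_of_real (S c i j))"
    using S_sym S_nonneg[OF c] by (intro psd_of_real)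
  then have "0 \<le> rip {0..<s} (\<lambda>i j. A $$ (i, j)) (\<lambda>i j. complex_of_real (S c i j))"
    using A(2) by (intro rip_psd_nonneg) auto
  then have "0 \<le> pairing (tensor A c)"
    unfolding pairing_tensor[OF A(1)] rip_def by simp
  moreover have "pairing (Matrix.mat s s (\<lambda>ij. Y $$ ij + t *\<^sub>R tensor A c $$ ij)) =
    pairing (Matrix.mat s s (\<lambda>ij. Y $$ ij + Matrix.mat s s (\<lambda>ij. t *\<^sub>R tensor A c $$ ij) $$ ij))"
    by (rule arg_cong[where f = pairing]) (rule eq_matI, auto)
  ultimately show ?case using Y t unfolding pairing_add pairing_scale by simp
qed

subsection \<open>Null rows\<close>

text \<open>A substitute for the null space in a GNS construction: the square of \<open>r\<close> is
  dominated, in the sense of sums of squares, by the image of some \<open>X\<close> in the cone that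
  the pencil does not see. Null rows form a module over the algebra, so one can compute modulo
  them.\<close>

definition null_row :: "(nat \<times> nat \<Rightarrow> 'a) \<Rightarrow> bool" where
  "null_row r \<longleftrightarrow> (\<forall>a\<in>D. r a \<in> carrier \<A>) \<and>
     (\<exists>X \<in> Cmin C s. pairing X = 0 \<and>
       (\<exists>g. sos D g \<and> (\<forall>a\<in>D. \<forall>b\<in>D. image_entry X a b = star \<A> (r a) \<otimes> r b \<oplus> g a b)))"

lemma null_rowI:
  assumes "\<And>a. a \<in> D \<Longrightarrow> r a \<in> carrier \<A>" "X \<in> Cmin C s" "pairing X = 0" "sos D g"
    and "\<And>a b. a \<in> D \<Longrightarrow> b \<in> D \<Longrightarrow> image_entry X a b = star \<A> (r a) \<otimes> r b \<oplus> g a b"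
  shows "null_row r"
  unfolding null_row_def using assms by blast

lemma null_rowE:
  assumes "null_row r"
  obtains X g where "X \<in> Cmin C s" "pairing X = 0" "sos D g"
    and "\<And>a b. a \<in> D \<Longrightarrow> b \<in> D \<Longrightarrow> image_entry X a b = star \<A> (r a) \<otimes> r b \<oplus> g a b"
  using assms unfolding null_row_def by blast

lemma null_row_closed: "null_row r \<Longrightarrow> a \<in> D \<Longrightarrow> r a \<in> carrier \<A>"
  unfolding null_row_def by blast

lemma null_row_cong: "null_row r \<Longrightarrow> (\<And>a. a \<in> D \<Longrightarrow> r a = r' a) \<Longrightarrow> null_row r'"
  unfolding null_row_def by simp

lemma null_row_zero: "null_row (\<lambda>_. \<zero>)"
  by (rule null_rowI[OF _ Cmin_zero pairing_zero sos_zero[of _ "\<lambda>_ _. \<zero>"]])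
    (auto simp: image_entry_def cx_zero)

lemma null_row_add:
  assumes "null_row r" "null_row r'" shows "null_row (\<lambda>a. r a \<oplus> r' a)"
proof -
  obtain X g where X: "X \<in> Cmin C s" "pairing X = 0" and g: "sos D g"
    and Xg: "\<And>a b. a \<in> D \<Longrightarrow> b \<in> D \<Longrightarrow> image_entry X a b = star \<A> (r a) \<otimes> r b \<oplus> g a b"
    using null_rowE[OF assms(1)] by blast
  obtain X' g' where X': "X' \<in> Cmin C s" "pairing X' = 0" and g': "sos D g'"
    and Xg': "\<And>a b. a \<in> D \<Longrightarrow> b \<in> D \<Longrightarrow> image_entry X' a b = star \<A> (r' a) \<otimes> r' b \<oplus> g' a b"
    using null_rowE[OF assms(2)] by blast
  let ?XX = "Matrix.mat s s (\<lambda>ij. X $$ ij + X' $$ ij)"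
  let ?g = "\<lambda>a b. star \<A> (r a \<ominus> r' a) \<otimes> (r b \<ominus> r' b) \<oplus> complex_of_real 2 \<odot> (g a b \<oplus> g' a b)"
  have r: "\<And>a. a \<in> D \<Longrightarrow> r a \<in> carrier \<A>" "\<And>a. a \<in> D \<Longrightarrow> r' a \<in> carrier \<A>"
    using assms null_row_closed by blast+
  have sg: "sos D (\<lambda>a b. complex_of_real 2 \<odot> (g a b \<oplus> g' a b))"
    using g g' by (intro sos_scale sos_add) simp_all
  show ?thesis
  proof (rule null_rowI[where X = "Matrix.mat s s (\<lambda>ij. 2 *\<^sub>R ?XX $$ ij)" and g = ?g])
    show "Matrix.mat s s (\<lambda>ij. 2 *\<^sub>R ?XX $$ ij) \<in> Cmin C s"
      using X X' by (intro Cmin_scale Cmin_add) auto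
    show "pairing (Matrix.mat s s (\<lambda>ij. 2 *\<^sub>R ?XX $$ ij)) = 0"
      using X X' unfolding pairing_scale pairing_add by simp
    show "sos D ?g"
      by (rule sos_row[OF sg, where r = "\<lambda>a. r a \<ominus> r' a"]) (use r in auto)
    fix a b assume ab: "a \<in> D" "b \<in> D"
    have c: "r a \<in> carrier \<A>" "r b \<in> carrier \<A>" "r' a \<in> carrier \<A>" "r' b \<in> carrier \<A>"
      "star \<A> (r a) \<in> carrier \<A>" "star \<A> (r' a) \<in> carrier \<A>" "g a b \<in> carrier \<A>" "g' a b \<in> carrier \<A>"
      by (intro star_closed r ab sos_closed[OF g] sos_closed[OF g'])+
    show "image_entry (Matrix.mat s s (\<lambda>ij. 2 *\<^sub>R ?XX $$ ij)) a b = star \<A> (r a \<oplus> r' a) \<otimes> (r b \<oplus> r' b) \<oplus> ?g a b"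
      unfolding image_entry_scale[OF ab] image_entry_add[OF ab] Xg[OF ab] Xg'[OF ab]
      using c by (simp add: star_minus star_add parallelogram)
  qed (use r in auto)
qed

text \<open>Because \<open>l = star c c + w\<^sup>2\<close>, the image of \<open>l\<close> times the
  old witness dominates the square of the new row.\<close>

lemma null_row_mult:
  assumes "null_row r" and c: "c \<in> carrier \<A>" shows "null_row (\<lambda>a. c \<otimes> r a)"
proof -
  obtain X g where X: "X \<in> Cmin C s" "pairing X = 0" and g: "sos D g"
    and Xg: "\<And>a b. a \<in> D \<Longrightarrow> b \<in> D \<Longrightarrow> image_entry X a b = star \<A> (r a) \<otimes> r b \<oplus> g a b"
    using null_rowE[OF assms(1)] by blast
  obtain l w where lw: "l > 0" "w \<in> carrier \<A>" "star \<A> w = w" "complex_of_real l \<odot> \<one> = star \<A> c \<otimes> c \<oplus> w \<otimes> w"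
    using star_mult_self_bound[OF c] by blast
  have r: "\<And>a. a \<in> D \<Longrightarrow> r a \<in> carrier \<A>" using assms null_row_closed by blast
  let ?g = "\<lambda>a b. star \<A> (w \<otimes> r a) \<otimes> (w \<otimes> r b) \<oplus> complex_of_real l \<odot> g a b"
  have sg: "sos D (\<lambda>a b. complex_of_real l \<odot> g a b)"
    using g lw by (intro sos_scale) simp_all
  show ?thesis
  proof (rule null_rowI[where X = "Matrix.mat s s (\<lambda>ij. l *\<^sub>R X $$ ij)" and g = ?g])
    show "Matrix.mat s s (\<lambda>ij. l *\<^sub>R X $$ ij) \<in> Cmin C s"
      using X lw by (intro Cmin_scale) auto
    show "pairing (Matrix.mat s s (\<lambda>ij. l *\<^sub>R X $$ ij)) = 0"
      using X unfolding pairing_scale by simp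
    show "sos D ?g"
      by (rule sos_row[OF sg, where r = "\<lambda>a. w \<otimes> r a"]) (use r lw in auto)
    fix a b assume ab: "a \<in> D" "b \<in> D"
    have k: "r a \<in> carrier \<A>" "r b \<in> carrier \<A>" "star \<A> (r a) \<in> carrier \<A>" "star \<A> c \<in> carrier \<A>" "g a b \<in> carrier \<A>"
      by (intro star_closed r ab c sos_closed[OF g])+
    have "complex_of_real l \<odot> (star \<A> (r a) \<otimes> r b) = (complex_of_real l \<odot> \<one>) \<otimes> (star \<A> (r a) \<otimes> r b)"
      using k by simp
    also have "\<dots> = star \<A> (c \<otimes> r a) \<otimes> (c \<otimes> r b) \<oplus> star \<A> (w \<otimes> r a) \<otimes> (w \<otimes> r b)"
      unfolding lw(4) using k c lw(2,3) by (simp add: star_mult l_distr r_distr m_ac)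
    finally have l: "complex_of_real l \<odot> (star \<A> (r a) \<otimes> r b) =
      star \<A> (c \<otimes> r a) \<otimes> (c \<otimes> r b) \<oplus> star \<A> (w \<otimes> r a) \<otimes> (w \<otimes> r b)" .
    show "image_entry (Matrix.mat s s (\<lambda>ij. l *\<^sub>R X $$ ij)) a b = star \<A> (c \<otimes> r a) \<otimes> (c \<otimes> r b) \<oplus> ?g a b"
      unfolding image_entry_scale[OF ab] Xg[OF ab]
      using k c lw(2) l by (simp add: sm_add_right star_closed M.a_assoc)
  qed (use r c in auto)
qed

lemma null_row_finsum:
  assumes "finite K" "\<And>k. k \<in> K \<Longrightarrow> null_row (r k)" shows "null_row (\<lambda>a. \<Oplus>k\<in>K. r k a)"
  using assms
proof (induction K rule: finite_induct)
  case empty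
  then show ?case by (simp add: null_row_zero)
next
  case (insert k K)
  have "null_row (\<lambda>a. r k a \<oplus> (\<Oplus>k\<in>K. r k a))"
    using insert.prems insert.IH by (intro null_row_add) auto
  then show ?case
  proof (rule null_row_cong)
    fix a assume "a \<in> D"
    then have "\<And>k'. k' \<in> insert k K \<Longrightarrow> r k' a \<in> carrier \<A>" using insert.prems null_row_closed by blast
    then show "r k a \<oplus> (\<Oplus>k\<in>K. r k a) = (\<Oplus>k\<in>insert k K. r k a)"
      using insert.hyps by (intro M.finsum_insert[symmetric]) auto
  qed
qed

end

context commutative_cstar_algebra
begin

lemma sm_finsum:
  "finite K \<Longrightarrow> (\<And>k. k \<in> K \<Longrightarrow> f k \<in> carrier \<A>) \<Longrightarrow> z \<odot> (\<Oplus>k\<in>K. f k) = (\<Oplus>k\<in>K. z \<odot> f k)"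
proof (induction K rule: finite_induct)
  case (insert k K)
  have "(\<Oplus>k\<in>insert k K. f k) = f k \<oplus> (\<Oplus>k\<in>K. f k)" "(\<Oplus>k\<in>insert k K. z \<odot> f k) = z \<odot> f k \<oplus> (\<Oplus>k\<in>K. z \<odot> f k)"
    using insert by (auto intro!: M.finsum_insert)
  then show ?case using insert by (simp add: sm_add_right)
qed simp

end

lemma mulv_prod: "mulv I (\<lambda>i j. \<Sum>k\<in>I. M i k * N k j) m i = mulv I M (mulv I N m) i"
proof -
  have "mulv I (\<lambda>i j. \<Sum>k\<in>I. M i k * N k j) m i = (\<Sum>j\<in>I. \<Sum>k\<in>I. M i k * N k j * m j)"
    unfolding mulv_def by (simp add: sum_distrib_right)
  also have "\<dots> = (\<Sum>k\<in>I. \<Sum>j\<in>I. M i k * N k j * m j)" by (rule sum.swap)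
  finally show ?thesis unfolding mulv_def by (simp add: sum_distrib_left mult_ac)
qed

lemma mulv_lincomb:
  "mulv I (\<lambda>i j. A i j + (z * B i j + w * C i j)) m i = mulv I A m i + (z * mulv I B m i + w * mulv I C m i)"
  unfolding mulv_def by (simp add: sum.distrib sum_distrib_left algebra_simps)

lemma mulv_unit:
  assumes "finite I" "k \<in> I" shows "mulv I M (\<lambda>j. if j = k then 1 else 0) i = M i k"
proof -
  have "mulv I M (\<lambda>j. if j = k then 1 else 0) i = (\<Sum>j\<in>I. if j = k then M i j else 0)"
    unfolding mulv_def by (intro sum.cong) auto
  then show ?thesis using assms by simp
qed

context embedded_pencil
begin

text \<open>The matrix \<open>m m\<^sup>T \<otimes> c\<close> has pairing 0 because
  \<open>S(c) m = 0\<close>. Positivity of the image of \<open>c\<close> at level 1 provides Gram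
  rows \<open>Y l\<close>; each row \<open>m \<otimes> Y l\<close> is null, and the row in question
  is a combination of them.\<close>

lemma null_row_kernel:
  assumes c: "c \<in> C" and m: "\<And>i. i < s \<Longrightarrow> (\<Sum>j\<in>{0..<s}. S c i j * m j) = 0" and p: "p < d"
  shows "null_row (\<lambda>a. complex_of_real (m (fst a)) \<odot> x c p (snd a))"
proof -
  let ?L = "{0..<1::nat} \<times> {0..<d}" and ?A = "Matrix.mat 1 1 (\<lambda>_. 1) :: complex mat"
  have "psd_matrix 1 ?A"
    unfolding psd_matrix_iff using psd_cong[OF _ psd_unit[of "{0..<1::nat}"]] by simp
  then have T: "tensor ?A c \<in> Cmin C 1" using c by (rule CminI_tensor)
  obtain Y where Y: "\<forall>l\<in>?L. \<forall>i\<in>?L. Y l i \<in> carrier \<A>"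
    and Y': "\<forall>i<1. \<forall>j<1. \<forall>p<d. \<forall>q<d. cx (tensor ?A c $$ (i, j)) p q = (\<Oplus>l\<in>?L. star \<A> (Y l (i, p)) \<otimes> Y l (j, q))"
    using Cmin_iff[OF order_refl Cmin_Her[OF T], THEN iffD1, OF T] by blast
  have xc: "x c p q = (\<Oplus>l\<in>?L. star \<A> (Y l (0, p)) \<otimes> Y l (0, q))" if "p < d" "q < d" for p q
  proof -
    have "cx (tensor ?A c $$ (0, 0)) p q = x c p q"
      using cx_complex[OF that, of 1 c] that by (simp add: tensor_def)
    then show ?thesis using Y' that by simp
  qed
  have Yc: "Y l (0, p) \<in> carrier \<A>" if "l \<in> ?L" "p < d" for l p
    using that by (intro Y[rule_format]) auto
  define \<rho> where "\<rho> = (\<lambda>l a. complex_of_real (m (fst a :: nat)) \<odot> Y l (0, snd a))"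
  have \<rho>c: "\<rho> l a \<in> carrier \<A>" if "l \<in> ?L" "a \<in> D" for l a
    unfolding \<rho>_def using Yc[OF that(1), of "snd a"] that(2) by auto
  let ?M = "Matrix.mat s s (\<lambda>(i, j). complex_of_real (m i) * cnj (complex_of_real (m j)))"
  have M: "psd_matrix s ?M"
    unfolding psd_matrix_iff
    by (intro conjI mat_carrier psd_cong[OF _ psd_outer[of "{0..<s}" "\<lambda>i. complex_of_real (m i)"]]) simp
  have null: "null_row (\<rho> l)" if l: "l \<in> ?L" for l
  proof (rule null_rowI[where X = "tensor ?M c" and g = "\<lambda>a b. \<Oplus>l\<in>?L - {l}. star \<A> (\<rho> l a) \<otimes> \<rho> l b"])
    show "tensor ?M c \<in> Cmin C s" using M c by (rule CminI_tensor)
    have "pairing (tensor ?M c) = (\<Sum>i\<in>{0..<s}. m i * (\<Sum>j\<in>{0..<s}. S c i j * m j))"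
      by (subst pairing_tensor) (auto simp: sum_distrib_left mult_ac intro!: sum.cong)
    then show "pairing (tensor ?M c) = 0" using m by simp
    show "sos D (\<lambda>a b. \<Oplus>l\<in>?L - {l}. star \<A> (\<rho> l a) \<otimes> \<rho> l b)"
      using \<rho>c by (intro sos_finsum) auto
    fix a b assume ab: "a \<in> D" "b \<in> D"
    obtain i p' j q' where e: "a = (i, p')" "b = (j, q')" "i < s" "p' < d" "j < s" "q' < d" using ab by auto
    have "image_entry (tensor ?M c) a b = (complex_of_real (m i) * complex_of_real (m j)) \<odot> x c p' q'"
      using ab by (subst image_entry_tensor) (auto simp: e)
    also have "\<dots> = (\<Oplus>l\<in>?L. (complex_of_real (m i) * complex_of_real (m j)) \<odot> (star \<A> (Y l (0, p')) \<otimes> Y l (0, q')))"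
      unfolding xc[OF e(4,6)] using Yc e star_closed by (intro sm_finsum) auto
    also have "\<dots> = (\<Oplus>l\<in>?L. star \<A> (\<rho> l a) \<otimes> \<rho> l b)"
    proof (rule M.finsum_cong')
      show "(\<lambda>l. star \<A> (\<rho> l a) \<otimes> \<rho> l b) \<in> ?L \<rightarrow> carrier \<A>" using \<rho>c ab star_closed by blast
      fix l assume "l \<in> ?L"
      then have "Y l (0, p') \<in> carrier \<A>" "Y l (0, q') \<in> carrier \<A>" using Yc e by blast+
      then show "(complex_of_real (m i) * complex_of_real (m j)) \<odot> (star \<A> (Y l (0, p')) \<otimes> Y l (0, q')) =
          star \<A> (\<rho> l a) \<otimes> \<rho> l b"
        by (simp add: \<rho>_def e star_smult star_closed mult.commute)
    qed simp
    also have "\<dots> = (\<Oplus>l\<in>insert l (?L - {l}). star \<A> (\<rho> l a) \<otimes> \<rho> l b)"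
      using l by (intro arg_cong[where f = "finsum \<A> _"]) auto
    also have "\<dots> = star \<A> (\<rho> l a) \<otimes> \<rho> l b \<oplus> (\<Oplus>l\<in>?L - {l}. star \<A> (\<rho> l a) \<otimes> \<rho> l b)"
      using \<rho>c ab l star_closed by (intro M.finsum_insert) auto
    finally show "image_entry (tensor ?M c) a b = star \<A> (\<rho> l a) \<otimes> \<rho> l b \<oplus> (\<Oplus>l\<in>?L - {l}. star \<A> (\<rho> l a) \<otimes> \<rho> l b)" .
  qed (use \<rho>c l in blast)
  have "null_row (\<lambda>a. \<Oplus>l\<in>?L. star \<A> (Y l (0, p)) \<otimes> \<rho> l a)"
    using null Yc p star_closed by (intro null_row_finsum null_row_mult) auto
  then show ?thesis
  proof (rule null_row_cong)
    fix a assume a: "a \<in> D"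
    then have q: "snd a < d" by auto
    have "(\<Oplus>l\<in>?L. star \<A> (Y l (0, p)) \<otimes> \<rho> l a) = (\<Oplus>l\<in>?L. complex_of_real (m (fst a)) \<odot> (star \<A> (Y l (0, p)) \<otimes> Y l (0, snd a)))"
    proof (rule M.finsum_cong')
      show "(\<lambda>l. complex_of_real (m (fst a)) \<odot> (star \<A> (Y l (0, p)) \<otimes> Y l (0, snd a))) \<in> ?L \<rightarrow> carrier \<A>"
        using Yc p q star_closed by auto
      fix l assume "l \<in> ?L"
      then show "star \<A> (Y l (0, p)) \<otimes> \<rho> l a = complex_of_real (m (fst a)) \<odot> (star \<A> (Y l (0, p)) \<otimes> Y l (0, snd a))"
        using Yc[of l p] Yc[of l "snd a"] p q by (simp add: \<rho>_def star_closed)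
    qed simp
    also have "\<dots> = complex_of_real (m (fst a)) \<odot> x c p (snd a)"
      unfolding xc[OF p q] using Yc p q star_closed by (intro sm_finsum[symmetric]) auto
    finally show "(\<Oplus>l\<in>?L. star \<A> (Y l (0, p)) \<otimes> \<rho> l a) = complex_of_real (m (fst a)) \<odot> x c p (snd a)" .
  qed
qed

lemma null_row_family:
  assumes "\<And>p. p < n \<Longrightarrow> null_row (r p)"
  shows "\<exists>X \<in> Cmin C s. pairing X = 0 \<and> (\<exists>g. sos D g \<and>
    (\<forall>a\<in>D. \<forall>b\<in>D. image_entry X a b = (\<Oplus>p\<in>{0..<n::nat}. star \<A> (r p a) \<otimes> r p b) \<oplus> g a b))"
  using assms
proof (induction n)
  case 0
  show ?case
    by (rule bexI[OF _ Cmin_zero], intro conjI exI[of _ "\<lambda>_ _. \<zero>"] sos_zero)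
      (auto simp: pairing_zero image_entry_def cx_zero)
next
  case (Suc n)
  obtain X g where X: "X \<in> Cmin C s" "pairing X = 0" and g: "sos D g"
    and Xg: "\<forall>a\<in>D. \<forall>b\<in>D. image_entry X a b = (\<Oplus>p\<in>{0..<n}. star \<A> (r p a) \<otimes> r p b) \<oplus> g a b"
    using Suc.IH Suc.prems less_SucI by blast
  obtain X' g' where X': "X' \<in> Cmin C s" "pairing X' = 0" and g': "sos D g'"
    and Xg': "\<And>a b. a \<in> D \<Longrightarrow> b \<in> D \<Longrightarrow> image_entry X' a b = star \<A> (r n a) \<otimes> r n b \<oplus> g' a b"
    using null_rowE[OF Suc.prems[of n]] by blast
  have rc: "r p a \<in> carrier \<A>" if "p \<le> n" "a \<in> D" for p a
    using null_row_closed[OF Suc.prems[of p]] that by simp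
  show ?case
  proof (intro bexI conjI exI[of _ "\<lambda>a b. g a b \<oplus> g' a b"] ballI)
    show "Matrix.mat s s (\<lambda>ij. X $$ ij + X' $$ ij) \<in> Cmin C s" using X X' by (intro Cmin_add) auto
    show "pairing (Matrix.mat s s (\<lambda>ij. X $$ ij + X' $$ ij)) = 0" using X X' by (simp add: pairing_add)
    show "sos D (\<lambda>a b. g a b \<oplus> g' a b)" using g g' by (rule sos_add)
    fix a b assume ab: "a \<in> D" "b \<in> D"
    let ?f = "\<lambda>p. star \<A> (r p a) \<otimes> r p b"
    have f: "?f p \<in> carrier \<A>" if "p \<le> n" for p
      using rc[OF that ab(1)] rc[OF that ab(2)] star_closed by blast
    have c: "(\<Oplus>p\<in>{0..<n}. ?f p) \<in> carrier \<A>" using f by (intro M.finsum_closed) auto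
    have "{0..<Suc n} = insert n {0..<n}" by auto
    then have "(\<Oplus>p\<in>{0..<Suc n}. ?f p) = ?f n \<oplus> (\<Oplus>p\<in>{0..<n}. ?f p)"
      using f by (simp only:) (intro M.finsum_insert, auto)
    then show "image_entry (Matrix.mat s s (\<lambda>ij. X $$ ij + X' $$ ij)) a b = (\<Oplus>p\<in>{0..<Suc n}. ?f p) \<oplus> (g a b \<oplus> g' a b)"
      unfolding image_entry_add[OF ab] Xg[rule_format, OF ab] Xg'[OF ab]
      using c f[of n] sos_closed[OF g ab] sos_closed[OF g' ab] by (simp add: M.a_ac)
  qed
qed

section \<open>Represented matrices modulo null rows\<close>

definition unit_row :: "nat \<Rightarrow> (nat \<Rightarrow> 'a) \<Rightarrow> nat \<times> nat \<Rightarrow> 'a" where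
  "unit_row p y a = (if snd a = p then y (fst a) else \<zero>)"

lemma finsum_delta:
  assumes "finite K" "k \<in> K" "f k \<in> carrier \<A>"
  shows "(\<Oplus>j\<in>K. if j = k then f j else \<zero>) = f k"
proof -
  have "(\<Oplus>j\<in>K. if j = k then f j else \<zero>) = (\<Oplus>j\<in>K. if k = j then f k else \<zero>)"
    using assms(3) by (intro M.finsum_cong') auto
  also have "\<dots> = f k" using M.finsum_singleton[of k K "\<lambda>_. f k"] assms by auto
  finally show ?thesis .
qed

text \<open>If these rows are null, some \<open>X\<close> of pairing 0 has an image that dominates
  the image of \<open>cnj (m i) * m j\<close> times \<open>u\<close>. By
  \<open>sos_plus_epsilon_gram\<close> and because the embedding reflects positivity, subtracting
  that matrix from \<open>X\<close> and adding \<open>\<epsilon>\<close> times the unit stays in the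
  cone. Its pairing is nonnegative, so \<open>\<delta> |m|\<^sup>2\<close> is at most
  \<open>\<epsilon>\<close> times the trace of \<open>S(u)\<close>, for all
  \<open>\<epsilon> > 0\<close>.\<close>

lemma separation:
  fixes m :: "nat \<Rightarrow> complex"
  assumes null: "\<And>p. p < d \<Longrightarrow> null_row (unit_row p (\<lambda>i. m i \<odot> \<one>))" and j: "j < s"
  shows "m j = 0"
proof -
  obtain X g where X: "X \<in> Cmin C s" "pairing X = 0" and g: "sos D g"
    and Xg: "\<And>a b. a \<in> D \<Longrightarrow> b \<in> D \<Longrightarrow> image_entry X a b =
      (\<Oplus>p\<in>{0..<d}. star \<A> (unit_row p (\<lambda>i. m i \<odot> \<one>) a) \<otimes> unit_row p (\<lambda>i. m i \<odot> \<one>) b) \<oplus> g a b"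
    using null_row_family[of d "\<lambda>p. unit_row p (\<lambda>i. m i \<odot> \<one>)", OF null] by blast
  have rows: "(\<Oplus>p\<in>{0..<d}. star \<A> (unit_row p (\<lambda>i. m i \<odot> \<one>) a) \<otimes> unit_row p (\<lambda>i. m i \<odot> \<one>) b) =
      (if snd a = snd b then (cnj (m (fst a)) * m (fst b)) \<odot> \<one> else \<zero>)" if "a \<in> D" "b \<in> D" for a b
  proof -
    have "(\<Oplus>p\<in>{0..<d}. star \<A> (unit_row p (\<lambda>i. m i \<odot> \<one>) a) \<otimes> unit_row p (\<lambda>i. m i \<odot> \<one>) b) =
      (\<Oplus>p\<in>{0..<d}. if p = snd a then (if snd a = snd b then (cnj (m (fst a)) * m (fst b)) \<odot> \<one> else \<zero>) else \<zero>)"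
      by (rule M.finsum_cong') (auto simp: unit_row_def star_smult)
    also have "\<dots> = (if snd a = snd b then (cnj (m (fst a)) * m (fst b)) \<odot> \<one> else \<zero>)"
      using that by (intro finsum_delta) auto
    finally show ?thesis .
  qed
  let ?T = "\<Sum>i\<in>{0..<s}. S u i i" and ?q = "\<Sum>i\<in>{0..<s}. (cmod (m i))\<^sup>2"
  have le: "\<delta> * ?q \<le> \<epsilon> * ?T" if \<epsilon>: "\<epsilon> > 0" for \<epsilon>
  proof -
    define c where "c i j = (if i = j then complex_of_real \<epsilon> else 0) - cnj (m i) * m j" for i j
    define X' where "X' = Matrix.mat s s (\<lambda>(i, j). X $$ (i, j) + (Re (c i j) *\<^sub>R u, Im (c i j) *\<^sub>R u))"
    have XH: "X $$ (j, i) = (fst (X $$ (i, j)), - snd (X $$ (i, j)))" if "i < s" "j < s" for i j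
      using Cmin_Her[OF X(1)] that unfolding Her_def by blast
    have X'H: "X' \<in> Her s"
      unfolding Her_def
    proof (intro CollectI conjI allI impI)
      fix i j assume ij: "i < s" "j < s"
      have "Re (c j i) = Re (c i j)" "Im (c j i) = - Im (c i j)" by (simp_all add: c_def)
      then show "X' $$ (j, i) = (fst (X' $$ (i, j)), - snd (X' $$ (i, j)))"
        using ij XH[OF ij] by (simp add: X'_def)
    qed (simp add: X'_def)
    obtain Y where Y: "\<forall>l\<in>D. \<forall>i\<in>D. Y l i \<in> carrier \<A>"
      and YY: "\<And>a b. a \<in> D \<Longrightarrow> b \<in> D \<Longrightarrow> (\<Oplus>l\<in>D. star \<A> (Y l a) \<otimes> Y l b) = g a b \<oplus> (if a = b then complex_of_real \<epsilon> \<odot> \<one> else \<zero>)"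
      using sos_plus_epsilon_gram[OF _ \<epsilon> g] by blast
    have e: "cx (X' $$ (i, j)) p q = (\<Oplus>l\<in>D. star \<A> (Y l (i, p)) \<otimes> Y l (j, q))"
      if "i < s" "j < s" "p < d" "q < d" for i j p q
    proof -
      have D: "(i, p) \<in> D" "(j, q) \<in> D" using that by auto
      have gc: "g (i, p) (j, q) \<in> carrier \<A>" using g D by (rule sos_closed)
      have "cx (X' $$ (i, j)) p q = cx (X $$ (i, j)) p q \<oplus> c i j \<odot> x u p q"
        using that by (simp add: X'_def cx_add cx_complex)
      also have "cx (X $$ (i, j)) p q = (if p = q then (cnj (m i) * m j) \<odot> \<one> else \<zero>) \<oplus> g (i, p) (j, q)"
        using Xg[OF D] rows[OF D] by (simp add: image_entry_def)
      also have "\<dots> \<oplus> c i j \<odot> x u p q = g (i, p) (j, q) \<oplus> (if (i, p) = (j, q) then complex_of_real \<epsilon> \<odot> \<one> else \<zero>)"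
      proof (cases "p = q")
        case True
        then have "((if p = q then (cnj (m i) * m j) \<odot> \<one> else \<zero>) \<oplus> g (i, p) (j, q)) \<oplus> c i j \<odot> x u p q = g (i, p) (j, q) \<oplus> ((cnj (m i) * m j) \<odot> \<one> \<oplus> c i j \<odot> \<one>)"
          using gc that by (simp add: x_u M.a_ac)
        also have "(cnj (m i) * m j) \<odot> \<one> \<oplus> c i j \<odot> \<one> = (cnj (m i) * m j + c i j) \<odot> \<one>"
          by (simp add: sm_add_left)
        finally show ?thesis using True by (auto simp: c_def)
      qed (use gc that in \<open>simp add: x_u\<close>)
      finally show ?thesis using YY[OF D] by simp
    qed
    have "X' \<in> Cmin C s"
      using Y e d by (intro Cmin_iff[OF _ X'H, THEN iffD2] exI[of _ Y] conjI) auto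
    then have "0 \<le> pairing X'" by (rule pairing_nonneg)
    also have "pairing X' = pairing X + (\<Sum>i\<in>{0..<s}. \<Sum>j\<in>{0..<s}. Re (c i j) * S u i j)"
      unfolding pairing_def X'_def by (simp add: S_add S_scale sum.distrib)
    also have "(\<Sum>i\<in>{0..<s}. \<Sum>j\<in>{0..<s}. Re (c i j) * S u i j) =
      (\<Sum>i\<in>{0..<s}. \<Sum>j\<in>{0..<s}. (if j = i then \<epsilon> * S u i j else 0) - (Re (m i) * S u i j * Re (m j) + Im (m i) * S u i j * Im (m j)))"
      by (intro sum.cong refl) (auto simp: c_def algebra_simps)
    also have "\<dots> = \<epsilon> * ?T - ((\<Sum>i\<in>{0..<s}. \<Sum>j\<in>{0..<s}. Re (m i) * S u i j * Re (m j)) +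
        (\<Sum>i\<in>{0..<s}. \<Sum>j\<in>{0..<s}. Im (m i) * S u i j * Im (m j)))"
      unfolding sum_subtractf sum.distrib by (simp add: sum_distrib_left)
    finally have "(\<Sum>i\<in>{0..<s}. \<Sum>j\<in>{0..<s}. Re (m i) * S u i j * Re (m j)) +
        (\<Sum>i\<in>{0..<s}. \<Sum>j\<in>{0..<s}. Im (m i) * S u i j * Im (m j)) \<le> \<epsilon> * ?T" using X(2) by simp
    moreover have "\<delta> * ?q = \<delta> * (\<Sum>i\<in>{0..<s}. (Re (m i))\<^sup>2) + \<delta> * (\<Sum>i\<in>{0..<s}. (Im (m i))\<^sup>2)"
      by (simp add: cmod_power2 sum.distrib distrib_left)
    ultimately show ?thesis using S_u[of "\<lambda>i. Re (m i)"] S_u[of "\<lambda>i. Im (m i)"] by linarith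
  qed
  have "\<not> \<delta> * ?q > 0"
  proof
    assume pos: "\<delta> * ?q > 0"
    then have T: "?T > 0" using le[of 1] by simp
    have "\<delta> * ?q \<le> \<delta> * ?q / (2 * ?T) * ?T" using pos T by (intro le) simp
    then show False using pos T by simp
  qed
  then have "?q \<le> 0" using \<delta> by (simp add: zero_less_mult_iff not_less)
  moreover have "(cmod (m j))\<^sup>2 \<le> ?q" using j by (intro member_le_sum) auto
  ultimately have "(cmod (m j))\<^sup>2 \<le> 0" by linarith
  then show ?thesis by simp
qed

text \<open>Modulo null rows, \<open>m \<otimes> b\<^sub>p\<close> equals the vector
  \<open>M m\<close> placed in copy \<open>p\<close>. In this way constant matrices of size
  \<open>s\<close> are obtained from matrices of size \<open>d\<close> over the algebra.\<close>

definition represents :: "(nat \<Rightarrow> nat \<Rightarrow> 'a) \<Rightarrow> (nat \<Rightarrow> nat \<Rightarrow> complex) \<Rightarrow> bool" where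
  "represents b M \<longleftrightarrow> (\<forall>p<d. \<forall>q<d. b p q \<in> carrier \<A>) \<and>
     (\<forall>m p. p < d \<longrightarrow> null_row (\<lambda>a. m (fst a) \<odot> b p (snd a) \<oplus> unit_row p (\<lambda>i. (- mulv {0..<s} M m i) \<odot> \<one>) a))"

lemma null_row_sm: "null_row r \<Longrightarrow> null_row (\<lambda>a. z \<odot> r a)"
  by (rule null_row_cong[OF null_row_mult[of r "z \<odot> \<one>"]]) (auto dest: null_row_closed)

lemma unit_row_closed: "(\<And>i. i < s \<Longrightarrow> y i \<in> carrier \<A>) \<Longrightarrow> a \<in> D \<Longrightarrow> unit_row p y a \<in> carrier \<A>"
  by (auto simp: unit_row_def)

lemma represents_closed: "represents b M \<Longrightarrow> p < d \<Longrightarrow> q < d \<Longrightarrow> b p q \<in> carrier \<A>"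
  unfolding represents_def by blast

lemma represents_row:
  "represents b M \<Longrightarrow> p < d \<Longrightarrow>
    null_row (\<lambda>a. m (fst a) \<odot> b p (snd a) \<oplus> unit_row p (\<lambda>i. (- mulv {0..<s} M m i) \<odot> \<one>) a)"
  unfolding represents_def by blast

lemma representsI:
  assumes "\<And>p q. p < d \<Longrightarrow> q < d \<Longrightarrow> b p q \<in> carrier \<A>"
    and "\<And>m p. p < d \<Longrightarrow> null_row (\<lambda>a. m (fst a) \<odot> b p (snd a) \<oplus> unit_row p (\<lambda>i. (- mulv {0..<s} M m i) \<odot> \<one>) a)"
  shows "represents b M"
  unfolding represents_def using assms by blast

lemma represents_cong:
  assumes "represents b M" "\<And>i j. i < s \<Longrightarrow> j < s \<Longrightarrow> M i j = M' i j"
  shows "represents b M'"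
proof (rule representsI)
  fix m p assume p: "p < d"
  show "null_row (\<lambda>a. m (fst a) \<odot> b p (snd a) \<oplus> unit_row p (\<lambda>i. (- mulv {0..<s} M' m i) \<odot> \<one>) a)"
  proof (rule null_row_cong[OF represents_row[OF assms(1) p, of m]])
    fix a assume "a \<in> D"
    then have "mulv {0..<s} M m (fst a) = mulv {0..<s} M' m (fst a)" using assms(2) by (intro mulv_cong) auto
    then show "m (fst a) \<odot> b p (snd a) \<oplus> unit_row p (\<lambda>i. (- mulv {0..<s} M m i) \<odot> \<one>) a =
      m (fst a) \<odot> b p (snd a) \<oplus> unit_row p (\<lambda>i. (- mulv {0..<s} M' m i) \<odot> \<one>) a"
      by (simp add: unit_row_def)
  qed
qed (rule represents_closed[OF assms(1)])

lemma represents_one: "represents (\<lambda>p q. if p = q then \<one> else \<zero>) (\<lambda>i j. if i = j then 1 else 0)"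
proof (rule representsI)
  fix m :: "nat \<Rightarrow> complex" and p assume p: "p < d"
  show "null_row (\<lambda>a. m (fst a) \<odot> (if p = snd a then \<one> else \<zero>) \<oplus>
      unit_row p (\<lambda>i. (- mulv {0..<s} (\<lambda>i j. if i = j then 1 else 0) m i) \<odot> \<one>) a)"
  proof (rule null_row_cong[OF null_row_zero])
    fix a assume a: "a \<in> D"
    have "mulv {0..<s} (\<lambda>i j. if i = j then 1 else 0) m (fst a) = (\<Sum>j\<in>{0..<s}. if fst a = j then m j else 0)"
      unfolding mulv_def by (intro sum.cong) auto
    also have "\<dots> = m (fst a)" using a by auto
    finally have e: "mulv {0..<s} (\<lambda>i j. if i = j then 1 else 0) m (fst a) = m (fst a)" .
    show "\<zero> = m (fst a) \<odot> (if p = snd a then \<one> else \<zero>) \<oplus>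
        unit_row p (\<lambda>i. (- mulv {0..<s} (\<lambda>i j. if i = j then 1 else 0) m i) \<odot> \<one>) a"
      unfolding unit_row_def e by (auto simp: sm_collect)
  qed
qed simp

lemma represents_add:
  assumes "represents b M" "represents b' M'"
  shows "represents (\<lambda>p q. b p q \<oplus> b' p q) (\<lambda>i j. M i j + M' i j)"
proof (rule representsI)
  fix m p assume p: "p < d"
  have e: "mulv {0..<s} (\<lambda>i j. M i j + M' i j) m i = mulv {0..<s} M m i + mulv {0..<s} M' m i" for i
    unfolding mulv_def by (simp add: sum.distrib distrib_right)
  show "null_row (\<lambda>a. m (fst a) \<odot> (b p (snd a) \<oplus> b' p (snd a)) \<oplus>
      unit_row p (\<lambda>i. (- mulv {0..<s} (\<lambda>i j. M i j + M' i j) m i) \<odot> \<one>) a)"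
  proof (rule null_row_cong[OF null_row_add[OF represents_row[OF assms(1) p, of m] represents_row[OF assms(2) p, of m]]])
    fix a assume "a \<in> D"
    then have "b p (snd a) \<in> carrier \<A>" "b' p (snd a) \<in> carrier \<A>"
      using represents_closed[OF assms(1) p] represents_closed[OF assms(2) p] by auto
    then show "m (fst a) \<odot> b p (snd a) \<oplus> unit_row p (\<lambda>i. (- mulv {0..<s} M m i) \<odot> \<one>) a \<oplus>
        (m (fst a) \<odot> b' p (snd a) \<oplus> unit_row p (\<lambda>i. (- mulv {0..<s} M' m i) \<odot> \<one>) a) =
        m (fst a) \<odot> (b p (snd a) \<oplus> b' p (snd a)) \<oplus>
        unit_row p (\<lambda>i. (- mulv {0..<s} (\<lambda>i j. M i j + M' i j) m i) \<odot> \<one>) a"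
      unfolding e minus_add_distrib sm_add_left[OF one_closed] by (simp add: unit_row_def sm_add_right sm_add_left M.a_ac)
  qed
qed (use represents_closed[OF assms(1)] represents_closed[OF assms(2)] in auto)

lemma represents_scale:
  assumes "represents b M" shows "represents (\<lambda>p q. z \<odot> b p q) (\<lambda>i j. z * M i j)"
proof (rule representsI)
  fix m p assume p: "p < d"
  have e: "mulv {0..<s} (\<lambda>i j. z * M i j) m i = z * mulv {0..<s} M m i" for i
    unfolding mulv_def by (simp add: sum_distrib_left mult.assoc)
  show "null_row (\<lambda>a. m (fst a) \<odot> (z \<odot> b p (snd a)) \<oplus> unit_row p (\<lambda>i. (- mulv {0..<s} (\<lambda>i j. z * M i j) m i) \<odot> \<one>) a)"
  proof (rule null_row_cong[OF null_row_sm[OF represents_row[OF assms(1) p, of m]]])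
    fix a assume "a \<in> D"
    then have "b p (snd a) \<in> carrier \<A>"
      using represents_closed[OF assms(1) p] by auto
    then show "z \<odot> (m (fst a) \<odot> b p (snd a) \<oplus> unit_row p (\<lambda>i. (- mulv {0..<s} M m i) \<odot> \<one>) a) =
        m (fst a) \<odot> (z \<odot> b p (snd a)) \<oplus> unit_row p (\<lambda>i. (- mulv {0..<s} (\<lambda>i j. z * M i j) m i) \<odot> \<one>) a"
      unfolding e by (simp add: unit_row_def sm_add_right mult.commute)
  qed
qed (use represents_closed[OF assms(1)] in auto)

lemma finsum_unit_rows:
  assumes "\<And>r. r < d \<Longrightarrow> f r \<in> carrier \<A>" "\<And>r i. r < d \<Longrightarrow> i < s \<Longrightarrow> y r i \<in> carrier \<A>" "a \<in> D"
  shows "(\<Oplus>r\<in>{0..<d}. f r \<otimes> unit_row r (y r) a) = f (snd a) \<otimes> y (snd a) (fst a)"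
proof -
  have "(\<Oplus>r\<in>{0..<d}. f r \<otimes> unit_row r (y r) a) = (\<Oplus>r\<in>{0..<d}. if r = snd a then f r \<otimes> y r (fst a) else \<zero>)"
    using assms by (intro M.finsum_cong') (auto simp: unit_row_def)
  also have "\<dots> = f (snd a) \<otimes> y (snd a) (fst a)" using assms by (intro finsum_delta) auto
  finally show ?thesis .
qed

text \<open>Expanding row \<open>p\<close> of the product along the rows of \<open>b'\<close> turns
  \<open>m\<close> into \<open>M' m\<close> tensored with row \<open>p\<close> of \<open>b\<close>;
  one more reduction gives \<open>M (M' m)\<close> in copy \<open>p\<close>.\<close>

lemma represents_mult:
  assumes "represents b M" "represents b' M'"
  shows "represents (\<lambda>p q. \<Oplus>r\<in>{0..<d}. b p r \<otimes> b' r q) (\<lambda>i j. \<Sum>k\<in>{0..<s}. M i k * M' k j)"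
proof (rule representsI)
  note c = represents_closed[OF assms(1)] represents_closed[OF assms(2)]
  show cl: "(\<Oplus>r\<in>{0..<d}. b p r \<otimes> b' r q) \<in> carrier \<A>" if "p < d" "q < d" for p q
    using c that by (intro M.finsum_closed) auto
  fix m p assume p: "p < d"
  let ?m = "mulv {0..<s} M' m"
  let ?r = "\<lambda>r a. m (fst a) \<odot> b' r (snd a) \<oplus> unit_row r (\<lambda>i. (- ?m i) \<odot> \<one>) a"
  have n1: "null_row (\<lambda>a. \<Oplus>r\<in>{0..<d}. b p r \<otimes> ?r r a)"
    using c p represents_row[OF assms(2)] by (intro null_row_finsum null_row_mult) auto
  have n2: "null_row (\<lambda>a. ?m (fst a) \<odot> b p (snd a) \<oplus> unit_row p (\<lambda>i. (- mulv {0..<s} M ?m i) \<odot> \<one>) a)"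
    using represents_row[OF assms(1) p] .
  show "null_row (\<lambda>a. m (fst a) \<odot> (\<Oplus>r\<in>{0..<d}. b p r \<otimes> b' r (snd a)) \<oplus>
      unit_row p (\<lambda>i. (- mulv {0..<s} (\<lambda>i j. \<Sum>k\<in>{0..<s}. M i k * M' k j) m i) \<odot> \<one>) a)"
  proof (rule null_row_cong[OF null_row_add[OF n1 n2]])
    fix a assume a: "a \<in> D"
    then have i: "fst a < s" "snd a < d" by auto
    have "(\<Oplus>r\<in>{0..<d}. b p r \<otimes> ?r r a) =
      (\<Oplus>r\<in>{0..<d}. m (fst a) \<odot> (b p r \<otimes> b' r (snd a)) \<oplus> b p r \<otimes> unit_row r (\<lambda>i. (- ?m i) \<odot> \<one>) a)"
      using c p i a by (intro M.finsum_cong') (auto simp: r_distr unit_row_closed)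
    also have "\<dots> = (\<Oplus>r\<in>{0..<d}. m (fst a) \<odot> (b p r \<otimes> b' r (snd a))) \<oplus> (\<Oplus>r\<in>{0..<d}. b p r \<otimes> unit_row r (\<lambda>i. (- ?m i) \<odot> \<one>) a)"
      using c p i a by (intro M.finsum_addf) (auto simp: unit_row_closed)
    also have "(\<Oplus>r\<in>{0..<d}. m (fst a) \<odot> (b p r \<otimes> b' r (snd a))) = m (fst a) \<odot> (\<Oplus>r\<in>{0..<d}. b p r \<otimes> b' r (snd a))"
      using c p i by (intro sm_finsum[symmetric]) auto
    also have "(\<Oplus>r\<in>{0..<d}. b p r \<otimes> unit_row r (\<lambda>i. (- ?m i) \<odot> \<one>) a) = b p (snd a) \<otimes> ((- ?m (fst a)) \<odot> \<one>)"
      using c p a by (intro finsum_unit_rows) auto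
    finally have e: "(\<Oplus>r\<in>{0..<d}. b p r \<otimes> ?r r a) =
      m (fst a) \<odot> (\<Oplus>r\<in>{0..<d}. b p r \<otimes> b' r (snd a)) \<oplus> (- ?m (fst a)) \<odot> b p (snd a)"
      using c p i by simp
    have "A \<oplus> (- z) \<odot> B \<oplus> (z \<odot> B \<oplus> E) = A \<oplus> E"
      if "A \<in> carrier \<A>" "B \<in> carrier \<A>" "E \<in> carrier \<A>" for A B E z
      using that by (simp add: M.a_assoc sm_collect)
    then show "(\<Oplus>r\<in>{0..<d}. b p r \<otimes> ?r r a) \<oplus>
        (?m (fst a) \<odot> b p (snd a) \<oplus> unit_row p (\<lambda>i. (- mulv {0..<s} M ?m i) \<odot> \<one>) a) =
        m (fst a) \<odot> (\<Oplus>r\<in>{0..<d}. b p r \<otimes> b' r (snd a)) \<oplus>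
        unit_row p (\<lambda>i. (- mulv {0..<s} (\<lambda>i j. \<Sum>k\<in>{0..<s}. M i k * M' k j) m i) \<odot> \<one>) a"
      unfolding e mulv_prod using cl p i c a by (simp add: unit_row_closed)
  qed
qed

text \<open>Rows supported on one copy of \<open>\<complex>\<^sup>s\<close> are moved by every represented matrix: modulo null rows the
  vector \<open>b y\<close> is \<open>M y\<close>, and it is null whenever \<open>y\<close> is.\<close>

lemma represents_push:
  assumes b: "represents b M" and y: "\<And>p. p < d \<Longrightarrow> null_row (unit_row p y)" and p: "p < d"
  shows "null_row (unit_row p (\<lambda>i. \<Oplus>k\<in>{0..<s}. M i k \<odot> y k))"
proof -
  note c = represents_closed[OF b]
  have yc: "y i \<in> carrier \<A>" if "i < s" for i
    using null_row_closed[OF y[of 0], of "(i, 0)"] that d by (simp add: unit_row_def)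
  let ?e = "\<lambda>k j. if j = k then 1 else 0 :: complex"
  let ?r = "\<lambda>k a. ?e k (fst a) \<odot> b p (snd a) \<oplus> unit_row p (\<lambda>i. (- mulv {0..<s} M (?e k) i) \<odot> \<one>) a"
  \<comment> \<open>The row with entries \<open>b p q\<close> times \<open>y i\<close> is null by
    \<open>n2\<close>, and by \<open>n1\<close> it agrees with \<open>M y\<close> in copy
    \<open>p\<close>.\<close>
  have n1: "null_row (\<lambda>a. \<Oplus>k\<in>{0..<s}. y k \<otimes> ?r k a)"
    using yc represents_row[OF b p] by (intro null_row_finsum null_row_mult) auto
  have n2: "null_row (\<lambda>a. \<Oplus>r\<in>{0..<d}. b p r \<otimes> unit_row r y a)"
    using c p y by (intro null_row_finsum null_row_mult) auto
  show ?thesis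
  proof (rule null_row_cong[OF null_row_add[OF n2 null_row_sm[OF n1, of "-1"]]])
    fix a assume a: "a \<in> D"
    then have i: "fst a < s" "snd a < d" by auto
    have bc: "b p (snd a) \<in> carrier \<A>" using c p i by simp
    have "(\<Oplus>k\<in>{0..<s}. y k \<otimes> ?r k a) =
      (\<Oplus>k\<in>{0..<s}. (if k = fst a then b p (snd a) \<otimes> y k else \<zero>) \<oplus> (if snd a = p then (- 1) \<odot> (M (fst a) k \<odot> y k) else \<zero>))"
    proof (rule M.finsum_cong')
      fix k assume k: "k \<in> {0..<s}"
      then have "mulv {0..<s} M (?e k) (fst a) = M (fst a) k" by (intro mulv_unit) auto
      then show "y k \<otimes> ?r k a = (if k = fst a then b p (snd a) \<otimes> y k else \<zero>) \<oplus> (if snd a = p then (- 1) \<odot> (M (fst a) k \<odot> y k) else \<zero>)"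
        using k yc[of k] bc by (auto simp: unit_row_def r_distr m_comm)
    qed (use bc yc in auto)
    also have "\<dots> = (\<Oplus>k\<in>{0..<s}. if k = fst a then b p (snd a) \<otimes> y k else \<zero>) \<oplus>
        (\<Oplus>k\<in>{0..<s}. if snd a = p then (- 1) \<odot> (M (fst a) k \<odot> y k) else \<zero>)"
      using bc yc by (intro M.finsum_addf) auto
    also have "(\<Oplus>k\<in>{0..<s}. if k = fst a then b p (snd a) \<otimes> y k else \<zero>) = b p (snd a) \<otimes> y (fst a)"
      using i bc yc by (intro finsum_delta) auto
    also have "(\<Oplus>k\<in>{0..<s}. if snd a = p then (- 1) \<odot> (M (fst a) k \<odot> y k) else \<zero>) =
        (- 1) \<odot> unit_row p (\<lambda>i. \<Oplus>k\<in>{0..<s}. M i k \<odot> y k) a"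
      using sm_finsum[of "{0..<s}" "\<lambda>k. M (fst a) k \<odot> y k" "- 1"] yc by (auto simp: unit_row_def simp del: sm_assoc)
    finally have e1: "(\<Oplus>k\<in>{0..<s}. y k \<otimes> ?r k a) = b p (snd a) \<otimes> y (fst a) \<oplus> (- 1) \<odot> unit_row p (\<lambda>i. \<Oplus>k\<in>{0..<s}. M i k \<odot> y k) a" .
    have e2: "(\<Oplus>r\<in>{0..<d}. b p r \<otimes> unit_row r y a) = b p (snd a) \<otimes> y (fst a)"
      using c p a yc by (intro finsum_unit_rows) auto
    have uc: "unit_row p (\<lambda>i. \<Oplus>k\<in>{0..<s}. M i k \<odot> y k) a \<in> carrier \<A>"
      using yc a by (intro unit_row_closed M.finsum_closed) auto
    show "(\<Oplus>r\<in>{0..<d}. b p r \<otimes> unit_row r y a) \<oplus> (- 1) \<odot> (\<Oplus>k\<in>{0..<s}. y k \<otimes> ?r k a) =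
        unit_row p (\<lambda>i. \<Oplus>k\<in>{0..<s}. M i k \<odot> y k) a"
      unfolding e1 e2 using bc yc[OF i(1)] uc by (simp add: sm_add_right sm_collect)
  qed
qed

text \<open>Since \<open>S(e) = 1\<close>, the family
  \<open>m\<^sub>j v - (S(v) m)\<^sub>j e\<close> is annihilated by the pencil, so
  \<open>kernel\<close> reduces it to null tensors. Complex \<open>m\<close> are split into real and
  imaginary parts. \<open>\<Phi>\<close> is unital at \<open>u\<close> and not at \<open>e\<close>,
  so the term with \<open>x e\<close> remains here.\<close>

lemma null_row_pencil:
  assumes p: "p < d"
  shows "null_row (\<lambda>a. m (fst a) \<odot> x v p (snd a) \<oplus>
    (- mulv {0..<s} (\<lambda>i j. complex_of_real (S v i j)) m (fst a)) \<odot> x e p (snd a))"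
proof -
  have real: "null_row (\<lambda>a. complex_of_real (m (fst a)) \<odot> x v p (snd a) \<oplus>
      complex_of_real (- (\<Sum>k\<in>{0..<s}. S v (fst a) k * m k)) \<odot> x e p (snd a))" for m :: "nat \<Rightarrow> real"
  proof -
    let ?w = "\<lambda>j. m j *\<^sub>R v + (- (\<Sum>k\<in>{0..<s}. S v j k * m k)) *\<^sub>R e"
    have "null_row (\<lambda>a. x (?w (fst a)) p (snd a))"
    proof (rule kernel[of "\<lambda>w. null_row (\<lambda>a. x (w (fst a)) p (snd a))" ?w])
      fix w w' :: "nat \<Rightarrow> 'v"
      assume "null_row (\<lambda>a. x (w (fst a)) p (snd a))" "null_row (\<lambda>a. x (w' (fst a)) p (snd a))"
      from null_row_add[OF this] show "null_row (\<lambda>a. x (w (fst a) + w' (fst a)) p (snd a))"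
        by (rule null_row_cong) (use p in \<open>auto simp: x_add\<close>)
    next
      fix r and w :: "nat \<Rightarrow> 'v" assume "null_row (\<lambda>a. x (w (fst a)) p (snd a))"
      from null_row_sm[OF this, of "complex_of_real r"] show "null_row (\<lambda>a. x (r *\<^sub>R w (fst a)) p (snd a))"
        by (rule null_row_cong) (use p in \<open>auto simp: x_scale\<close>)
    next
      fix w w' :: "nat \<Rightarrow> 'v" assume "\<And>j. j < s \<Longrightarrow> w j = w' j" "null_row (\<lambda>a. x (w (fst a)) p (snd a))"
      then show "null_row (\<lambda>a. x (w' (fst a)) p (snd a))" by (elim null_row_cong) auto
    next
      fix m' c assume c: "c \<in> C" "\<And>i. i < s \<Longrightarrow> (\<Sum>j\<in>{0..<s}. S c i j * m' j) = 0"
      from null_row_kernel[OF this p] show "null_row (\<lambda>a. x (m' (fst a) *\<^sub>R c) p (snd a))"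
        by (rule null_row_cong) (use p in \<open>auto simp: x_scale\<close>)
    next
      fix i assume i: "i < s"
      have "(\<Sum>j\<in>{0..<s}. S (?w j) i j) = (\<Sum>j\<in>{0..<s}. m j * S v i j - (if j = i then (\<Sum>k\<in>{0..<s}. S v j k * m k) else 0))"
      proof (rule sum.cong)
        fix j assume j: "j \<in> {0..<s}"
        have "S (?w j) i j = m j * S v i j + (- (\<Sum>k\<in>{0..<s}. S v j k * m k)) * S e i j" by (simp only: S_add S_scale)
        then show "S (?w j) i j = m j * S v i j - (if j = i then (\<Sum>k\<in>{0..<s}. S v j k * m k) else 0)"
          using i j by (simp add: S_e)
      qed simp
      also have "\<dots> = 0" using i by (simp add: sum_subtractf mult.commute)
      finally show "(\<Sum>j\<in>{0..<s}. S (?w j) i j) = 0" .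
    qed
    then show ?thesis by (rule null_row_cong) (use p in \<open>auto simp: x_add x_scale simp del: of_real_minus scaleR_minus_left\<close>)
  qed
  from null_row_add[OF real[of "\<lambda>j. Re (m j)"] null_row_sm[OF real[of "\<lambda>j. Im (m j)"], of \<i>]]
  show ?thesis
  proof (rule null_row_cong)
    fix a assume a: "a \<in> D"
    then have c: "x v p (snd a) \<in> carrier \<A>" "x e p (snd a) \<in> carrier \<A>" using p by auto
    let ?R = "\<Sum>k\<in>{0..<s}. S v (fst a) k * Re (m k)" and ?I = "\<Sum>k\<in>{0..<s}. S v (fst a) k * Im (m k)"
    have "complex_of_real (Re (m (fst a))) + \<i> * complex_of_real (Im (m (fst a))) = m (fst a)"
      by (simp add: complex_eq[symmetric])
    moreover have "complex_of_real (- ?R) + \<i> * complex_of_real (- ?I) = - mulv {0..<s} (\<lambda>i j. complex_of_real (S v i j)) m (fst a)"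
      by (simp add: complex_eq_iff mulv_def)
    moreover have "(z \<odot> A \<oplus> w \<odot> B) \<oplus> \<i> \<odot> (z' \<odot> A \<oplus> w' \<odot> B) = (z + \<i> * z') \<odot> A \<oplus> (w + \<i> * w') \<odot> B"
      if "A \<in> carrier \<A>" "B \<in> carrier \<A>" for A B z w z' w'
      using that by (simp add: sm_add_left sm_add_right M.a_ac)
    ultimately show "complex_of_real (Re (m (fst a))) \<odot> x v p (snd a) \<oplus> complex_of_real (- ?R) \<odot> x e p (snd a) \<oplus>
        \<i> \<odot> (complex_of_real (Im (m (fst a))) \<odot> x v p (snd a) \<oplus> complex_of_real (- ?I) \<odot> x e p (snd a)) =
        m (fst a) \<odot> x v p (snd a) \<oplus> (- mulv {0..<s} (\<lambda>i j. complex_of_real (S v i j)) m (fst a)) \<odot> x e p (snd a)"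
      using c by presburger
  qed
qed

definition represented :: "(nat \<Rightarrow> nat \<Rightarrow> complex) \<Rightarrow> bool" where
  "represented M \<longleftrightarrow> (\<exists>b. represents b M)"

lemma represented_cong:
  "(\<And>i j. i < s \<Longrightarrow> j < s \<Longrightarrow> M i j = N i j) \<Longrightarrow> represented M \<Longrightarrow> represented N"
  unfolding represented_def using represents_cong by blast

lemma represented_algebra:
  shows "represented (\<lambda>i j. if i = j then 1 else 0)"
    and "represented M \<Longrightarrow> represented N \<Longrightarrow> represented (\<lambda>i j. M i j + N i j)"
    and "represented M \<Longrightarrow> represented (\<lambda>i j. z * M i j)"
    and "represented M \<Longrightarrow> represented N \<Longrightarrow> represented (\<lambda>i j. \<Sum>k\<in>{0..<s}. M i k * N k j)"
  unfolding represented_def using represents_one represents_add represents_scale represents_mult by blast+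

text \<open>With \<open>U = S(u)\<close> the algebra of represented matrices contains \<open>U\<^sup>-\<^sup>1 S(v)\<close> for all \<open>v\<close>; it contains
  \<open>U\<close> as well, since \<open>\<Prod>(1 - \<mu> U\<^sup>-\<^sup>1) = 0\<close> over the eigenvalues \<open>\<mu>\<close> of \<open>U\<close>.\<close>

lemma represented_pencil: "represented (\<lambda>i j. complex_of_real (S v i j))"
proof -
  let ?I = "{0..<s}"
  define U where "U i j = complex_of_real (S u i j)" for i j
  have "herm ?I U" by (rule hermI) (simp add: U_def S_sym)
  then obtain f \<mu> where f: "orthonormal ?I ?I f"
    and f': "\<And>k i. k \<in> ?I \<Longrightarrow> i \<in> ?I \<Longrightarrow> mulv ?I U (f k) i = of_real (\<mu> k) * f k i"
    using spectral[of ?I U] by blast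
  have \<mu>: "\<mu> k > 0" if k: "k \<in> ?I" for k
  proof -
    have fk: "ip ?I (f k) (f k) = 1" using f k unfolding orthonormal_def by simp
    have "form ?I U (f k) = of_real (\<mu> k)" using f'[OF k] fk by (rule form_eigenvector)
    then have "\<mu> k = Re (form ?I U (f k))" by simp
    also have "\<dots> = (\<Sum>i\<in>?I. \<Sum>j\<in>?I. Re (f k i) * S u i j * Re (f k j)) + (\<Sum>i\<in>?I. \<Sum>j\<in>?I. Im (f k i) * S u i j * Im (f k j))"
      unfolding form_expand sum.distrib[symmetric] Re_sum U_def by (intro sum.cong refl) (simp add: algebra_simps)
    also have "\<dots> \<ge> \<delta> * (\<Sum>i\<in>?I. (Re (f k i))\<^sup>2) + \<delta> * (\<Sum>i\<in>?I. (Im (f k i))\<^sup>2)"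
      using S_u by (intro add_mono)
    also have "\<delta> * (\<Sum>i\<in>?I. (Re (f k i))\<^sup>2) + \<delta> * (\<Sum>i\<in>?I. (Im (f k i))\<^sup>2) = \<delta> * Re (ip ?I (f k) (f k))"
      unfolding ip_self by (simp add: cmod_power2 sum.distrib distrib_left)
    finally show ?thesis using \<delta> fk by simp
  qed
  \<comment> \<open>The inverse of \<open>U\<close>; the eigenvalues \<open>\<mu>\<close> are
    positive by \<open>S_u\<close>.\<close>
  define W where "W i j = (\<Sum>k\<in>?I. of_real (1 / \<mu> k) * f k i * cnj (f k j))" for i j
  have UW: "(\<Sum>k\<in>?I. U i k * W k j) = (if i = j then 1 else 0)" if ij: "i \<in> ?I" "j \<in> ?I" for i j
  proof -
    have "(\<Sum>k\<in>?I. U i k * W k j) = (\<Sum>k\<in>?I. \<Sum>l\<in>?I. of_real (1 / \<mu> l) * cnj (f l j) * (U i k * f l k))"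
      unfolding W_def by (simp add: sum_distrib_left mult_ac)
    also have "\<dots> = (\<Sum>l\<in>?I. \<Sum>k\<in>?I. of_real (1 / \<mu> l) * cnj (f l j) * (U i k * f l k))" by (rule sum.swap)
    also have "\<dots> = (\<Sum>l\<in>?I. of_real (1 / \<mu> l) * cnj (f l j) * mulv ?I U (f l) i)"
      unfolding mulv_def by (simp add: sum_distrib_left)
    also have "\<dots> = (\<Sum>l\<in>?I. f l i * cnj (f l j))"
    proof (rule sum.cong)
      fix l assume l: "l \<in> ?I"
      have "complex_of_real (1 / \<mu> l) * complex_of_real (\<mu> l) = 1" using \<mu>[OF l] by simp
      then show "of_real (1 / \<mu> l) * cnj (f l j) * mulv ?I U (f l) i = f l i * cnj (f l j)"
        unfolding f'[OF l ij(1)] by (metis (no_types, lifting) mult.assoc mult.commute mult.left_neutral)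
    qed simp
    also have "\<dots> = (if i = j then 1 else 0)" using f ij by (intro orthonormal_complete) auto
    finally show ?thesis .
  qed
  have UWm: "mulv ?I U (mulv ?I W m) i = m i" if "i < s" for m i
  proof -
    have "mulv ?I U (mulv ?I W m) i = mulv ?I (\<lambda>i j. \<Sum>k\<in>?I. U i k * W k j) m i" by (rule mulv_prod[symmetric])
    also have "\<dots> = (\<Sum>j\<in>?I. if i = j then m j else 0)"
      unfolding mulv_def using UW that by (intro sum.cong) auto
    finally show ?thesis using that by simp
  qed
  have rep: "represents (x v) (\<lambda>i j. \<Sum>k\<in>?I. W i k * complex_of_real (S v k j))" for v
  proof (rule representsI)
    fix m p assume p: "p < d"
    let ?n = "mulv ?I (\<lambda>i j. complex_of_real (S v i j)) m"
    \<comment> \<open>The relation for \<open>u\<close> and the vector \<open>W S(v) m\<close> has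
      the same term with \<open>x e\<close>. Subtracting it leaves \<open>x v\<close> and
      \<open>x u\<close>, and \<open>x u\<close> is the identity.\<close>
    have "null_row (\<lambda>a. mulv ?I W ?n (fst a) \<odot> x u p (snd a) \<oplus> (- mulv ?I U (mulv ?I W ?n) (fst a)) \<odot> x e p (snd a))"
      unfolding U_def using p by (rule null_row_pencil)
    from null_row_add[OF null_row_pencil[OF p, of m v] null_row_sm[OF this, of "- 1"]]
    show "null_row (\<lambda>a. m (fst a) \<odot> x v p (snd a) \<oplus>
        unit_row p (\<lambda>i. (- mulv ?I (\<lambda>i j. \<Sum>k\<in>?I. W i k * complex_of_real (S v k j)) m i) \<odot> \<one>) a)"
    proof (rule null_row_cong)
      fix a assume a: "a \<in> D"
      then have i: "fst a < s" "snd a < d" by auto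
      have "A \<oplus> (- z) \<odot> B \<oplus> (- 1) \<odot> (w \<odot> E \<oplus> (- z) \<odot> B) = A \<oplus> (- w) \<odot> E"
        if "A \<in> carrier \<A>" "B \<in> carrier \<A>" "E \<in> carrier \<A>" for A B E z w
      proof -
        have "A \<oplus> (- z) \<odot> B \<oplus> (- 1) \<odot> (w \<odot> E \<oplus> (- z) \<odot> B) = A \<oplus> (- w) \<odot> E \<oplus> ((- z) \<odot> B \<oplus> z \<odot> B)"
          using that by (simp add: sm_add_right M.a_ac)
        then show ?thesis using that by (simp add: sm_collect)
      qed
      then show "m (fst a) \<odot> x v p (snd a) \<oplus> (- ?n (fst a)) \<odot> x e p (snd a) \<oplus>
          (- 1) \<odot> (mulv ?I W ?n (fst a) \<odot> x u p (snd a) \<oplus> (- mulv ?I U (mulv ?I W ?n) (fst a)) \<odot> x e p (snd a)) =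
          m (fst a) \<odot> x v p (snd a) \<oplus>
          unit_row p (\<lambda>i. (- mulv ?I (\<lambda>i j. \<Sum>k\<in>?I. W i k * complex_of_real (S v k j)) m i) \<odot> \<one>) a"
        unfolding UWm[OF i(1)] mulv_prod using p i by (auto simp: unit_row_def x_u)
    qed
  qed simp
  have W: "represented W"
  proof (rule represented_cong)
    show "represented (\<lambda>i j. \<Sum>k\<in>?I. W i k * complex_of_real (S e k j))"
      unfolding represented_def using rep by blast
    fix i j assume "i < s" "j < s"
    then have "(\<Sum>k\<in>?I. W i k * complex_of_real (S e k j)) = (\<Sum>k\<in>?I. if k = j then W i k else 0)"
      by (intro sum.cong) (auto simp: S_e)
    then show "(\<Sum>k\<in>?I. W i k * complex_of_real (S e k j)) = W i j" using \<open>j < s\<close> by simp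
  qed
  have Wf: "mulv ?I W (f k) i = of_real (1 / \<mu> k) * f k i" if k: "k \<in> ?I" for k i
  proof -
    have "mulv ?I W (f k) i = (\<Sum>j\<in>?I. \<Sum>l\<in>?I. of_real (1 / \<mu> l) * f l i * (cnj (f l j) * f k j))"
      unfolding mulv_def W_def sum_distrib_right by (intro sum.cong refl) (simp add: mult_ac)
    also have "\<dots> = (\<Sum>l\<in>?I. \<Sum>j\<in>?I. of_real (1 / \<mu> l) * f l i * (cnj (f l j) * f k j))" by (rule sum.swap)
    also have "\<dots> = (\<Sum>l\<in>?I. of_real (1 / \<mu> l) * f l i * ip ?I (f l) (f k))"
      unfolding ip_def by (simp add: sum_distrib_left)
    also have "\<dots> = (\<Sum>l\<in>?I. if l = k then of_real (1 / \<mu> l) * f l i else 0)"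
      using f k unfolding orthonormal_def by (intro sum.cong) auto
    finally show ?thesis using k by simp
  qed
  have "\<exists>M. represented M \<and> (\<forall>k\<in>?I. \<forall>i\<in>?I. mulv ?I M (f k) i = of_real (\<mu> k * (1 - (\<Prod>i\<in>J. 1 - \<mu> i / \<mu> k))) * f k i)"
    if "finite J" for J
    using that
  proof (induction J rule: finite_induct)
    case empty
    have "represented (\<lambda>i j. 0 * W i j)" using W by (rule represented_algebra)
    then show ?case by (intro exI[of _ "\<lambda>i j. 0 * W i j"]) (simp add: mulv_def)
  next
    case (insert l J)
    then obtain M where M: "represented M"
      and Mf: "\<And>k i. k \<in> ?I \<Longrightarrow> i \<in> ?I \<Longrightarrow>
        mulv ?I M (f k) i = of_real (\<mu> k * (1 - (\<Prod>i\<in>J. 1 - \<mu> i / \<mu> k))) * f k i" by blast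
    let ?z = "complex_of_real (\<mu> l)"
    \<comment> \<open>\<open>M\<close> is
      \<open>U (1 - \<Prod>(1 - \<mu>\<^sub>i U\<^sup>-\<^sup>1))\<close>, obtained as a polynomial
      in \<open>W\<close>; one more factor amounts to adding
      \<open>\<mu>\<^sub>l (1 - M W)\<close>.\<close>
    let ?N = "\<lambda>i j. M i j + (?z * (if i = j then 1 else 0) + (- ?z) * (\<Sum>k\<in>?I. M i k * W k j))"
    have "represented ?N" using M W by (intro represented_algebra)
    moreover have "mulv ?I ?N (f k) i = of_real (\<mu> k * (1 - (\<Prod>i\<in>insert l J. 1 - \<mu> i / \<mu> k))) * f k i"
      if k: "k \<in> ?I" and i: "i \<in> ?I" for k i
    proof -
      let ?P = "\<Prod>i\<in>J. 1 - \<mu> i / \<mu> k"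
      have W': "mulv ?I M (mulv ?I W (f k)) i = of_real (1 / \<mu> k) * mulv ?I M (f k) i"
        unfolding Wf[OF k] mulv_mult ..
      have "(\<Sum>j\<in>?I. (if i = j then 1 else 0) * f k j) = (\<Sum>j\<in>?I. if i = j then f k j else 0)"
        by (intro sum.cong) auto
      then have one: "(\<Sum>j\<in>?I. (if i = j then 1 else 0) * f k j) = f k i" using i by simp
      have "mulv ?I ?N (f k) i = mulv ?I M (f k) i + (?z * (\<Sum>j\<in>?I. (if i = j then 1 else 0) * f k j) +
          (- ?z) * mulv ?I (\<lambda>i j. \<Sum>k\<in>?I. M i k * W k j) (f k) i)"
        unfolding mulv_lincomb by (simp only: mulv_def)
      also have "\<dots> = of_real (\<mu> k * (1 - ?P) + (\<mu> l - \<mu> l * (1 / \<mu> k * (\<mu> k * (1 - ?P))))) * f k i"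
        unfolding mulv_prod W' one Mf[OF k i] by (simp add: algebra_simps)
      also have "\<mu> k * (1 - ?P) + (\<mu> l - \<mu> l * (1 / \<mu> k * (\<mu> k * (1 - ?P)))) = \<mu> k * (1 - (1 - \<mu> l / \<mu> k) * ?P)"
        using \<mu>[OF k] by (simp add: field_simps)
      also have "(1 - \<mu> l / \<mu> k) * ?P = (\<Prod>i\<in>insert l J. 1 - \<mu> i / \<mu> k)"
        using insert.hyps by simp
      finally show ?thesis .
    qed
    ultimately show ?case by blast
  qed
  from this[of ?I] obtain M where M: "represented M" and Mf: "\<forall>k\<in>?I. \<forall>i\<in>?I.
    mulv ?I M (f k) i = of_real (\<mu> k * (1 - (\<Prod>i\<in>?I. 1 - \<mu> i / \<mu> k))) * f k i" by blast
  have Mf': "mulv ?I M (f k) i = of_real (\<mu> k) * f k i" if "k \<in> ?I" "i \<in> ?I" for k i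
  proof -
    have z: "(\<Prod>i\<in>?I. 1 - \<mu> i / \<mu> k) = 0" using that \<mu>[of k] by (intro prod_zero bexI[of _ k]) auto
    show ?thesis using Mf[rule_format, OF that] unfolding z by simp
  qed
  have U: "represented U"
  proof (rule represented_cong[OF _ M])
    fix i j assume "i < s" "j < s"
    then show "M i j = U i j"
      using spectral_expand[OF _ f Mf', of i j] spectral_expand[OF _ f f', of i j] by simp
  qed
  have "represented (\<lambda>i j. \<Sum>k\<in>?I. W i k * complex_of_real (S v k j))"
    unfolding represented_def using rep by blast
  from represented_algebra(4)[OF U this] show ?thesis
  proof (rule represented_cong[rotated])
    fix i j assume "i < s" "j < s"
    then show "(\<Sum>k\<in>?I. U i k * (\<Sum>l\<in>?I. W k l * complex_of_real (S v l j))) = complex_of_real (S v i j)"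
      using UWm[of i "\<lambda>l. complex_of_real (S v l j)"] unfolding mulv_def by simp
  qed
qed

lemma represented_unit:
  assumes "a \<le> d" "b \<le> d" shows "represented (\<lambda>i j. if i = a \<and> j = b then 1 else 0)"
proof (rule generation[of represented a b])
  show "represented (\<lambda>i j. complex_of_real (S v i j))" for v by (rule represented_pencil)
  show "represented (\<lambda>i j. M i j + N i j)" if "represented M" "represented N" for M N
    using that by (rule represented_algebra)
  show "represented (\<lambda>i j. z * M i j)" if "represented M" for z M using that by (rule represented_algebra)
  show "represented (\<lambda>i j. \<Sum>k\<in>{0..<s}. M i k * N k j)" if "represented M" "represented N" for M N
    using that by (rule represented_algebra)
  show "represented N" if "\<And>i j. i < s \<Longrightarrow> j < s \<Longrightarrow> M i j = N i j" "represented M" for M N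
    using that by (rule represented_cong)
qed (use assms in auto)

section \<open>The rank argument\<close>

definition null_ideal :: "'a set" where
  "null_ideal = {a \<in> carrier \<A>. \<forall>p<d. null_row (unit_row p (\<lambda>i. if i = 0 then a else \<zero>))}"

lemma absorbing_null_ideal: "absorbing null_ideal"
proof -
  have "null_row (unit_row p (\<lambda>i. if i = 0 then a \<oplus> b else \<zero>))"
    if "a \<in> null_ideal" "b \<in> null_ideal" "p < d" for a b p
    by (rule null_row_cong[OF null_row_add[of "unit_row p (\<lambda>i. if i = 0 then a else \<zero>)" "unit_row p (\<lambda>i. if i = 0 then b else \<zero>)"]])
      (use that in \<open>auto simp: unit_row_def null_ideal_def\<close>)
  moreover have "null_row (unit_row p (\<lambda>i. if i = 0 then c \<otimes> a else \<zero>))"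
    if "a \<in> null_ideal" "c \<in> carrier \<A>" "p < d" for a c p
    by (rule null_row_cong[OF null_row_mult[of "unit_row p (\<lambda>i. if i = 0 then a else \<zero>)" c]])
      (use that in \<open>auto simp: unit_row_def null_ideal_def\<close>)
  moreover have "null_row (unit_row p (\<lambda>i. if i = 0 then \<zero> else \<zero>))" for p
    by (rule null_row_cong[OF null_row_zero]) (auto simp: unit_row_def)
  ultimately show ?thesis unfolding absorbing_def by (auto simp: null_ideal_def)
qed

lemma one_not_null: "\<one> \<notin> null_ideal"
proof
  assume *: "\<one> \<in> null_ideal"
  have "null_row (unit_row p (\<lambda>i. (if i = 0 then 1 else 0) \<odot> \<one>))" if "p < d" for p
    by (rule null_row_cong[of "unit_row p (\<lambda>i. if i = 0 then \<one> else \<zero>)"])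
      (use that * in \<open>auto simp: unit_row_def null_ideal_def\<close>)
  from separation[OF this, of 0] d show False by simp
qed

text \<open>The matrix unit at \<open>(l, 0)\<close> carries \<open>t\<close> from coordinate 0 to
  coordinate \<open>l\<close>.\<close>

lemma null_ideal_transport:
  assumes t: "t \<in> null_ideal" and l: "l \<le> d" and p: "p < d"
  shows "null_row (unit_row p (\<lambda>i. if i = l then t else \<zero>))"
proof -
  have tc: "t \<in> carrier \<A>" using t by (simp add: null_ideal_def)
  obtain b where b: "represents b (\<lambda>i j. if i = l \<and> j = 0 then 1 else 0)"
    using represented_unit[OF l, of 0] unfolding represented_def by auto
  have "null_row (unit_row p (\<lambda>i. \<Oplus>k\<in>{0..<s}. (if i = l \<and> k = 0 then 1 else 0) \<odot> (if k = 0 then t else \<zero>)))"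
    using t by (intro represents_push[OF b _ p]) (auto simp: null_ideal_def)
  then show ?thesis
  proof (rule null_row_cong)
    fix a
    have "(\<Oplus>k\<in>{0..<s}. (if i = l \<and> k = 0 then 1 else 0) \<odot> (if k = 0 then t else \<zero>)) =
      (\<Oplus>k\<in>{0..<s}. if k = 0 then (if i = l then t else \<zero>) else \<zero>)" for i
      using tc by (intro M.finsum_cong') auto
    moreover have "(\<Oplus>k\<in>{0..<s}. if k = 0 then (if i = l then t else \<zero>) else \<zero>) = (if i = l then t else \<zero>)" for i
      using tc d by (intro finsum_delta) auto
    ultimately show "unit_row p (\<lambda>i. \<Oplus>k\<in>{0..<s}. (if i = l \<and> k = 0 then 1 else 0) \<odot> (if k = 0 then t else \<zero>)) a =
      unit_row p (\<lambda>i. if i = l then t else \<zero>) a" by (simp add: unit_row_def)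
  qed
qed

text \<open>The \<open>(d + 1)\<^sup>2\<close> matrix units are represented by elements of \<open>Mat\<^sub>d(\<A>)\<close>, hence satisfy a linear
  relation over \<open>\<A>\<close> modulo the null ideal, since \<open>Mat\<^sub>d(\<A>)\<close> has rank \<open>d\<^sup>2\<close>. Acting on rows, the relation
  puts its own coefficients into the null ideal.\<close>

theorem no_embedded_pencil: False
proof -
  let ?E = "\<lambda>i l i' j'. if i' = (i::nat) \<and> j' = (l::nat) then 1 else 0 :: complex"
  define b where "b i l = (SOME b. represents b (?E i l))" for i l
  have b: "represents (b i l) (?E i l)" if "i \<le> d" "l \<le> d" for i l
    using someI_ex[of "\<lambda>b. represents b (?E i l)"] represented_unit[OF that] unfolding b_def represented_def by blast
  let ?K = "{0..d} \<times> {0..d}" and ?P = "{0..<d} \<times> {0..<d}"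
  have bc: "b (fst k) (snd k) p q \<in> carrier \<A>" if "k \<in> ?K" "p < d" "q < d" for k p q
    using represents_closed[OF b] that by auto
  have "d * d < Suc d * Suc d" by simp
  then have "\<exists>a. (\<forall>k\<in>?K. a k \<in> carrier \<A>) \<and> (\<exists>k\<in>?K. a k \<notin> null_ideal) \<and>
      (\<forall>c\<in>?P. (\<Oplus>k\<in>?K. a k \<otimes> b (fst k) (snd k) (fst c) (snd c)) \<in> null_ideal)"
    using bc by (intro underdetermined_system absorbing_null_ideal one_not_null) (auto simp: card_cartesian_product)
  then obtain a where a: "\<forall>k\<in>?K. a k \<in> carrier \<A>" and nz: "\<exists>k\<in>?K. a k \<notin> null_ideal"
    and rel': "\<forall>c\<in>?P. (\<Oplus>k\<in>?K. a k \<otimes> b (fst k) (snd k) (fst c) (snd c)) \<in> null_ideal" by blast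
  have ac: "a k \<in> carrier \<A>" if "k \<in> ?K" for k using a that by blast
  have rel: "(\<Oplus>k\<in>?K. a k \<otimes> b (fst k) (snd k) p q) \<in> null_ideal" if "p < d" "q < d" for p q
    using rel'[rule_format, of "(p, q)"] that by simp
  from nz obtain i0 l0 where i0: "i0 \<le> d" and l0: "l0 \<le> d" and nz: "a (i0, l0) \<notin> null_ideal" by auto
  define t where "t p q = (\<Oplus>k\<in>?K. a k \<otimes> b (fst k) (snd k) p q)" for p q
  have tc: "t p q \<in> carrier \<A>" if "p < d" "q < d" for p q
    using rel[OF that] by (simp add: t_def null_ideal_def)
  \<comment> \<open>Column \<open>l0\<close> of the coefficients: the combination of matrix units,
    applied to the unit vector \<open>l0\<close>, yields this vector.\<close>
  define y where "y i = (if i \<le> d then a (i, l0) else \<zero>)" for i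
  have yc: "y i \<in> carrier \<A>" for i using ac l0 by (simp add: y_def)
  have y: "null_row (unit_row p y)" if p: "p < d" for p
  proof -
    have "null_row (\<lambda>c. \<Oplus>r\<in>{0..<d}. \<one> \<otimes> unit_row r (\<lambda>i. if i = l0 then t p r else \<zero>) c)"
      using rel[OF p] l0 by (intro null_row_finsum null_row_mult null_ideal_transport) (auto simp: t_def)
    then have n1: "null_row (\<lambda>c. if fst c = l0 then t p (snd c) else \<zero>)"
      by (rule null_row_cong) (subst finsum_unit_rows, use tc p in auto)
    let ?e = "\<lambda>i. if i = l0 then 1 else 0 :: complex"
    let ?r = "\<lambda>k c. ?e (fst c) \<odot> b (fst k) (snd k) p (snd c) \<oplus>
      unit_row p (\<lambda>i. (- mulv {0..<s} (?E (fst k) (snd k)) ?e i) \<odot> \<one>) c"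
    have "null_row (\<lambda>c. \<Oplus>k\<in>?K. a k \<otimes> ?r k c)"
      using ac by (intro null_row_finsum null_row_mult represents_row[OF b p]) auto
    from null_row_add[OF n1 null_row_sm[OF this, of "- 1"]] show ?thesis
    proof (rule null_row_cong)
      fix c assume c: "c \<in> D"
      then have q: "fst c < s" "snd c < d" by auto
      have l0s: "l0 \<in> {0..<s}" using l0 d by auto
      have "(\<Oplus>k\<in>?K. a k \<otimes> ?r k c) =
        (\<Oplus>k\<in>?K. (if fst c = l0 then a k \<otimes> b (fst k) (snd k) p (snd c) else \<zero>) \<oplus>
          (if k = (fst c, l0) then (if snd c = p then (- 1) \<odot> a k else \<zero>) else \<zero>))"
        using ac bc[OF _ p q(2)] by (intro M.finsum_cong') (auto simp: unit_row_def r_distr mulv_unit[OF _ l0s] prod_eq_iff)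
      also have "\<dots> = (\<Oplus>k\<in>?K. if fst c = l0 then a k \<otimes> b (fst k) (snd k) p (snd c) else \<zero>) \<oplus>
          (\<Oplus>k\<in>?K. if k = (fst c, l0) then (if snd c = p then (- 1) \<odot> a k else \<zero>) else \<zero>)"
        using ac bc[OF _ p q(2)] by (intro M.finsum_addf) auto
      also have "(\<Oplus>k\<in>?K. if fst c = l0 then a k \<otimes> b (fst k) (snd k) p (snd c) else \<zero>) = (if fst c = l0 then t p (snd c) else \<zero>)"
        by (auto simp: t_def)
      also have "(\<Oplus>k\<in>?K. if k = (fst c, l0) then (if snd c = p then (- 1) \<odot> a k else \<zero>) else \<zero>) = (- 1) \<odot> unit_row p y c"
      proof (cases "fst c \<le> d")
        case True
        then have "(\<Oplus>k\<in>?K. if k = (fst c, l0) then (if snd c = p then (- 1) \<odot> a k else \<zero>) else \<zero>) =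
          (if snd c = p then (- 1) \<odot> a (fst c, l0) else \<zero>)"
          using ac l0 by (intro finsum_delta) auto
        then show ?thesis using True by (simp add: unit_row_def y_def)
      next
        case False
        then have "(\<Oplus>k\<in>?K. if k = (fst c, l0) then (if snd c = p then (- 1) \<odot> a k else \<zero>) else \<zero>) = (\<Oplus>k\<in>?K. \<zero>)"
          by (intro M.finsum_cong') auto
        then show ?thesis using False by (simp add: unit_row_def y_def)
      qed
      finally have e: "(\<Oplus>k\<in>?K. a k \<otimes> ?r k c) = (if fst c = l0 then t p (snd c) else \<zero>) \<oplus> (- 1) \<odot> unit_row p y c" .
      have "unit_row p y c \<in> carrier \<A>" "(if fst c = l0 then t p (snd c) else \<zero>) \<in> carrier \<A>"
        using yc tc p q by (auto simp: unit_row_def)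
      then show "(if fst c = l0 then t p (snd c) else \<zero>) \<oplus> (- 1) \<odot> (\<Oplus>k\<in>?K. a k \<otimes> ?r k c) = unit_row p y c"
        unfolding e by (simp add: sm_add_right sm_collect split del: if_split)
    qed
  qed
  \<comment> \<open>The matrix unit at \<open>(0, i0)\<close> isolates the coefficient that was
    chosen outside the ideal.\<close>
  have "null_row (unit_row p (\<lambda>i. if i = 0 then a (i0, l0) else \<zero>))" if p: "p < d" for p
  proof (rule null_row_cong[OF represents_push[OF b[of 0 i0] y p]])
    fix c
    have "(\<Oplus>k\<in>{0..<s}. ?E 0 i0 i k \<odot> y k) = (\<Oplus>k\<in>{0..<s}. if k = i0 then (if i = 0 then y i0 else \<zero>) else \<zero>)" for i
      using yc by (intro M.finsum_cong') auto
    moreover have "(\<Oplus>k\<in>{0..<s}. if k = i0 then (if i = 0 then y i0 else \<zero>) else \<zero>) = (if i = 0 then y i0 else \<zero>)" for i :: nat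
      using yc i0 d by (intro finsum_delta) auto
    moreover have "y i0 = a (i0, l0)" using i0 by (simp add: y_def)
    ultimately show "unit_row p (\<lambda>i. \<Oplus>k\<in>{0..<s}. ?E 0 i0 i k \<odot> y k) c = unit_row p (\<lambda>i. if i = 0 then a (i0, l0) else \<zero>) c"
      by (simp add: unit_row_def)
  qed (use i0 in auto)
  then have "a (i0, l0) \<in> null_ideal" using ac i0 l0 by (simp add: null_ideal_def)
  then show False using nz by blast
qed

end

section \<open>Subhomogeneity from positive maps\<close>

text \<open>Bounded functions on a whole type with the supremum norm. Later the points are
  candidates for positive maps and the embedding is evaluation.\<close>

definition function_algebra :: "('k \<Rightarrow> complex) cstar_algebra" where
  "function_algebra =
     \<lparr>carrier = {f. bounded (range f)}, mult = (\<lambda>f g t. f t * g t), one = (\<lambda>_. 1), zero = (\<lambda>_. 0),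
      add = (\<lambda>f g t. f t + g t), smult = (\<lambda>a f t. a * f t), star = (\<lambda>f t. cnj (f t)),
      cnorm = (\<lambda>f. SUP t. cmod (f t))\<rparr>"

lemma function_algebra_simps:
  "f \<in> carrier function_algebra \<longleftrightarrow> (\<exists>B. \<forall>t. cmod (f t) \<le> B)"
  "f \<otimes>\<^bsub>function_algebra\<^esub> g = (\<lambda>t. f t * g t)" "\<one>\<^bsub>function_algebra\<^esub> = (\<lambda>_. 1)"
  "f \<oplus>\<^bsub>function_algebra\<^esub> g = (\<lambda>t. f t + g t)" "\<zero>\<^bsub>function_algebra\<^esub> = (\<lambda>_. 0)"
  "a \<odot>\<^bsub>function_algebra\<^esub> f = (\<lambda>t. a * f t)" "star function_algebra f = (\<lambda>t. cnj (f t))"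
  "cnorm function_algebra f = (SUP t. cmod (f t))"
  by (auto simp: function_algebra_def bounded_iff)

lemma cmod_le_sup: "\<exists>B. \<forall>t. cmod (f t) \<le> B \<Longrightarrow> cmod (f t) \<le> (SUP t. cmod (f t))"
  by (rule cSUP_upper) (auto simp: bdd_above_def)

lemma sup_cmod_le: "(\<And>t. cmod (f t) \<le> B) \<Longrightarrow> (SUP t. cmod (f t)) \<le> B"
  by (rule cSUP_least) auto

lemma bounded_functions_closed:
  fixes f g :: "'k \<Rightarrow> complex"
  assumes "\<exists>B. \<forall>t. cmod (f t) \<le> B" "\<exists>B. \<forall>t. cmod (g t) \<le> B"
  shows "\<exists>B. \<forall>t. cmod (f t + g t) \<le> B" "\<exists>B. \<forall>t. cmod (f t * g t) \<le> B" "\<exists>B. \<forall>t. cmod (a * f t) \<le> B"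
    "\<exists>B. \<forall>t. cmod (- f t) \<le> B"
proof -
  obtain A B where A: "\<And>t. cmod (f t) \<le> A" and B: "\<And>t. cmod (g t) \<le> B" using assms by blast
  have A0: "0 \<le> A" using A[of undefined] norm_ge_zero order_trans by blast
  show "\<exists>B. \<forall>t. cmod (f t + g t) \<le> B" by (rule exI[of _ "A + B"]) (auto intro: norm_triangle_mono A B)
  show "\<exists>B. \<forall>t. cmod (f t * g t) \<le> B"
    by (rule exI[of _ "A * B"]) (auto simp: norm_mult intro!: mult_mono A B A0)
  show "\<exists>B. \<forall>t. cmod (a * f t) \<le> B"
    by (rule exI[of _ "cmod a * A"]) (auto simp: norm_mult intro!: mult_left_mono A)
  show "\<exists>B. \<forall>t. cmod (- f t) \<le> B" using assms(1) by simp
qed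

lemma cring_function_algebra: "cring (function_algebra :: ('k \<Rightarrow> complex) cstar_algebra)"
proof (rule cringI)
  show "abelian_group (function_algebra :: ('k \<Rightarrow> complex) cstar_algebra)"
  proof (rule abelian_groupI)
    fix f :: "'k \<Rightarrow> complex" assume "f \<in> carrier function_algebra"
    then show "\<exists>g \<in> carrier function_algebra. g \<oplus>\<^bsub>function_algebra\<^esub> f = \<zero>\<^bsub>function_algebra\<^esub>"
      by (intro bexI[of _ "\<lambda>t. - f t"]) (auto simp: function_algebra_simps bounded_functions_closed)
  qed (auto simp: function_algebra_simps bounded_functions_closed add_ac)
  show "Group.comm_monoid (function_algebra :: ('k \<Rightarrow> complex) cstar_algebra)"
    by (rule comm_monoidI) (auto simp: function_algebra_simps bounded_functions_closed mult_ac)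
qed (auto simp: function_algebra_simps bounded_functions_closed distrib_right)

lemma function_algebra_minus:
  assumes "f \<in> carrier function_algebra" "g \<in> carrier function_algebra"
  shows "f \<ominus>\<^bsub>function_algebra\<^esub> g = (\<lambda>t. f t - g t)"
proof -
  interpret cring function_algebra by (rule cring_function_algebra)
  have "\<ominus>\<^bsub>function_algebra\<^esub> g = (\<lambda>t. - g t)"
    using assms by (intro minus_equality) (auto simp: function_algebra_simps)
  then show ?thesis by (simp add: a_minus_def function_algebra_simps)
qed

lemma commutative_cstar_function_algebra:
  "commutative_cstar_algebra (function_algebra :: ('k \<Rightarrow> complex) cstar_algebra)"
proof -
  let ?F = "function_algebra :: ('k \<Rightarrow> complex) cstar_algebra"
  have cring: "cring (class_ring :: complex ring)"
    using class_field unfolding field_def domain_def by blast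
  have alg: "algebra (class_ring :: complex ring) ?F"
    by (rule algebraI[OF cring cring_function_algebra])
      (auto simp: function_algebra_simps bounded_functions_closed class_ring_simps algebra_simps)
  show ?thesis
  proof (intro commutative_cstar_algebra.intro alg commutative_cstar_algebra_axioms.intro)
    fix X :: "nat \<Rightarrow> 'k \<Rightarrow> complex"
    assume X: "\<forall>n. X n \<in> carrier ?F"
      and C: "\<forall>e>0. \<exists>N. \<forall>m\<ge>N. \<forall>n\<ge>N. cnorm ?F (X m \<ominus>\<^bsub>?F\<^esub> X n) < e"
    have Xb: "\<exists>B. \<forall>t. cmod (X m t - X n t) \<le> B" for m n
      using bounded_functions_closed(1)[of "X m" "\<lambda>t. - X n t"] X by (auto simp: function_algebra_simps)
    have cau: "\<exists>N. \<forall>m\<ge>N. \<forall>n\<ge>N. \<forall>t. cmod (X m t - X n t) < e" if e: "e > 0" for e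
    proof -
      obtain N where N: "\<forall>m\<ge>N. \<forall>n\<ge>N. cnorm ?F (X m \<ominus>\<^bsub>?F\<^esub> X n) < e" using C e by blast
      have "cmod (X m t - X n t) < e" if "m \<ge> N" "n \<ge> N" for m n t
      proof -
        have "cmod (X m t - X n t) \<le> (SUP t. cmod (X m t - X n t))" using Xb by (rule cmod_le_sup)
        also have "\<dots> = cnorm ?F (X m \<ominus>\<^bsub>?F\<^esub> X n)" using X by (simp add: function_algebra_minus function_algebra_simps(8))
        finally show ?thesis using N that by fastforce
      qed
      then show ?thesis by blast
    qed
    have "Cauchy (\<lambda>n. X n t)" for t
      unfolding Cauchy_def dist_norm using cau by blast
    then have "\<forall>t. \<exists>l. (\<lambda>n. X n t) \<longlonglongrightarrow> l" using Cauchy_convergent convergent_def by blast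
    then obtain x where x: "\<And>t. (\<lambda>n. X n t) \<longlonglongrightarrow> x t" by metis
    have lim: "\<exists>N. \<forall>m\<ge>N. \<forall>t. cmod (X m t - x t) \<le> e" if e: "e > 0" for e
    proof -
      obtain N where N: "\<And>m n t. m \<ge> N \<Longrightarrow> n \<ge> N \<Longrightarrow> cmod (X m t - X n t) < e" using cau[OF e] by blast
      have "cmod (X m t - x t) \<le> e" if m: "m \<ge> N" for m t
      proof (rule LIMSEQ_le_const2)
        show "(\<lambda>n. cmod (X m t - X n t)) \<longlonglongrightarrow> cmod (X m t - x t)" by (intro tendsto_intros x)
        show "\<exists>K. \<forall>n\<ge>K. cmod (X m t - X n t) \<le> e" using N[OF m] less_imp_le by blast
      qed
      then show ?thesis by blast
    qed
    have xc: "x \<in> carrier ?F"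
    proof -
      obtain N where N: "\<forall>t. cmod (X N t - x t) \<le> 1" using lim[of 1] by auto
      then have "\<exists>B. \<forall>t. cmod (- (X N t - x t)) \<le> B" by (auto simp: norm_minus_commute)
      from bounded_functions_closed(1)[OF _ this, of "X N"] show ?thesis using X by (simp add: function_algebra_simps)
    qed
    have "(\<lambda>n. cnorm ?F (X n \<ominus>\<^bsub>?F\<^esub> x)) \<longlonglongrightarrow> 0"
    proof (rule LIMSEQ_I)
      fix e :: real assume e: "e > 0"
      obtain N where N: "\<forall>m\<ge>N. \<forall>t. cmod (X m t - x t) \<le> e / 2" using lim[of "e / 2"] e by auto
      have "norm (cnorm ?F (X m \<ominus>\<^bsub>?F\<^esub> x) - 0) < e" if "m \<ge> N" for m
      proof -
        have s: "cnorm ?F (X m \<ominus>\<^bsub>?F\<^esub> x) = (SUP t. cmod (X m t - x t))"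
          using X xc by (simp add: function_algebra_minus function_algebra_simps(8))
        have "(SUP t. cmod (X m t - x t)) \<le> e / 2" using N that by (intro sup_cmod_le) auto
        moreover have "0 \<le> cmod (X m undefined - x undefined)" by simp
        moreover have "cmod (X m undefined - x undefined) \<le> (SUP t. cmod (X m t - x t))"
          using N that by (intro cmod_le_sup exI[of _ "e / 2"]) auto
        ultimately show ?thesis unfolding s using e by (simp del: norm_ge_zero)
      qed
      then show "\<exists>N. \<forall>n\<ge>N. norm (cnorm ?F (X n \<ominus>\<^bsub>?F\<^esub> x) - 0) < e" by blast
    qed
    then show "\<exists>x \<in> carrier ?F. (\<lambda>n. cnorm ?F (X n \<ominus>\<^bsub>?F\<^esub> x)) \<longlonglongrightarrow> 0" using xc by blast
  next
    fix f assume "f \<in> carrier ?F"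
    then have f: "\<exists>B. \<forall>t. cmod (f t) \<le> B" by (simp add: function_algebra_simps)
    note u = cmod_le_sup[OF f]
    show "0 \<le> cnorm ?F f" unfolding function_algebra_simps using norm_ge_zero u[of undefined] order_trans by blast
    show "cnorm ?F f = 0 \<longleftrightarrow> f = \<zero>\<^bsub>?F\<^esub>"
    proof
      assume "cnorm ?F f = 0"
      then have "cmod (f t) \<le> 0" for t using u[of t] by (simp only: function_algebra_simps)
      then show "f = \<zero>\<^bsub>?F\<^esub>" by (auto simp: function_algebra_simps)
    qed (simp add: function_algebra_simps)
    show "cnorm ?F (a \<odot>\<^bsub>?F\<^esub> f) = cmod a * cnorm ?F f" for a
    proof (cases "a = 0")
      case False
      have "(SUP t. cmod (f t)) \<le> (SUP t. cmod (a * f t)) / cmod a"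
      proof (rule sup_cmod_le)
        fix t
        have "cmod (a * f t) \<le> (SUP t. cmod (a * f t))" using bounded_functions_closed(3)[OF f f] by (rule cmod_le_sup)
        then show "cmod (f t) \<le> (SUP t. cmod (a * f t)) / cmod a" using False by (simp add: norm_mult field_simps)
      qed
      moreover have "(SUP t. cmod (a * f t)) \<le> cmod a * (SUP t. cmod (f t))"
        by (rule sup_cmod_le) (auto simp: norm_mult intro!: mult_left_mono u)
      ultimately show ?thesis using False by (simp add: function_algebra_simps field_simps)
    qed (simp add: function_algebra_simps)
    have "(SUP t. cmod (f t)) \<le> sqrt (SUP t. cmod (cnj (f t) * f t))"
    proof (rule sup_cmod_le)
      fix t
      have "\<exists>B. \<forall>t. cmod (cnj (f t)) \<le> B" using f by simp
      then have "cmod (cnj (f t) * f t) \<le> (SUP t. cmod (cnj (f t) * f t))"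
        by (intro cmod_le_sup bounded_functions_closed(2) f)
      moreover have "cmod (cnj (f t) * f t) = (cmod (f t))\<^sup>2" by (simp add: norm_mult power2_eq_square)
      ultimately show "cmod (f t) \<le> sqrt (SUP t. cmod (cnj (f t) * f t))" by (simp add: real_le_rsqrt)
    qed
    moreover have "0 \<le> (SUP t. cmod (f t))" using norm_ge_zero u[of undefined] order_trans by blast
    ultimately have "(SUP t. cmod (f t))\<^sup>2 \<le> (SUP t. cmod (cnj (f t) * f t))"
      by (metis order_trans real_sqrt_ge_0_iff real_sqrt_le_iff real_sqrt_abs abs_of_nonneg)
    moreover have "(SUP t. cmod (cnj (f t) * f t)) \<le> (SUP t. cmod (f t))\<^sup>2"
      by (rule sup_cmod_le) (auto simp: norm_mult power2_eq_square intro!: mult_mono u \<open>0 \<le> (SUP t. cmod (f t))\<close>)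
    ultimately show "cnorm ?F (star ?F f \<otimes>\<^bsub>?F\<^esub> f) = (cnorm ?F f)\<^sup>2" by (simp add: function_algebra_simps)
    fix g assume "g \<in> carrier ?F"
    then have g: "\<exists>B. \<forall>t. cmod (g t) \<le> B" by (simp add: function_algebra_simps)
    note v = cmod_le_sup[OF g]
    show "cnorm ?F (f \<oplus>\<^bsub>?F\<^esub> g) \<le> cnorm ?F f + cnorm ?F g"
      unfolding function_algebra_simps by (intro sup_cmod_le norm_triangle_mono u v)
    show "cnorm ?F (f \<otimes>\<^bsub>?F\<^esub> g) \<le> cnorm ?F f * cnorm ?F g"
      unfolding function_algebra_simps
      by (intro sup_cmod_le) (auto simp: norm_mult intro!: mult_mono u v \<open>0 \<le> (SUP t. cmod (f t))\<close>)
  qed (auto simp: function_algebra_simps)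
qed

lemma function_algebra_finsum:
  assumes "finite K" "\<And>k. k \<in> K \<Longrightarrow> f k \<in> carrier function_algebra"
  shows "(\<Oplus>\<^bsub>function_algebra\<^esub>k\<in>K. f k) t = (\<Sum>k\<in>K. f k t)"
proof -
  interpret cring function_algebra by (rule cring_function_algebra)
  show ?thesis using assms
  proof (induction K rule: finite_induct)
    case empty
    show ?case by (simp add: function_algebra_simps)
  next
    case (insert k K)
    then have "(\<Oplus>\<^bsub>function_algebra\<^esub>k\<in>insert k K. f k) = f k \<oplus>\<^bsub>function_algebra\<^esub> (\<Oplus>\<^bsub>function_algebra\<^esub>k\<in>K. f k)"
      by (intro finsum_insert) auto
    then show ?case using insert by (simp add: function_algebra_simps(4))
  qed
qed

section \<open>Positive maps and evaluation\<close>

lemma psd_of_gram: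
  assumes "\<And>i j. i \<in> I \<Longrightarrow> j \<in> I \<Longrightarrow> h i j = (\<Sum>l\<in>L. cnj (y l i) * y l j)"
  shows "psd I h"
proof (rule psdI)
  show "herm I h" by (rule hermI) (simp add: assms mult.commute)
  fix x
  have "form I h x = of_real (\<Sum>l\<in>L. (cmod (\<Sum>j\<in>I. y l j * x j))\<^sup>2)" by (rule form_gram) (rule assms)
  then show "0 \<le> Re (form I h x)" by (simp add: sum_nonneg)
qed

lemma psd_gram_ex:
  assumes "finite I" "psd I h" shows "\<exists>y. \<forall>i\<in>I. \<forall>j\<in>I. h i j = (\<Sum>l\<in>I. cnj (y l i) * y l j)"
  by (rule psd_gram[OF assms]) blast

definition positive_map :: "'v::real_vector set \<Rightarrow> nat \<Rightarrow> ('v \<Rightarrow> nat \<Rightarrow> nat \<Rightarrow> complex) \<Rightarrow> bool" where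
  "positive_map C d \<rho> \<longleftrightarrow> (\<forall>x y p q. \<rho> (x + y) p q = \<rho> x p q + \<rho> y p q) \<and>
     (\<forall>r x p q. \<rho> (r *\<^sub>R x) p q = of_real r * \<rho> x p q) \<and> (\<forall>x. herm {0..<d} (\<rho> x)) \<and>
     (\<forall>c\<in>C. psd {0..<d} (\<rho> c))"

definition amplified :: "('v \<Rightarrow> nat \<Rightarrow> nat \<Rightarrow> complex) \<Rightarrow> ('v \<times> 'v) mat \<Rightarrow> nat \<times> nat \<Rightarrow> nat \<times> nat \<Rightarrow> complex" where
  "amplified \<rho> X a b = \<rho> (fst (X $$ (fst a, fst b))) (snd a) (snd b) + \<i> * \<rho> (snd (X $$ (fst a, fst b))) (snd a) (snd b)"

text \<open>\<open>A \<otimes> c\<close> goes to a Kronecker product of psd matrices, whose Gram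
  factor is the product of those of \<open>A\<close> and \<open>\<rho> c\<close>.\<close>

lemma psd_amplified:
  assumes \<rho>: "positive_map C d \<rho>" and X: "X \<in> Cmin C s"
  shows "psd ({0..<s} \<times> {0..<d}) (amplified \<rho> X)"
  using X
proof (induction rule: Cmin_induct)
  case zero
  have "\<rho> 0 p q = 0" for p q using \<rho>[unfolded positive_map_def] by (metis mult_zero_left of_real_0 scaleR_zero_left)
  then show ?case by (intro psd_of_gram[where L = "{}"]) (auto simp: amplified_def)
next
  case (add Y t A c)
  let ?D = "{0..<s} \<times> {0..<d}"
  have A: "A \<in> carrier_mat s s" "psd {0..<s} (\<lambda>i j. A $$ (i, j))" using add by (simp_all add: psd_matrix_iff)
  obtain y where y: "\<And>i j. i \<in> {0..<s} \<Longrightarrow> j \<in> {0..<s} \<Longrightarrow> A $$ (i, j) = (\<Sum>l\<in>{0..<s}. cnj (y l i) * y l j)"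
    using psd_gram[OF _ A(2)] by auto
  have "psd {0..<d} (\<rho> c)" using \<rho> add unfolding positive_map_def by blast
  then obtain z where z: "\<And>i j. i \<in> {0..<d} \<Longrightarrow> j \<in> {0..<d} \<Longrightarrow> \<rho> c i j = (\<Sum>l\<in>{0..<d}. cnj (z l i) * z l j)"
    using psd_gram[of "{0..<d}" "\<rho> c"] by auto
  have "psd ?D (\<lambda>a b. A $$ (fst a, fst b) * \<rho> c (snd a) (snd b))"
  proof (rule psd_of_gram[where L = "?D" and y = "\<lambda>l a. y (fst l) (fst a) * z (snd l) (snd a)"])
    fix a b assume "a \<in> ?D" "b \<in> ?D"
    then have "A $$ (fst a, fst b) * \<rho> c (snd a) (snd b) =
      (\<Sum>l\<in>{0..<s}. cnj (y l (fst a)) * y l (fst b)) * (\<Sum>l\<in>{0..<d}. cnj (z l (snd a)) * z l (snd b))"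
      using y z by auto
    also have "\<dots> = (\<Sum>l\<in>?D. (cnj (y (fst l) (fst a)) * y (fst l) (fst b)) * (cnj (z (snd l) (snd a)) * z (snd l) (snd b)))"
      by (simp add: sum_product sum.cartesian_product split_def)
    finally show "A $$ (fst a, fst b) * \<rho> c (snd a) (snd b) =
      (\<Sum>l\<in>?D. cnj (y (fst l) (fst a) * z (snd l) (snd a)) * (y (fst l) (fst b) * z (snd l) (snd b)))"
      by (simp add: mult_ac)
  qed
  from psd_add[OF add(1) psd_scale[OF this add(3)]] show ?case
  proof (rule psd_cong[rotated])
    fix a b assume "a \<in> ?D" "b \<in> ?D"
    then have i: "fst a < s" "fst b < s" by auto
    have \<rho>': "\<rho> (x + y) p q = \<rho> x p q + \<rho> y p q" "\<rho> (r *\<^sub>R x) p q = of_real r * \<rho> x p q" for x y r p q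
      using \<rho> unfolding positive_map_def by blast+
    have w: "A $$ (fst a, fst b) * \<rho> c (snd a) (snd b) = complex_of_real (Re (A $$ (fst a, fst b))) * \<rho> c (snd a) (snd b) +
        \<i> * (complex_of_real (Im (A $$ (fst a, fst b))) * \<rho> c (snd a) (snd b))"
      by (simp add: complex_eq_iff algebra_simps)
    show "amplified \<rho> Y a b + complex_of_real t * (A $$ (fst a, fst b) * \<rho> c (snd a) (snd b)) =
      amplified \<rho> (Matrix.mat s s (\<lambda>ij. Y $$ ij + t *\<^sub>R tensor A c $$ ij)) a b"
      unfolding w using i by (simp add: amplified_def tensor_index[OF A(1)] \<rho>') (simp add: algebra_simps)
  qed
qed

text \<open>Evaluation at all \<open>\<rho> \<in> R\<close>. Being unital at an interior point makes
  every matrix entry a bounded function of \<open>\<rho>\<close>. Positivity in the function algebra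
  can then be tested pointwise, since Gram factors chosen separately at each point are bounded by
  the diagonal entries.\<close>

lemma d_subhomogeneousI_unital_maps:
  fixes C :: "'v::euclidean_space set"
  assumes C: "convex_cone C" and u: "u \<in> interior C" and R: "R \<noteq> {}"
    and R': "\<And>\<rho>. \<rho> \<in> R \<Longrightarrow> positive_map C d \<rho> \<and> (\<forall>p<d. \<forall>q<d. \<rho> u p q = (if p = q then 1 else 0))"
    and suff: "\<And>s X. X \<in> Her s \<Longrightarrow> (\<And>\<rho>. \<rho> \<in> R \<Longrightarrow> psd ({0..<s} \<times> {0..<d}) (amplified \<rho> X)) \<Longrightarrow> X \<in> Cmin C s"
  shows "d_subhomogeneous d (Cmin C) u"
proof -
  let ?F = "function_algebra :: (('v \<Rightarrow> nat \<Rightarrow> nat \<Rightarrow> complex) \<Rightarrow> complex) cstar_algebra"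
  interpret F: commutative_cstar_algebra ?F by (rule commutative_cstar_function_algebra)
  obtain \<rho>0 where \<rho>0: "\<rho>0 \<in> R" using R by blast
  \<comment> \<open>Functions live on the whole type, so points outside \<open>R\<close> repeat the
    value at a fixed element of \<open>R\<close>.\<close>
  define \<sigma> where "\<sigma> \<rho> = (if \<rho> \<in> R then \<rho> else \<rho>0)" for \<rho>
  have \<sigma>: "\<sigma> \<rho> \<in> R" for \<rho> using \<rho>0 by (simp add: \<sigma>_def)
  have add: "\<sigma> \<rho> (x + y) p q = \<sigma> \<rho> x p q + \<sigma> \<rho> y p q" and scale: "\<sigma> \<rho> (r *\<^sub>R x) p q = of_real r * \<sigma> \<rho> x p q"
    and h: "herm {0..<d} (\<sigma> \<rho> x)" and p: "c \<in> C \<Longrightarrow> psd {0..<d} (\<sigma> \<rho> c)"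
    and one: "p < d \<Longrightarrow> q < d \<Longrightarrow> \<sigma> \<rho> u p q = (if p = q then 1 else 0)" for x y r p q c \<rho>
    using R'[OF \<sigma>[of \<rho>]] unfolding positive_map_def by blast+
  have bnd: "\<exists>K. \<forall>\<rho>. cmod (\<sigma> \<rho> x p q) \<le> K" if pq: "p < d" "q < d" for x p q
  proof -
    obtain e where e: "e > 0" "cball u e \<subseteq> C" using u mem_interior_cball by blast
    define K where "K = norm x / e + 1"
    have K: "K > 0" using e by (simp add: K_def add_nonneg_pos)
    have uC: "u + r *\<^sub>R x \<in> C" if "\<bar>r\<bar> * norm x \<le> e" for r
      using that e by (intro subsetD[OF e(2)]) (simp add: dist_norm)
    have "norm x \<le> K * e" using e by (simp add: K_def field_simps)
    then have "1 / K * norm x \<le> e" using K by (simp add: field_simps)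
    then have c: "u + (1 / K) *\<^sub>R x \<in> C" using K by (intro uC) simp
    have c': "u + (- (1 / K)) *\<^sub>R x \<in> C" using K \<open>1 / K * norm x \<le> e\<close> by (intro uC) simp
    \<comment> \<open>Positivity at \<open>u - x / K\<close> bounds the diagonal of
      \<open>x / K\<close> by 1, so the entries at \<open>u + x / K\<close> have modulus at most 2;
      removing the identity leaves at most 3.\<close>
    have bound: "cmod (\<sigma> \<rho> x p q) \<le> 3 * K" for \<rho>
    proof -
      have e: "\<sigma> \<rho> (u + r *\<^sub>R x) a b = (if a = b then 1 else 0) + of_real r * \<sigma> \<rho> x a b" if "a < d" "b < d" for r a b
        using one[OF that] by (simp add: add scale)
      have diag: "Re (\<sigma> \<rho> (u + (1 / K) *\<^sub>R x) a a) \<le> 2" if a: "a < d" for a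
        using psd_entry_bounds(1)[OF _ p[OF c', of \<rho>], of a a] a unfolding e[OF a a] by simp
      have "cmod (\<sigma> \<rho> (u + (1 / K) *\<^sub>R x) p q) \<le>
          (Re (\<sigma> \<rho> (u + (1 / K) *\<^sub>R x) p p) + Re (\<sigma> \<rho> (u + (1 / K) *\<^sub>R x) q q)) / 2"
        using pq by (intro psd_entry_bounds(2)[OF _ p[OF c]]) auto
      also have "\<dots> \<le> (2 + 2) / 2" by (intro divide_right_mono add_mono diag pq) simp
      finally have "cmod ((if p = q then 1 else 0) + of_real (1 / K) * \<sigma> \<rho> x p q) \<le> 2" unfolding e[OF pq] by simp
      moreover have "cmod (of_real (1 / K) * \<sigma> \<rho> x p q) \<le>
          cmod ((if p = q then 1 else 0) + of_real (1 / K) * \<sigma> \<rho> x p q) + cmod (if p = q then 1 else 0)"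
        by (metis add_diff_cancel_left' norm_triangle_ineq4 add.commute)
      ultimately have "cmod (of_real (1 / K) * \<sigma> \<rho> x p q) \<le> 3" by (auto split: if_splits)
      then show ?thesis using K by (simp add: norm_mult field_simps norm_divide)
    qed
    then show ?thesis by blast
  qed
  define \<Phi> where "\<Phi> x = Matrix.mat d d (\<lambda>(p, q). \<lambda>\<rho>. \<sigma> \<rho> x p q)" for x
  have \<Phi>c: "\<Phi> x \<in> carrier (Mat d ?F)" for x
    using bnd by (auto simp: \<Phi>_def Mat_carrier_iff function_algebra_simps(1))
  have ampl: "amplification (Mat d ?F) \<Phi> X $$ (i, j) $$ (p, q) = (\<lambda>\<rho>. amplified (\<sigma> \<rho>) X (i, p) (j, q))"
    if "X \<in> carrier_mat s s" "i < s" "j < s" "p < d" "q < d" for X s i j p q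
    using that by (auto simp: amplification_def amplified_def \<Phi>_def Mat_def function_algebra_simps split: prod.splits)
  have amplc: "amplification (Mat d ?F) \<Phi> X \<in> carrier (Mat s (Mat d ?F))" if "X \<in> carrier_mat s s" for X s
  proof -
    interpret B: pre_star_algebra "Mat d ?F" by (rule pre_star_algebra_Mat[OF F.pre_star_algebra])
    show ?thesis using that \<Phi>c
      by (auto simp: Mat_carrier_iff[of _ s] amplification_def split: prod.splits intro!: B.smult_closed B.a_closed)
  qed
  have iff: "X \<in> Cmin C s \<longleftrightarrow> positive_element (Mat s (Mat d ?F)) (amplification (Mat d ?F) \<Phi> X)" if X: "X \<in> Her s" for s X
  proof -
    let ?D = "{0..<s} \<times> {0..<d}"
    have Xm: "X \<in> carrier_mat s s" using X by (simp add: Her_def)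
    have amplb: "\<exists>B. \<forall>\<rho>. cmod (amplified (\<sigma> \<rho>) X a b) \<le> B" if "a \<in> ?D" "b \<in> ?D" for a b
    proof -
      have "amplification (Mat d ?F) \<Phi> X $$ (fst a, fst b) \<in> carrier (Mat d ?F)"
        using amplc[OF Xm] that unfolding Mat_carrier_iff[of _ s] by auto
      then have "amplification (Mat d ?F) \<Phi> X $$ (fst a, fst b) $$ (snd a, snd b) \<in> carrier ?F"
        using that unfolding Mat_carrier_iff by auto
      moreover have "amplification (Mat d ?F) \<Phi> X $$ (fst a, fst b) $$ (snd a, snd b) = (\<lambda>\<rho>. amplified (\<sigma> \<rho>) X a b)"
        using ampl[OF Xm, of "fst a" "fst b" "snd a" "snd b"] that by auto
      ultimately have "(\<lambda>\<rho>. amplified (\<sigma> \<rho>) X a b) \<in> carrier ?F" by simp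
      then show ?thesis unfolding function_algebra_simps(1) .
    qed
    show ?thesis
      unfolding F.positive_element_Mat_iff[OF amplc[OF Xm]]
    proof
      assume XC: "X \<in> Cmin C s"
      have "\<exists>y. \<forall>a\<in>?D. \<forall>b\<in>?D. amplified (\<sigma> \<rho>) X a b = (\<Sum>l\<in>?D. cnj (y l a) * y l b)" for \<rho>
        using psd_gram_ex[OF _ psd_amplified[OF _ XC, of d "\<sigma> \<rho>"]] R'[OF \<sigma>[of \<rho>]] by blast
      then obtain y where y: "\<And>\<rho> a b. a \<in> ?D \<Longrightarrow> b \<in> ?D \<Longrightarrow> amplified (\<sigma> \<rho>) X a b = (\<Sum>l\<in>?D. cnj (y \<rho> l a) * y \<rho> l b)"
        using choice[of "\<lambda>\<rho> y. \<forall>a\<in>?D. \<forall>b\<in>?D. amplified (\<sigma> \<rho>) X a b = (\<Sum>l\<in>?D. cnj (y l a) * y l b)"] by blast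
      have yc: "(\<lambda>\<rho>. y \<rho> l a) \<in> carrier ?F" if l: "l \<in> ?D" and a: "a \<in> ?D" for l a
      proof -
        obtain B where B: "\<And>\<rho>. cmod (amplified (\<sigma> \<rho>) X a a) \<le> B" using amplb[OF a a] by blast
        have "cmod (y \<rho> l a) \<le> sqrt B" for \<rho>
        proof -
          have "(cmod (y \<rho> l a))\<^sup>2 \<le> (\<Sum>l\<in>?D. (cmod (y \<rho> l a))\<^sup>2)" using l by (intro member_le_sum) auto
          also have "\<dots> = Re (amplified (\<sigma> \<rho>) X a a)"
            unfolding y[OF a a] Re_sum by (intro sum.cong refl) (simp add: cmod_power2, simp add: power2_eq_square)
          also have "\<dots> \<le> B" using B[of \<rho>] complex_Re_le_cmod order_trans by blast
          finally show ?thesis by (rule real_le_rsqrt)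
        qed
        then show ?thesis unfolding function_algebra_simps by blast
      qed
      show "\<exists>Y. (\<forall>l\<in>?D. \<forall>a\<in>?D. Y l a \<in> carrier ?F) \<and>
          (\<forall>i<s. \<forall>j<s. \<forall>p<d. \<forall>q<d. amplification (Mat d ?F) \<Phi> X $$ (i, j) $$ (p, q) =
            (\<Oplus>\<^bsub>?F\<^esub>l\<in>?D. star ?F (Y l (i, p)) \<otimes>\<^bsub>?F\<^esub> Y l (j, q)))"
      proof (intro exI[of _ "\<lambda>l a \<rho>. y \<rho> l a"] conjI ballI allI impI)
        fix i j p q assume ij: "i < s" "j < s" "p < d" "q < d"
        have c: "star ?F (\<lambda>\<rho>. y \<rho> l (i, p)) \<otimes>\<^bsub>?F\<^esub> (\<lambda>\<rho>. y \<rho> l (j, q)) \<in> carrier ?F" if "l \<in> ?D" for l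
          using that ij by (intro F.m_closed F.star_closed yc) auto
        have "(\<Oplus>\<^bsub>?F\<^esub>l\<in>?D. star ?F (\<lambda>\<rho>. y \<rho> l (i, p)) \<otimes>\<^bsub>?F\<^esub> (\<lambda>\<rho>. y \<rho> l (j, q))) \<rho> =
          (\<Sum>l\<in>?D. cnj (y \<rho> l (i, p)) * y \<rho> l (j, q))" for \<rho>
          using function_algebra_finsum[where K = ?D and t = \<rho>, OF _ c] by (simp add: function_algebra_simps(2,7))
        then show "amplification (Mat d ?F) \<Phi> X $$ (i, j) $$ (p, q) =
            (\<Oplus>\<^bsub>?F\<^esub>l\<in>?D. star ?F (\<lambda>\<rho>. y \<rho> l (i, p)) \<otimes>\<^bsub>?F\<^esub> (\<lambda>\<rho>. y \<rho> l (j, q)))"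
          unfolding ampl[OF Xm ij] using y ij by (intro ext) simp
      qed (rule yc)
    next
      assume "\<exists>Y. (\<forall>l\<in>?D. \<forall>a\<in>?D. Y l a \<in> carrier ?F) \<and>
          (\<forall>i<s. \<forall>j<s. \<forall>p<d. \<forall>q<d. amplification (Mat d ?F) \<Phi> X $$ (i, j) $$ (p, q) =
            (\<Oplus>\<^bsub>?F\<^esub>l\<in>?D. star ?F (Y l (i, p)) \<otimes>\<^bsub>?F\<^esub> Y l (j, q)))"
      then obtain Y where Yc: "\<forall>l\<in>?D. \<forall>a\<in>?D. Y l a \<in> carrier ?F"
        and Y: "\<forall>i<s. \<forall>j<s. \<forall>p<d. \<forall>q<d. amplification (Mat d ?F) \<Phi> X $$ (i, j) $$ (p, q) =
            (\<Oplus>\<^bsub>?F\<^esub>l\<in>?D. star ?F (Y l (i, p)) \<otimes>\<^bsub>?F\<^esub> Y l (j, q))" by blast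
      show "X \<in> Cmin C s"
      proof (rule suff[OF X])
        fix \<rho> assume \<rho>: "\<rho> \<in> R"
        show "psd ?D (amplified \<rho> X)"
        proof (rule psd_of_gram)
          fix a b assume ab: "a \<in> ?D" "b \<in> ?D"
          obtain i p j q where e: "a = (i, p)" "b = (j, q)" and ij: "i < s" "j < s" "p < d" "q < d" using ab by auto
          have "amplified \<rho> X a b = (\<lambda>\<rho>. amplified (\<sigma> \<rho>) X (i, p) (j, q)) \<rho>" using \<rho> by (simp add: \<sigma>_def e)
          also have "(\<lambda>\<rho>. amplified (\<sigma> \<rho>) X (i, p) (j, q)) = (\<Oplus>\<^bsub>?F\<^esub>l\<in>?D. star ?F (Y l (i, p)) \<otimes>\<^bsub>?F\<^esub> Y l (j, q))"
            unfolding ampl[OF Xm ij, symmetric] using Y ij by blast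
          also have "\<dots> \<rho> = (\<Sum>l\<in>?D. cnj (Y l (i, p) \<rho>) * Y l (j, q) \<rho>)"
          proof -
            have "star ?F (Y l (i, p)) \<otimes>\<^bsub>?F\<^esub> Y l (j, q) \<in> carrier ?F" if "l \<in> ?D" for l
              using that ij Yc by (intro F.m_closed F.star_closed) auto
            from function_algebra_finsum[where K = ?D and t = \<rho>, OF _ this] show ?thesis by (simp add: function_algebra_simps(2,7))
          qed
          finally show "amplified \<rho> X a b = (\<Sum>l\<in>?D. cnj (Y l a \<rho>) * Y l b \<rho>)" by (simp add: e)
        qed
      qed
    qed
  qed
  have "unital_complete_order_embedding (Cmin C) u (Mat d ?F) \<Phi>"
    unfolding unital_complete_order_embedding_def
  proof (intro conjI allI impI ballI)
    fix x y and r :: real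
    show "\<Phi> x \<in> carrier (Mat d ?F)" by (rule \<Phi>c)
    show "star (Mat d ?F) (\<Phi> x) = \<Phi> x"
      by (rule eq_matI) (auto simp: Mat_def \<Phi>_def function_algebra_simps intro!: ext hermD[OF h])
    show "\<Phi> (x + y) = \<Phi> x \<oplus>\<^bsub>Mat d ?F\<^esub> \<Phi> y"
      by (rule eq_matI) (auto simp: Mat_def \<Phi>_def function_algebra_simps add)
    show "\<Phi> (r *\<^sub>R x) = complex_of_real r \<odot>\<^bsub>Mat d ?F\<^esub> \<Phi> x"
      by (rule eq_matI) (auto simp: Mat_def \<Phi>_def function_algebra_simps scale)
    show "\<Phi> u = \<one>\<^bsub>Mat d ?F\<^esub>"
      by (rule eq_matI) (auto simp: Mat_def \<Phi>_def function_algebra_simps one)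
  qed (use iff in blast)
  then show ?thesis by (rule d_subhomogeneousI[OF commutative_cstar_function_algebra])
qed

text \<open>Each \<open>\<rho>\<close> is normalised at some \<open>e\<close> of its own. As
  \<open>u - \<delta> e\<close> lies in the cone for small \<open>\<delta>\<close>, the matrix
  \<open>\<rho> u\<close> is positive definite, and a congruence makes the map unital at
  \<open>u\<close>. The congruence can be undone, so positivity under the unital maps implies
  positivity under \<open>\<rho>\<close>.\<close>

lemma d_subhomogeneousI_positive_maps:
  fixes C :: "'v::euclidean_space set"
  assumes C: "convex_cone C" and u: "u \<in> interior C" and R: "R \<noteq> {}"
    and R': "\<And>\<rho>. \<rho> \<in> R \<Longrightarrow> positive_map C d \<rho>"
    and R1: "\<And>\<rho>. \<rho> \<in> R \<Longrightarrow> \<exists>e. \<forall>p<d. \<forall>q<d. \<rho> e p q = (if p = q then 1 else 0)"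
    and suff: "\<And>s X. X \<in> Her s \<Longrightarrow> (\<And>\<rho>. \<rho> \<in> R \<Longrightarrow> psd ({0..<s} \<times> {0..<d}) (amplified \<rho> X)) \<Longrightarrow> X \<in> Cmin C s"
  shows "d_subhomogeneous d (Cmin C) u"
proof -
  let ?I = "{0..<d}"
  let ?R = "{\<rho>. positive_map C d \<rho> \<and> (\<forall>p<d. \<forall>q<d. \<rho> u p q = (if p = q then 1 else 0))}"
  have normal: "\<exists>\<tau> T. \<tau> \<in> ?R \<and> (\<forall>x. \<forall>a\<in>?I. \<forall>b\<in>?I. \<rho> x a b = (\<Sum>p\<in>?I. \<Sum>q\<in>?I. cnj (T a p) * \<tau> x p q * T b q))"
    if \<rho>: "\<rho> \<in> R" for \<rho>
  proof -
    have add: "\<rho> (x + y) p q = \<rho> x p q + \<rho> y p q" and scale: "\<rho> (r *\<^sub>R x) p q = of_real r * \<rho> x p q"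
      and h: "herm ?I (\<rho> x)" and pos: "c \<in> C \<Longrightarrow> psd ?I (\<rho> c)" for x y r p q c
      using R'[OF \<rho>] unfolding positive_map_def by blast+
    obtain e where e: "\<forall>p<d. \<forall>q<d. \<rho> e p q = (if p = q then 1 else 0)" using R1[OF \<rho>] by blast
    obtain r where r: "r > 0" "cball u r \<subseteq> C" using u mem_interior_cball by blast
    define \<delta> where "\<delta> = r / (norm e + 1)"
    have ne: "norm e + 1 > 0" using norm_ge_zero[of e] by linarith
    have "r * (norm e / (norm e + 1)) \<le> r * 1" using r ne by (intro mult_left_mono) simp_all
    then have \<delta>: "\<delta> > 0" "\<delta> * norm e \<le> r" using r ne by (simp_all add: \<delta>_def)
    have "u + (- \<delta>) *\<^sub>R e \<in> C" using \<delta> by (intro subsetD[OF r(2)]) (simp add: dist_norm)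
    then have "psd ?I (\<rho> (u + (- \<delta>) *\<^sub>R e))" by (rule pos)
    then have "psd ?I (\<lambda>p q. \<rho> u p q - of_real \<delta> * (if p = q then 1 else 0))"
      by (rule psd_cong[rotated]) (use e in \<open>auto simp: add scale simp del: scaleR_minus_left\<close>)
    then have pd: "\<delta> * Re (ip ?I x x) \<le> Re (form ?I (\<rho> u) x)" for x
      using psdD(2)[of ?I "\<lambda>p q. \<rho> u p q - of_real \<delta> * (if p = q then 1 else 0)" x]
      unfolding form_diff form_mult by (simp add: form_unit)
    obtain y z where yz: "\<And>b c. b \<in> ?I \<Longrightarrow> c \<in> ?I \<Longrightarrow> (\<Sum>j\<in>?I. y j b * cnj (z j c)) = (if b = c then 1 else 0)"
      and z1: "\<And>i j. i \<in> ?I \<Longrightarrow> j \<in> ?I \<Longrightarrow> cong_form ?I z (\<rho> u) i j = (if i = j then 1 else 0)"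
      using pos_def_orthonormalize[OF _ h[of u] \<delta>(1) pd] by auto
    let ?t = "\<lambda>x. cong_form ?I z (\<rho> x)"
    have "?t \<in> ?R"
      unfolding positive_map_def
    proof (intro CollectI conjI allI ballI impI)
      fix x x' p q and r :: real
      show "?t (x + x') p q = ?t x p q + ?t x' p q"
        by (simp add: cong_form_def ip_def mulv_def add distrib_left distrib_right sum.distrib)
      show "?t (r *\<^sub>R x) p q = of_real r * ?t x p q"
        unfolding cong_form_def ip_def mulv_def scale sum_distrib_left by (intro sum.cong refl) (simp add: mult_ac)
    qed (use h pos z1 in \<open>auto intro: herm_cong_form psd_cong_form\<close>)
    moreover have "\<rho> x a b = (\<Sum>p\<in>?I. \<Sum>q\<in>?I. y p a * ?t x p q * cnj (y q b))" if ab: "a \<in> ?I" "b \<in> ?I" for x a b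
    proof -
      have cz: "(\<Sum>j\<in>?I. z j c * cnj (y j b)) = (if b = c then 1 else 0)" if "b \<in> ?I" "c \<in> ?I" for b c
        using arg_cong[OF yz[OF that], of cnj] by (simp add: mult.commute)
      have "(\<Sum>p\<in>?I. \<Sum>q\<in>?I. y p a * ?t x p q * cnj (y q b)) =
          (\<Sum>p\<in>?I. \<Sum>q\<in>?I. \<Sum>c\<in>?I. \<Sum>e\<in>?I. (y p a * cnj (z p c)) * \<rho> x c e * (z q e * cnj (y q b)))"
        unfolding cong_form_def ip_def mulv_def sum_distrib_left sum_distrib_right
        by (intro sum.cong refl) (simp add: mult_ac)
      also have "\<dots> = (\<Sum>p\<in>?I. \<Sum>c\<in>?I. \<Sum>q\<in>?I. \<Sum>e\<in>?I. (y p a * cnj (z p c)) * \<rho> x c e * (z q e * cnj (y q b)))"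
        by (intro sum.cong refl sum.swap)
      also have "\<dots> = (\<Sum>c\<in>?I. \<Sum>p\<in>?I. \<Sum>q\<in>?I. \<Sum>e\<in>?I. (y p a * cnj (z p c)) * \<rho> x c e * (z q e * cnj (y q b)))"
        by (rule sum.swap)
      also have "\<dots> = (\<Sum>c\<in>?I. \<Sum>p\<in>?I. \<Sum>e\<in>?I. \<Sum>q\<in>?I. (y p a * cnj (z p c)) * \<rho> x c e * (z q e * cnj (y q b)))"
        by (intro sum.cong refl sum.swap)
      also have "\<dots> = (\<Sum>c\<in>?I. \<Sum>p\<in>?I. (y p a * cnj (z p c)) * (\<Sum>e\<in>?I. \<rho> x c e * (\<Sum>q\<in>?I. z q e * cnj (y q b))))"
        unfolding sum_distrib_left by (intro sum.cong refl) (simp add: mult_ac)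
      also have "\<dots> = (\<Sum>c\<in>?I. \<Sum>p\<in>?I. (y p a * cnj (z p c)) * (\<Sum>e\<in>?I. if b = e then \<rho> x c e else 0))"
        using cz ab by (intro sum.cong refl arg_cong2[where f = "(*)"]) auto
      also have "\<dots> = (\<Sum>c\<in>?I. (\<Sum>p\<in>?I. y p a * cnj (z p c)) * \<rho> x c b)"
        using ab by (simp add: sum_distrib_right)
      also have "\<dots> = (\<Sum>c\<in>?I. if a = c then \<rho> x c b else 0)" using yz ab by (intro sum.cong) auto
      finally show ?thesis using ab by simp
    qed
    ultimately show ?thesis by (intro exI[of _ ?t] exI[of _ "\<lambda>a p. cnj (y p a)"]) simp
  qed
  show ?thesis
  proof (rule d_subhomogeneousI_unital_maps[OF C u, of ?R])
    show "?R \<noteq> {}" using R normal by blast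
    fix s and X :: "('v \<times> 'v) mat"
    assume X: "X \<in> Her s" and psd: "\<And>\<tau>. \<tau> \<in> ?R \<Longrightarrow> psd ({0..<s} \<times> ?I) (amplified \<tau> X)"
    show "X \<in> Cmin C s"
    proof (rule suff[OF X])
      fix \<rho> assume "\<rho> \<in> R"
      then obtain \<tau> T where \<tau>: "\<tau> \<in> ?R"
        and T': "\<forall>x. \<forall>a\<in>?I. \<forall>b\<in>?I. \<rho> x a b = (\<Sum>p\<in>?I. \<Sum>q\<in>?I. cnj (T a p) * \<tau> x p q * T b q)"
        using normal[OF \<open>\<rho> \<in> R\<close>] by (elim exE conjE)
      note T = T'[rule_format]
      let ?D = "{0..<s} \<times> ?I"
      obtain y where y: "\<And>a b. a \<in> ?D \<Longrightarrow> b \<in> ?D \<Longrightarrow> amplified \<tau> X a b = (\<Sum>l\<in>?D. cnj (y l a) * y l b)"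
        using psd_gram_ex[OF _ psd[OF \<tau>]] by blast
      show "psd ?D (amplified \<rho> X)"
      proof (rule psd_of_gram[where L = ?D and y = "\<lambda>l a. \<Sum>p\<in>?I. T (snd a) p * y l (fst a, p)"])
        fix a b assume ab: "a \<in> ?D" "b \<in> ?D"
        then have i: "fst a < s" "fst b < s" "snd a \<in> ?I" "snd b \<in> ?I" by auto
        have "amplified \<rho> X a b = (\<Sum>p\<in>?I. \<Sum>q\<in>?I. cnj (T (snd a) p) * amplified \<tau> X (fst a, p) (fst b, q) * T (snd b) q)"
          unfolding amplified_def T[OF i(3,4)] sum_distrib_left sum.distrib[symmetric]
          by (intro sum.cong refl) (simp add: algebra_simps)
        also have "\<dots> = (\<Sum>p\<in>?I. \<Sum>q\<in>?I. \<Sum>l\<in>?D. cnj (T (snd a) p * y l (fst a, p)) * (T (snd b) q * y l (fst b, q)))"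
          using i by (intro sum.cong refl) (simp add: y sum_distrib_left sum_distrib_right mult_ac)
        also have "\<dots> = (\<Sum>p\<in>?I. \<Sum>l\<in>?D. \<Sum>q\<in>?I. cnj (T (snd a) p * y l (fst a, p)) * (T (snd b) q * y l (fst b, q)))"
          by (intro sum.cong refl sum.swap)
        also have "\<dots> = (\<Sum>l\<in>?D. \<Sum>p\<in>?I. \<Sum>q\<in>?I. cnj (T (snd a) p * y l (fst a, p)) * (T (snd b) q * y l (fst b, q)))"
          by (rule sum.swap)
        finally show "amplified \<rho> X a b = (\<Sum>l\<in>?D. cnj (\<Sum>p\<in>?I. T (snd a) p * y l (fst a, p)) * (\<Sum>p\<in>?I. T (snd b) p * y l (fst b, p)))"
          by (simp add: sum_product)
      qed
    qed
  qed blast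
qed

section \<open>Polyhedral cones in coordinates\<close>

lemma convex_cone_hull_induct [consumes 1, case_names base zero add scale]:
  assumes "x \<in> convex_cone hull S" and "\<And>x. x \<in> S \<Longrightarrow> P x" "P 0" "\<And>x y. P x \<Longrightarrow> P y \<Longrightarrow> P (x + y)"
    and "\<And>r x. 0 \<le> r \<Longrightarrow> P x \<Longrightarrow> P (r *\<^sub>R x)"
  shows "P x"
proof -
  have "convex_cone {x. P x}" using assms(3-5) by (simp add: convex_cone_iff)
  then have "convex_cone hull S \<subseteq> {x. P x}" using assms(2) by (intro hull_minimal) auto
  then show ?thesis using assms(1) by blast
qed

definition ray :: "'v::real_vector \<Rightarrow> 'v set" where "ray g = (\<lambda>r. r *\<^sub>R g) ` {0..}"

lemma rayI: "0 \<le> r \<Longrightarrow> r *\<^sub>R g \<in> ray g"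
  unfolding ray_def by (rule imageI) simp

lemma zero_in_ray: "0 \<in> ray g" and self_in_ray: "g \<in> ray g"
  using rayI[of 0 g] rayI[of 1 g] by simp_all

lemma ray_add: "x \<in> ray g \<Longrightarrow> y \<in> ray g \<Longrightarrow> x + y \<in> ray g"
  by (auto simp: ray_def scaleR_add_left[symmetric])

lemma ray_scale: "0 \<le> r \<Longrightarrow> x \<in> ray g \<Longrightarrow> r *\<^sub>R x \<in> ray g"
  by (auto simp: ray_def)

lemma aff_dim_ray:
  fixes g :: "'v::euclidean_space" assumes "g \<noteq> 0" shows "aff_dim (ray g) = 1"
proof -
  have "span (ray g) = span {g}"
  proof (rule antisym)
    show "span (ray g) \<subseteq> span {g}" by (rule span_minimal) (auto simp: ray_def span_base span_scale)
    show "span {g} \<subseteq> span (ray g)" by (rule span_mono) (simp add: self_in_ray)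
  qed
  then have "dim (ray g) = dim {g}" by (metis dim_span)
  also have "\<dots> = 1" using assms by (simp add: dim_insert)
  finally show ?thesis using aff_dim_zero[of "ray g"] zero_in_ray[of g] by (simp add: hull_inc)
qed

text \<open>\<open>a0\<close> gives pointedness, and spanning gives interior points. A functional
  that vanishes at \<open>g\<close> and is positive on the other generators exposes the ray of
  \<open>g\<close>. Conversely, a nonzero point of an extreme ray has a multiple of a generator as a
  summand, and a face containing a sum contains the summands.\<close>

lemma polyhedral_cone_with_rays:
  fixes S :: "'v::euclidean_space set"
  assumes fin: "finite S" and sp: "span S = UNIV" and pos: "\<And>g. g \<in> S \<Longrightarrow> 0 < inner a0 g"
    and exposed: "\<And>g. g \<in> S \<Longrightarrow> \<exists>a. inner a g = 0 \<and> (\<forall>h\<in>S - {g}. 0 < inner a h)"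
  shows "proper_polyhedral_cone (convex_cone hull S)"
    and "card (extreme_rays (convex_cone hull S)) = card S"
proof -
  let ?C = "convex_cone hull S"
  have nz: "g \<noteq> 0" if "g \<in> S" for g using pos[OF that] by auto
  have posC: "x = 0 \<or> 0 < inner a0 x" if "x \<in> ?C" for x
    using that
  proof (induction rule: convex_cone_hull_induct)
    case (scale r x)
    then show ?case by (cases "r = 0") auto
  qed (auto simp: pos inner_right_distrib)
  have "0 \<in> affine hull ?C" by (simp add: hull_inc convex_cone_hull_contains_0)
  then have "affine hull ?C = span ?C" by (rule affine_hull_span_0)
  also have "span ?C = UNIV" using sp span_mono[of S ?C] hull_subset[of S convex_cone] by blast
  finally have "rel_interior ?C = interior ?C" by (rule rel_interior_interior)
  then have int: "interior ?C \<noteq> {}"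
    using rel_interior_eq_empty[OF convex_convex_cone_hull, of S] convex_cone_hull_nonempty by metis
  have "?C \<inter> uminus ` ?C = {0}"
  proof (rule antisym)
    show "?C \<inter> uminus ` ?C \<subseteq> {0}"
    proof
      fix x assume x: "x \<in> ?C \<inter> uminus ` ?C"
      then have "- x \<in> ?C" by auto
      then show "x \<in> {0}" using posC[of x] posC[of "- x"] x by auto
    qed
    show "{0} \<subseteq> ?C \<inter> uminus ` ?C" using convex_cone_hull_contains_0[of S] by force
  qed
  then show "proper_polyhedral_cone ?C" unfolding proper_polyhedral_cone_def using fin int by blast
  have ray_face: "ray g face_of ?C" if g: "g \<in> S" for g
  proof -
    obtain a where a: "inner a g = 0" "\<forall>h\<in>S - {g}. 0 < inner a h" using exposed[OF g] by blast
    have aC: "0 \<le> inner a x \<and> (inner a x = 0 \<longrightarrow> x \<in> ray g)" if "x \<in> ?C" for x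
      using that
    proof (induction rule: convex_cone_hull_induct)
      case (base x)
      then have "x = g \<or> 0 < inner a x" using a(2) by blast
      then show ?case using a(1) self_in_ray[of g] by auto
    next
      case (add x y)
      then show ?case by (auto simp: inner_right_distrib ray_add add_nonneg_eq_0_iff)
    next
      case (scale r x)
      then show ?case by (auto simp: ray_scale zero_in_ray)
    qed (simp add: zero_in_ray)
    have gC: "g \<in> ?C" using g by (rule hull_inc)
    have "?C \<inter> {x. inner a x = 0} face_of ?C"
      using aC by (intro face_of_Int_supporting_hyperplane_ge convex_convex_cone_hull) auto
    also have "?C \<inter> {x. inner a x = 0} = ray g"
      using aC a gC by (auto simp: ray_def convex_cone_hull_mul)
    finally show ?thesis .
  qed
  have decomp: "x = 0 \<or> (\<exists>g\<in>S. \<exists>t>0. \<exists>y\<in>?C. x = t *\<^sub>R g + y)" if "x \<in> ?C" for x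
  proof -
    have "x \<in> ?C \<and> (x = 0 \<or> (\<exists>g\<in>S. \<exists>t>0. \<exists>y\<in>?C. x = t *\<^sub>R g + y))"
      using that
    proof (induction rule: convex_cone_hull_induct)
      case (base x)
      have "\<exists>g\<in>S. \<exists>t>0. \<exists>y\<in>?C. x = t *\<^sub>R g + y"
        by (intro bexI[of _ x] exI[of _ 1] conjI bexI[of _ 0]) (use base in \<open>auto simp: convex_cone_hull_contains_0\<close>)
      then show ?case using hull_inc[OF base] by blast
    next
      case (add x y)
      show ?case
      proof (cases "x = 0")
        case False
        then obtain g t z where "g \<in> S" "t > 0" "z \<in> ?C" "x = t *\<^sub>R g + z" using add by blast
        then have "x + y = t *\<^sub>R g + (z + y)" "z + y \<in> ?C" using add by (auto intro: convex_cone_hull_add)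
        then show ?thesis using \<open>g \<in> S\<close> \<open>t > 0\<close> add by (blast intro: convex_cone_hull_add)
      qed (use add in simp)
    next
      case (scale r x)
      show ?case
      proof (cases "r = 0 \<or> x = 0")
        case False
        then obtain g t z where z: "g \<in> S" "t > 0" "z \<in> ?C" "x = t *\<^sub>R g + z" using scale by blast
        then have "r *\<^sub>R x = (r * t) *\<^sub>R g + r *\<^sub>R z" "r *\<^sub>R z \<in> ?C" "r * t > 0"
          using scale False by (auto intro: convex_cone_hull_mul simp: scaleR_add_right)
        then show ?thesis using z(1) scale by (blast intro: convex_cone_hull_mul)
      qed (use scale convex_cone_hull_contains_0[of S] in auto)
    qed (simp add: convex_cone_hull_contains_0)
    then show ?thesis by blast
  qed
  have "\<exists>g\<in>S. R = ray g" if R: "R face_of ?C" and dim: "aff_dim R = 1" for R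
  proof -
    have RC: "R \<subseteq> ?C" and cR: "convex R" using R by (simp_all add: face_of_def)
    have "\<not> R \<subseteq> {0}" using dim by (auto simp: subset_singleton_iff)
    then obtain x where x: "x \<in> R" "x \<noteq> 0" by blast
    then obtain g t y where g: "g \<in> S" and t: "t > 0" and y: "y \<in> ?C" and xe: "x = t *\<^sub>R g + y"
      using decomp[of x] RC by blast
    have gC: "r *\<^sub>R g \<in> ?C" if "0 \<le> r" for r using hull_inc[OF g] that by (rule convex_cone_hull_mul)
    \<comment> \<open>\<open>x\<close> is the midpoint of \<open>2 t g\<close> and
      \<open>2 y\<close>. If these coincide there is no open segment, but then \<open>x\<close>
      itself is \<open>2 t g\<close>.\<close>
    have z: "(2 * t) *\<^sub>R g \<in> R"
    proof (cases "(2 * t) *\<^sub>R g = 2 *\<^sub>R y")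
      case True
      then have "(2 * t) *\<^sub>R g = x" unfolding xe by (metis scaleR_2 scaleR_scaleR add.commute scaleR_cancel_left zero_neq_numeral)
      then show ?thesis using x by simp
    next
      case False
      have "x = (1 - 1/2) *\<^sub>R ((2 * t) *\<^sub>R g) + (1/2) *\<^sub>R (2 *\<^sub>R y)" unfolding xe by simp
      then have "x \<in> open_segment ((2 * t) *\<^sub>R g) (2 *\<^sub>R y)"
        unfolding in_segment using False by (intro conjI exI[of _ "1/2"]) auto
      then show ?thesis using face_ofD[OF R] gC[of "2 * t"] t y x convex_cone_hull_mul[of y S 2] by simp
    qed
    \<comment> \<open>\<open>2 t g\<close> lies strictly between 0 and any farther point of its ray,
      so the face contains both ends.\<close>
    have far: "0 \<in> R \<and> (2 * t + r) *\<^sub>R g \<in> R" if r: "r > 0" for r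
    proof -
      let ?u = "2 * t / (2 * t + r)"
      have u: "?u > 0" "?u < 1" "?u * (2 * t + r) = 2 * t" using t r by (auto simp: field_simps)
      have "(2 * t) *\<^sub>R g = (1 - ?u) *\<^sub>R 0 + ?u *\<^sub>R ((2 * t + r) *\<^sub>R g)" using u(3) by simp
      moreover have "(0::'v) \<noteq> (2 * t + r) *\<^sub>R g" using nz[OF g] t r by simp
      ultimately have "(2 * t) *\<^sub>R g \<in> open_segment 0 ((2 * t + r) *\<^sub>R g)"
        unfolding in_segment using u by (intro conjI exI[of _ ?u]) auto
      then show ?thesis using face_ofD[OF R] gC[of 0] gC[of "2 * t + r"] z t r by simp
    qed
    have "ray g \<subseteq> R"
    proof
      fix w assume "w \<in> ray g"
      then obtain r where r: "r \<ge> 0" "w = r *\<^sub>R g" by (auto simp: ray_def)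
      show "w \<in> R"
      proof (cases "r = 0")
        case False
        let ?u = "r / (2 * t + r)"
        have u: "0 \<le> ?u" "?u \<le> 1" "?u * (2 * t + r) = r" using t r by (auto simp: field_simps)
        have "(1 - ?u) *\<^sub>R 0 + ?u *\<^sub>R ((2 * t + r) *\<^sub>R g) \<in> R"
          using far[of r] False r u by (intro convexD[OF cR]) auto
        then show ?thesis using u(3) r by simp
      qed (use far[of 1] r in simp)
    qed
    then have rf: "ray g face_of R" using face_of_subset[OF ray_face[OF g]] RC by blast
    have "R = ray g"
    proof (rule ccontr)
      assume "R \<noteq> ray g"
      then have "aff_dim (ray g) < aff_dim R" using face_of_aff_dim_lt[OF cR rf] by metis
      then show False using aff_dim_ray[OF nz[OF g]] dim by simp
    qed
    then show ?thesis using g by blast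
  qed
  then have "extreme_rays ?C = ray ` S"
    using ray_face aff_dim_ray[OF nz] unfolding extreme_rays_def by blast
  moreover have "inj_on ray S"
  proof (rule inj_onI, rule ccontr)
    fix g h assume gh: "g \<in> S" "h \<in> S" "ray g = ray h" "g \<noteq> h"
    obtain a where a: "inner a g = 0" "\<forall>h\<in>S - {g}. 0 < inner a h" using exposed[OF gh(1)] by blast
    have "h \<in> ray g" using gh(3) self_in_ray[of h] by simp
    then obtain r where "h = r *\<^sub>R g" unfolding ray_def by blast
    moreover have "0 < inner a h" using a(2) gh by blast
    ultimately show False using a(1) by simp
  qed
  ultimately show "card (extreme_rays ?C) = card S" by (simp add: card_image)
qed

section \<open>Cones given by coordinates\<close>

definition vector_of :: "(nat \<Rightarrow> 'v::euclidean_space) \<Rightarrow> nat \<Rightarrow> (nat \<Rightarrow> real) \<Rightarrow> 'v" where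
  "vector_of b n f = (\<Sum>i<n. f i *\<^sub>R b i)"

lemma inner_vector_of_right: "inner x (vector_of b n f) = (\<Sum>i<n. f i * (inner x (b i)))"
  unfolding vector_of_def by (simp add: inner_sum_right)

lemma basis_inner:
  assumes "bij_betw b {..<n} (Basis :: 'v::euclidean_space set)" "i < n" "j < n"
  shows "inner (b i) (b j) = (if i = j then 1 else 0)"
proof -
  have "b i \<in> Basis" "b j \<in> Basis" using assms by (auto simp: bij_betw_def)
  moreover have "b i = b j \<longleftrightarrow> i = j" using assms by (auto simp: bij_betw_def inj_on_def)
  ultimately show ?thesis by (simp add: inner_Basis)
qed

lemma vector_of_inner:
  assumes "bij_betw b {..<n} (Basis :: 'v::euclidean_space set)" "i < n"
  shows "inner (vector_of b n f) (b i) = f i"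
proof -
  have "inner (b i) (vector_of b n f) = (\<Sum>j<n. if i = j then f j else 0)"
    unfolding inner_vector_of_right using assms by (intro sum.cong) (auto simp: basis_inner)
  then show ?thesis using assms(2) by (simp add: inner_commute)
qed

lemma vector_of_coordinates:
  assumes "bij_betw b {..<n} (Basis :: 'v::euclidean_space set)"
  shows "vector_of b n (\<lambda>i. inner x (b i)) = x"
  unfolding vector_of_def using sum.reindex_bij_betw[OF assms, of "\<lambda>e. (inner x e) *\<^sub>R e"] by (simp add: euclidean_representation)

lemma coordinate_cone:
  fixes b :: "nat \<Rightarrow> 'v::euclidean_space"
  assumes b: "bij_betw b {..<n} Basis" and J: "finite J"
    and exposed: "\<And>j. j \<in> J \<Longrightarrow> \<exists>\<alpha>. (\<Sum>i<n. \<gamma> j i * \<alpha> i) = 0 \<and> (\<forall>k\<in>J - {j}. 0 < (\<Sum>i<n. \<gamma> k i * \<alpha> i))"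
    and pos: "\<And>j. j \<in> J \<Longrightarrow> 0 < (\<Sum>i<n. \<gamma> j i * \<beta> i)"
    and units: "\<And>i. i < n \<Longrightarrow> \<exists>j\<in>J. \<forall>l<n. \<gamma> j l = (if l = i then 1 else 0)"
  shows "proper_polyhedral_cone (convex_cone hull (\<lambda>j. vector_of b n (\<gamma> j)) ` J)"
    and "card (extreme_rays (convex_cone hull (\<lambda>j. vector_of b n (\<gamma> j)) ` J)) = card J"
proof -
  let ?g = "\<lambda>j. vector_of b n (\<gamma> j)"
  have ip: "inner (vector_of b n \<alpha>) (?g j) = (\<Sum>i<n. \<gamma> j i * \<alpha> i)" for \<alpha> j
    unfolding inner_vector_of_right[of _ b n "\<gamma> j"] using vector_of_inner[OF b] by simp
  have inj: "inj_on ?g J"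
  proof (rule inj_onI, rule ccontr)
    fix j k assume jk: "j \<in> J" "k \<in> J" "?g j = ?g k" "j \<noteq> k"
    obtain \<alpha> where \<alpha>: "(\<Sum>i<n. \<gamma> j i * \<alpha> i) = 0" "\<forall>k\<in>J - {j}. 0 < (\<Sum>i<n. \<gamma> k i * \<alpha> i)"
      using exposed[OF jk(1)] by blast
    have "0 < (\<Sum>i<n. \<gamma> k i * \<alpha> i)" using \<alpha>(2) jk by blast
    then show False using \<alpha>(1) jk(3) ip[of \<alpha> j] ip[of \<alpha> k] by simp
  qed
  have bS: "b i \<in> ?g ` J" if i: "i < n" for i
  proof -
    obtain j where j: "j \<in> J" "\<forall>l<n. \<gamma> j l = (if l = i then 1 else 0)" using units[OF i] by blast
    have "?g j = (\<Sum>l<n. if l = i then b l else 0)" unfolding vector_of_def using j(2) by (intro sum.cong) auto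
    then have "?g j = b i" using i by simp
    then show ?thesis using j(1) by force
  qed
  have be: "Basis = b ` {..<n}" using b by (simp add: bij_betw_def)
  have "Basis \<subseteq> ?g ` J" unfolding be using bS by blast
  then have sp: "span (?g ` J) = UNIV" using span_mono[of Basis "?g ` J"] by auto
  have ex: "\<exists>a. inner a g = 0 \<and> (\<forall>h\<in>?g ` J - {g}. 0 < inner a h)" if g: "g \<in> ?g ` J" for g
  proof -
    obtain j where j: "j \<in> J" "g = ?g j" using g by blast
    obtain \<alpha> where \<alpha>: "(\<Sum>i<n. \<gamma> j i * \<alpha> i) = 0" "\<forall>k\<in>J - {j}. 0 < (\<Sum>i<n. \<gamma> k i * \<alpha> i)"
      using exposed[OF j(1)] by blast
    then show ?thesis by (intro exI[of _ "vector_of b n \<alpha>"]) (auto simp: ip j)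
  qed
  note cone = polyhedral_cone_with_rays[OF finite_imageI[OF J] sp, of "vector_of b n \<beta>"]
  show "proper_polyhedral_cone (convex_cone hull ?g ` J)"
    using pos ex by (intro cone) (auto simp: ip)
  have "card (extreme_rays (convex_cone hull ?g ` J)) = card (?g ` J)"
    using pos ex by (intro cone) (auto simp: ip)
  then show "card (extreme_rays (convex_cone hull ?g ` J)) = card J" using inj by (simp add: card_image)
qed

section \<open>Cones over products of squares\<close>

lemma Cmin_sum:
  fixes c :: "'j \<Rightarrow> 'v::real_vector"
  assumes J: "finite J" and j: "\<And>j. j \<in> J \<Longrightarrow> psd {0..<s} (M j) \<and> c j \<in> C"
  shows "Matrix.mat s s (\<lambda>(a, b). \<Sum>j\<in>J. (Re (M j a b) *\<^sub>R c j, Im (M j a b) *\<^sub>R c j)) \<in> Cmin C s"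
  using J j
proof (induction J rule: finite_induct)
  case empty
  have "Matrix.mat s s (\<lambda>(a, b). \<Sum>j\<in>{}. (Re (M j a b) *\<^sub>R c j, Im (M j a b) *\<^sub>R c j)) = Matrix.mat s s (\<lambda>_. 0)"
    by (rule eq_matI) auto
  then show ?case using Cmin_zero by simp
next
  case (insert j J)
  let ?A = "Matrix.mat s s (\<lambda>(a, b). M j a b)"
  have "psd {0..<s} (\<lambda>a b. ?A $$ (a, b))" by (rule psd_cong[of _ "M j"]) (use insert in auto)
  then have "tensor ?A (c j) \<in> Cmin C s" using insert by (intro CminI_tensor) (auto simp: psd_matrix_iff)
  moreover have "Matrix.mat s s (\<lambda>(a, b). \<Sum>j\<in>J. (Re (M j a b) *\<^sub>R c j, Im (M j a b) *\<^sub>R c j)) \<in> Cmin C s"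
    using insert by blast
  ultimately have "Matrix.mat s s (\<lambda>ij. tensor ?A (c j) $$ ij +
      Matrix.mat s s (\<lambda>(a, b). \<Sum>j\<in>J. (Re (M j a b) *\<^sub>R c j, Im (M j a b) *\<^sub>R c j)) $$ ij) \<in> Cmin C s"
    by (rule Cmin_add)
  moreover have "Matrix.mat s s (\<lambda>ij. tensor ?A (c j) $$ ij +
      Matrix.mat s s (\<lambda>(a, b). \<Sum>j\<in>J. (Re (M j a b) *\<^sub>R c j, Im (M j a b) *\<^sub>R c j)) $$ ij) =
    Matrix.mat s s (\<lambda>(a, b). \<Sum>j\<in>insert j J. (Re (M j a b) *\<^sub>R c j, Im (M j a b) *\<^sub>R c j))"
    by (rule eq_matI) (use insert in \<open>auto simp: tensor_def\<close>)
  ultimately show ?case by simp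
qed

text \<open>The cone over a product of \<open>k\<close> squares and a simplex: each square contributes the coordinate
  vectors \<open>e\<^sub>3\<^sub>l, e\<^sub>3\<^sub>l\<^sub>+\<^sub>1, e\<^sub>3\<^sub>l\<^sub>+\<^sub>2\<close> and, as generator \<open>n + l\<close>, the vector
  \<open>e\<^sub>3\<^sub>l + e\<^sub>3\<^sub>l\<^sub>+\<^sub>1 - e\<^sub>3\<^sub>l\<^sub>+\<^sub>2\<close>.\<close>

definition squares :: "nat \<Rightarrow> nat \<Rightarrow> nat \<Rightarrow> real" where
  "squares n j i = (if j < n then (if i = j then 1 else 0) else
     if i = 3 * (j - n) \<or> i = 3 * (j - n) + 1 then 1 else if i = 3 * (j - n) + 2 then - 1 else 0)"

lemma sum_squares_unit: "j < n \<Longrightarrow> (\<Sum>i<n. squares n j i * \<alpha> i) = \<alpha> j"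
proof -
  assume j: "j < n"
  then have "(\<Sum>i<n. squares n j i * \<alpha> i) = (\<Sum>i<n. if i = j then \<alpha> i else 0)"
    by (intro sum.cong) (auto simp: squares_def)
  then show ?thesis using j by simp
qed

lemma sum_squares_new:
  assumes "3 * l + 2 < n"
  shows "(\<Sum>i<n. squares n (n + l) i * \<alpha> i) = \<alpha> (3 * l) + \<alpha> (3 * l + 1) - \<alpha> (3 * l + 2)"
proof -
  have "(\<Sum>i<n. squares n (n + l) i * \<alpha> i) =
    (\<Sum>i<n. (if i = 3 * l then \<alpha> i else 0) + (if i = 3 * l + 1 then \<alpha> i else 0) - (if i = 3 * l + 2 then \<alpha> i else 0))"
    by (intro sum.cong) (auto simp: squares_def)
  then show ?thesis using assms by (simp add: sum.distrib sum_subtractf)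
qed

lemma squares_cone:
  fixes b :: "nat \<Rightarrow> 'v::euclidean_space"
  assumes b: "bij_betw b {..<n} Basis" and k: "3 * k \<le> n"
  defines "C \<equiv> convex_cone hull (\<lambda>j. vector_of b n (squares n j)) ` {..<n + k}"
  shows "proper_polyhedral_cone C" "card (extreme_rays C) = n + k"
proof -
  \<comment> \<open>The weights 2, 2, 1 on a block give \<open>2 + 2 - 1 = 3\<close> at its new
    generator. This stays positive when one weight is set to 0, which exposes a coordinate vector;
    raising the last weight to 4 makes it 0 and exposes the new generator.\<close>
  define \<pi> :: "nat \<Rightarrow> real" where "\<pi> i = (if i < 3 * k \<and> i mod 3 \<noteq> 2 then 2 else 1)" for i
  have \<pi>: "\<pi> (3 * l) = 2" "\<pi> (3 * l + 1) = 2" "\<pi> (Suc (3 * l)) = 2" "\<pi> (3 * l + 2) = 1" "\<pi> (Suc (Suc (3 * l))) = 1" if "l < k" for l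
    using that by (auto simp: \<pi>_def mod_Suc)
  have \<pi>pos: "0 < \<pi> i" for i by (simp add: \<pi>_def)
  have cases: "(\<exists>l<k. j = n + l) \<or> j < n" if "j < n + k" for j using that by presburger
  have new: "(\<Sum>i<n. squares n (n + l) i * \<alpha> i) = \<alpha> (3 * l) + \<alpha> (3 * l + 1) - \<alpha> (3 * l + 2)" if "l < k" for l \<alpha>
    using that k by (intro sum_squares_new) linarith
  have ex: "\<exists>\<alpha>. (\<Sum>i<n. squares n j i * \<alpha> i) = 0 \<and> (\<forall>h\<in>{..<n + k} - {j}. 0 < (\<Sum>i<n. squares n h i * \<alpha> i))"
    if j: "j < n + k" for j
  proof (cases "j < n")
    case True
    have "0 < (\<Sum>i<n. squares n h i * (\<pi>(j := 0)) i)" if h: "h < n + k" "h \<noteq> j" for h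
    proof -
      from cases[OF h(1)] show ?thesis
      proof
        assume "\<exists>l<k. h = n + l"
        then obtain l where l: "l < k" "h = n + l" by blast
        then show ?thesis unfolding l(2) new[OF l(1)] using \<pi>[OF l(1)] by auto
      qed (use h \<pi>pos in \<open>simp add: sum_squares_unit\<close>)
    qed
    moreover have "(\<Sum>i<n. squares n j i * (\<pi>(j := 0)) i) = 0" using True by (simp add: sum_squares_unit)
    ultimately show ?thesis by blast
  next
    case False
    then obtain l where l: "l < k" "j = n + l" using cases[OF j] by blast
    have "0 < (\<Sum>i<n. squares n h i * (\<pi>(3 * l + 2 := 4)) i)" if h: "h < n + k" "h \<noteq> j" for h
    proof -
      from cases[OF h(1)] show ?thesis
      proof
        assume "\<exists>l<k. h = n + l"
        then obtain l' where l': "l' < k" "h = n + l'" by blast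
        have "3 * l' \<noteq> 3 * l + 2" "3 * l' + 1 \<noteq> 3 * l + 2" by presburger+
        moreover have "l' \<noteq> l" using l l' h by blast
        ultimately show ?thesis unfolding l'(2) new[OF l'(1)] using \<pi>[OF l'(1)] by simp
      qed (use h \<pi>pos in \<open>simp add: sum_squares_unit\<close>)
    qed
    moreover have "(\<Sum>i<n. squares n j i * (\<pi>(3 * l + 2 := 4)) i) = 0"
      unfolding l(2) new[OF l(1)] using \<pi>[OF l(1)] by simp
    ultimately show ?thesis by blast
  qed
  have pos: "0 < (\<Sum>i<n. squares n j i * \<pi> i)" if j: "j < n + k" for j
  proof (cases "j < n")
    case False
    then obtain l where l: "l < k" "j = n + l" using cases[OF j] by blast
    show ?thesis unfolding l(2) new[OF l(1)] using \<pi>[OF l(1)] by simp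
  qed (simp add: sum_squares_unit \<pi>pos)
  have un: "\<exists>j\<in>{..<n + k}. \<forall>l<n. squares n j l = (if l = i then 1 else 0)" if "i < n" for i
    using that by (intro bexI[of _ i]) (auto simp: squares_def)
  note cone = coordinate_cone[OF b, of "{..<n + k}" "squares n" \<pi>]
  show "proper_polyhedral_cone C" unfolding C_def by (rule cone(1)) (use ex pos un in blast)+
  have "card (extreme_rays C) = card {..<n + k}" unfolding C_def by (rule cone(2)) (use ex pos un in blast)+
  then show "card (extreme_rays C) = n + k" by simp
qed

lemma positive_map_convex_cone_hull:
  assumes add: "\<And>x y p q. \<rho> (x + y) p q = \<rho> x p q + \<rho> y p q" and scale: "\<And>r x p q. \<rho> (r *\<^sub>R x) p q = of_real r * \<rho> x p q"
    and herm: "\<And>x. herm {0..<d} (\<rho> x)" and S: "\<And>c. c \<in> S \<Longrightarrow> psd {0..<d} (\<rho> c)"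
  shows "positive_map (convex_cone hull S) d \<rho>"
proof -
  have "psd {0..<d} (\<rho> c)" if "c \<in> convex_cone hull S" for c
    using that
  proof (induction rule: convex_cone_hull_induct)
    case zero
    have "\<rho> 0 p q = 0" for p q using scale[of 0 0] by simp
    then show ?case by (intro psd_of_gram[where L = "{}"]) simp
  next
    case (add x y)
    from psd_add[OF this] show ?case by (rule psd_cong[rotated]) (simp add: assms(1))
  next
    case (scale r x)
    from psd_scale[OF scale(2,1)] show ?case by (rule psd_cong[rotated]) (simp add: assms(2))
  qed (rule S)
  then show ?thesis unfolding positive_map_def using assms by blast
qed

section \<open>Representations of the blocks\<close>

definition coordinate_map :: "'v::real_inner \<Rightarrow> 'v \<Rightarrow> nat \<Rightarrow> nat \<Rightarrow> complex" where
  "coordinate_map e x p q = (if p = q then of_real (inner x e) else 0)"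

text \<open>For orthonormal \<open>e0\<close>, \<open>e1\<close>, \<open>e2\<close> the first two go
  to the diagonal projections and \<open>e2\<close> to the projection onto \<open>(c, s)\<close>. If
  \<open>c\<^sup>2 + s\<^sup>2 = 1\<close>, the fourth generator \<open>e0 + e1 - e2\<close> goes to
  the complementary projection.\<close>

definition square_map :: "'v::real_inner \<Rightarrow> 'v \<Rightarrow> 'v \<Rightarrow> real \<Rightarrow> real \<Rightarrow> 'v \<Rightarrow> nat \<Rightarrow> nat \<Rightarrow> complex" where
  "square_map e0 e1 e2 c s x p q = of_real ((if p = q then inner x (if p = 0 then e0 else e1) else 0) +
     inner x e2 * (if p = 0 then c else s) * (if q = 0 then c else s))"

definition coordinate_matrix :: "'v::real_inner \<Rightarrow> ('v \<times> 'v) mat \<Rightarrow> nat \<Rightarrow> nat \<Rightarrow> complex" where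
  "coordinate_matrix e X a b = Complex (inner (fst (X $$ (a, b))) e) (inner (snd (X $$ (a, b))) e)"

lemma herm_coordinate_matrix:
  assumes "X \<in> Her s" shows "herm {0..<s} (coordinate_matrix e X)"
proof (rule hermI)
  fix i j assume "i \<in> {0..<s}" "j \<in> {0..<s}"
  then have "i < s" "j < s" by simp_all
  then have "X $$ (j, i) = (fst (X $$ (i, j)), - snd (X $$ (i, j)))" using assms unfolding Her_def by blast
  then show "cnj (coordinate_matrix e X i j) = coordinate_matrix e X j i"
    by (simp add: coordinate_matrix_def complex_eq_iff)
qed

lemma psd_coordinate_matrix:
  assumes X: "X \<in> Her s" and d: "0 < d" and psd: "psd ({0..<s} \<times> {0..<d}) (amplified (coordinate_map e) X)"
  shows "psd {0..<s} (coordinate_matrix e X)"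
proof (rule psdI[OF herm_coordinate_matrix[OF X]])
  fix y :: "nat \<Rightarrow> complex"
  let ?z = "\<lambda>a. if snd a = (0::nat) then y (fst a) else 0"
  have "form ({0..<s} \<times> {0..<d}) (amplified (coordinate_map e) X) ?z =
    (\<Sum>i\<in>{0..<s}. \<Sum>p\<in>{0..<d}. \<Sum>j\<in>{0..<s}. \<Sum>q\<in>{0..<d}. if q = 0 then (if p = 0 then cnj (y i) * coordinate_matrix e X i j * y j else 0) else 0)"
    unfolding form_expand sum.cartesian_product'
    by (intro sum.cong refl) (auto simp: amplified_def coordinate_map_def coordinate_matrix_def complex_eq_iff)
  also have "\<dots> = (\<Sum>i\<in>{0..<s}. \<Sum>p\<in>{0..<d}. if p = 0 then (\<Sum>j\<in>{0..<s}. cnj (y i) * coordinate_matrix e X i j * y j) else 0)"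
    using d by (intro sum.cong refl) auto
  also have "\<dots> = form {0..<s} (coordinate_matrix e X) y" using d by (simp add: form_expand)
  finally show "0 \<le> Re (form {0..<s} (coordinate_matrix e X) y)" using psdD(2)[OF psd, of ?z] by simp
qed

lemma square_positive_coordinate_matrix:
  assumes psd: "\<And>c t. c\<^sup>2 + t\<^sup>2 = 1 \<Longrightarrow> psd ({0..<s} \<times> {0..<2}) (amplified (square_map e0 e1 e2 c t) X)"
  shows "square_positive {0..<s} (coordinate_matrix e0 X) (coordinate_matrix e1 X) (coordinate_matrix e2 X)"
  unfolding square_positive_def
proof (intro allI impI)
  fix x y :: "nat \<Rightarrow> complex" and c t :: real assume ct: "c\<^sup>2 + t\<^sup>2 = 1"
  let ?z = "\<lambda>a. if snd a = (0::nat) then x (fst a) else y (fst a)"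
  have two: "{0..<2::nat} = {0, 1}" by auto
  have a: "amplified (square_map e0 e1 e2 c t) X (i, p) (j, q) =
      (if p = q then (if p = 0 then coordinate_matrix e0 X i j else coordinate_matrix e1 X i j) else 0) +
      coordinate_matrix e2 X i j * of_real (if p = 0 then c else t) * of_real (if q = 0 then c else t)" for i j p q
    by (auto simp: amplified_def square_map_def coordinate_matrix_def complex_eq_iff algebra_simps)
  have "form ({0..<s} \<times> {0..<2}) (amplified (square_map e0 e1 e2 c t) X) ?z =
    form {0..<s} (coordinate_matrix e0 X) x + form {0..<s} (coordinate_matrix e1 X) y +
    form {0..<s} (coordinate_matrix e2 X) (\<lambda>i. of_real c * x i + of_real t * y i)"
    unfolding form_expand sum.cartesian_product' two
    by (simp add: a sum.distrib algebra_simps)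
  then show "0 \<le> Re (form {0..<s} (coordinate_matrix e0 X) x) + Re (form {0..<s} (coordinate_matrix e1 X) y) +
      Re (form {0..<s} (coordinate_matrix e2 X) (\<lambda>i. of_real c * x i + of_real t * y i))"
    using psdD(2)[OF psd[OF ct], of ?z] by simp
qed

text \<open>Writing \<open>X\<close> over the generators with coefficient \<open>T\<close> at the
  new generator of a block leaves \<open>A - T\<close>, \<open>B - T\<close> and
  \<open>G + T\<close> at the other three. That all four are psd for a suitable \<open>T\<close> is
  \<open>square_interpolation\<close>, whose hypothesis is positivity under the maps
  \<open>square_map\<close>. For \<open>k = 0\<close> only coordinate maps occur, and size 1 is
  enough.\<close>

lemma squares_subhomogeneous:
  fixes b :: "nat \<Rightarrow> 'v::euclidean_space"
  assumes b: "bij_betw b {..<n} Basis" and k: "3 * k \<le> n" and n: "0 < n"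
  defines "C \<equiv> convex_cone hull (\<lambda>j. vector_of b n (squares n j)) ` {..<n + k}"
  assumes u: "u \<in> interior C" and d: "d = 2 \<or> d = 1 \<and> k = 0"
  shows "d_subhomogeneous d (Cmin C) u"
proof -
  let ?g = "\<lambda>j. vector_of b n (squares n j)"
  define R where "R = {coordinate_map (b i) |i. 3 * k \<le> i \<and> i < n} \<union>
    {square_map (b (3 * l)) (b (3 * l + 1)) (b (3 * l + 2)) c t |l c t. l < k \<and> c\<^sup>2 + t\<^sup>2 = 1}"
  have g: "inner (?g j) (b i) = squares n j i" if "i < n" for i j using vector_of_inner[OF b that] .
  have l: "3 * l + 2 < n" if "l < k" for l using that k by linarith
  have pc: "positive_map C d (coordinate_map (b i))" if i: "3 * k \<le> i" "i < n" for i
    unfolding C_def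
  proof (rule positive_map_convex_cone_hull)
    fix c assume "c \<in> ?g ` {..<n + k}"
    then obtain j where j: "j < n + k" "c = ?g j" by blast
    have "0 \<le> squares n j i" using j(1) i by (auto simp: squares_def)
    then have "psd {0..<d} (\<lambda>p q. of_real (squares n j i) * (if p = q then 1 else 0))" by (intro psd_scale psd_unit) auto
    then show "psd {0..<d} (coordinate_map (b i) c)"
      by (rule psd_cong[rotated]) (simp add: coordinate_map_def j(2) g[OF i(2)])
  qed (auto simp: coordinate_map_def inner_add_left intro!: hermI)
  have ps: "positive_map C d (square_map (b (3 * l)) (b (3 * l + 1)) (b (3 * l + 2)) c t)"
    if lk: "l < k" and ct: "c\<^sup>2 + t\<^sup>2 = 1" for l c t
    unfolding C_def
  proof (rule positive_map_convex_cone_hull)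
    have d: "d = 2" using d lk by auto
    have two: "{0..<2::nat} = {0, 1}" by auto
    fix x assume "x \<in> ?g ` {..<n + k}"
    then obtain j where j: "j < n + k" "x = ?g j" by blast
    let ?A = "squares n j (3 * l)" and ?B = "squares n j (3 * l + 1)" and ?G = "squares n j (3 * l + 2)"
    have e: "square_map (b (3 * l)) (b (3 * l + 1)) (b (3 * l + 2)) c t x p q =
      of_real ((if p = q then (if p = 0 then ?A else ?B) else 0) + ?G * (if p = 0 then c else t) * (if q = 0 then c else t))" for p q
      using g l[OF lk] by (simp add: square_map_def j(2))
    show "psd {0..<d} (square_map (b (3 * l)) (b (3 * l + 1)) (b (3 * l + 2)) c t x)"
      unfolding e d
    proof (rule psd_of_real)
      fix y :: "nat \<Rightarrow> real"
      consider "?A \<ge> 0" "?B \<ge> 0" "?G \<ge> 0" | "?A = 1" "?B = 1" "?G = - 1"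
        by (cases "j < n"; cases "j = n + l") (auto simp: squares_def)
      then have "0 \<le> ?A * (y 0)\<^sup>2 + ?B * (y 1)\<^sup>2 + ?G * (c * y 0 + t * y 1)\<^sup>2"
      proof cases
        case 2
        have "?A * (y 0)\<^sup>2 + ?B * (y 1)\<^sup>2 + ?G * (c * y 0 + t * y 1)\<^sup>2 = (c\<^sup>2 + t\<^sup>2) * ((y 0)\<^sup>2 + (y 1)\<^sup>2) - (c * y 0 + t * y 1)\<^sup>2"
          unfolding 2 ct by simp
        also have "\<dots> = (t * y 0 - c * y 1)\<^sup>2" by (simp add: power2_eq_square algebra_simps)
        finally show ?thesis by simp
      qed simp
      also have "\<dots> = (\<Sum>p\<in>{0..<2}. \<Sum>q\<in>{0..<2}. y p * ((if p = q then (if p = 0 then ?A else ?B) else 0) +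
          ?G * (if p = 0 then c else t) * (if q = 0 then c else t)) * y q)"
        unfolding two by (simp add: power2_eq_square algebra_simps)
      finally show "0 \<le> (\<Sum>p\<in>{0..<2}. \<Sum>q\<in>{0..<2}. y p * ((if p = q then (if p = 0 then ?A else ?B) else 0) +
          ?G * (if p = 0 then c else t) * (if q = 0 then c else t)) * y q)" .
    qed auto
  qed (auto simp: square_map_def inner_add_left algebra_simps intro!: hermI)
  show ?thesis
  proof (rule d_subhomogeneousI_positive_maps[OF _ u, of R])
    show "convex_cone C" unfolding C_def by (rule convex_cone_convex_cone_hull)
    show "R \<noteq> {}"
    proof (cases "k = 0")
      case True
      have "coordinate_map (b 0) \<in> R"
        unfolding R_def by (intro UnI1 CollectI exI[of _ 0]) (use True n in simp)
      then show ?thesis by blast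
    next
      case False
      have "square_map (b (3 * 0)) (b (3 * 0 + 1)) (b (3 * 0 + 2)) 1 0 \<in> R"
        unfolding R_def by (rule UnI2, rule CollectI, rule exI[of _ 0], rule exI[of _ 1], rule exI[of _ 0]) (use False in simp)
      then show ?thesis by blast
    qed
    show "positive_map C d \<rho>" if "\<rho> \<in> R" for \<rho>
      using that unfolding R_def by (elim UnE CollectE exE conjE) (simp_all only: pc ps)
    show "\<exists>e. \<forall>p<d. \<forall>q<d. \<rho> e p q = (if p = q then 1 else 0)" if "\<rho> \<in> R" for \<rho>
      using that unfolding R_def
    proof (elim UnE CollectE exE conjE)
      fix i assume "\<rho> = coordinate_map (b i)" "i < n"
      then show ?thesis using basis_inner[OF b] by (intro exI[of _ "b i"]) (simp add: coordinate_map_def)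
    next
      fix l c t assume \<rho>: "\<rho> = square_map (b (3 * l)) (b (3 * l + 1)) (b (3 * l + 2)) c t" and lk: "l < k"
      show ?thesis
        using l[OF lk] basis_inner[OF b]
        by (intro exI[of _ "b (3 * l) + b (3 * l + 1)"]) (simp add: \<rho> square_map_def inner_add_left)
    qed
    fix s and X :: "('v \<times> 'v) mat"
    assume X: "X \<in> Her s" and psd: "\<And>\<rho>. \<rho> \<in> R \<Longrightarrow> psd ({0..<s} \<times> {0..<d}) (amplified \<rho> X)"
    let ?M = "\<lambda>i. coordinate_matrix (b i) X"
    define ok where "ok l T \<longleftrightarrow> psd {0..<s} T \<and> psd {0..<s} (\<lambda>i j. T i j + ?M (3 * l + 2) i j) \<and>
        psd {0..<s} (\<lambda>i j. ?M (3 * l) i j - T i j) \<and> psd {0..<s} (\<lambda>i j. ?M (3 * l + 1) i j - T i j)" for l T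
    have ex: "\<exists>T. ok l T" if lk: "l < k" for l
      unfolding ok_def
    proof (rule square_interpolation)
      have d: "d = 2" using d lk by auto
      show "square_positive {0..<s} (?M (3 * l)) (?M (3 * l + 1)) (?M (3 * l + 2))"
      proof (rule square_positive_coordinate_matrix)
        fix c t :: real assume "c\<^sup>2 + t\<^sup>2 = 1"
        then have "square_map (b (3 * l)) (b (3 * l + 1)) (b (3 * l + 2)) c t \<in> R" unfolding R_def using lk by blast
        from psd[OF this] show "psd ({0..<s} \<times> {0..<2}) (amplified (square_map (b (3 * l)) (b (3 * l + 1)) (b (3 * l + 2)) c t) X)"
          unfolding d .
      qed
    qed (auto intro: herm_coordinate_matrix X)
    define T where "T l = (SOME T. ok l T)" for l
    have "ok l (T l)" if "l < k" for l unfolding T_def using ex[OF that] by (rule someI_ex)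
    then have T: "psd {0..<s} (T l)" "psd {0..<s} (\<lambda>i j. T l i j + ?M (3 * l + 2) i j)"
      "psd {0..<s} (\<lambda>i j. ?M (3 * l) i j - T l i j)" "psd {0..<s} (\<lambda>i j. ?M (3 * l + 1) i j - T l i j)" if "l < k" for l
      using that unfolding ok_def by blast+
    \<comment> \<open>The coordinate of residue 2 modulo 3 enters the new generator with sign -1,
      hence the plus sign in front of \<open>T\<close>.\<close>
    define Z where "Z j = (if j < 3 * k then (\<lambda>a c. ?M j a c + (if j mod 3 = 2 then T (j div 3) a c else - T (j div 3) a c))
      else if j < n then ?M j else T (j - n))" for j
    have Zpsd: "psd {0..<s} (Z j)" if j: "j < n + k" for j
    proof (cases "j < 3 * k")
      case True
      have lk: "j div 3 < k" using True by (simp add: div_less_iff_less_mult mult.commute)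
      have "3 * (j div 3) + j mod 3 = j" by (rule mult_div_mod_eq)
      moreover have "j mod 3 < 3" by simp
      ultimately consider "3 * (j div 3) = j" "j mod 3 = 0" | "3 * (j div 3) + 1 = j" "j mod 3 = 1" | "3 * (j div 3) + 2 = j" "j mod 3 = 2"
        by linarith
      then show ?thesis
      proof cases
        case 1
        from T(3)[OF lk] show ?thesis by (rule psd_cong[rotated]) (simp only: 1, use True 1 in \<open>simp add: Z_def\<close>)
      next
        case 2
        from T(4)[OF lk] show ?thesis by (rule psd_cong[rotated]) (simp only: 2, use True 2 in \<open>simp add: Z_def\<close>)
      next
        case 3
        from T(2)[OF lk] show ?thesis by (rule psd_cong[rotated]) (simp only: 3, use True 3 in \<open>simp add: Z_def add.commute\<close>)
      qed
    next
      case False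
      show ?thesis
      proof (cases "j < n")
        case True
        have "psd {0..<s} (?M j)"
          by (rule psd_coordinate_matrix[OF X _ psd]) (use d True False in \<open>auto simp: R_def\<close>)
        then show ?thesis using True False by (simp add: Z_def)
      qed (use T(1)[of "j - n"] False j k in \<open>simp add: Z_def\<close>)
    qed
    have gC: "?g j \<in> C" if "j < n + k" for j unfolding C_def using that by (intro hull_inc) auto
    have sumZ: "(\<Sum>j<n + k. squares n j i * f (Z j)) = f (?M i)"
      if i: "i < n" and f: "\<And>A B. f (\<lambda>a c. A a c + B a c) = f A + f B" "\<And>A. f (\<lambda>a c. - A a c) = - f A"
      for i and f :: "(nat \<Rightarrow> nat \<Rightarrow> complex) \<Rightarrow> real"
    proof -
      have "(\<Sum>j<n + k. squares n j i * f (Z j)) = (\<Sum>j<n. squares n j i * f (Z j)) + (\<Sum>l<k. squares n (n + l) i * f (Z (n + l)))"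
        by (rule sum_lessThan_add)
      also have "(\<Sum>j<n. squares n j i * f (Z j)) = (\<Sum>j<n. if j = i then f (Z j) else 0)"
        by (intro sum.cong) (auto simp: squares_def)
      also have "\<dots> = f (Z i)" using i by simp
      also have "(\<Sum>l<k. squares n (n + l) i * f (Z (n + l))) =
          (\<Sum>l<k. if l = i div 3 then (if i mod 3 = 2 then - f (T l) else f (T l)) else 0)"
      proof (intro sum.cong refl)
        fix l assume "l \<in> {..<k}"
        then have Z: "Z (n + l) = T l" using k by (auto simp: Z_def)
        have "((i = 3 * l \<or> i = 3 * l + 1) \<longleftrightarrow> l = q \<and> r \<noteq> 2) \<and> (i = 3 * l + 2 \<longleftrightarrow> l = q \<and> r = 2)"
          if "3 * q + r = i" "r < 3" for q r using that by presburger
        from this[of "i div 3" "i mod 3"]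
        have A: "(i = 3 * l \<or> i = 3 * l + 1) = (l = i div 3 \<and> i mod 3 \<noteq> 2)" and B: "(i = 3 * l + 2) = (l = i div 3 \<and> i mod 3 = 2)"
          by simp_all
        have "squares n (n + l) i = (if l = i div 3 then (if i mod 3 = 2 then - 1 else 1) else 0)"
          unfolding squares_def add_diff_cancel_left' A B by auto
        then show "squares n (n + l) i * f (Z (n + l)) = (if l = i div 3 then (if i mod 3 = 2 then - f (T l) else f (T l)) else 0)"
          unfolding Z by simp
      qed
      also have "\<dots> = (if i < 3 * k then (if i mod 3 = 2 then - f (T (i div 3)) else f (T (i div 3))) else 0)"
        by (auto simp: div_less_iff_less_mult mult.commute)
      finally show ?thesis using i by (simp add: Z_def f)
    qed
    have "Matrix.mat s s (\<lambda>(a, c). \<Sum>j\<in>{..<n + k}. (Re (Z j a c) *\<^sub>R ?g j, Im (Z j a c) *\<^sub>R ?g j)) \<in> Cmin C s"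
      using Zpsd gC by (intro Cmin_sum) auto
    also have "Matrix.mat s s (\<lambda>(a, c). \<Sum>j\<in>{..<n + k}. (Re (Z j a c) *\<^sub>R ?g j, Im (Z j a c) *\<^sub>R ?g j)) = X"
    proof (rule eq_matI)
      have eqI: "v = w" if "\<And>i. i < n \<Longrightarrow> inner v (b i) = inner w (b i)" for v w :: 'v
      proof -
        have "vector_of b n (\<lambda>i. inner v (b i)) = vector_of b n (\<lambda>i. inner w (b i))"
          unfolding vector_of_def using that by (intro sum.cong) auto
        then show ?thesis unfolding vector_of_coordinates[OF b] .
      qed
      fix a c assume "a < dim_row X" "c < dim_col X"
      then have ac: "a < s" "c < s" using X by (auto simp: Her_def)
      have "(\<Sum>j<n + k. Re (Z j a c) *\<^sub>R ?g j) = fst (X $$ (a, c))"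
      proof (rule eqI)
        fix i assume i: "i < n"
        have "inner (\<Sum>j<n + k. Re (Z j a c) *\<^sub>R ?g j) (b i) = (\<Sum>j<n + k. squares n j i * Re (Z j a c))"
          using g[OF i] by (simp add: inner_sum_left mult.commute)
        also have "\<dots> = Re (?M i a c)" using sumZ[OF i, of "\<lambda>A. Re (A a c)"] by simp
        finally show "inner (\<Sum>j<n + k. Re (Z j a c) *\<^sub>R ?g j) (b i) = inner (fst (X $$ (a, c))) (b i)"
          by (simp add: coordinate_matrix_def)
      qed
      moreover have "(\<Sum>j<n + k. Im (Z j a c) *\<^sub>R ?g j) = snd (X $$ (a, c))"
      proof (rule eqI)
        fix i assume i: "i < n"
        have "inner (\<Sum>j<n + k. Im (Z j a c) *\<^sub>R ?g j) (b i) = (\<Sum>j<n + k. squares n j i * Im (Z j a c))"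
          using g[OF i] by (simp add: inner_sum_left mult.commute)
        also have "\<dots> = Im (?M i a c)" using sumZ[OF i, of "\<lambda>A. Im (A a c)"] by simp
        finally show "inner (\<Sum>j<n + k. Im (Z j a c) *\<^sub>R ?g j) (b i) = inner (snd (X $$ (a, c))) (b i)"
          by (simp add: coordinate_matrix_def)
      qed
      ultimately show "Matrix.mat s s (\<lambda>(a, c). \<Sum>j\<in>{..<n + k}. (Re (Z j a c) *\<^sub>R ?g j, Im (Z j a c) *\<^sub>R ?g j)) $$ (a, c) = X $$ (a, c)"
        using ac by (simp add: prod_eq_iff fst_sum snd_sum)
    qed (use X in \<open>auto simp: Her_def\<close>)
    finally show "X \<in> Cmin C s" .
  qed
qed

section \<open>Pencils from two projections\<close>

text \<open>Holding for every such predicate means lying in the span of the null tensors: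
  quantification over \<open>Z\<close> is an induction principle that stands for this span.\<close>

definition closed_null :: "'v::real_vector set \<Rightarrow> ('v \<Rightarrow> nat \<Rightarrow> nat \<Rightarrow> real) \<Rightarrow> nat \<Rightarrow> ((nat \<Rightarrow> 'v) \<Rightarrow> bool) \<Rightarrow> bool" where
  "closed_null C S s Z \<longleftrightarrow> (\<forall>w w'. Z w \<longrightarrow> Z w' \<longrightarrow> Z (\<lambda>j. w j + w' j)) \<and> (\<forall>r w. Z w \<longrightarrow> Z (\<lambda>j. r *\<^sub>R w j)) \<and>
     (\<forall>w w'. (\<forall>j<s. w j = w' j) \<longrightarrow> Z w \<longrightarrow> Z w') \<and>
     (\<forall>x c. c \<in> C \<longrightarrow> (\<forall>i<s. (\<Sum>j\<in>{0..<s}. S c i j * x j) = 0) \<longrightarrow> Z (\<lambda>j. x j *\<^sub>R c))"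

lemma closed_nullD:
  assumes "closed_null C S s Z"
  shows "Z w \<Longrightarrow> Z w' \<Longrightarrow> Z (\<lambda>j. w j + w' j)" and "Z w \<Longrightarrow> Z (\<lambda>j. r *\<^sub>R w j)"
    and "(\<And>j. j < s \<Longrightarrow> w j = w' j) \<Longrightarrow> Z w \<Longrightarrow> Z w'"
    and "c \<in> C \<Longrightarrow> (\<And>i. i < s \<Longrightarrow> (\<Sum>j\<in>{0..<s}. S c i j * x j) = 0) \<Longrightarrow> Z (\<lambda>j. x j *\<^sub>R c)"
proof -
  note a = assms[unfolded closed_null_def]
  note a' = a[THEN conjunct2] a[THEN conjunct2, THEN conjunct2]
  show "Z w \<Longrightarrow> Z w' \<Longrightarrow> Z (\<lambda>j. w j + w' j)" by (rule a[THEN conjunct1, rule_format])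
  show "Z w \<Longrightarrow> Z (\<lambda>j. r *\<^sub>R w j)" by (rule a'(1)[THEN conjunct1, rule_format])
  show "(\<And>j. j < s \<Longrightarrow> w j = w' j) \<Longrightarrow> Z w \<Longrightarrow> Z w'" by (rule a'(2)[THEN conjunct1, rule_format])
  show "c \<in> C \<Longrightarrow> (\<And>i. i < s \<Longrightarrow> (\<Sum>j\<in>{0..<s}. S c i j * x j) = 0) \<Longrightarrow> Z (\<lambda>j. x j *\<^sub>R c)"
    by (rule a'(2)[THEN conjunct2, rule_format])
qed

definition closed_algebra :: "nat \<Rightarrow> ((nat \<Rightarrow> nat \<Rightarrow> complex) \<Rightarrow> bool) \<Rightarrow> bool" where
  "closed_algebra s G \<longleftrightarrow> (\<forall>M N. G M \<longrightarrow> G N \<longrightarrow> G (\<lambda>i j. M i j + N i j)) \<and> (\<forall>z M. G M \<longrightarrow> G (\<lambda>i j. z * M i j)) \<and>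
     (\<forall>M N. G M \<longrightarrow> G N \<longrightarrow> G (\<lambda>i j. \<Sum>k\<in>{0..<s}. M i k * N k j)) \<and>
     (\<forall>M N. (\<forall>i<s. \<forall>j<s. M i j = N i j) \<longrightarrow> G M \<longrightarrow> G N)"

lemma closed_algebraD:
  assumes "closed_algebra s G"
  shows "G M \<Longrightarrow> G N \<Longrightarrow> G (\<lambda>i j. M i j + N i j)" and "G M \<Longrightarrow> G (\<lambda>i j. z * M i j)"
    and "G M \<Longrightarrow> G N \<Longrightarrow> G (\<lambda>i j. \<Sum>k\<in>{0..<s}. M i k * N k j)"
    and "(\<And>i j. i < s \<Longrightarrow> j < s \<Longrightarrow> M i j = N i j) \<Longrightarrow> G M \<Longrightarrow> G N"
proof -
  note a = assms[unfolded closed_algebra_def]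
  note a' = a[THEN conjunct2] a[THEN conjunct2, THEN conjunct2]
  show "G M \<Longrightarrow> G N \<Longrightarrow> G (\<lambda>i j. M i j + N i j)" by (rule a[THEN conjunct1, rule_format])
  show "G M \<Longrightarrow> G (\<lambda>i j. z * M i j)" by (rule a'(1)[THEN conjunct1, rule_format])
  show "G M \<Longrightarrow> G N \<Longrightarrow> G (\<lambda>i j. \<Sum>k\<in>{0..<s}. M i k * N k j)" by (rule a'(2)[THEN conjunct1, rule_format])
  show "(\<And>i j. i < s \<Longrightarrow> j < s \<Longrightarrow> M i j = N i j) \<Longrightarrow> G M \<Longrightarrow> G N"
    by (rule a'(2)[THEN conjunct2, rule_format])
qed

text \<open>The kernel can be described one coordinate at a time: if each
  \<open>x \<otimes> b\<^sub>l\<close> agrees with \<open>S(b\<^sub>l) x \<otimes> e\<close> modulo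
  null tensors, then a family \<open>w\<close> agrees with
  \<open>(\<Sum>\<^sub>j S(w\<^sub>j) \<epsilon>\<^sub>j) \<otimes> e\<close>, which vanishes on the
  kernel.\<close>

lemma pencil_not_d_subhomogeneous:
  fixes b :: "nat \<Rightarrow> 'v::euclidean_space" and S :: "'v \<Rightarrow> nat \<Rightarrow> nat \<Rightarrow> real"
  assumes b: "bij_betw b {..<n} Basis" and u: "u \<in> interior (convex_cone hull T)"
    and d: "1 \<le> d" "d < s"
    and S_add: "\<And>x y i j. S (x + y) i j = S x i j + S y i j" and S_scale: "\<And>r x i j. S (r *\<^sub>R x) i j = r * S x i j"
    and S_sym: "\<And>x i j. S x i j = S x j i"
    and S_nonneg: "\<And>c y. c \<in> T \<Longrightarrow> 0 \<le> (\<Sum>i\<in>{0..<s}. \<Sum>j\<in>{0..<s}. y i * S c i j * y j)"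
    and S_e: "\<And>i j. i < s \<Longrightarrow> j < s \<Longrightarrow> S e i j = (if i = j then 1 else 0)"
    and coordinates: "\<And>Z l x. closed_null (convex_cone hull T) S s Z \<Longrightarrow> l < n \<Longrightarrow>
      Z (\<lambda>j. x j *\<^sub>R b l - (\<Sum>k\<in>{0..<s}. S (b l) j k * x k) *\<^sub>R e)"
    and generation: "\<And>G a b. closed_algebra s G \<Longrightarrow> (\<And>x. G (\<lambda>i j. complex_of_real (S x i j))) \<Longrightarrow>
      a \<le> d \<Longrightarrow> b \<le> d \<Longrightarrow> G (\<lambda>i j. if i = a \<and> j = b then 1 else 0)"
  shows "\<not> d_subhomogeneous d (Cmin (convex_cone hull T)) u"
proof
  let ?C = "convex_cone hull T"
  have S0: "S 0 i j = 0" for i j using S_scale[of 0 0] by simp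
  have S_sum: "S (\<Sum>l<k. f l) i j = (\<Sum>l<k. S (f l) i j)" for f and k :: nat and i j
    by (induction k) (simp_all add: S0 S_add)
  have nonneg: "0 \<le> (\<Sum>i\<in>{0..<s}. \<Sum>j\<in>{0..<s}. y i * S c i j * y j)" if "c \<in> ?C" for c y
    using that
  proof (induction rule: convex_cone_hull_induct)
    case (add x y)
    then show ?case by (simp add: S_add distrib_left distrib_right sum.distrib)
  next
    case (scale r x)
    have "(\<Sum>i\<in>{0..<s}. \<Sum>j\<in>{0..<s}. y i * S (r *\<^sub>R x) i j * y j) = r * (\<Sum>i\<in>{0..<s}. \<Sum>j\<in>{0..<s}. y i * S x i j * y j)"
      by (simp add: S_scale sum_distrib_left mult_ac)
    then show ?case using scale by simp
  qed (simp_all add: S_nonneg S0)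
  obtain r where r: "r > 0" "cball u r \<subseteq> ?C" using u mem_interior_cball by blast
  define \<delta> where "\<delta> = r / (norm e + 1)"
  have ne: "norm e + 1 > 0" using norm_ge_zero[of e] by linarith
  have "r * (norm e / (norm e + 1)) \<le> r * 1" using r ne by (intro mult_left_mono) simp_all
  then have \<delta>: "\<delta> > 0" "\<delta> * norm e \<le> r" using r ne by (simp_all add: \<delta>_def)
  have uC: "u + (- \<delta>) *\<^sub>R e \<in> ?C" using \<delta> by (intro subsetD[OF r(2)]) (simp add: dist_norm)
  have S_u: "\<delta> * (\<Sum>i\<in>{0..<s}. (y i)\<^sup>2) \<le> (\<Sum>i\<in>{0..<s}. \<Sum>j\<in>{0..<s}. y i * S u i j * y j)" for y
  proof -
    have "(\<Sum>i\<in>{0..<s}. \<Sum>j\<in>{0..<s}. y i * S (u + (- \<delta>) *\<^sub>R e) i j * y j) =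
      (\<Sum>i\<in>{0..<s}. \<Sum>j\<in>{0..<s}. y i * S u i j * y j - (if j = i then \<delta> * (y i)\<^sup>2 else 0))"
      unfolding S_add S_scale by (intro sum.cong refl) (auto simp: S_e algebra_simps power2_eq_square)
    also have "\<dots> = (\<Sum>i\<in>{0..<s}. \<Sum>j\<in>{0..<s}. y i * S u i j * y j) - \<delta> * (\<Sum>i\<in>{0..<s}. (y i)\<^sup>2)"
      by (simp add: sum_subtractf sum_distrib_left)
    finally show ?thesis using nonneg[OF uC, of y] by simp
  qed
  assume "d_subhomogeneous d (Cmin ?C) u"
  then obtain \<A> :: "(nat \<Rightarrow> complex) cstar_algebra" and \<Phi> where A: "commutative_cstar_algebra \<A>"
    and emb: "unital_complete_order_embedding (Cmin ?C) u (Mat d \<A>) \<Phi>"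
    unfolding d_subhomogeneous_def by blast
  have "embedded_pencil \<A> ?C u e d s \<Phi> S \<delta>"
  proof (intro embedded_pencil.intro embedded_pencil_axioms.intro A emb d S_add S_scale S_u \<delta>)
    show "S v i j = S v j i" for v i j by (rule S_sym)
    show "0 \<le> (\<Sum>i\<in>{0..<s}. \<Sum>j\<in>{0..<s}. y i * S c i j * y j)" if "c \<in> ?C" for c y using nonneg[OF that] .
    show "S e i j = (if i = j then 1 else 0)" if "i < s" "j < s" for i j using S_e[OF that] .
  next
    fix Z :: "(nat \<Rightarrow> 'v) \<Rightarrow> bool" and w
    assume Z: "\<And>w w'. Z w \<Longrightarrow> Z w' \<Longrightarrow> Z (\<lambda>j. w j + w' j)" "\<And>r w. Z w \<Longrightarrow> Z (\<lambda>j. r *\<^sub>R w j)"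
      "\<And>w w'. (\<And>j. j < s \<Longrightarrow> w j = w' j) \<Longrightarrow> Z w \<Longrightarrow> Z w'"
      "\<And>m c. c \<in> ?C \<Longrightarrow> (\<And>i. i < s \<Longrightarrow> (\<Sum>j\<in>{0..<s}. S c i j * m j) = 0) \<Longrightarrow> Z (\<lambda>j. m j *\<^sub>R c)"
      and w: "\<And>i. i < s \<Longrightarrow> (\<Sum>j\<in>{0..<s}. S (w j) i j) = 0"
    have cl: "closed_null ?C S s Z"
      unfolding closed_null_def
      by (intro conjI allI impI, erule (1) Z(1), erule Z(2), erule Z(3)[rotated], blast, erule Z(4), blast)
    let ?t = "\<lambda>l j. inner (w j) (b l) *\<^sub>R b l - (\<Sum>k\<in>{0..<s}. S (b l) j k * inner (w k) (b l)) *\<^sub>R e"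
    have zero: "Z (\<lambda>j. 0)" using Z(4)[of 0 "\<lambda>_. 0"] by (simp add: convex_cone_hull_contains_0)
    have "Z (\<lambda>j. \<Sum>l<k. ?t l j)" if "k \<le> n" for k
      using that
    proof (induction k)
      case (Suc k)
      then have "Z (\<lambda>j. (\<Sum>l<k. ?t l j) + ?t k j)" using coordinates[OF cl] by (intro Z(1)) auto
      then show ?case by simp
    qed (simp add: zero)
    then have "Z (\<lambda>j. \<Sum>l<n. ?t l j)" by simp
    then show "Z w"
    proof (rule Z(3)[rotated])
      fix j assume j: "j < s"
      have W: "(\<Sum>l<n. inner (w k) (b l) *\<^sub>R b l) = w k" for k
        using vector_of_coordinates[OF b] unfolding vector_of_def .
      have "(\<Sum>l<n. \<Sum>k\<in>{0..<s}. S (b l) j k * inner (w k) (b l)) = (\<Sum>k\<in>{0..<s}. \<Sum>l<n. S (inner (w k) (b l) *\<^sub>R b l) j k)"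
        unfolding S_scale by (subst sum.swap) (simp add: mult.commute)
      also have "\<dots> = (\<Sum>k\<in>{0..<s}. S (w k) j k)" unfolding S_sum[symmetric] W ..
      finally have "(\<Sum>l<n. \<Sum>k\<in>{0..<s}. S (b l) j k * inner (w k) (b l)) = 0" using w[OF j] by simp
      then show "(\<Sum>l<n. ?t l j) = w j"
        unfolding sum_subtractf W scaleR_sum_left[symmetric] by simp
    qed
  next
    fix G :: "(nat \<Rightarrow> nat \<Rightarrow> complex) \<Rightarrow> bool" and a a'
    assume G: "\<And>v. G (\<lambda>i j. complex_of_real (S v i j))"
      "\<And>M N. G M \<Longrightarrow> G N \<Longrightarrow> G (\<lambda>i j. M i j + N i j)" "\<And>z M. G M \<Longrightarrow> G (\<lambda>i j. z * M i j)"
      "\<And>M N. G M \<Longrightarrow> G N \<Longrightarrow> G (\<lambda>i j. \<Sum>k\<in>{0..<s}. M i k * N k j)"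
      "\<And>M N. (\<And>i j. i < s \<Longrightarrow> j < s \<Longrightarrow> M i j = N i j) \<Longrightarrow> G M \<Longrightarrow> G N"
      and a: "a \<le> d" "a' \<le> d"
    have "closed_algebra s G"
      unfolding closed_algebra_def
      by (intro conjI allI impI, erule (1) G(2), erule G(3), erule (1) G(4), erule G(5)[rotated], blast)
    then show "G (\<lambda>i j. if i = a \<and> j = a' then 1 else 0)" using G(1) a by (rule generation)
  qed
  then show False by (rule embedded_pencil.no_embedded_pencil)
qed

text \<open>Matrices of size \<open>2m\<close> with basis \<open>g\<^sub>0, \<dots>, g\<^sub>m\<^sub>-\<^sub>1, f\<^sub>0, \<dots>, f\<^sub>m\<^sub>-\<^sub>1\<close>: \<open>P\<close> projects onto the span of
  the \<open>q\<^sub>a g\<^sub>a + p\<^sub>a f\<^sub>a\<close>, \<open>Q\<close> onto that of the \<open>g\<^sub>a\<close>, and \<open>V = v v\<^sup>T\<close>. The \<open>v\<^sub>a\<close> are chosen such that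
  \<open>P + Q - V \<ge> 1/2\<close> with one-dimensional kernel of the difference.\<close>

locale two_projections =
  fixes m :: nat
  assumes m: "0 < m"
begin

abbreviation "N \<equiv> {0..<2 * m}"

text \<open>Distinct values in [1/10, 1/5). Distinctness separates the eigenvalues of
  \<open>Q P Q\<close>, the upper bound keeps \<open>1 / 4 - q2 a\<close> positive in
  \<open>vv\<close>, and the lower bound is the source of the constant 1/20 in
  \<open>qf_coercive\<close>.\<close>

definition q2 :: "nat \<Rightarrow> real" where "q2 a = 1 / 10 + real a / (10 * real m)"
definition qq :: "nat \<Rightarrow> real" where "qq a = sqrt (q2 a)"
definition pp :: "nat \<Rightarrow> real" where "pp a = sqrt (1 - q2 a)"
text \<open>On the block \<open>(g\<^sub>a, f\<^sub>a)\<close>, eliminating \<open>f\<^sub>a\<close>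
  from \<open>P + Q - 1/2\<close> leaves the Schur complement
  \<open>(1/4 - q2 a) / (1/2 - q2 a)\<close>, which is \<open>m\<close> times
  \<open>(vv a)\<^sup>2\<close>. The diagonal matrix of these numbers minus
  \<open>vv vv\<^sup>T\<close> is psd by Cauchy-Schwarz, with kernel spanned by
  \<open>1 / vv\<close>.\<close>

definition vv :: "nat \<Rightarrow> real" where "vv a = sqrt ((1 / 4 - q2 a) / (real m * (1 / 2 - q2 a)))"
definition r :: "nat \<Rightarrow> nat \<Rightarrow> real" where "r a i = (if i = a then qq a else if i = m + a then pp a else 0)"
definition v :: "nat \<Rightarrow> real" where "v i = (if i < m then vv i else 0)"
text \<open>The null vector of \<open>P + Q - V - 1/2\<close>: proportional to \<open>1 / vv\<close>
  on the \<open>g\<^sub>a\<close>, completed on the \<open>f\<^sub>a\<close> by back substitution,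
  and scaled such that \<open>dot v kv = 1\<close>.\<close>

definition kv :: "nat \<Rightarrow> real" where
  "kv i = (if i < m then 1 / (real m * vv i)
     else - pp (i - m) * qq (i - m) / ((1 / 2 - q2 (i - m)) * (real m * vv (i - m))))"
definition P :: "nat \<Rightarrow> nat \<Rightarrow> real" where "P i j = (\<Sum>a<m. r a i * r a j)"
definition Q :: "nat \<Rightarrow> nat \<Rightarrow> real" where "Q i j = (if i = j \<and> i < m then 1 else 0)"
definition V :: "nat \<Rightarrow> nat \<Rightarrow> real" where "V i j = v i * v j"
definition one :: "nat \<Rightarrow> nat \<Rightarrow> real" where "one i j = (if i = j then 1 else 0)"

definition dot :: "(nat \<Rightarrow> real) \<Rightarrow> (nat \<Rightarrow> real) \<Rightarrow> real" where "dot y z = (\<Sum>i\<in>N. y i * z i)"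
definition app :: "(nat \<Rightarrow> nat \<Rightarrow> real) \<Rightarrow> (nat \<Rightarrow> real) \<Rightarrow> nat \<Rightarrow> real" where "app A y i = (\<Sum>j\<in>N. A i j * y j)"
definition qf :: "(nat \<Rightarrow> nat \<Rightarrow> real) \<Rightarrow> (nat \<Rightarrow> real) \<Rightarrow> real" where "qf A y = (\<Sum>i\<in>N. \<Sum>j\<in>N. y i * A i j * y j)"

lemma sum_double: "(\<Sum>i\<in>N. f i) = (\<Sum>a<m. f a) + (\<Sum>a<m. f (m + a) :: 'b :: comm_monoid_add)"
  using sum_lessThan_add[of f m m] by (simp add: mult_2 atLeast0LessThan)

lemma q2_bounds: "a < m \<Longrightarrow> 1 / 10 \<le> q2 a \<and> q2 a < 1 / 5"
  using m by (simp add: q2_def field_simps)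

lemma squares: assumes "a < m" shows "(qq a)\<^sup>2 = q2 a" "(pp a)\<^sup>2 = 1 - q2 a"
    "(vv a)\<^sup>2 * (real m * (1 / 2 - q2 a)) = 1 / 4 - q2 a" "0 < vv a"
proof -
  note q = q2_bounds[OF assms]
  have den: "0 < real m * (1 / 2 - q2 a)" using q m by simp
  show "(qq a)\<^sup>2 = q2 a" "(pp a)\<^sup>2 = 1 - q2 a" using q by (simp_all add: qq_def pp_def)
  have "0 < (1 / 4 - q2 a) / (real m * (1 / 2 - q2 a))" using q den by (intro divide_pos_pos) simp_all
  then have "0 < vv a" and eq: "(vv a)\<^sup>2 = (1 / 4 - q2 a) / (real m * (1 / 2 - q2 a))" by (simp_all add: vv_def)
  then show "0 < vv a" by blast
  show "(vv a)\<^sup>2 * (real m * (1 / 2 - q2 a)) = 1 / 4 - q2 a" using eq den by (metis eq_divide_eq less_irrefl)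
qed

lemma dot_r: assumes "a < m" shows "dot (r a) y = qq a * y a + pp a * y (m + a)"
proof -
  have "dot (r a) y = (\<Sum>i<m. if i = a then qq a * y i else 0) + (\<Sum>i<m. if i = a then pp a * y (m + i) else 0)"
    unfolding dot_def sum_double using assms by (intro arg_cong2[where f = "(+)"] sum.cong) (auto simp: r_def)
  then show ?thesis using assms by simp
qed

lemma dot_r_r: "a < m \<Longrightarrow> c < m \<Longrightarrow> dot (r a) (r c) = (if a = c then 1 else 0)"
  using squares(1)[of a] squares(2)[of a] by (auto simp: dot_r r_def power2_eq_square)

lemma dot_v: "dot v y = (\<Sum>a<m. vv a * y a)"
  unfolding dot_def sum_double by (simp add: v_def)

lemma dot_linear: "dot z (\<lambda>i. x i + y i) = dot z x + dot z y" "dot z (\<lambda>i. x i - y i) = dot z x - dot z y"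
  "dot z (\<lambda>i. c * x i) = c * dot z x"
  unfolding dot_def by (simp_all add: algebra_simps sum.distrib sum_subtractf sum_distrib_left)

lemma dot_sum: "dot z (\<lambda>i. \<Sum>a\<in>K. f a i) = (\<Sum>a\<in>K. dot z (f a))"
  unfolding dot_def sum_distrib_left by (rule sum.swap)

lemma app_P: "app P y i = (\<Sum>a<m. r a i * dot (r a) y)"
  unfolding app_def P_def dot_def sum_distrib_left sum_distrib_right by (subst sum.swap) (simp add: mult_ac)

lemma app_V: "app V y i = v i * dot v y"
  unfolding app_def V_def dot_def sum_distrib_left by (simp add: mult_ac)

lemma app_one: "i < 2 * m \<Longrightarrow> app one y i = y i"
proof -
  assume i: "i < 2 * m"
  have "app one y i = (\<Sum>j\<in>N. if i = j then y j else 0)" unfolding app_def one_def by (intro sum.cong) auto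
  then show ?thesis using i by simp
qed

lemma app_Q: "i < 2 * m \<Longrightarrow> app Q y i = (if i < m then y i else 0)"
proof -
  assume i: "i < 2 * m"
  have "app Q y i = (\<Sum>j\<in>N. if i = j then (if i < m then y j else 0) else 0)" unfolding app_def Q_def by (intro sum.cong) auto
  then show ?thesis using i by simp
qed

lemma app_linear: "app A (\<lambda>i. x i + y i) i = app A x i + app A y i" "app A (\<lambda>i. x i - y i) i = app A x i - app A y i"
  "app A (\<lambda>i. c * x i) i = c * app A x i"
  "app (\<lambda>i j. A i j + B i j) y i = app A y i + app B y i" "app (\<lambda>i j. A i j - B i j) y i = app A y i - app B y i"
  "app (\<lambda>i j. c * A i j) y i = c * app A y i"
  unfolding app_def by (simp_all add: algebra_simps sum.distrib sum_subtractf sum_distrib_left)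

lemma app_cong: "(\<And>i. i < 2 * m \<Longrightarrow> x i = y i) \<Longrightarrow> app A x i = app A y i"
  unfolding app_def by (intro sum.cong) auto

lemma dot_cong: "(\<And>i. i < 2 * m \<Longrightarrow> x i = y i) \<Longrightarrow> dot z x = dot z y"
  unfolding dot_def by (intro sum.cong) auto

lemma app_PP: "app P (app P y) i = app P y i"
proof -
  have "dot (r a) (app P y) = dot (r a) y" if a: "a < m" for a
  proof -
    have "dot (r a) (app P y) = (\<Sum>c<m. dot (r a) (\<lambda>i. dot (r c) y * r c i))"
      unfolding app_P[abs_def] dot_sum by (simp add: mult.commute)
    also have "\<dots> = (\<Sum>c<m. if a = c then dot (r c) y else 0)"
      unfolding dot_linear using a by (intro sum.cong) (auto simp: dot_r_r)
    finally show ?thesis using a by simp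
  qed
  then show ?thesis unfolding app_P by simp
qed

lemma dot_v_app_Q: "dot v (app Q y) = dot v y"
  unfolding dot_v using app_Q[of _ y] by simp

lemma dot_v_v: "dot v v = (\<Sum>a<m. (vv a)\<^sup>2)"
  unfolding dot_v by (simp add: v_def power2_eq_square)

lemma dot_v_v_bounds: "0 < dot v v" "dot v v \<le> 1 / 2"
proof -
  have "(vv a)\<^sup>2 \<le> 1 / (2 * real m)" if a: "a < m" for a
  proof -
    have "(vv a)\<^sup>2 * (real m * (1 / 2 - q2 a)) \<le> 1 / (2 * real m) * (real m * (1 / 2 - q2 a))"
      unfolding squares(3)[OF a] using m q2_bounds[OF a] by (simp add: field_simps)
    then show ?thesis using m q2_bounds[OF a] by (subst (asm) mult_le_cancel_right_pos) simp_all
  qed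
  then have "dot v v \<le> (\<Sum>a<m. 1 / (2 * real m))" unfolding dot_v_v by (intro sum_mono) simp
  then show "dot v v \<le> 1 / 2" using m by simp
  show "0 < dot v v" unfolding dot_v_v by (intro sum_pos zero_less_power squares(4)) (use m in auto)
qed

lemma qf_app: "qf A y = dot y (app A y)"
  unfolding qf_def dot_def app_def by (simp add: sum_distrib_left mult.assoc)

lemma qf_linear: "qf (\<lambda>i j. A i j + B i j) y = qf A y + qf B y" "qf (\<lambda>i j. A i j - B i j) y = qf A y - qf B y"
  "qf (\<lambda>i j. c * A i j) y = c * qf A y"
  unfolding qf_def by (simp_all add: algebra_simps sum.distrib sum_subtractf sum_distrib_left)

lemma dot_commute: "dot x y = dot y x" unfolding dot_def by (simp add: mult.commute)

lemma qf_P: "qf P y = (\<Sum>a<m. (qq a * y a + pp a * y (m + a))\<^sup>2)"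
proof -
  have "qf P y = (\<Sum>a<m. dot y (\<lambda>i. dot (r a) y * r a i))"
    unfolding qf_app app_P[abs_def] dot_sum by (simp add: mult.commute)
  also have "\<dots> = (\<Sum>a<m. (dot (r a) y)\<^sup>2)" unfolding dot_linear by (simp add: power2_eq_square dot_commute)
  finally show ?thesis by (simp add: dot_r)
qed

lemma qf_V: "qf V y = (dot v y)\<^sup>2"
proof -
  have "qf V y = dot y (\<lambda>i. dot v y * v i)" unfolding qf_app app_V[abs_def] by (simp add: mult.commute)
  then show ?thesis unfolding dot_linear by (simp add: power2_eq_square dot_commute)
qed

lemma qf_Q: "qf Q y = (\<Sum>a<m. (y a)\<^sup>2)"
proof -
  have "qf Q y = dot y (\<lambda>i. if i < m then y i else 0)" unfolding qf_app by (rule dot_cong) (rule app_Q)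
  then show ?thesis unfolding dot_def sum_double by (simp add: power2_eq_square)
qed

lemma qf_one: "qf one y = (\<Sum>a<m. (y a)\<^sup>2 + (y (m + a))\<^sup>2)"
proof -
  have "qf one y = dot y y" unfolding qf_app by (rule dot_cong) (rule app_one)
  then show ?thesis unfolding dot_def sum_double by (simp add: power2_eq_square sum.distrib)
qed

lemma qf_nonneg: "0 \<le> qf P y" "0 \<le> qf V y" "0 \<le> qf Q y" "0 \<le> qf one y" "qf Q y \<le> qf one y"
  unfolding qf_P qf_V qf_Q qf_one by (auto intro!: sum_nonneg add_nonneg_nonneg sum_mono)

lemma qf_P_le: "qf P y \<le> qf one y"
  unfolding qf_P qf_one
proof (rule sum_mono)
  fix a assume "a \<in> {..<m}"
  then have a: "a < m" by simp
  have "(qq a * y a + pp a * y (m + a))\<^sup>2 + (pp a * y a - qq a * y (m + a))\<^sup>2 = ((qq a)\<^sup>2 + (pp a)\<^sup>2) * ((y a)\<^sup>2 + (y (m + a))\<^sup>2)"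
    by (simp add: power2_eq_square algebra_simps)
  moreover have "(qq a)\<^sup>2 + (pp a)\<^sup>2 = 1" using squares(1,2)[OF a] by simp
  ultimately show "(qq a * y a + pp a * y (m + a))\<^sup>2 \<le> (y a)\<^sup>2 + (y (m + a))\<^sup>2"
    using zero_le_power2[of "pp a * y a - qq a * y (m + a)"] by (simp only: mult_1)
qed

lemma qf_V_le: "qf V y \<le> dot v v * qf Q y"
  unfolding qf_V qf_Q dot_v_v using Cauchy_Schwarz_ineq_sum[of vv y "{..<m}"] by (simp add: dot_v)

lemma qf_V_le_Q: "qf V y \<le> qf Q y"
proof -
  have "dot v v * qf Q y \<le> 1 * qf Q y" using dot_v_v_bounds qf_nonneg(3) by (intro mult_right_mono) simp_all
  then show ?thesis using qf_V_le[of y] by simp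
qed

text \<open>The kernel of \<open>P\<close> and the range of \<open>Q\<close> are at a positive
  angle, quantified by \<open>q2 a \<ge> 1/10\<close>. The slack allows the conic generators a
  negative third coordinate of size up to 1/20.\<close>

lemma qf_coercive: "qf one y / 20 \<le> qf P y + qf one y - qf Q y"
proof -
  have "((y a)\<^sup>2 + (y (m + a))\<^sup>2) / 20 \<le> (qq a * y a + pp a * y (m + a))\<^sup>2 + (y (m + a))\<^sup>2" if a: "a < m" for a
  proof -
    let ?g = "y a" and ?f = "y (m + a)"
    have "(qq a)\<^sup>2 * ?g\<^sup>2 \<le> 2 * (qq a * ?g + pp a * ?f)\<^sup>2 + 2 * ((pp a)\<^sup>2 * ?f\<^sup>2)"
      using zero_le_power2[of "qq a * ?g + 2 * (pp a * ?f)"] by (simp add: power2_eq_square algebra_simps)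
    then have "q2 a * (?g\<^sup>2 / 2 + ?f\<^sup>2) \<le> (qq a * ?g + pp a * ?f)\<^sup>2 + ?f\<^sup>2"
      unfolding squares(1,2)[OF a] by (simp add: algebra_simps)
    moreover have "1 / 10 * (?g\<^sup>2 / 2 + ?f\<^sup>2) \<le> q2 a * (?g\<^sup>2 / 2 + ?f\<^sup>2)"
      using q2_bounds[OF a] by (intro mult_right_mono) simp_all
    moreover have "(?g\<^sup>2 + ?f\<^sup>2) / 20 \<le> 1 / 10 * (?g\<^sup>2 / 2 + ?f\<^sup>2)" by simp
    ultimately show ?thesis by linarith
  qed
  then have "(\<Sum>a<m. ((y a)\<^sup>2 + (y (m + a))\<^sup>2) / 20) \<le> (\<Sum>a<m. (qq a * y a + pp a * y (m + a))\<^sup>2 + (y (m + a))\<^sup>2)"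
    by (intro sum_mono) simp
  also have "\<dots> = qf P y + qf one y - qf Q y" by (simp add: qf_P qf_one qf_Q sum.distrib)
  finally show ?thesis unfolding sum_divide_distrib[symmetric] qf_one .
qed

text \<open>The Schur complement argument behind \<open>vv\<close>: blockwise, after multiplication
  by \<open>1 - 2 q2 a\<close>, the difference is the square that eliminates
  \<open>f\<^sub>a\<close>; the blocks are joined by Cauchy-Schwarz for
  \<open>dot v y\<close>.\<close>

lemma qf_half: "0 \<le> 2 * qf P y + 2 * (qf Q y - qf V y) - qf one y"
proof -
  have "2 * real m * ((vv a)\<^sup>2 * (y a)\<^sup>2) \<le> 2 * (qq a * y a + pp a * y (m + a))\<^sup>2 + (y a)\<^sup>2 - (y (m + a))\<^sup>2" if a: "a < m" for a
  proof -
    let ?g = "y a" and ?f = "y (m + a)" and ?t = "1 - 2 * q2 a"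
    have t: "0 < ?t" using q2_bounds[OF a] by simp
    have v: "2 * real m * (vv a)\<^sup>2 * ?t = 1 - 4 * q2 a" using squares(3)[OF a] by (simp add: algebra_simps)
    have pq: "(pp a * qq a)\<^sup>2 = (1 - q2 a) * q2 a" using squares[OF a] by (simp add: power_mult_distrib)
    have "?t * (2 * (qq a * ?g + pp a * ?f)\<^sup>2 + ?g\<^sup>2 - ?f\<^sup>2) - 2 * real m * (vv a)\<^sup>2 * ?t * ?g\<^sup>2 =
      ?t * (2 * ((qq a)\<^sup>2 * ?g\<^sup>2 + 2 * (pp a * qq a) * ?f * ?g + (pp a)\<^sup>2 * ?f\<^sup>2) + ?g\<^sup>2 - ?f\<^sup>2) - (1 - 4 * q2 a) * ?g\<^sup>2"
      unfolding v by (simp add: power2_eq_square algebra_simps)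
    also have "\<dots> = (?t * ?f)\<^sup>2 + 2 * (?t * ?f) * (2 * (pp a * qq a) * ?g) + 4 * ((1 - q2 a) * q2 a) * ?g\<^sup>2"
      unfolding squares(1,2)[OF a] by (simp add: power2_eq_square algebra_simps)
    also have "\<dots> = (?t * ?f + 2 * (pp a * qq a) * ?g)\<^sup>2"
      unfolding pq[symmetric] by (simp add: power2_eq_square algebra_simps)
    finally have "0 \<le> ?t * (2 * (qq a * ?g + pp a * ?f)\<^sup>2 + ?g\<^sup>2 - ?f\<^sup>2) - 2 * real m * (vv a)\<^sup>2 * ?t * ?g\<^sup>2" by simp
    then have "0 \<le> ?t * (2 * (qq a * ?g + pp a * ?f)\<^sup>2 + ?g\<^sup>2 - ?f\<^sup>2 - 2 * real m * ((vv a)\<^sup>2 * ?g\<^sup>2))"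
      by (simp add: algebra_simps)
    then show ?thesis using t by (simp add: zero_le_mult_iff)
  qed
  then have "(\<Sum>a<m. 2 * real m * ((vv a)\<^sup>2 * (y a)\<^sup>2)) \<le> (\<Sum>a<m. 2 * (qq a * y a + pp a * y (m + a))\<^sup>2 + (y a)\<^sup>2 - (y (m + a))\<^sup>2)"
    by (intro sum_mono) simp
  moreover have "(\<Sum>a<m. vv a * y a)\<^sup>2 \<le> (\<Sum>a<m. (vv a)\<^sup>2 * (y a)\<^sup>2) * real m"
    using sum_squared_le_sum_of_squares[of "\<lambda>a. vv a * y a" "{..<m}"] by (simp add: power_mult_distrib)
  ultimately show ?thesis
    unfolding qf_P qf_Q qf_one qf_V dot_v by (simp add: sum.distrib sum_subtractf sum_distrib_left[symmetric] algebra_simps)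
qed

lemma dot_v_kv: "dot v kv = 1"
proof -
  have "dot v kv = (\<Sum>a<m. 1 / real m)" unfolding dot_v using squares(4) m by (intro sum.cong) (auto simp: kv_def less_imp_neq[symmetric])
  then show ?thesis using m by simp
qed

text \<open>The case of equality in \<open>qf_half\<close>, stated as a vector equation so that
  \<open>kv\<close> serves as a null vector of \<open>2 (P + Q - V) - 1\<close>.\<close>

lemma app_kv:
  assumes i: "i < 2 * m" shows "app P kv i + app Q kv i - app V kv i = kv i / 2"
proof -
  have P: "app P kv i = (\<Sum>a<m. r a i * (qq a * kv a + pp a * kv (m + a)))" unfolding app_P by (simp add: dot_r)
  have d: "qq a * kv a + pp a * kv (m + a) = - qq a / (2 * (1 / 2 - q2 a) * (real m * vv a))" if a: "a < m" for a
  proof -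
    have nz: "1 / 2 - q2 a \<noteq> 0" "real m * vv a \<noteq> 0" using q2_bounds[OF a] squares(4)[OF a] m by simp_all
    have kv: "kv a = 1 / (real m * vv a)" "kv (m + a) = - pp a * qq a / ((1 / 2 - q2 a) * (real m * vv a))"
      using a by (simp_all add: kv_def)
    have "x * (1 / w) + z * (- z * x / (t * w)) = x * (t - z\<^sup>2) / (t * w)" if "t \<noteq> 0" "w \<noteq> 0" for x z t w :: real
      using that by (simp add: field_simps power2_eq_square)
    from this[OF nz]
    have "qq a * kv a + pp a * kv (m + a) = qq a * ((1 / 2 - q2 a) - (pp a)\<^sup>2) / ((1 / 2 - q2 a) * (real m * vv a))"
      unfolding kv .
    also have "(1 / 2 - q2 a) - (pp a)\<^sup>2 = - (1 / 2)" using squares(2)[OF a] by simp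
    finally show ?thesis by simp
  qed
  show ?thesis
  proof (cases "i < m")
    case True
    let ?t = "1 / 2 - q2 i" and ?w = "real m * vv i"
    have nz: "?t \<noteq> 0" "?w \<noteq> 0" using q2_bounds[OF True] squares(4)[OF True] m by simp_all
    have "app P kv i = (\<Sum>a<m. if a = i then qq a * (qq a * kv a + pp a * kv (m + a)) else 0)"
      unfolding P using True by (intro sum.cong) (auto simp: r_def)
    then have "app P kv i = qq i * (qq i * kv i + pp i * kv (m + i))" using True by simp
    then have "app P kv i = - q2 i / (2 * ?t * ?w)"
      unfolding d[OF True] using squares(1)[OF True] by (simp add: power2_eq_square)
    moreover have "app Q kv i = 1 / ?w" using app_Q[OF i, of kv] True by (simp add: kv_def)
    moreover have "app V kv i = vv i" unfolding app_V dot_v_kv using True by (simp add: v_def)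
    moreover have "vv i = (1 / 4 - q2 i) / (?t * ?w)"
    proof -
      have "vv i * (?t * ?w) = 1 / 4 - q2 i" using squares(3)[OF True] by (simp add: power2_eq_square mult_ac)
      then show ?thesis using nz by (simp add: field_simps)
    qed
    moreover have "- q2 i / (2 * ?t * ?w) + 1 / ?w - (1 / 4 - q2 i) / (?t * ?w) = 1 / ?w / 2"
    proof -
      have "- q / (2 * t * w) + 1 / w - z / (t * w) = 1 / w / 2"
        if "t \<noteq> 0" "w \<noteq> 0" and t: "- q + 2 * t - 2 * z = t" for q t w z :: real
      proof -
        have "- q / (2 * t * w) + 1 / w - z / (t * w) = (- q + 2 * t - 2 * z) / (2 * t * w)"
          using that(1,2) by (simp add: field_simps)
        then show ?thesis unfolding t using that(1,2) by simp
      qed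
      from this[OF nz] show ?thesis by simp
    qed
    ultimately show ?thesis using True by (simp add: kv_def)
  next
    case False
    define a where "a = i - m"
    have a: "a < m" "i = m + a" using False i by (simp_all add: a_def)
    have "app P kv i = (\<Sum>c<m. if c = a then pp c * (qq c * kv c + pp c * kv (m + c)) else 0)"
      unfolding P using a by (intro sum.cong) (auto simp: r_def)
    then have "app P kv i = pp a * (qq a * kv a + pp a * kv (m + a))" using a by simp
    then have "app P kv i = kv i / 2" unfolding d[OF a(1)] using a by (simp add: kv_def)
    then show ?thesis using app_Q[OF i, of kv] a by (simp add: app_V v_def)
  qed
qed

section \<open>The algebra generated by P, Q and V\<close>

definition diag :: "(nat \<Rightarrow> complex) \<Rightarrow> nat \<Rightarrow> nat \<Rightarrow> complex" where "diag c i j = (if i = j \<and> i < m then c i else 0)"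

lemma diag_left: "i < 2 * m \<Longrightarrow> (\<Sum>k\<in>N. diag c i k * B k) = (if i < m then c i * B i else 0)"
proof -
  assume i: "i < 2 * m"
  have "(\<Sum>k\<in>N. diag c i k * B k) = (\<Sum>k\<in>N. if i = k then (if i < m then c i * B k else 0) else 0)"
    by (intro sum.cong) (auto simp: diag_def)
  then show ?thesis using i by simp
qed

lemma diag_right: "j < 2 * m \<Longrightarrow> (\<Sum>k\<in>N. B k * diag c k j) = (if j < m then B j * c j else 0)"
proof -
  assume j: "j < 2 * m"
  have "(\<Sum>k\<in>N. B k * diag c k j) = (\<Sum>k\<in>N. if k = j then (if j < m then B k * c j else 0) else 0)"
    by (intro sum.cong) (auto simp: diag_def)
  then show ?thesis using j by simp
qed

text \<open>\<open>Q P Q\<close> is diagonal with distinct entries, so Lagrange interpolation gives the diagonal units, and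
  \<open>V\<close> connects them.\<close>

lemma unit_generated:
  assumes G: "closed_algebra (2 * m) G" and GP: "G (\<lambda>i j. complex_of_real (P i j))"
    and GQ: "G (\<lambda>i j. complex_of_real (Q i j))" and GV: "G (\<lambda>i j. complex_of_real (V i j))" and ab: "a < m" "b < m"
  shows "G (\<lambda>i j. if i = a \<and> j = b then 1 else 0)"
proof -
  note cl = closed_algebraD[OF G]
  have one: "G (diag (\<lambda>_. 1))" by (rule cl(4)[OF _ GQ]) (auto simp: diag_def Q_def)
  have Pm: "P i j = (if i = j then q2 i else 0)" if "i < m" "j < m" for i j
  proof -
    have "P i j = (\<Sum>a<m. if a = i then (if i = j then (qq a)\<^sup>2 else 0) else 0)"
      unfolding P_def using that by (intro sum.cong) (auto simp: r_def power2_eq_square)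
    then show ?thesis using that by (auto simp: squares)
  qed
  have "G (\<lambda>i j. \<Sum>k\<in>N. diag (\<lambda>_. 1) i k * (\<Sum>l\<in>N. complex_of_real (P k l) * diag (\<lambda>_. 1) l j))"
    by (intro cl(3) one GP)
  then have qd: "G (diag (\<lambda>i. of_real (q2 i)))"
    by (rule cl(4)[rotated]) (simp add: diag_left diag_right, auto simp: diag_def Pm)
  have prod: "G (diag (\<lambda>i. \<Prod>c\<in>B. of_real (q2 i - q2 c)))" if "finite B" for B
    using that
  proof (induction B rule: finite_induct)
    case (insert c B)
    let ?D = "diag (\<lambda>i. \<Prod>c\<in>B. of_real (q2 i - q2 c))"
    have "G (\<lambda>i j. \<Sum>k\<in>N. ?D i k * (diag (\<lambda>i. of_real (q2 i)) k j + (- of_real (q2 c)) * diag (\<lambda>_. 1) k j))"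
      using insert.IH qd one by (intro cl(1-3))
    then show ?case
      by (rule cl(4)[rotated]) (use insert.hyps in \<open>simp add: diag_left, auto simp: diag_def algebra_simps\<close>)
  qed (simp add: one)
  have inj: "q2 i \<noteq> q2 c" if "i \<noteq> c" for i c using that m by (simp add: q2_def)
  have unit: "G (diag (\<lambda>i. if i = a then 1 else 0))" if a: "a < m" for a
  proof -
    let ?z = "\<Prod>c\<in>{..<m} - {a}. complex_of_real (q2 a - q2 c)"
    have z: "?z \<noteq> 0" using inj[of a] by auto
    have "G (\<lambda>i j. 1 / ?z * diag (\<lambda>i. \<Prod>c\<in>{..<m} - {a}. of_real (q2 i - q2 c)) i j)" by (intro cl(2) prod) simp
    then show ?thesis
    proof (rule cl(4)[rotated])
      fix i j assume "i < 2 * m" "j < 2 * m"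
      have "(\<Prod>c\<in>{..<m} - {a}. complex_of_real (q2 i - q2 c)) = 0" if "i < m" "i \<noteq> a"
        using that by (intro prod_zero bexI[of _ i]) auto
      then show "1 / ?z * diag (\<lambda>i. \<Prod>c\<in>{..<m} - {a}. of_real (q2 i - q2 c)) i j = diag (\<lambda>i. if i = a then 1 else 0) i j"
        using z by (auto simp: diag_def simp del: of_real_diff)
    qed
  qed
  let ?w = "complex_of_real (vv a * vv b)"
  have w: "?w \<noteq> 0" using squares(4)[OF ab(1)] squares(4)[OF ab(2)] by simp
  have "G (\<lambda>i j. 1 / ?w * (\<Sum>k\<in>N. diag (\<lambda>i. if i = a then 1 else 0) i k *
      (\<Sum>l\<in>N. complex_of_real (V k l) * diag (\<lambda>i. if i = b then 1 else 0) l j)))"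
    by (intro cl(2,3) unit GV ab)
  then show ?thesis
    by (rule cl(4)[rotated]) (use ab w in \<open>simp add: diag_left diag_right, auto simp: V_def v_def\<close>)
qed

end

section \<open>Cones that are not subhomogeneous\<close>

lemma vector_of_unit:
  assumes "l < n" "\<And>i. i < n \<Longrightarrow> f i = (if i = l then 1 else 0)" shows "vector_of b n f = b l"
proof -
  have "vector_of b n f = (\<Sum>i<n. if i = l then b i else 0)" unfolding vector_of_def using assms(2) by (intro sum.cong) auto
  then show ?thesis using assms(1) by simp
qed

lemma closed_null_diff: "closed_null C S s Z \<Longrightarrow> Z w \<Longrightarrow> Z w' \<Longrightarrow> Z (\<lambda>j. w j - w' j)"
  using closed_nullD(1)[of C S s Z w "\<lambda>j. (- 1) *\<^sub>R w' j"] closed_nullD(2)[of C S s Z w' "- 1"] by simp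

context two_projections
begin

lemma null_tensor:
  assumes "closed_null C S (2 * m) Z" "c \<in> C" "\<And>i. i < 2 * m \<Longrightarrow> app (S c) x i = 0" shows "Z (\<lambda>j. x j *\<^sub>R c)"
  using assms(3) unfolding app_def by (rule closed_nullD(4)[OF assms(1,2)])

text \<open>If \<open>e = c + c' + c''\<close> and \<open>S\<close> maps the summands to mutually orthogonal projections, then \<open>x \<otimes> c\<close> agrees with
  \<open>S(c) x \<otimes> e\<close> modulo null tensors.\<close>

lemma resolution:
  assumes Z: "closed_null C S (2 * m) Z" and C: "c \<in> C" "c' \<in> C" "c'' \<in> C" and e: "e = c + c' + c''"
    and S: "\<And>i. i < 2 * m \<Longrightarrow> app (S c) (app (S c) x) i = app (S c) x i"
      "\<And>i. i < 2 * m \<Longrightarrow> app (S c') (app (S c) x) i = 0" "\<And>i. i < 2 * m \<Longrightarrow> app (S c'') (app (S c) x) i = 0"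
  shows "Z (\<lambda>j. x j *\<^sub>R c - app (S c) x j *\<^sub>R e)"
proof -
  have z1: "Z (\<lambda>j. (x j - app (S c) x j) *\<^sub>R c)" by (rule null_tensor[OF Z C(1)]) (simp add: app_linear S)
  have z2: "Z (\<lambda>j. app (S c) x j *\<^sub>R c')" by (rule null_tensor[OF Z C(2)]) (simp add: S)
  have z3: "Z (\<lambda>j. app (S c) x j *\<^sub>R c'')" by (rule null_tensor[OF Z C(3)]) (simp add: S)
  from closed_null_diff[OF Z closed_null_diff[OF Z z1 z2] z3]
  show ?thesis by (rule closed_nullD(3)[OF Z, rotated]) (simp add: e algebra_simps)
qed

lemma app_V_V: "app V (app V y) i = dot v v * app V y i"
proof -
  have "dot v (app V y) = dot v (\<lambda>i. dot v y * v i)" unfolding app_V[abs_def] by (simp add: mult.commute)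
  then show ?thesis unfolding app_V dot_linear by simp
qed

lemma divide_V: "app A (\<lambda>j. y j / c) i = app A y i / c"
  using app_linear(3)[of A "1 / c" y i] by simp

lemma app_V_Q: "app V (app Q y) i = app V y i"
  unfolding app_V dot_v_app_Q ..

lemma app_Q_V: "i < 2 * m \<Longrightarrow> app Q (app V y) i = app V y i"
  by (simp add: app_Q app_V v_def)

lemma app_Q_Q: "i < 2 * m \<Longrightarrow> app Q (app Q y) i = app Q y i"
  by (simp add: app_Q)

lemma app_zero: "app (\<lambda>_ _. 0) y i = 0" "app A (\<lambda>_. 0) i = 0"
  by (simp_all add: app_def)

lemma qf_zero: "qf (\<lambda>_ _. 0) y = 0"
  by (simp add: qf_def)

lemma divide_scalar: "app (\<lambda>i j. A i j / c) y i = app A y i / c" "qf (\<lambda>i j. A i j / c) y = qf A y / c"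
  using app_linear(6)[of "1 / c" A y i] qf_linear(3)[of "1 / c" A y] by simp_all

lemma app_one_in: "app A (app one y) i = app A y i"
  by (rule app_cong) (rule app_one)

lemma symmetric: "P i j = P j i" "Q i j = Q j i" "V i j = V j i" "one i j = one j i"
  by (auto simp: P_def Q_def V_def one_def mult.commute)

text \<open>The vector \<open>b 0 + b 1\<close> is decomposed twice: into \<open>b 0\<close>,
  \<open>b 1\<close>, sent to \<open>P\<close>, \<open>1 - P\<close>, and into \<open>b 2\<close>,
  \<open>b 3\<close> and the additional generator, sent to the projections
  \<open>V / |v|\<^sup>2\<close>, \<open>1 - Q\<close>, \<open>Q - V / |v|\<^sup>2\<close>.\<close>

definition S4 :: "(nat \<Rightarrow> 'v::real_inner) \<Rightarrow> 'v \<Rightarrow> nat \<Rightarrow> nat \<Rightarrow> real" where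
  "S4 b x i j = inner x (b 0) * P i j + inner x (b (Suc 0)) * (one i j - P i j) + inner x (b 2) * (V i j / dot v v) +
     inner x (b 3) * (one i j - Q i j)"

text \<open>The first two additional generators are sent to \<open>Q - V\<close> and
  \<open>2 (P + Q - V) - 1\<close>. The latter is psd and singular by the choice of
  \<open>v\<close>.\<close>

definition S3 :: "(nat \<Rightarrow> 'v::real_inner) \<Rightarrow> 'v \<Rightarrow> nat \<Rightarrow> nat \<Rightarrow> real" where
  "S3 b x i j = inner x (b 0) * P i j + inner x (b (Suc 0)) * (one i j - Q i j + V i j) + inner x (b 2) * (one i j - P i j)"

end

section \<open>One additional ray in dimension at least four\<close>

definition square_gen :: "nat \<Rightarrow> nat \<Rightarrow> nat \<Rightarrow> real" where
  "square_gen n j i = (if j < n then (if i = j then 1 else 0) else if i < 2 then 1 else if i < 4 then - 1 else 0)"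

lemma sum_first4:
  fixes f :: "nat \<Rightarrow> real"
  assumes "4 \<le> n" "\<And>i. 4 \<le> i \<Longrightarrow> f i = 0" shows "(\<Sum>i<n. f i) = f 0 + f 1 + f 2 + f 3"
proof -
  have "(\<Sum>i<n. f i) = (\<Sum>i<4. f i)" using assms by (intro sum.mono_neutral_right) auto
  then show ?thesis by (simp add: eval_nat_numeral)
qed

text \<open>In the relation \<open>b 0 + b 1 = b 2 + b 3 + g\<^sub>n\<close> a segment meets a
  triangle: for \<open>n = 4\<close> the cone is the one over a triangular bipyramid. Decompositions
  of one vector with two and with three summands accommodate \<open>P\<close> on one side and
  \<open>Q\<close>, \<open>V\<close> on the other.\<close>

lemma square_cone_not_subhomogeneous:
  fixes b :: "nat \<Rightarrow> 'v::euclidean_space"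
  assumes b: "bij_betw b {..<n} Basis" and n: "4 \<le> n"
  defines "T \<equiv> (\<lambda>j. vector_of b n (square_gen n j)) ` {..<n + 1}"
  shows "proper_polyhedral_cone (convex_cone hull T)" "card (extreme_rays (convex_cone hull T)) = n + 1"
    and "u \<in> interior (convex_cone hull T) \<Longrightarrow> 1 \<le> d \<Longrightarrow> \<not> d_subhomogeneous d (Cmin (convex_cone hull T)) u"
proof -
  let ?g = "\<lambda>j. vector_of b n (square_gen n j)"
  have unit: "(\<Sum>i<n. square_gen n j i * \<alpha> i) = \<alpha> j" if "j < n" for j and \<alpha> :: "nat \<Rightarrow> real"
  proof -
    have "(\<Sum>i<n. square_gen n j i * \<alpha> i) = (\<Sum>i<n. if i = j then \<alpha> i else 0)"
      using that by (intro sum.cong) (auto simp: square_gen_def)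
    then show ?thesis using that by simp
  qed
  have new: "(\<Sum>i<n. square_gen n n i * \<alpha> i) = \<alpha> 0 + \<alpha> 1 - \<alpha> 2 - \<alpha> 3" for \<alpha> :: "nat \<Rightarrow> real"
    by (subst sum_first4) (use n in \<open>auto simp: square_gen_def\<close>)
  note one_values = unit[of _ "\<lambda>_. 1", simplified] new[of "\<lambda>_. 1", simplified]
  \<comment> \<open>At the new generator a functional has the value
    \<open>a 0 + a 1 - a 2 - a 3\<close>. Constant 1 vanishes there. In all other cases the value is
    1: by the entries 0 and 3 on the first pair, by the zero at 2 or 3, or by the two
    halves.\<close>
  define \<alpha> :: "nat \<Rightarrow> nat \<Rightarrow> real" where
    "\<alpha> j = (if j = 0 then (\<lambda>_. 1)(0 := 0, 1 := 3) else if j = 1 then (\<lambda>_. 1)(0 := 3, 1 := 0)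
      else if j = n then (\<lambda>_. 1) else if j < 4 then (\<lambda>_. 1)(j := 0) else (\<lambda>_. 1)(2 := 1 / 2, 3 := 1 / 2, j := 0))" for j
  have exposed: "\<exists>a. (\<Sum>i<n. square_gen n j i * a i) = 0 \<and> (\<forall>k\<in>{..<n + 1} - {j}. 0 < (\<Sum>i<n. square_gen n k i * a i))"
    if j: "j \<in> {..<n + 1}" for j
  proof (intro exI[of _ "\<alpha> j"] conjI ballI)
    have "j < n \<or> j = n" using j by auto
    then show "(\<Sum>i<n. square_gen n j i * \<alpha> j i) = 0" using n by (auto simp: unit new one_values \<alpha>_def)
    fix k assume k: "k \<in> {..<n + 1} - {j}"
    then have "k < n \<or> k = n" by auto
    moreover have "j = 0 \<or> j = 1 \<or> j = 2 \<or> j = 3 \<or> j = n \<or> j \<ge> 4 \<and> j \<noteq> n" by linarith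
    ultimately show "0 < (\<Sum>i<n. square_gen n k i * \<alpha> j i)" using n k by (elim disjE) (auto simp: unit new one_values \<alpha>_def)
  qed
  have pos: "0 < (\<Sum>i<n. square_gen n j i * ((\<lambda>_. 1)(2 := 1 / 2, 3 := 1 / 2)) i)" if j: "j \<in> {..<n + 1}" for j
  proof -
    have "j < n \<or> j = n" using j by auto
    then show ?thesis by (elim disjE) (auto simp: unit new)
  qed
  have units: "\<exists>j\<in>{..<n + 1}. \<forall>l<n. square_gen n j l = (if l = i then 1 else 0)" if "i < n" for i
    using that by (intro bexI[of _ i]) (auto simp: square_gen_def)
  note cone = coordinate_cone[OF b, of "{..<n + 1}" "square_gen n" "(\<lambda>_. 1)(2 := 1 / 2, 3 := 1 / 2)"]
  show "proper_polyhedral_cone (convex_cone hull T)" unfolding T_def by (rule cone(1)) (use exposed pos units in blast)+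
  have "card (extreme_rays (convex_cone hull T)) = card {..<n + 1}" unfolding T_def by (rule cone(2)) (use exposed pos units in blast)+
  then show "card (extreme_rays (convex_cone hull T)) = n + 1" by simp
  assume u: "u \<in> interior (convex_cone hull T)" and d: "1 \<le> d"
  \<comment> \<open>The indices up to \<open>d\<close> are then below \<open>m\<close>, so
    \<open>unit_generated\<close> supplies all matrix units that the obstruction requires.\<close>
  define m where "m = Suc d"
  have m0: "0 < m" and dm: "d < m" by (simp_all add: m_def)
  interpret two_projections m by unfold_locales (rule m0)
  let ?C = "convex_cone hull T" and ?w = "dot v v" and ?S = "S4 b"
  have w: "?w > 0" by (rule dot_v_v_bounds)
  have bl: "?g l = b l" if "l < n" for l using that by (intro vector_of_unit) (auto simp: square_gen_def)
  have gT: "?g j \<in> ?C" if "j < n + 1" for j unfolding T_def using that by (intro hull_inc) auto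
  have bC: "b l \<in> ?C" if "l < n" for l using gT[of l] bl[OF that] that by simp
  have q3: "?g n = b 0 + b (Suc 0) - b 2 - b 3"
  proof -
    have "?g n = (\<Sum>i<4. square_gen n n i *\<^sub>R b i)"
      unfolding vector_of_def using n by (intro sum.mono_neutral_right) (auto simp: square_gen_def)
    then show ?thesis using n by (simp add: eval_nat_numeral square_gen_def)
  qed
  have ip: "inner (b l) (b k) = (if l = k then 1 else 0)" if "l < n" "k < 4" for l k
    using basis_inner[OF b] that n by simp
  have Sb: "?S (b 0) = P" "?S (b (Suc 0)) = (\<lambda>i j. one i j - P i j)" "?S (b 2) = (\<lambda>i j. V i j / ?w)"
    "?S (b 3) = (\<lambda>i j. one i j - Q i j)"
    using n by (intro ext; simp add: S4_def ip)+
  have S0: "?S (b l) = (\<lambda>_ _. 0)" if "4 \<le> l" "l < n" for l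
    using that by (intro ext) (simp add: S4_def ip)
  have S_e: "?S (b 0 + b (Suc 0)) = one"
    using n by (intro ext) (simp add: S4_def ip inner_add_left)
  have Sq3: "?S (b 0 + b (Suc 0) - b 2 - b 3) = (\<lambda>i j. Q i j - V i j / ?w)"
    using n by (intro ext) (simp add: S4_def ip inner_add_left inner_diff_left)
  have Sz: "?S 0 = (\<lambda>_ _. 0)" by (intro ext) (simp add: S4_def)
  show "\<not> d_subhomogeneous d (Cmin ?C) u"
  proof (rule pencil_not_d_subhomogeneous[OF b u d, where s = "2 * m" and S = ?S and e = "b 0 + b (Suc 0)"])
    show "d < 2 * m" using dm by simp
    show "?S (x + y) i j = ?S x i j + ?S y i j" for x y i j by (simp add: S4_def inner_add_left algebra_simps)
    show "?S (r *\<^sub>R x) i j = r * ?S x i j" for r x i j by (simp add: S4_def algebra_simps)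
    show "?S x i j = ?S x j i" for x i j unfolding S4_def using symmetric by metis
    show "?S (b 0 + b (Suc 0)) i j = (if i = j then 1 else 0)" for i j by (simp add: S_e one_def)
  next
    fix c y assume "c \<in> T"
    then obtain j where j: "j < n + 1" "c = ?g j" by (auto simp: T_def)
    have "0 \<le> qf (?S c) y"
    proof (cases "j < n")
      case True
      then have c: "c = b j" using j bl by simp
      have "j = 0 \<or> j = 1 \<or> j = 2 \<or> j = 3 \<or> 4 \<le> j" by linarith
      then show ?thesis
        unfolding c using True qf_P_le[of y] qf_nonneg[of y] w
        by (elim disjE) (simp_all add: Sb S0 qf_linear qf_zero divide_scalar)
    next
      case False
      then have "j = n" using j by simp
      then have c: "c = b 0 + b (Suc 0) - b 2 - b 3" using j q3 by simp
      show ?thesis unfolding c Sq3 qf_linear divide_scalar using qf_V_le[of y] w by (simp add: field_simps)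
    qed
    then show "0 \<le> (\<Sum>i\<in>{0..<2 * m}. \<Sum>j\<in>{0..<2 * m}. y i * ?S c i j * y j)" unfolding qf_def .
  next
    fix Z and l :: nat and x
    assume Z: "closed_null ?C ?S (2 * m) Z" and l: "l < n"
    have V: "app (\<lambda>i j. V i j / ?w) (app (\<lambda>i j. V i j / ?w) x) i = app (\<lambda>i j. V i j / ?w) x i" for i
    proof -
      have "app V (\<lambda>i. 1 / ?w * app V x i) i = 1 / ?w * app V (app V x) i" by (rule app_linear)
      then show ?thesis unfolding divide_scalar(1)[abs_def] app_V_V using w by simp
    qed
    \<comment> \<open>Each of the first four vectors is a summand in one of the two decompositions
      of \<open>b 0 + b 1\<close>; the remaining coordinates are sent to 0.\<close>
    have "Z (\<lambda>j. x j *\<^sub>R b l - app (?S (b l)) x j *\<^sub>R (b 0 + b (Suc 0)))"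
    proof (cases "l < 4")
      case True
      then have "l = 0 \<or> l = 1 \<or> l = 2 \<or> l = 3" by linarith
      then show ?thesis
      proof (elim disjE)
        assume l: "l = 0"
        show ?thesis unfolding l
          by (rule resolution[OF Z, where c' = "b (Suc 0)" and c'' = 0])
            (use n bC in \<open>simp_all add: Sb Sz app_linear app_one app_PP app_zero convex_cone_hull_contains_0\<close>)
      next
        assume l: "l = 1"
        show ?thesis unfolding l
          by (rule resolution[OF Z, where c' = "b 0" and c'' = 0])
            (use n bC in \<open>simp_all add: Sb Sz app_linear app_linear(5)[abs_def] app_one app_one_in app_PP app_zero
               convex_cone_hull_contains_0 add.commute\<close>)
      next
        assume l: "l = 2"
        show ?thesis unfolding l
          by (rule resolution[OF Z, where c' = "b 3" and c'' = "b 0 + b (Suc 0) - b 2 - b 3"])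
            (use n bC gT[of n] q3 in \<open>simp_all add: Sb Sq3 V, simp_all add: app_linear divide_V divide_scalar(1)[abs_def] app_one app_Q_V app_V_V w[THEN less_imp_neq, symmetric]\<close>)
      next
        assume l: "l = 3"
        show ?thesis unfolding l
          by (rule resolution[OF Z, where c' = "b 2" and c'' = "b 0 + b (Suc 0) - b 2 - b 3"])
            (use n bC gT[of n] q3 in \<open>simp_all add: Sb Sq3 app_linear app_linear(5)[abs_def] app_one app_one_in app_Q_Q app_V_Q divide_scalar\<close>)
      qed
    next
      case False
      then have "Z (\<lambda>j. x j *\<^sub>R b l)" using l bC by (intro null_tensor[OF Z]) (simp_all add: S0 app_zero)
      then show ?thesis using False l by (simp add: S0 app_zero)
    qed
    then show "Z (\<lambda>j. x j *\<^sub>R b l - (\<Sum>k\<in>{0..<2 * m}. ?S (b l) j k * x k) *\<^sub>R (b 0 + b (Suc 0)))" unfolding app_def .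
  next
    fix G and a a' :: nat
    assume G: "closed_algebra (2 * m) G" and GS: "\<And>x. G (\<lambda>i j. complex_of_real (?S x i j))" and a: "a \<le> d" "a' \<le> d"
    note cl = closed_algebraD[OF G]
    show "G (\<lambda>i j. if i = a \<and> j = a' then 1 else 0)"
    proof (rule unit_generated[OF G])
      show "G (\<lambda>i j. complex_of_real (P i j))" using GS[of "b 0"] by (simp add: Sb)
      have "G (\<lambda>i j. of_real ?w * complex_of_real (?S (b 2) i j))" using GS by (rule cl(2))
      then show "G (\<lambda>i j. complex_of_real (V i j))" using w by (simp add: Sb)
      have "G (\<lambda>i j. complex_of_real (?S (b 0 + b (Suc 0)) i j) + (- 1) * complex_of_real (?S (b 3) i j))"
        using GS by (intro cl(1,2))
      then show "G (\<lambda>i j. complex_of_real (Q i j))" by (simp add: Sb S_e)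
    qed (use a dm in auto)
  qed
qed

section \<open>Two or more additional rays in dimension at least three\<close>

definition curve :: "nat \<Rightarrow> nat \<Rightarrow> nat \<Rightarrow> real" where "curve n k j = real (j - n - 1) / real (k + 1)"

text \<open>The generators with index \<open>j \<ge> n + 2\<close> lie on a conic through \<open>e\<^sub>0\<close> and \<open>e\<^sub>1\<close>, at parameter \<open>curve n k j\<close>.\<close>

definition conic_gen :: "nat \<Rightarrow> nat \<Rightarrow> nat \<Rightarrow> nat \<Rightarrow> real" where
  "conic_gen n k j i = (if j < n then (if i = j then 1 else 0)
     else if i = 0 then (if j = n then 1 else if j = n + 1 then 3 else 1 - curve n k j)
     else if i = 1 then (if j = n then - 1 else if j = n + 1 then - 2 else curve n k j)
     else if i = 2 then (if j = n then 1 else if j = n + 1 then 1 else - (curve n k j * (1 - curve n k j) / 20)) else 0)"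

lemma curve_bounds:
  assumes "n + 2 \<le> j" "j < n + 2 + k"
  shows "0 < curve n k j" "curve n k j < 1" "0 < curve n k j * (1 - curve n k j)"
    "curve n k j * (1 - curve n k j) < curve n k j" "curve n k j * (1 - curve n k j) < 1 - curve n k j"
proof -
  \<comment> \<open>For these \<open>j\<close> the numerator runs through 1, ..., k, so the
    parameters cut the unit interval into \<open>k + 1\<close> equal parts.\<close>
  show l: "0 < curve n k j" and u: "curve n k j < 1" using assms by (simp_all add: curve_def)
  then show "0 < curve n k j * (1 - curve n k j)" by simp
  have "0 < (curve n k j)\<^sup>2" "0 < (1 - curve n k j)\<^sup>2" using l u by simp_all
  then show "curve n k j * (1 - curve n k j) < curve n k j" "curve n k j * (1 - curve n k j) < 1 - curve n k j"
    by (simp_all add: power2_eq_square algebra_simps)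
qed

lemma curve_positive:
  assumes "n + 2 \<le> j" "j < n + 2 + k"
    and "\<And>l t. 0 < l \<Longrightarrow> l < 1 \<Longrightarrow> 0 < t \<Longrightarrow> t < l \<Longrightarrow> t < 1 - l \<Longrightarrow> 0 < (1 - l) * a + l * b - t / 20 * c"
  shows "0 < (1 - curve n k j) * a + curve n k j * b - curve n k j * (1 - curve n k j) / 20 * c"
  by (rule assms(3)) (rule curve_bounds[OF assms(1,2)])+

lemma curve_inj: "n + 2 \<le> i \<Longrightarrow> n + 2 \<le> j \<Longrightarrow> i \<noteq> j \<Longrightarrow> curve n k i \<noteq> curve n k j"
  by (auto simp: curve_def)

lemma sum_first3:
  fixes f :: "nat \<Rightarrow> 'b::comm_monoid_add"
  assumes "3 \<le> n" "\<And>i. 3 \<le> i \<Longrightarrow> f i = 0" shows "(\<Sum>i<n. f i) = f 0 + f (Suc 0) + f 2"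
proof -
  have "(\<Sum>i<n. f i) = (\<Sum>i<3. f i)" using assms by (intro sum.mono_neutral_right) auto
  then show ?thesis by (simp add: eval_nat_numeral)
qed

text \<open>Exposing functionals are given by three coordinates, with 1 in the others. A third
  coordinate of 20 turns the negative term on the conic into
  \<open>\<lambda> (1 - \<lambda>)\<close>, still below the first two; to vanish at the generators
  \<open>n\<close> or \<open>n + 1\<close>, which pull the other way, a small third coordinate is
  used.\<close>

lemma conic_cone:
  fixes b :: "nat \<Rightarrow> 'v::euclidean_space" and k :: nat
  assumes b: "bij_betw b {..<n} Basis" and n: "3 \<le> n"
  defines "T \<equiv> (\<lambda>j. vector_of b n (conic_gen n k j)) ` {..<n + 2 + k}"
  shows "proper_polyhedral_cone (convex_cone hull T)" "card (extreme_rays (convex_cone hull T)) = n + 2 + k"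
proof -
  let ?s = "\<lambda>j \<alpha>. \<Sum>i<n. conic_gen n k j i * \<alpha> i"
  have unit: "?s j \<alpha> = \<alpha> j" if "j < n" for j and \<alpha> :: "nat \<Rightarrow> real"
  proof -
    have "?s j \<alpha> = (\<Sum>i<n. if i = j then \<alpha> i else 0)" using that by (intro sum.cong) (auto simp: conic_gen_def)
    then show ?thesis using that by simp
  qed
  have three: "?s j \<alpha> = conic_gen n k j 0 * \<alpha> 0 + conic_gen n k j 1 * \<alpha> 1 + conic_gen n k j 2 * \<alpha> 2"
    if "n \<le> j" for j and \<alpha> :: "nat \<Rightarrow> real"
    using that by (subst sum_first3[OF n]) (auto simp: conic_gen_def)
  have v1: "?s n \<alpha> = \<alpha> 0 - \<alpha> 1 + \<alpha> 2" and v2: "?s (n + 1) \<alpha> = 3 * \<alpha> 0 - 2 * \<alpha> 1 + \<alpha> 2" for \<alpha> :: "nat \<Rightarrow> real"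
    by (simp_all only: three le_add1 order_refl) (simp_all add: conic_gen_def)
  have v3: "?s j \<alpha> = (1 - curve n k j) * \<alpha> 0 + curve n k j * \<alpha> 1 - curve n k j * (1 - curve n k j) / 20 * \<alpha> 2"
    if "n + 2 \<le> j" for j and \<alpha> :: "nat \<Rightarrow> real"
    using that by (subst three) (auto simp: conic_gen_def)
  have positive: "0 < ?s h \<alpha>"
    if h: "h \<in> {..<n + 2 + k} - {j}" and "\<And>h. h < n \<Longrightarrow> h \<noteq> j \<Longrightarrow> 0 < \<alpha> h" "n \<noteq> j \<Longrightarrow> 0 < \<alpha> 0 - \<alpha> 1 + \<alpha> 2"
      "n + 1 \<noteq> j \<Longrightarrow> 0 < 3 * \<alpha> 0 - 2 * \<alpha> 1 + \<alpha> 2"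
      "\<And>h. n + 2 \<le> h \<Longrightarrow> h < n + 2 + k \<Longrightarrow> h \<noteq> j \<Longrightarrow>
        0 < (1 - curve n k h) * \<alpha> 0 + curve n k h * \<alpha> 1 - curve n k h * (1 - curve n k h) / 20 * \<alpha> 2"
    for h j and \<alpha> :: "nat \<Rightarrow> real"
  proof -
    consider "h < n" | "h = n" | "h = n + 1" | "n + 2 \<le> h" by linarith
    then show ?thesis
    proof cases
      case 1 then show ?thesis using that(2)[of h] h unit by simp
    next
      case 2 then show ?thesis using that(3) h v1 by simp
    next
      case 3 then show ?thesis unfolding 3 v2 using that(4) h 3 by simp
    next
      case 4 then show ?thesis unfolding v3[OF 4] using that(5)[OF 4] h by simp
    qed
  qed
  define tri :: "real \<Rightarrow> real \<Rightarrow> real \<Rightarrow> nat \<Rightarrow> real" where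
    "tri a c e i = (if i = 0 then a else if i = 1 then c else if i = 2 then e else 1)" for a c e i
  have tri: "tri a c e 0 = a" "tri a c e 1 = c" "tri a c e (Suc 0) = c" "tri a c e 2 = e" "3 \<le> i \<Longrightarrow> tri a c e i = 1" for a c e i
    by (auto simp: tri_def)
  have exposed: "\<exists>\<alpha>. ?s j \<alpha> = 0 \<and> (\<forall>h\<in>{..<n + 2 + k} - {j}. 0 < ?s h \<alpha>)" if j: "j \<in> {..<n + 2 + k}" for j
  proof -
    note cb = curve_bounds[of n _ k]
    consider "j = 0" | "j = 1" | "j = 2" | "3 \<le> j" "j < n" | "j = n" | "j = n + 1" | "n + 2 \<le> j" using n by linarith
    then show ?thesis
    proof cases
      case 1
      have "?s j (tri 0 1 20) = 0" using 1 n by (simp add: unit tri)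
      moreover have "0 < ?s h (tri 0 1 20)" if "h \<in> {..<n + 2 + k} - {j}" for h
        by (rule positive[OF that]) (use 1 cb in \<open>auto simp: tri tri_def\<close>)
      ultimately show ?thesis by blast
    next
      case 2
      have "?s j (tri 1 0 20) = 0" using 2 n by (simp add: unit tri)
      moreover have "0 < ?s h (tri 1 0 20)" if "h \<in> {..<n + 2 + k} - {j}" for h
        by (rule positive[OF that]) (use 2 cb in \<open>auto simp: tri tri_def\<close>)
      ultimately show ?thesis by blast
    next
      case 3
      have "?s j (tri 2 1 0) = 0" using 3 n by (simp add: unit tri)
      moreover have "0 < ?s h (tri 2 1 0)" if "h \<in> {..<n + 2 + k} - {j}" for h
      proof (rule positive[OF that])
        fix h assume h: "n + 2 \<le> h" "h < n + 2 + k"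
        show "0 < (1 - curve n k h) * tri 2 1 0 0 + curve n k h * tri 2 1 0 1 - curve n k h * (1 - curve n k h) / 20 * tri 2 1 0 2"
          by (rule curve_positive[OF h]) (use n in \<open>simp add: tri\<close>)
      qed (use 3 in \<open>auto simp: tri tri_def\<close>)
      ultimately show ?thesis by blast
    next
      case 4
      have "?s j ((tri 1 1 20)(j := 0)) = 0" using 4 by (simp add: unit)
      moreover have "0 < ?s h ((tri 1 1 20)(j := 0))" if "h \<in> {..<n + 2 + k} - {j}" for h
      proof (rule positive[OF that])
        fix h assume h: "n + 2 \<le> h" "h < n + 2 + k"
        show "0 < (1 - curve n k h) * ((tri 1 1 20)(j := 0)) 0 + curve n k h * ((tri 1 1 20)(j := 0)) 1 -
            curve n k h * (1 - curve n k h) / 20 * ((tri 1 1 20)(j := 0)) 2"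
          by (rule curve_positive[OF h]) (use 4 n in \<open>simp add: tri\<close>)
      qed (use 4 in \<open>auto simp: tri tri_def\<close>)
      ultimately show ?thesis by blast
    next
      case 5
      have "?s j (tri 2 3 1) = 0" using 5 n by (simp add: v1 tri)
      moreover have "0 < ?s h (tri 2 3 1)" if "h \<in> {..<n + 2 + k} - {j}" for h
      proof (rule positive[OF that])
        fix h assume h: "n + 2 \<le> h" "h < n + 2 + k"
        show "0 < (1 - curve n k h) * tri 2 3 1 0 + curve n k h * tri 2 3 1 1 - curve n k h * (1 - curve n k h) / 20 * tri 2 3 1 2"
          by (rule curve_positive[OF h]) (use n in \<open>simp add: tri\<close>)
      qed (use 5 in \<open>auto simp: tri tri_def\<close>)
      ultimately show ?thesis by blast
    next
      case 6
      have "?s j (tri 1 3 3) = 0" unfolding 6 v2 by (simp add: tri)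
      moreover have "0 < ?s h (tri 1 3 3)" if "h \<in> {..<n + 2 + k} - {j}" for h
      proof (rule positive[OF that])
        fix h assume h: "n + 2 \<le> h" "h < n + 2 + k"
        show "0 < (1 - curve n k h) * tri 1 3 3 0 + curve n k h * tri 1 3 3 1 - curve n k h * (1 - curve n k h) / 20 * tri 1 3 3 2"
          by (rule curve_positive[OF h]) (use n in \<open>simp add: tri\<close>)
      qed (use 6 in \<open>auto simp: tri tri_def\<close>)
      ultimately show ?thesis by blast
    next
      case 7
      \<comment> \<open>The tangent to the conic at \<open>?l\<close>: by the identity
        \<open>id\<close> its value at parameter \<open>x\<close> is
        \<open>(x - ?l)\<^sup>2\<close>.\<close>
      let ?l = "curve n k j"
      have l: "0 < ?l" "?l < 1" using cb[of j] 7 j by simp_all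
      then have l2: "0 < ?l\<^sup>2" "?l\<^sup>2 < 1" "0 < (1 - ?l)\<^sup>2" "(1 - ?l)\<^sup>2 < 1" by (simp_all add: power_less_one_iff)
      have id: "(1 - x) * y\<^sup>2 + x * (1 - y)\<^sup>2 - x * (1 - x) / 20 * 20 = (x - y)\<^sup>2" for x y :: real
      proof -
        have c: "x * (1 - x) / 20 * 20 = x * (1 - x)" by simp
        show ?thesis unfolding c by (simp add: power2_eq_square algebra_simps)
      qed
      have "?s j (tri (?l\<^sup>2) ((1 - ?l)\<^sup>2) 20) = 0" unfolding v3[OF 7] tri id by simp
      moreover have "0 < ?s h (tri (?l\<^sup>2) ((1 - ?l)\<^sup>2) 20)" if "h \<in> {..<n + 2 + k} - {j}" for h
      proof (rule positive[OF that])
        show "0 < tri (?l\<^sup>2) ((1 - ?l)\<^sup>2) 20 h" for h using l2 by (simp add: tri_def)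
        show "0 < tri (?l\<^sup>2) ((1 - ?l)\<^sup>2) 20 0 - tri (?l\<^sup>2) ((1 - ?l)\<^sup>2) 20 1 + tri (?l\<^sup>2) ((1 - ?l)\<^sup>2) 20 2"
          "0 < 3 * tri (?l\<^sup>2) ((1 - ?l)\<^sup>2) 20 0 - 2 * tri (?l\<^sup>2) ((1 - ?l)\<^sup>2) 20 1 + tri (?l\<^sup>2) ((1 - ?l)\<^sup>2) 20 2"
          unfolding tri using l2 by linarith+
        show "0 < (1 - curve n k h) * tri (?l\<^sup>2) ((1 - ?l)\<^sup>2) 20 0 + curve n k h * tri (?l\<^sup>2) ((1 - ?l)\<^sup>2) 20 1 -
            curve n k h * (1 - curve n k h) / 20 * tri (?l\<^sup>2) ((1 - ?l)\<^sup>2) 20 2" if "n + 2 \<le> h" "h \<noteq> j" for h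
          unfolding tri id using curve_inj[OF that(1) 7 that(2), of k] by simp
      qed
      ultimately show ?thesis by blast
    qed
  qed
  have pos: "0 < ?s h (tri 1 1 20)" if h: "h \<in> {..<n + 2 + k}" for h
  \<comment> \<open>The index \<open>n + 2 + k\<close> belongs to no generator, so excluding it
    excludes nothing.\<close>
  proof (rule positive[of h "n + 2 + k"])
    show "h \<in> {..<n + 2 + k} - {n + 2 + k}" using h by simp
    fix h assume h: "n + 2 \<le> h" "h < n + 2 + k"
        show "0 < (1 - curve n k h) * tri 1 1 20 0 + curve n k h * tri 1 1 20 1 - curve n k h * (1 - curve n k h) / 20 * tri 1 1 20 2"
          by (rule curve_positive[OF h]) (use n in \<open>simp add: tri\<close>)
  qed (auto simp: tri tri_def)
  have units: "\<exists>j\<in>{..<n + 2 + k}. \<forall>l<n. conic_gen n k j l = (if l = i then 1 else 0)" if "i < n" for i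
    using that by (intro bexI[of _ i]) (auto simp: conic_gen_def)
  note cone = coordinate_cone[OF b finite_lessThan exposed pos units]
  show "proper_polyhedral_cone (convex_cone hull T)" unfolding T_def by (rule cone(1))
  have "card (extreme_rays (convex_cone hull T)) = card {..<n + 2 + k}" unfolding T_def by (rule cone(2))
  then show "card (extreme_rays (convex_cone hull T)) = n + 2 + k" by simp
qed

context two_projections
begin

text \<open>With \<open>Y = Q - V\<close> this gives
  \<open>Y - Y\<^sup>2 = (1 - |v|\<^sup>2) V\<close>, because \<open>Q V = V\<close>. It recovers
  \<open>Q\<close> and \<open>V\<close> separately from a pencil that supplies only their
  difference.\<close>

lemma Y_square:
  assumes i: "i < 2 * m" and j: "j < 2 * m"
  shows "(\<Sum>k\<in>N. (Q i k - V i k) * (Q k j - V k j)) = Q i j - (2 - dot v v) * V i j"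
proof -
  have "dot v (\<lambda>k. Q k j) = app Q v j"
    unfolding dot_def app_def by (simp add: symmetric(2)[of _ j] mult.commute)
  also have "app Q v j = v j" using app_Q[OF j, of v] by (simp add: v_def)
  finally have "dot v (\<lambda>k. Q k j - v j * v k) = v j - v j * dot v v" unfolding dot_linear by simp
  moreover have "(\<lambda>k. Q k j - V k j) = (\<lambda>k. Q k j - v j * v k)" by (simp add: V_def mult.commute)
  ultimately have d: "dot v (\<lambda>k. Q k j - V k j) = v j - v j * dot v v" by (simp only:)
  have "(\<Sum>k\<in>N. (Q i k - V i k) * (Q k j - V k j)) = app (\<lambda>i k. Q i k - V i k) (\<lambda>k. Q k j - V k j) i"
    by (simp add: app_def)
  also have "\<dots> = (if i < m then Q i j - V i j else 0) - v i * (v j - v j * dot v v)"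
    unfolding app_linear(5) app_Q[OF i] app_V d ..
  finally show ?thesis by (auto simp: Q_def V_def v_def algebra_simps)
qed

text \<open>\<open>x\<close> splits into a multiple of \<open>kv\<close> and two vectors orthogonal
  to \<open>v\<close>, one supported on the \<open>f\<^sub>a\<close> and one on the
  \<open>g\<^sub>a\<close>. They are null vectors of \<open>2 (P + Q - V) - 1\<close>, of
  \<open>Q - V\<close> and of \<open>1 - Q + V\<close>. Each relation moves its part of
  \<open>x \<otimes> q1\<close> to \<open>p1 + p2\<close>; the one for \<open>kv\<close> also uses
  what \<open>p1\<close> satisfies.\<close>

lemma kernel_conic_coordinate:
  fixes p1 q1 p2 :: "'v::euclidean_space"
  assumes Z: "closed_null C S (2 * m) Z"
    and C: "q1 \<in> C" "p1 + p2 - q1 \<in> C" "3 *\<^sub>R p1 + p2 - 2 *\<^sub>R q1 \<in> C"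
    and S: "S q1 = (\<lambda>i j. one i j - Q i j + V i j)" "S (p1 + p2 - q1) = (\<lambda>i j. Q i j - V i j)"
      "S (3 *\<^sub>R p1 + p2 - 2 *\<^sub>R q1) = (\<lambda>i j. 2 * (P i j + Q i j - V i j) - one i j)"
    and p1: "\<And>x. Z (\<lambda>j. x j *\<^sub>R p1 - app P x j *\<^sub>R (p1 + p2))"
  shows "Z (\<lambda>j. x j *\<^sub>R q1 - app (S q1) x j *\<^sub>R (p1 + p2))"
proof -
  define \<gamma> where "\<gamma> = dot v x"
  define y where "y i = x i - \<gamma> * kv i" for i
  define yf where "yf i = (if i < m then 0 else y i)" for i
  define yg where "yg i = (if i < m then y i else 0)" for i
  have y0: "dot v y = 0" unfolding y_def dot_linear dot_v_kv by (simp add: \<gamma>_def)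
  have yg0: "dot v yg = 0" using y0 unfolding dot_v by (simp add: yg_def)
  have yf0: "dot v yf = 0" unfolding dot_v by (simp add: yf_def)
  have z1: "Z (\<lambda>j. yf j *\<^sub>R (p1 + p2 - q1))"
    by (rule null_tensor[OF Z C(2)]) (simp add: S app_linear app_Q app_V yf0, simp add: yf_def)
  have z2: "Z (\<lambda>j. yg j *\<^sub>R q1)"
    by (rule null_tensor[OF Z C(1)]) (simp add: S app_linear app_one app_Q app_V yg0, simp add: yg_def)
  have z3: "Z (\<lambda>j. kv j *\<^sub>R (3 *\<^sub>R p1 + p2 - 2 *\<^sub>R q1))"
  proof (rule null_tensor[OF Z C(3)])
    fix i assume i: "i < 2 * m"
    show "app (S (3 *\<^sub>R p1 + p2 - 2 *\<^sub>R q1)) kv i = 0"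
      unfolding S(3) app_linear(4-6) app_one[OF i] using app_kv[OF i] by simp
  qed
  \<comment> \<open>Since \<open>3 p1 + p2 - 2 q1 = (p1 + p2) + 2 (p1 - q1)\<close>, subtracting
    half of it from the relation for \<open>p1\<close> leaves \<open>q1\<close> and a multiple of
    \<open>p1 + p2\<close>.\<close>
  let ?w = "\<lambda>j. yg j *\<^sub>R q1 - yf j *\<^sub>R (p1 + p2 - q1) +
      \<gamma> *\<^sub>R ((kv j *\<^sub>R p1 - app P kv j *\<^sub>R (p1 + p2)) - (1 / 2) *\<^sub>R (kv j *\<^sub>R (3 *\<^sub>R p1 + p2 - 2 *\<^sub>R q1)))"
  have "Z ?w"
    by (intro closed_nullD(1,2)[OF Z] closed_null_diff[OF Z] z1 z2 z3 p1)
  then show ?thesis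
  proof (rule closed_nullD(3)[OF Z, rotated])
    fix j assume j: "j < 2 * m"
    have Pk: "app P kv j = kv j / 2 - (if j < m then kv j else 0) + v j"
      using app_kv[OF j] by (simp add: app_Q[OF j] app_V dot_v_kv)
    have Sx: "app (S q1) x j = x j - (if j < m then x j else 0) + v j * \<gamma>"
      unfolding S(1) app_linear(4,5) by (simp add: app_one[OF j] app_Q[OF j] app_V \<gamma>_def)
    have x: "x j = y j + \<gamma> * kv j" by (simp add: y_def)
    show "?w j = x j *\<^sub>R q1 - app (S q1) x j *\<^sub>R (p1 + p2)"
    proof (cases "j < m")
      case True
      have "?w j = y j *\<^sub>R q1 + \<gamma> *\<^sub>R ((kv j *\<^sub>R p1 - (v j - kv j / 2) *\<^sub>R (p1 + p2)) - (1 / 2) *\<^sub>R (kv j *\<^sub>R (3 *\<^sub>R p1 + p2 - 2 *\<^sub>R q1)))"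
        using True Pk by (simp add: yf_def yg_def)
      also have "\<dots> = (y j + \<gamma> * kv j) *\<^sub>R q1 - (v j * \<gamma>) *\<^sub>R (p1 + p2)"
        by (rule euclidean_eqI) (simp add: inner_simps algebra_simps)
      finally show ?thesis unfolding Sx using True x by simp
    next
      case False
      have "?w j = - (y j *\<^sub>R (p1 + p2 - q1)) + \<gamma> *\<^sub>R ((kv j *\<^sub>R p1 - (kv j / 2) *\<^sub>R (p1 + p2)) - (1 / 2) *\<^sub>R (kv j *\<^sub>R (3 *\<^sub>R p1 + p2 - 2 *\<^sub>R q1)))"
        using False Pk by (simp add: yf_def yg_def v_def)
      also have "\<dots> = (y j + \<gamma> * kv j) *\<^sub>R q1 - (y j + \<gamma> * kv j) *\<^sub>R (p1 + p2)"
        by (rule euclidean_eqI) (simp add: inner_simps algebra_simps)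
      finally show ?thesis unfolding Sx using False x by (simp add: v_def)
    qed
  qed
qed

end

text \<open>The rays on the conic only have to be sent to psd matrices; rigidity of the pencil comes
  from the generators 0, 1, 2, \<open>n\<close> and \<open>n + 1\<close>, so rays can be added in
  any number. The coordinates from 3 on are sent to 0.\<close>

lemma conic_cone_not_subhomogeneous:
  fixes b :: "nat \<Rightarrow> 'v::euclidean_space" and k :: nat
  assumes b: "bij_betw b {..<n} Basis" and n: "3 \<le> n"
  defines "T \<equiv> (\<lambda>j. vector_of b n (conic_gen n k j)) ` {..<n + 2 + k}"
  assumes u: "u \<in> interior (convex_cone hull T)" and d: "1 \<le> d"
  shows "\<not> d_subhomogeneous d (Cmin (convex_cone hull T)) u"
proof -
  let ?g = "\<lambda>j. vector_of b n (conic_gen n k j)"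
  define m where "m = Suc d"
  have m0: "0 < m" and dm: "d < m" by (simp_all add: m_def)
  interpret two_projections m by unfold_locales (rule m0)
  let ?C = "convex_cone hull T" and ?w = "dot v v" and ?S = "S3 b"
  have w: "?w < 1" using dot_v_v_bounds by linarith
  have bl: "?g l = b l" if "l < n" for l using that by (intro vector_of_unit) (auto simp: conic_gen_def)
  have gT: "?g j \<in> ?C" if "j < n + 2 + k" for j unfolding T_def using that by (intro hull_inc) auto
  have bC: "b l \<in> ?C" if "l < n" for l using gT[of l] bl[OF that] that by simp
  have g3: "?g j = conic_gen n k j 0 *\<^sub>R b 0 + conic_gen n k j (Suc 0) *\<^sub>R b (Suc 0) + conic_gen n k j 2 *\<^sub>R b 2" if "n \<le> j" for j
    unfolding vector_of_def using that by (intro sum_first3[OF n]) (auto simp: conic_gen_def)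
  have q1: "?g n = b 0 + b 2 - b (Suc 0)" by (simp add: g3 conic_gen_def)
  have c5: "?g (Suc n) = 3 *\<^sub>R b 0 + b 2 - 2 *\<^sub>R b (Suc 0)" by (simp add: g3 conic_gen_def)
  have ip: "inner (b l) (b k) = (if l = k then 1 else 0)" if "l < n" "k < 3" for l k
    using basis_inner[OF b] that n by simp
  have Sb: "?S (b 0) = P" "?S (b (Suc 0)) = (\<lambda>i j. one i j - Q i j + V i j)" "?S (b 2) = (\<lambda>i j. one i j - P i j)"
    using n by (intro ext; simp add: S3_def ip)+
  have S0: "?S (b l) = (\<lambda>_ _. 0)" if "3 \<le> l" "l < n" for l
    using that by (intro ext) (simp add: S3_def ip)
  have S_e: "?S (b 0 + b 2) = one"
    using n by (intro ext) (simp add: S3_def ip inner_add_left)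
  have Sq1: "?S (b 0 + b 2 - b (Suc 0)) = (\<lambda>i j. Q i j - V i j)"
    using n by (intro ext) (simp add: S3_def ip inner_add_left inner_diff_left)
  have Sc5: "?S (3 *\<^sub>R b 0 + b 2 - 2 *\<^sub>R b (Suc 0)) = (\<lambda>i j. 2 * (P i j + Q i j - V i j) - one i j)"
    using n by (intro ext) (simp add: S3_def ip inner_add_left inner_diff_left algebra_simps)
  have Sz: "?S 0 = (\<lambda>_ _. 0)" by (intro ext) (simp add: S3_def)
  have qS: "qf (?S c) y = inner c (b 0) * qf P y + inner c (b (Suc 0)) * (qf one y - qf Q y + qf V y) + inner c (b 2) * (qf one y - qf P y)" for c y
    unfolding S3_def[abs_def] qf_linear by simp
  show ?thesis
  proof (rule pencil_not_d_subhomogeneous[OF b u d, where s = "2 * m" and S = ?S and e = "b 0 + b 2"])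
    show "d < 2 * m" using dm by simp
    show "?S (x + y) i j = ?S x i j + ?S y i j" for x y i j by (simp add: S3_def inner_add_left algebra_simps)
    show "?S (r *\<^sub>R x) i j = r * ?S x i j" for r x i j by (simp add: S3_def algebra_simps)
    show "?S x i j = ?S x j i" for x i j unfolding S3_def using symmetric by metis
    show "?S (b 0 + b 2) i j = (if i = j then 1 else 0)" for i j by (simp add: S_e one_def)
  next
    fix c y assume "c \<in> T"
    then obtain j where j: "j < n + 2 + k" "c = ?g j" by (auto simp: T_def)
    have ci: "inner c (b l) = conic_gen n k j l" if "l < 3" for l using vector_of_inner[OF b] that n j(2) by simp
    have qc: "qf (?S c) y = conic_gen n k j 0 * qf P y + conic_gen n k j (Suc 0) * (qf one y - qf Q y + qf V y) + conic_gen n k j 2 * (qf one y - qf P y)"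
      unfolding qS by (simp add: ci)
    note q = qf_P_le[of y] qf_nonneg[of y] qf_V_le_Q[of y]
    consider "j < n" | "j = n" | "j = Suc n" | "n + 2 \<le> j" by linarith
    then have "0 \<le> qf (?S c) y"
    proof cases
      case 1
      then show ?thesis unfolding qc using q by (auto simp: conic_gen_def)
    next
      case 2
      then show ?thesis unfolding qc using q by (simp add: conic_gen_def)
    next
      case 3
      have "qf (?S c) y = 2 * qf P y + 2 * (qf Q y - qf V y) - qf one y" unfolding qc 3 by (simp add: conic_gen_def)
      then show ?thesis using qf_half[of y] by simp
    next
      case 4
      \<comment> \<open>Both \<open>\<lambda>\<close> and \<open>1 - \<lambda>\<close> exceed their
        product \<open>?t\<close>, so the positive terms are at least \<open>?t (P + 1 - Q)\<close>,
        hence at least \<open>?t / 20\<close>, which pays for the negative term.\<close>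
      let ?l = "curve n k j" let ?t = "curve n k j * (1 - curve n k j)"
      note cb = curve_bounds[OF 4 j(1)]
      have f1: "?t * qf P y \<le> (1 - ?l) * qf P y" using cb q by (intro mult_right_mono) simp_all
      have f2: "?t * (qf one y - qf Q y) \<le> ?l * (qf one y - qf Q y + qf V y)" using cb q by (intro mult_mono) simp_all
      have f3: "?t * (qf one y / 20) \<le> ?t * (qf P y + qf one y - qf Q y)" using cb qf_coercive[of y] by (intro mult_left_mono) simp_all
      have f4: "?t * (qf one y - qf P y) \<le> ?t * qf one y" using cb q by (intro mult_left_mono) simp_all
      have qt: "qf (?S c) y = (1 - ?l) * qf P y + ?l * (qf one y - qf Q y + qf V y) - ?t * (qf one y - qf P y) / 20"
        unfolding qc using 4 by (simp add: conic_gen_def)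
      have "0 \<le> A + B - t * (w - p) / 20"
        if "t * p \<le> A" "t * (w - q) \<le> B" "t * (w / 20) \<le> t * (p + w - q)" "t * (w - p) \<le> t * w" for t p q w A B :: real
      proof -
        have lin: "0 \<le> A + B - (c - a) / 20" if "a \<le> A" "c - e \<le> B" "c / 20 \<le> a + c - e" "c - a \<le> c" for a c e :: real
          using that by (simp add: field_simps)
        have "0 \<le> A + B - (t * w - t * p) / 20"
        proof (rule lin[OF that(1)])
          show "t * w - t * q \<le> B" using that(2) by (simp only: right_diff_distrib)
          show "t * w / 20 \<le> t * p + t * w - t * q"
            using that(3) by (simp only: right_diff_distrib distrib_left times_divide_eq_right)
          show "t * w - t * p \<le> t * w" using that(4) by (simp only: right_diff_distrib)
        qed
        then show ?thesis by (simp only: right_diff_distrib)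
      qed
      from this[OF f1 f2 f3 f4] show ?thesis unfolding qt .
    qed
    then show "0 \<le> (\<Sum>i\<in>{0..<2 * m}. \<Sum>j\<in>{0..<2 * m}. y i * ?S c i j * y j)" unfolding qf_def .
  next
    fix Z and l :: nat and x
    assume Z: "closed_null ?C ?S (2 * m) Z" and l: "l < n"
    have P0: "Z (\<lambda>j. x j *\<^sub>R b 0 - app (?S (b 0)) x j *\<^sub>R (b 0 + b 2))" for x
      by (rule resolution[OF Z, where c' = "b 2" and c'' = 0])
        (use n bC in \<open>simp_all add: Sb Sz app_linear app_one app_PP app_zero convex_cone_hull_contains_0\<close>)
    have "Z (\<lambda>j. x j *\<^sub>R b l - app (?S (b l)) x j *\<^sub>R (b 0 + b 2))"
    proof (cases "l < 3")
      case True
      then have "l = 0 \<or> l = 1 \<or> l = 2" by linarith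
      then show ?thesis
      proof (elim disjE)
        assume l: "l = 0"
        show ?thesis unfolding l by (rule P0)
      next
        assume l: "l = 1"
        have "Z (\<lambda>j. x j *\<^sub>R b (Suc 0) - app (?S (b (Suc 0))) x j *\<^sub>R (b 0 + b 2))"
        proof (rule kernel_conic_coordinate[OF Z])
          show "b (Suc 0) \<in> ?C" using bC n by simp
          show "b 0 + b 2 - b (Suc 0) \<in> ?C" using gT[of n] q1 by simp
          show "3 *\<^sub>R b 0 + b 2 - 2 *\<^sub>R b (Suc 0) \<in> ?C" using gT[of "Suc n"] c5 by simp
          show "Z (\<lambda>j. x j *\<^sub>R b 0 - app P x j *\<^sub>R (b 0 + b 2))" for x using P0[of x] by (simp add: Sb)
        qed (rule Sb Sq1 Sc5)+
        then show ?thesis using l by simp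
      next
        assume l: "l = 2"
        show ?thesis unfolding l
          by (rule resolution[OF Z, where c' = "b 0" and c'' = 0])
            (use n bC in \<open>simp_all add: Sb Sz app_linear app_linear(5)[abs_def] app_one app_one_in app_PP app_zero
               convex_cone_hull_contains_0 add.commute\<close>)
      qed
    next
      case False
      then have "Z (\<lambda>j. x j *\<^sub>R b l)" using l bC by (intro null_tensor[OF Z]) (simp_all add: S0 app_zero)
      then show ?thesis using False l by (simp add: S0 app_zero)
    qed
    then show "Z (\<lambda>j. x j *\<^sub>R b l - (\<Sum>k\<in>{0..<2 * m}. ?S (b l) j k * x k) *\<^sub>R (b 0 + b 2))" unfolding app_def .
  next
    fix G and a a' :: nat
    assume G: "closed_algebra (2 * m) G" and GS: "\<And>x. G (\<lambda>i j. complex_of_real (?S x i j))" and a: "a \<le> d" "a' \<le> d"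
    note cl = closed_algebraD[OF G]
    have Y: "G (\<lambda>i j. complex_of_real (Q i j - V i j))" using GS[of "b 0 + b 2 - b (Suc 0)"] by (simp only: Sq1)
    then have YY: "G (\<lambda>i j. \<Sum>k\<in>{0..<2 * m}. complex_of_real (Q i k - V i k) * complex_of_real (Q k j - V k j))"
      by (intro cl(3))
    have "G (\<lambda>i j. of_real (1 / (1 - ?w)) * (complex_of_real (Q i j - V i j) +
        (- 1) * (\<Sum>k\<in>{0..<2 * m}. complex_of_real (Q i k - V i k) * complex_of_real (Q k j - V k j))))"
      using Y YY by (intro cl(1,2))
    then have GV: "G (\<lambda>i j. complex_of_real (V i j))"
    proof (rule cl(4)[rotated])
      fix i j assume ij: "i < 2 * m" "j < 2 * m"
      have Y2: "(\<Sum>k\<in>{0..<2 * m}. complex_of_real (Q i k - V i k) * complex_of_real (Q k j - V k j)) = complex_of_real (Q i j - (2 - ?w) * V i j)"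
        unfolding Y_square[OF ij, symmetric] of_real_sum of_real_mult ..
      have e: "1 / (1 - ?w) * ((Q i j - V i j) + (- 1) * (Q i j - (2 - ?w) * V i j)) = V i j"
        using w by (simp add: field_simps)
      have "complex_of_real (1 / (1 - ?w)) * (complex_of_real (Q i j - V i j) + (- 1) * complex_of_real (Q i j - (2 - ?w) * V i j)) =
          complex_of_real (1 / (1 - ?w) * ((Q i j - V i j) + (- 1) * (Q i j - (2 - ?w) * V i j)))"
        by (simp only: of_real_mult of_real_add of_real_minus of_real_1)
      then show "of_real (1 / (1 - ?w)) * (complex_of_real (Q i j - V i j) +
        (- 1) * (\<Sum>k\<in>{0..<2 * m}. complex_of_real (Q i k - V i k) * complex_of_real (Q k j - V k j))) = complex_of_real (V i j)"
        unfolding Y2 e .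
    qed
    show "G (\<lambda>i j. if i = a \<and> j = a' then 1 else 0)"
    proof (rule unit_generated[OF G _ _ GV])
      show "G (\<lambda>i j. complex_of_real (P i j))" using GS[of "b 0"] by (simp add: Sb)
      have "G (\<lambda>i j. complex_of_real (Q i j - V i j) + complex_of_real (V i j))" using Y GV by (rule cl(1))
      then show "G (\<lambda>i j. complex_of_real (Q i j))" by simp
    qed (use a dm in auto)
  qed
qed

section \<open>Assembly\<close>

lemma obtain_basis:
  obtains b :: "nat \<Rightarrow> 'v::euclidean_space" where "bij_betw b {..<DIM('v)} Basis"
  using ex_bij_betw_nat_finite[of "Basis :: 'v set"] by (auto simp: atLeast0LessThan)

text \<open>Each of \<open>k = r - n\<close> squares occupies three coordinates and adds one ray,
  whence the bound \<open>n div 3\<close>.\<close>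

lemma exists_subhomogeneous_cone:
  assumes n: "DIM('v::euclidean_space) = n" "0 < n" and r: "n \<le> r" "r \<le> n + n div 3"
  shows "\<exists>C :: 'v set. proper_polyhedral_cone C \<and> card (extreme_rays C) = r \<and>
    (\<forall>u \<in> interior C. d_subhomogeneous 2 (Cmin C) u) \<and> (r = n \<longrightarrow> (\<forall>u \<in> interior C. d_subhomogeneous 1 (Cmin C) u))"
proof -
  obtain b :: "nat \<Rightarrow> 'v" where b: "bij_betw b {..<n} Basis" using obtain_basis n(1) by metis
  obtain k where k: "r = n + k" using r(1) le_Suc_ex by blast
  then have k3: "3 * k \<le> n" using r(2) by linarith
  have "d_subhomogeneous 1 (Cmin (convex_cone hull (\<lambda>j. vector_of b n (squares n j)) ` {..<n + k})) u"
    if "u \<in> interior (convex_cone hull (\<lambda>j. vector_of b n (squares n j)) ` {..<n + k})" "r = n" for u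
    using that(2) k by (intro squares_subhomogeneous[OF b k3 n(2) that(1)]) simp
  then show ?thesis
    using squares_cone[OF b k3] squares_subhomogeneous[OF b k3 n(2), of _ 2] k
    by (intro exI[of _ "convex_cone hull (\<lambda>j. vector_of b n (squares n j)) ` {..<n + k}"]) blast
qed

text \<open>One additional ray takes four coordinates. From two on, three coordinates suffice, with
  \<open>k = r - n - 2\<close> rays on the conic; this explains the bound 5 in dimension
  three.\<close>

lemma exists_non_subhomogeneous_cone:
  assumes n: "DIM('v::euclidean_space) = n" and r: "n = 3 \<and> r \<ge> 5 \<or> n \<ge> 4 \<and> r \<ge> n + 1"
  shows "\<exists>C :: 'v set. proper_polyhedral_cone C \<and> card (extreme_rays C) = r \<and> (\<forall>u \<in> interior C. \<not> subhomogeneous (Cmin C) u)"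
proof -
  obtain b :: "nat \<Rightarrow> 'v" where b: "bij_betw b {..<n} Basis" using obtain_basis n(1) by metis
  show ?thesis
  proof (cases "r = n + 1")
    case True
    then have n4: "4 \<le> n" using r by auto
    show ?thesis
      using square_cone_not_subhomogeneous[OF b n4] unfolding True subhomogeneous_def by blast
  next
    case False
    then have n3: "3 \<le> n" and "n + 2 \<le> r" using r by auto
    then obtain k where k: "r = n + 2 + k" using le_Suc_ex by blast
    show ?thesis
      using conic_cone[OF b n3, of k] conic_cone_not_subhomogeneous[OF b n3, of _ k] unfolding k subhomogeneous_def by blast
  qed
qed

theorem theorem4p7:
  fixes n :: nat
  assumes "n \<ge> 1" and "CARD('n::finite) = n"
  shows
    "(\<forall>r. n \<le> r \<and> r \<le> n + n div 3 \<longrightarrow>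
       (\<exists>C :: (real ^ 'n) set.
          proper_polyhedral_cone C \<and> card (extreme_rays C) = r \<and>
          (\<forall>u \<in> interior C. d_subhomogeneous 2 (Cmin C) u) \<and>
          (r = n \<longrightarrow> (\<forall>u \<in> interior C. d_subhomogeneous 1 (Cmin C) u)))) \<and>
     (\<forall>r. n = 3 \<and> r \<ge> 5 \<or> n \<ge> 4 \<and> r \<ge> n + 1 \<longrightarrow>
       (\<exists>C :: (real ^ 'n) set.
          proper_polyhedral_cone C \<and> card (extreme_rays C) = r \<and>
          (\<forall>u \<in> interior C. \<not> subhomogeneous (Cmin C) u))) \<and>
     (\<forall>r. n \<ge> 4 \<and> n + 1 \<le> r \<and> r \<le> n + n div 3 \<longrightarrow>
       (\<exists>C :: (real ^ 'n) set.
          proper_polyhedral_cone C \<and> card (extreme_rays C) = r \<and>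
          (\<forall>u \<in> interior C. subhomogeneous (Cmin C) u)) \<and>
       (\<exists>C :: (real ^ 'n) set.
          proper_polyhedral_cone C \<and> card (extreme_rays C) = r \<and>
          (\<forall>u \<in> interior C. \<not> subhomogeneous (Cmin C) u)))"
proof -
  have dim: "DIM(real ^ 'n) = n" using assms(2) by simp
  have pos: "0 < n" using assms(1) by simp
  note sub = exists_subhomogeneous_cone[OF dim pos]
  note non = exists_non_subhomogeneous_cone[OF dim]
  have sub': "\<exists>C :: (real ^ 'n) set. proper_polyhedral_cone C \<and> card (extreme_rays C) = r \<and>
      (\<forall>u \<in> interior C. subhomogeneous (Cmin C) u)" if r: "n + 1 \<le> r" "r \<le> n + n div 3" for r
  proof -
    have "n \<le> r" using r by simp
    then obtain C :: "(real ^ 'n) set" where "proper_polyhedral_cone C" "card (extreme_rays C) = r"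
      "\<forall>u \<in> interior C. d_subhomogeneous 2 (Cmin C) u" using sub[OF _ r(2)] by blast
    moreover have "(1::nat) \<le> 2" by simp
    ultimately show ?thesis unfolding subhomogeneous_def by blast
  qed
  show ?thesis
  proof (intro conjI allI impI)
    fix r assume "n \<le> r \<and> r \<le> n + n div 3"
    then show "\<exists>C :: (real ^ 'n) set. proper_polyhedral_cone C \<and> card (extreme_rays C) = r \<and>
        (\<forall>u \<in> interior C. d_subhomogeneous 2 (Cmin C) u) \<and> (r = n \<longrightarrow> (\<forall>u \<in> interior C. d_subhomogeneous 1 (Cmin C) u))"
      by (intro sub) blast+
  next
    fix r assume "n = 3 \<and> r \<ge> 5 \<or> n \<ge> 4 \<and> r \<ge> n + 1"
    then show "\<exists>C :: (real ^ 'n) set. proper_polyhedral_cone C \<and> card (extreme_rays C) = r \<and>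
        (\<forall>u \<in> interior C. \<not> subhomogeneous (Cmin C) u)" by (rule non)
  next
    fix r assume r: "n \<ge> 4 \<and> n + 1 \<le> r \<and> r \<le> n + n div 3"
    then show "\<exists>C :: (real ^ 'n) set. proper_polyhedral_cone C \<and> card (extreme_rays C) = r \<and>
        (\<forall>u \<in> interior C. subhomogeneous (Cmin C) u)" by (intro sub') blast+
    show "\<exists>C :: (real ^ 'n) set. proper_polyhedral_cone C \<and> card (extreme_rays C) = r \<and>
        (\<forall>u \<in> interior C. \<not> subhomogeneous (Cmin C) u)" by (rule non) (use r in blast)
  qed
qed

end
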